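(* Fix a sieving system $\mathcal{I}$ which is non-degenerate, $B$-bounded, one-dimensional (with constant $C_1$) and $\rho$-supported with $\rho>0$. Fix $\delta\in(0,1/2)$ with $\frac{(4+\delta)10^{2\delta}}{\log(1/(2\delta))}<\rho$, fix $M$ with $4+\delta<M\le 5$, an integer $K\ge 2$ and a real $\xi>1$, where $K$ is sufficiently large, $\xi$ sufficiently close to $1$ and $M$ sufficiently close to $4+\delta$ (in terms of $\rho,\delta$), and let $\varepsilon>0$ be fixed and sufficiently small. If $x$ is sufficiently large (in terms of all these parameters), then there exist an integer $b$ and a set $\mathcal{Q}'\subset\mathcal{Q}$ such that, with $S:=S_z+b$: (i) $|S\cap[1,y]|\le 2\sigma y$; (ii) for all $q\in\mathcal{Q}'$, $$\sum_{-Ky<n\le y}\lambda(H_q;q,n)=\Bigl(1+O\bigl((\log x)^{-\delta(1+\varepsilon)}\bigr)\Bigr)(K+1)y;$$ (iii) for all but at most $\frac{\rho x}{8\log x}$ elements $n$ of $S\cap[1,y]$, $$\sum_{q\in\mathcal{Q}'}\ \sum_{h\le KH_q}\lambda(H_q;q,n-qh)=\Bigl(C_2+O\bigl((\log x)^{-\delta(1+\varepsilon)}\bigr)\Bigr)(K+1)y,$$ for some quantity $C_2$ independent of $n$ satisfying $10^{2\delta}\le C_2\le 100$.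
   Context: A sieving system is a collection of sets $I_p\subset\mathbb{Z}/p\mathbb{Z}$, one for each prime $p$ ($p,q$ always denote primes); non-degenerate: $|I_p|\le p-1$ for all $p$; $B$-bounded: $|I_p|\le B$ for all $p$; one-dimensional: $\prod_{p\le x}(1-|I_p|/p)\sim C_1/\log x$ for some $C_1>0$; $\rho$-supported: $|\{p\le x:|I_p|\ge1\}|\sim\rho x/\log x$. For $w\ge 2$ let $S_w:=\{n\in\mathbb{Z}: n\bmod p\notin I_p\ \forall p\le w\}$, $P(w)=\prod_{p\le w,\,I_p\neq\emptyset}p$, $\sigma(w)=\prod_{p\le w}(1-|I_p|/p)$; for $u<w$ let $S_{u,w}:=\{n: n\bmod p\notin I_p\ \forall u<p\le w\}$ and $\sigma(u,w)=\prod_{u<p\le w}(1-|I_p|/p)$. Set $y=\lceil x(\log x)^\delta\rceil$, $z=y\log\log x/(\log x)^{1/2}$, $\sigma=\sigma(z)$. Let $\mathfrak{H}=\{H\in\{1,\xi,\xi^2,\dots\}: 2y/x\le H\le y/(\xi z)\}$. For each $H\in\mathfrak{H}$, $\mathcal{Q}_H$ is a fixed collection of primes $q\in(y/(\xi H),y/H]$ with $|I_q|\ge1$ and $|\mathcal{Q}_H|\sim\rho(1-1/\xi)\frac{y}{H\log x}$ as $x\to\infty$; $\mathcal{Q}=\bigcup_{H\in\mathfrak{H}}\mathcal{Q}_H$, and for $q\in\mathcal{Q}$, $H_q$ is the unique $H\in\mathfrak{H}$ with $y/(\xi H)<q\le y/H$. Given the integer $b$ and $H\in\mathfrak{H}$,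 let $S_1:=S_{H^M}+b$, $S_2:=S_{H^M,z}+b$, $\sigma_2:=\sigma(H^M,z)$, let $AP(J;q,n):=\{n+qh:1\le h\le J\}\cap S_1$, and define $\lambda(H;q,n):=\sigma_2^{-|AP(KH;q,n)|}$ if $AP(KH;q,n)\subset S_2$ and $\lambda(H;q,n):=0$ otherwise. Implied constants in $O(\cdot)$ may depend on $B,\rho,C_1,\delta,M,K,\xi,\varepsilon$. *)

theory Defs
  imports
    Complex_Main
    "HOL-Computational_Algebra.Primes"
    "HOL-Library.Landau_Symbols"
begin

section \<open>Sieving systems\<close>

text \<open>
  The residue class set \<open>I\<^sub>p\<close> is represented by the set of its representatives in
  \<open>{0..<p}\<close>. The values of \<open>I\<close> at non-primes are never used.
\<close>

definition sieving_system :: "(nat \<Rightarrow> int set) \<Rightarrow> bool" where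
  "sieving_system I \<longleftrightarrow> (\<forall>p. prime p \<longrightarrow> I p \<subseteq> {0..<int p})"

definition non_degenerate :: "(nat \<Rightarrow> int set) \<Rightarrow> bool" where
  "non_degenerate I \<longleftrightarrow> (\<forall>p. prime p \<longrightarrow> card (I p) \<le> p - 1)"

definition bounded_by :: "real \<Rightarrow> (nat \<Rightarrow> int set) \<Rightarrow> bool" where
  "bounded_by B I \<longleftrightarrow> (\<forall>p. prime p \<longrightarrow> real (card (I p)) \<le> B)"

definition sieve_density :: "(nat \<Rightarrow> int set) \<Rightarrow> real \<Rightarrow> real" where
  "sieve_density I w = (\<Prod>p | prime p \<and> real p \<le> w. 1 - real (card (I p)) / real p)"

definition sieve_density_between :: "(nat \<Rightarrow> int set) \<Rightarrow> real \<Rightarrow> real \<Rightarrow> real" where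
  "sieve_density_between I u w =
     (\<Prod>p | prime p \<and> u < real p \<and> real p \<le> w. 1 - real (card (I p)) / real p)"

definition one_dimensional :: "real \<Rightarrow> (nat \<Rightarrow> int set) \<Rightarrow> bool" where
  "one_dimensional C1 I \<longleftrightarrow>
     C1 > 0 \<and> (\<lambda>x. sieve_density I x) \<sim>[at_top] (\<lambda>x. C1 / ln x)"

definition supported :: "real \<Rightarrow> (nat \<Rightarrow> int set) \<Rightarrow> bool" where
  "supported \<rho> I \<longleftrightarrow>
     (\<lambda>x::real. real (card {p. prime p \<and> real p \<le> x \<and> card (I p) \<ge> 1}))
       \<sim>[at_top] (\<lambda>x. \<rho> * x / ln x)"

definition sifted :: "(nat \<Rightarrow> int set) \<Rightarrow> real \<Rightarrow> int set" where
  "sifted I w = {n. \<forall>p. prime p \<and> real p \<le> w \<longrightarrow> n mod int p \<notin> I p}"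

definition sifted_between :: "(nat \<Rightarrow> int set) \<Rightarrow> real \<Rightarrow> real \<Rightarrow> int set" where
  "sifted_between I u w =
     {n. \<forall>p. prime p \<and> u < real p \<and> real p \<le> w \<longrightarrow> n mod int p \<notin> I p}"

definition shift :: "int \<Rightarrow> int set \<Rightarrow> int set" where
  "shift b A = (\<lambda>n. n + b) ` A"


section \<open>Scales\<close>

definition y_of :: "real \<Rightarrow> real \<Rightarrow> int" where
  "y_of \<delta> x = \<lceil>x * ln x powr \<delta>\<rceil>"

definition z_of :: "real \<Rightarrow> real \<Rightarrow> real" where
  "z_of \<delta> x = real_of_int (y_of \<delta> x) * ln (ln x) / sqrt (ln x)"

definition scales :: "real \<Rightarrow> real \<Rightarrow> real \<Rightarrow> real set" where
  "scales \<delta> \<xi> x =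
     {H. (\<exists>k::nat. H = \<xi> ^ k) \<and> 2 * real_of_int (y_of \<delta> x) / x \<le> H \<and>
         H \<le> real_of_int (y_of \<delta> x) / (\<xi> * z_of \<delta> x)}"


section \<open>The large sieving primes\<close>

text \<open>
  \<open>Q x H\<close> is the collection \<open>\<Q>\<^sub>H\<close> at the parameter \<open>x\<close>. The range of \<open>H\<close> depends on \<open>x\<close> and
  every fixed \<open>H\<close> leaves it as \<open>x \<rightarrow> \<infinity>\<close>, so the asymptotic formula for \<open>card (Q x H)\<close> can only
  be meant uniformly over the admissible \<open>H\<close>.
\<close>

definition large_prime_family ::
    "(nat \<Rightarrow> int set) \<Rightarrow> real \<Rightarrow> real \<Rightarrow> real \<Rightarrow> (real \<Rightarrow> real \<Rightarrow> nat set) \<Rightarrow> bool" where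
  "large_prime_family I \<rho> \<delta> \<xi> Q \<longleftrightarrow>
     (\<forall>x. \<forall>H \<in> scales \<delta> \<xi> x.
        Q x H \<subseteq> {q. prime q \<and> card (I q) \<ge> 1 \<and>
                    real_of_int (y_of \<delta> x) / (\<xi> * H) < real q \<and>
                    real q \<le> real_of_int (y_of \<delta> x) / H}) \<and>
     (\<forall>\<eta>>0. \<forall>\<^sub>F x in at_top. \<forall>H \<in> scales \<delta> \<xi> x.
        \<bar>real (card (Q x H)) - \<rho> * (1 - 1 / \<xi>) * (real_of_int (y_of \<delta> x) / (H * ln x))\<bar>
          \<le> \<eta> * (\<rho> * (1 - 1 / \<xi>) * (real_of_int (y_of \<delta> x) / (H * ln x))))"

definition all_large_primes ::
    "(real \<Rightarrow> real \<Rightarrow> nat set) \<Rightarrow> real \<Rightarrow> real \<Rightarrow> real \<Rightarrow> nat set" where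
  "all_large_primes Q \<delta> \<xi> x = (\<Union>H \<in> scales \<delta> \<xi> x. Q x H)"

definition scale_of :: "real \<Rightarrow> real \<Rightarrow> real \<Rightarrow> nat \<Rightarrow> real" where
  "scale_of \<delta> \<xi> x q =
     (THE H. H \<in> scales \<delta> \<xi> x \<and>
        real_of_int (y_of \<delta> x) / (\<xi> * H) < real q \<and> real q \<le> real_of_int (y_of \<delta> x) / H)"


section \<open>The weights\<close>

text \<open>
  In \<open>AP_set\<close> the parameter \<open>H\<close> only enters through \<open>S\<^sub>1 = S\<^bsub>H^M\<^esub> + b\<close>; the length \<open>J\<close> is a
  separate argument, taken to be \<open>K * H\<close> in \<open>sieve_weight\<close>.
\<close>

definition AP_set ::
    "(nat \<Rightarrow> int set) \<Rightarrow> real \<Rightarrow> int \<Rightarrow> real \<Rightarrow> real \<Rightarrow> nat \<Rightarrow> int \<Rightarrow> int set" where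
  "AP_set I M b H J q n =
     {n + int q * int h | h::nat. 1 \<le> h \<and> real h \<le> J} \<inter> shift b (sifted I (H powr M))"

definition sieve_weight ::
    "(nat \<Rightarrow> int set) \<Rightarrow> real \<Rightarrow> nat \<Rightarrow> real \<Rightarrow> int \<Rightarrow> real \<Rightarrow> nat \<Rightarrow> int \<Rightarrow> real" where
  "sieve_weight I M K z b H q n =
     (let AP = AP_set I M b H (real K * H) q n in
      if AP \<subseteq> shift b (sifted_between I (H powr M) z)
      then sieve_density_between I (H powr M) z powi (- int (card AP))
      else 0)"

end

theory Submission
  imports Defs "HOL-Library.FuncSet" "HOL-Number_Theory.Cong" "HOL-Real_Asymp.Real_Asymp"
    "HOL-Analysis.Convex" "HOL-Analysis.Harmonic_Numbers"
begin

text \<open>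
  Choose the residues of \<open>b\<close> modulo the primes \<open>p \<le> z\<close> independently and uniformly. Each weight
  \<open>\<lambda>(H; q, n)\<close> has mean \<open>1\<close> given the residues modulo \<open>p \<le> H\<^sup>M\<close>, and \<open>n \<in> S\<close> is an event of probability \<open>\<sigma>\<close>. Both
  sums in (ii) and (iii) are sums, over an index set \<open>\<Omega>\<close> (an interval, or the primes of \<open>\<Q>\<^sub>H\<close>), of
  products over \<open>H\<^sup>M < p \<le> z\<close> of independent local factors, so that their variance is a sum over pairs
  in \<open>\<Omega>\<close> of products of \<open>1 + \<kappa>\<^sub>p\<close> with \<open>\<kappa>\<^sub>p\<close> the local covariance.

  The trivial estimate of this variance, of order \<open>H\<^bsup>2-M\<^esup>\<close>, is not sufficient, the loss being in the terms linear in
  the \<open>\<kappa>\<^sub>p\<close>. These measure the equidistribution of \<open>\<Omega>\<close> modulo the primes \<open>p \<le> H\<^sup>8\<close> on average, which a large sieve inequality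
  controls with only a logarithmic loss: \<open>\<Omega>\<close> has positive density, up to logarithms, in a set sifted by
  Brun's sieve, and the Brun weights are well distributed in residue classes. All other terms are \<open>O(H\<^bsup>-M\<^esup>)\<close>
  up to logarithms, once the few primes \<open>q\<close> are dropped for which the classes removed by two terms of a
  progression of difference \<open>q\<close> overlap modulo too many \<open>p\<close>.

  By Markov's inequality some choice of residues satisfies (i), makes the sum in (ii) accurate for nearly
  all \<open>q\<close>, and makes the sum in (iii) accurate for nearly all \<open>n\<close>; \<open>\<Q>'\<close> consists of the good \<open>q\<close>, and
  \<open>C\<^sub>2\<close>, a sum over the scales \<open>H\<close> of terms of order \<open>1 / log H\<close>, is trimmed to the
  required range by discarding scales.
\<close>

text \<open>The error budget dictates M. The exceptional n number about v / \<tau>^3 times the total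
  of K H over the primes of all \<Q>_H, and that total is x (log x)^(\<delta>-1) up to powers of log
  log x. With \<tau> = (log x)^(-\<delta>(1+\<epsilon>)), this is small against x / log x only if
  the relative variance v beats (log x)^(-4\<delta>-3\<delta>\<epsilon>). Since H may be as small as
  2 (log x)^\<delta>, a variance H^(-M) suffices for every M > 4, whereas H^(2-M) would need M > 6.
  The upper end of the scales matters too: H \<le> (log x)^(1/2) / log log x keeps exp(O(H^2 log log
  x)) below every power of x, so the remainder x^(-1/4) of the class counts survives the expansion
  of the product over all sets of primes. The condition on \<rho> comes from \<open>C_2\<close>. As
  1/\<sigma>_2 is about log x / (M log H), a scale contributes about \<rho> (1 - 1/\<xi>) K / ((K+1)
  M log H), and summing over the powers H of \<xi> between (log x)^\<delta> and (log x)^(1/2) gives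
  the factor log(1/(2\<delta>)) / log \<xi>. For large K, \<xi> near 1 and M near 4+\<delta> the
  total is near \<rho> log(1/(2\<delta>)) / (4+\<delta>).\<close>

section \<open>Sums over independent residues\<close>

text \<open>This is conditioning: with \<open>A\<close> the primes up to H^M and \<open>B\<close>
  the larger ones, the outer sum freezes the residues that decide which terms lie in
  \<open>S_1\<close>. The function \<open>override_on \<beta>2 \<beta>1 A\<close> is
  \<open>\<beta>1\<close> on \<open>A\<close> and \<open>\<beta>2\<close> elsewhere; extensionality
  makes this gluing a bijection.\<close>

lemma sum_PiE_Un:
  fixes f :: "('a \<Rightarrow> 'b) \<Rightarrow> 'c::comm_monoid_add"
  assumes "finite A" "finite B" "A \<inter> B = {}"
  shows "(\<Sum>\<beta>\<in>PiE (A \<union> B) F. f \<beta>) =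
    (\<Sum>\<beta>1\<in>PiE A F. \<Sum>\<beta>2\<in>PiE B F. f (override_on \<beta>2 \<beta>1 A))"
proof -
  have bij: "bij_betw (\<lambda>(\<beta>1,\<beta>2). override_on \<beta>2 \<beta>1 A) (PiE A F \<times> PiE B F) (PiE (A \<union> B) F)"
  proof (rule bij_betw_byWitness[where f' = "\<lambda>\<beta>. (restrict \<beta> A, restrict \<beta> B)"])
    show "\<forall>a\<in>PiE A F \<times> PiE B F. (restrict (case a of (\<beta>1, \<beta>2) \<Rightarrow> override_on \<beta>2 \<beta>1 A) A,
        restrict (case a of (\<beta>1, \<beta>2) \<Rightarrow> override_on \<beta>2 \<beta>1 A) B) = a"
      using assms(3) by (auto simp: override_on_def fun_eq_iff restrict_def PiE_def extensional_def)
    show "\<forall>a'\<in>PiE (A \<union> B) F. (case (restrict a' A, restrict a' B) of (\<beta>1, \<beta>2) \<Rightarrow> override_on \<beta>2 \<beta>1 A) = a'"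
      by (auto simp: override_on_def fun_eq_iff restrict_def PiE_def extensional_def)
    show "(\<lambda>(\<beta>1, \<beta>2). override_on \<beta>2 \<beta>1 A) ` (PiE A F \<times> PiE B F) \<subseteq> PiE (A \<union> B) F"
      by (auto simp: override_on_def PiE_def extensional_def Pi_def)
    show "(\<lambda>\<beta>. (restrict \<beta> A, restrict \<beta> B)) ` PiE (A \<union> B) F \<subseteq> PiE A F \<times> PiE B F"
      by (auto simp: PiE_def extensional_def Pi_def)
  qed
  have "(\<Sum>\<beta>\<in>PiE (A \<union> B) F. f \<beta>) =
      (\<Sum>x\<in>PiE A F \<times> PiE B F. f (case x of (\<beta>1,\<beta>2) \<Rightarrow> override_on \<beta>2 \<beta>1 A))"
    by (rule sum.reindex_bij_betw[OF bij, symmetric])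
  also have "\<dots> = (\<Sum>\<beta>1\<in>PiE A F. \<Sum>\<beta>2\<in>PiE B F. f (override_on \<beta>2 \<beta>1 A))"
    by (subst sum.cartesian_product) (auto intro!: sum.cong)
  finally show ?thesis .
qed

text \<open>Independence of the residues at distinct primes, as an identity between unnormalised
  sums.\<close>

lemma sum_PiE_prod:
  fixes f :: "'a \<Rightarrow> 'b \<Rightarrow> 'c::comm_semiring_1"
  assumes "finite A" "\<And>x. x \<in> A \<Longrightarrow> finite (B x)"
  shows "(\<Sum>g\<in>PiE A B. \<Prod>x\<in>A. f x (g x)) = (\<Prod>x\<in>A. \<Sum>y\<in>B x. f x y)"
  using prod_sum_PiE[of A B f] assms by simp

lemma prod_le_exp_sum:
  fixes f :: "'a \<Rightarrow> real"
  assumes "\<And>x. x \<in> A \<Longrightarrow> 0 \<le> f x"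
  shows "(\<Prod>x\<in>A. 1 + f x) \<le> exp (\<Sum>x\<in>A. f x)"
proof (cases "finite A")
  case True
  have "(\<Prod>x\<in>A. 1 + f x) \<le> (\<Prod>x\<in>A. exp (f x))"
    by (intro prod_mono) (use assms in \<open>auto intro: exp_ge_add_one_self add_nonneg_nonneg\<close>)
  then show ?thesis using True by (simp add: exp_sum)
qed auto

section \<open>Counting in residue classes\<close>

text \<open>A class modulo the squarefree number \<open>\<Prod>F\<close>, kept as a family of
  residues so that primes can be added or dropped without computing a representative. For
  \<open>F = {}\<close> every integer qualifies.\<close>

definition in_class :: "nat set \<Rightarrow> (nat \<Rightarrow> int) \<Rightarrow> int \<Rightarrow> bool" where
  "in_class F r n \<longleftrightarrow> (\<forall>p\<in>F. [n = r p] (mod int p))"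

lemma card_cong_interval:
  fixes a b c m :: int
  assumes "m > 0" "a \<le> b"
  shows "\<bar>real (card {n\<in>{a<..b}. [n = c] (mod m)}) - real_of_int (b - a) / real_of_int m\<bar> \<le> 1"
proof -
  define lo hi where "lo = (a - c) div m" and "hi = (b - c) div m"
  have eq: "{n\<in>{a<..b}. [n = c] (mod m)} = (\<lambda>k. c + m * k) ` {lo<..hi}"
  proof (intro equalityI subsetI)
    fix n assume n: "n \<in> {n\<in>{a<..b}. [n = c] (mod m)}"
    then have "m dvd n - c" by (simp add: cong_iff_dvd_diff)
    then obtain k where "n - c = m * k" by (elim dvdE)
    then have k: "n = c + m * k" by simp
    have "lo < k"
    proof -
      have "m * lo \<le> a - c" unfolding lo_def using assms pos_mod_sign[of m "a - c"] mult_div_mod_eq[of m "a - c"] by linarith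
      also have "\<dots> < m * k" using n k by auto
      finally show ?thesis using assms by simp
    qed
    moreover have "k \<le> hi"
    proof -
      have "m * k \<le> b - c" using n k by auto
      then have "(m * k) div m \<le> (b - c) div m" using assms by (intro zdiv_mono1) auto
      then show ?thesis unfolding hi_def using assms by simp
    qed
    ultimately show "n \<in> (\<lambda>k. c + m * k) ` {lo<..hi}" using k by auto
  next
    fix n assume "n \<in> (\<lambda>k. c + m * k) ` {lo<..hi}"
    then obtain k where "n = c + m * k" "k \<in> {lo<..hi}" by (rule imageE)
    then have k: "n = c + m * k" "lo < k" "k \<le> hi" by auto
    have "m * k \<le> m * hi" using k assms by simp
    also have "m * hi \<le> b - c" unfolding hi_def using assms pos_mod_sign[of m "b - c"] mult_div_mod_eq[of m "b - c"] by linarith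
    finally have 1: "n \<le> b" using k by simp
    have "a - c = m * lo + (a - c) mod m" unfolding lo_def by simp
    also have "\<dots> < m * lo + m" using assms by simp
    also have "\<dots> = m * (lo + 1)" by (simp add: algebra_simps)
    also have "\<dots> \<le> m * k" using k assms by (intro mult_left_mono) auto
    finally have 2: "a < n" using k by simp
    show "n \<in> {n\<in>{a<..b}. [n = c] (mod m)}" using 1 2 k by (auto simp: cong_iff_dvd_diff)
  qed
  have inj: "inj_on (\<lambda>k. c + m * k) {lo<..hi}" using assms by (auto simp: inj_on_def)
  have "lo \<le> hi" unfolding lo_def hi_def using assms by (intro zdiv_mono1) auto
  then have card: "real (card {n\<in>{a<..b}. [n = c] (mod m)}) = real_of_int (hi - lo)"
    unfolding eq using card_image[OF inj] by simp
  have fl: "x div m = \<lfloor>real_of_int x / real_of_int m\<rfloor>" for x using floor_divide_of_int_eq by metis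
  have "real_of_int hi = of_int \<lfloor>real_of_int (b - c) / real_of_int m\<rfloor>" 
    "real_of_int lo = of_int \<lfloor>real_of_int (a - c) / real_of_int m\<rfloor>"
    unfolding hi_def lo_def fl by auto
  moreover have "real_of_int (b - c) / real_of_int m - real_of_int (a - c) / real_of_int m = real_of_int (b - a) / real_of_int m"
    by (simp add: diff_divide_distrib)
  ultimately show ?thesis unfolding card of_int_diff by linarith
qed

lemma in_class_cong:
  assumes "finite F" "\<And>p. p \<in> F \<Longrightarrow> prime p"
  obtains c where "\<And>n. in_class F r n \<longleftrightarrow> [n = c] (mod int (\<Prod>F))"
proof -
  have "\<exists>x. \<forall>p\<in>F. [x = nat (r p mod int p)] (mod p)"
    by (rule chinese_remainder_nat) (use assms(1) assms(2) primes_coprime in blast)+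
  then obtain x where x: "\<And>p. p \<in> F \<Longrightarrow> [x = nat (r p mod int p)] (mod p)" by auto
  have x': "[int x = r p] (mod int p)" if "p \<in> F" for p
  proof -
    have "p > 0" using assms(2)[OF that] prime_gt_0_nat by auto
    then have "int (nat (r p mod int p)) = r p mod int p" by simp
    then show ?thesis using x[OF that] by (metis cong_int_iff cong_mod_right)
  qed
  have "in_class F r n \<longleftrightarrow> [n = int x] (mod int (\<Prod>F))" for n
  proof -
    have "in_class F r n \<longleftrightarrow> (\<forall>p\<in>F. [n = int x] (mod int p))"
      unfolding in_class_def using x' cong_sym cong_trans by meson
    also have "\<dots> \<longleftrightarrow> [n = int x] (mod (\<Prod>p\<in>F. int p))"
    proof
      assume *: "\<forall>p\<in>F. [n = int x] (mod int p)"
      have "coprime (int p) (int q)" if "p \<in> F" "q \<in> F" "p \<noteq> q" for p q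
        using that assms(2) primes_coprime by (metis coprime_int_iff)
      then show "[n = int x] (mod (\<Prod>p\<in>F. int p))"
        using * assms(1) by (intro cong_cong_prod_coprime) auto
    next
      assume "[n = int x] (mod (\<Prod>p\<in>F. int p))"
      then show "\<forall>p\<in>F. [n = int x] (mod int p)" using assms(1)
        by (meson cong_dvd_modulus dvd_prodI)
    qed
    also have "\<dots> \<longleftrightarrow> [n = int x] (mod int (\<Prod>F))" by simp
    finally show ?thesis .
  qed
  then show thesis using that by blast
qed

lemma card_in_class_interval:
  assumes "finite F" "\<And>p. p \<in> F \<Longrightarrow> prime p" "a \<le> b"
  shows "\<bar>real (card {n\<in>{a<..b}. in_class F r n}) - real_of_int (b - a) / real (\<Prod>F)\<bar> \<le> 1"
proof -
  obtain c where c: "\<And>n. in_class F r n \<longleftrightarrow> [n = c] (mod int (\<Prod>F))"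
    using in_class_cong[OF assms(1,2)] by metis
  have "\<Prod>F > 0" using assms(2) prime_gt_0_nat by (auto intro!: prod_pos)
  then have "int (\<Prod>F) > 0" by linarith
  then show ?thesis using card_cong_interval[OF _ assms(3), of "int (\<Prod>F)" c] c
    by (simp del: of_nat_prod)
qed

section \<open>Brun's sieve\<close>

text \<open>Legendre's inclusion-exclusion over the primes of \<open>Z\<close> dividing
  \<open>n\<close>, cut off at an even level: this is Brun's pure sieve, a majorant of the indicator
  that no prime of \<open>Z\<close> divides \<open>n\<close>.\<close>

definition brun_weight :: "nat set \<Rightarrow> nat \<Rightarrow> int \<Rightarrow> real" where
  "brun_weight Z k n = (\<Sum>D | D \<subseteq> {p\<in>Z. int p dvd n} \<and> card D \<le> 2 * k. (-1) ^ card D)"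

text \<open>Partial alternating sums of a binomial row collapse to a single coefficient, with
  positive sign because the level is even. The generalised coefficient also covers the case without
  prime divisors, where its upper entry is -1.\<close>

lemma brun_weight_eq:
  assumes "finite Z"
  shows "brun_weight Z k n = (real (card {p\<in>Z. int p dvd n}) - 1) gchoose (2 * k)"
proof -
  let ?A = "{p\<in>Z. int p dvd n}"
  have fin: "finite ?A" using assms by auto
  have "brun_weight Z k n = (\<Sum>j\<le>2*k. \<Sum>D | D \<in> {D. D \<subseteq> ?A \<and> card D \<le> 2 * k} \<and> card D = j. (-1) ^ card D)"
    unfolding brun_weight_def
    by (rule sum.group[symmetric]) (use fin in auto)
  also have "\<dots> = (\<Sum>j\<le>2*k. (real (card ?A) gchoose j) * (-1) ^ j)"
  proof (rule sum.cong[OF refl])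
    fix j assume "j \<in> {..2*k}"
    then have "{D \<in> {D. D \<subseteq> ?A \<and> card D \<le> 2 * k}. card D = j} = {D. D \<subseteq> ?A \<and> card D = j}" by auto
    then have "(\<Sum>D | D \<in> {D. D \<subseteq> ?A \<and> card D \<le> 2 * k} \<and> card D = j. (-1) ^ card D) 
       = (\<Sum>D | D \<subseteq> ?A \<and> card D = j. (-1::real) ^ j)" by (intro sum.cong) auto
    also have "\<dots> = real (card ?A choose j) * (-1) ^ j" using n_subsets[OF fin, of j] by simp
    finally show "(\<Sum>D | D \<in> {D. D \<subseteq> ?A \<and> card D \<le> 2 * k} \<and> card D = j. (-1) ^ card D) 
       = (real (card ?A) gchoose j) * (-1) ^ j" by (simp add: binomial_gbinomial)
  qed
  also have "\<dots> = (real (card ?A) - 1) gchoose (2 * k)"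
    by (subst gbinomial_sum_lower_neg) simp
  finally show ?thesis .
qed

lemma brun_weight_nonneg: 
  assumes "finite Z"
  shows "brun_weight Z k n \<ge> 0"
proof (cases "card {p\<in>Z. int p dvd n}")
  case 0
  \<comment> \<open>With upper entry -1, reflection turns the coefficient into this one, so the
    weight is 1.\<close>
  have "(2 * real k) gchoose (2 * k) = real ((2 * k) choose (2 * k))"
    by (simp only: binomial_gbinomial of_nat_mult of_nat_numeral)
  then show ?thesis using 0 brun_weight_eq[OF assms, of k n] by (simp add: gbinomial_minus)
next
  case (Suc m)
  then show ?thesis using brun_weight_eq[OF assms, of k n] by (simp flip: binomial_gbinomial)
qed

lemma brun_weight_eq_1: 
  assumes "\<And>p. p \<in> Z \<Longrightarrow> \<not> int p dvd n"
  shows "brun_weight Z k n = 1"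
proof -
  have "{p\<in>Z. int p dvd n} = {}" using assms by auto
  then have "{D. D \<subseteq> {p\<in>Z. int p dvd n} \<and> card D \<le> 2 * k} = {{}}" by auto
  then show ?thesis unfolding brun_weight_def by simp
qed

text \<open>The main term of the sieve per unit length, that is, the Euler product of
  \<open>1 - 1 / p\<close> over \<open>Z\<close> with its expansion cut off at level 2k.\<close>

definition brun_density :: "nat set \<Rightarrow> nat \<Rightarrow> real" where
  "brun_density Z k = (\<Sum>D | D \<subseteq> Z \<and> card D \<le> 2 * k. (-1) ^ card D / real (\<Prod>D))"

text \<open>This is the remainder of the sieve: each of these sets costs a counting error of at most
  1.\<close>

definition brun_size :: "nat set \<Rightarrow> nat \<Rightarrow> nat" where
  "brun_size Z k = card {D. D \<subseteq> Z \<and> card D \<le> 2 * k}"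

text \<open>After exchanging the sums, a set \<open>D\<close> of divisors merely adds the conditions
  n = 0 modulo its primes. As \<open>Z\<close> and \<open>F\<close> are disjoint these combine with
  the given class to a class modulo \<open>\<Prod>(D \<union> F)\<close>, counted up to 1.\<close>

lemma sum_brun_weight_class:
  assumes "finite Z" "finite F" "\<And>p. p \<in> Z \<union> F \<Longrightarrow> prime p" "Z \<inter> F = {}" "a \<le> b"
  shows "\<bar>(\<Sum>n | n \<in> {a<..b} \<and> in_class F r n. brun_weight Z k n) 
     - real_of_int (b - a) * brun_density Z k / real (\<Prod>F)\<bar> \<le> real (brun_size Z k)"
proof -
  let ?S = "{D. D \<subseteq> Z \<and> card D \<le> 2 * k}"
  let ?r = "\<lambda>D p. if p \<in> D then 0 else r p"
  have fin: "finite ?S" using assms(1) by auto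
  have finD: "finite D" if "D \<in> ?S" for D using that assms(1) finite_subset by auto
  have "(\<Sum>n | n \<in> {a<..b} \<and> in_class F r n. brun_weight Z k n) 
     = (\<Sum>n | n \<in> {a<..b} \<and> in_class F r n. \<Sum>D | D \<in> ?S \<and> (\<forall>p\<in>D. int p dvd n). (-1) ^ card D)"
    unfolding brun_weight_def by (intro sum.cong refl) auto
  also have "\<dots> = (\<Sum>D\<in>?S. \<Sum>n | n \<in> {n. n \<in> {a<..b} \<and> in_class F r n} \<and> (\<forall>p\<in>D. int p dvd n). (-1) ^ card D)"
  proof (rule sum.swap_restrict)
    show "finite {n. n \<in> {a<..b} \<and> in_class F r n}" by (rule finite_subset[of _ "{a<..b}"]) auto
  qed (use fin in auto)
  also have "\<dots> = (\<Sum>D\<in>?S. (-1) ^ card D * real (card {n\<in>{a<..b}. in_class (D \<union> F) (?r D) n}))"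
  proof (rule sum.cong[OF refl])
    fix D assume D: "D \<in> ?S"
    then have "D \<inter> F = {}" using assms(4) by auto
    then have "{n \<in> {n. n \<in> {a<..b} \<and> in_class F r n}. \<forall>p\<in>D. int p dvd n} 
       = {n\<in>{a<..b}. in_class (D \<union> F) (?r D) n}"
      unfolding in_class_def by (auto simp: cong_0_iff) 
    then show "(\<Sum>n | n \<in> {n. n \<in> {a<..b} \<and> in_class F r n} \<and> (\<forall>p\<in>D. int p dvd n). (-1) ^ card D)
       = (-1::real) ^ card D * real (card {n\<in>{a<..b}. in_class (D \<union> F) (?r D) n})" by simp
  qed
  finally have 1: "(\<Sum>n | n \<in> {a<..b} \<and> in_class F r n. brun_weight Z k n) 
     = (\<Sum>D\<in>?S. (-1) ^ card D * real (card {n\<in>{a<..b}. in_class (D \<union> F) (?r D) n}))" .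
  have 2: "real_of_int (b - a) * brun_density Z k / real (\<Prod>F) 
     = (\<Sum>D\<in>?S. (-1) ^ card D * (real_of_int (b - a) / real (\<Prod>(D \<union> F))))"
    unfolding brun_density_def sum_distrib_left sum_divide_distrib
  proof (rule sum.cong[OF refl])
    fix D assume D: "D \<in> ?S"
    then have "D \<inter> F = {}" using assms(4) by auto
    then have "\<Prod>(D \<union> F) = \<Prod>D * \<Prod>F" using finD[OF D] assms(2) by (intro prod.union_disjoint) auto
    then show "real_of_int (b - a) * ((-1) ^ card D / real (\<Prod>D)) / real (\<Prod>F) =
         (-1) ^ card D * (real_of_int (b - a) / real (\<Prod>(D \<union> F)))" by simp
  qed
  have "\<bar>(\<Sum>D\<in>?S. (-1) ^ card D * real (card {n\<in>{a<..b}. in_class (D \<union> F) (?r D) n}))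
      - (\<Sum>D\<in>?S. (-1) ^ card D * (real_of_int (b - a) / real (\<Prod>(D \<union> F))))\<bar>
     \<le> (\<Sum>D\<in>?S. \<bar>(-1) ^ card D * (real (card {n\<in>{a<..b}. in_class (D \<union> F) (?r D) n}) 
          - real_of_int (b - a) / real (\<Prod>(D \<union> F)))\<bar>)"
    unfolding sum_subtractf[symmetric] right_diff_distrib[symmetric] by (rule sum_abs)
  also have "\<dots> \<le> (\<Sum>D\<in>?S. 1)"
  proof (rule sum_mono)
    fix D assume D: "D \<in> ?S"
    have "\<bar>real (card {n\<in>{a<..b}. in_class (D \<union> F) (?r D) n}) 
          - real_of_int (b - a) / real (\<Prod>(D \<union> F))\<bar> \<le> 1"
      using finD[OF D] assms D by (intro card_in_class_interval) auto
    then show "\<bar>(-1) ^ card D * (real (card {n\<in>{a<..b}. in_class (D \<union> F) (?r D) n}) 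
          - real_of_int (b - a) / real (\<Prod>(D \<union> F)))\<bar> \<le> 1" by (simp add: abs_mult power_abs)
  qed
  also have "\<dots> = real (brun_size Z k)" by (simp add: brun_size_def)
  finally show ?thesis unfolding 1 2 .
qed

lemma brun_density_le:
  assumes "finite Z" "\<And>p. p \<in> Z \<Longrightarrow> p > 0"
  shows "brun_density Z k \<le> (\<Prod>p\<in>Z. 1 - 1 / real p) + exp (2 * (\<Sum>p\<in>Z. 1 / real p)) / 2 ^ (2 * k)"
proof -
  have full: "(\<Prod>p\<in>Z. 1 - 1 / real p) = (\<Sum>D\<in>Pow Z. (-1) ^ card D / real (\<Prod>D))"
  proof -
    have "(\<Prod>p\<in>Z. 1 - 1 / real p) = (\<Prod>p\<in>Z. - (1 / real p) + 1)" by simp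
    also have "\<dots> = (\<Sum>D\<in>Pow Z. (\<Prod>p\<in>D. - (1 / real p)) * (\<Prod>p\<in>Z-D. 1))"
      by (rule prod_add[OF assms(1)])
    also have "\<dots> = (\<Sum>D\<in>Pow Z. (-1) ^ card D / real (\<Prod>D))"
      by (intro sum.cong refl) (simp add: prod_uminus prod_dividef)
    finally show ?thesis .
  qed
  have split: "Pow Z = {D. D \<subseteq> Z \<and> card D \<le> 2 * k} \<union> {D. D \<subseteq> Z \<and> card D > 2 * k}" by auto
  have "(\<Sum>D\<in>Pow Z. (-1) ^ card D / real (\<Prod>D)) = brun_density Z k 
     + (\<Sum>D | D \<subseteq> Z \<and> card D > 2 * k. (-1) ^ card D / real (\<Prod>D))"
    unfolding brun_density_def split using assms(1) by (intro sum.union_disjoint) auto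
  moreover have "\<bar>\<Sum>D | D \<subseteq> Z \<and> card D > 2 * k. (-1) ^ card D / real (\<Prod>D)\<bar> 
     \<le> exp (2 * (\<Sum>p\<in>Z. 1 / real p)) / 2 ^ (2 * k)"
  proof -
    have "\<bar>\<Sum>D | D \<subseteq> Z \<and> card D > 2 * k. (-1) ^ card D / real (\<Prod>D)\<bar> 
       \<le> (\<Sum>D | D \<subseteq> Z \<and> card D > 2 * k. \<bar>(-1) ^ card D / real (\<Prod>D)\<bar>)" by (rule sum_abs)
    also have "\<dots> \<le> (\<Sum>D | D \<subseteq> Z \<and> card D > 2 * k. (\<Prod>p\<in>D. 2 / real p) / 2 ^ (2 * k))"
    proof (rule sum_mono)
      fix D assume "D \<in> {D. D \<subseteq> Z \<and> card D > 2 * k}"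
      then have D: "D \<subseteq> Z" "card D > 2 * k" by auto
      have "\<bar>(-1) ^ card D / real (\<Prod>D)\<bar> = 1 / (\<Prod>p\<in>D. real p)" by (simp add: abs_mult power_abs prod_nonneg)
      \<comment> \<open>Rankin's trick: beyond level 2k the inserted quotient is at least 1. The sum
        can then be extended to all subsets, where it factors over the primes.\<close>
      also have "\<dots> \<le> (2 ^ card D / 2 ^ (2 * k)) * (1 / (\<Prod>p\<in>D. real p))"
      proof -
        have "(2::real) ^ (2 * k) \<le> 2 ^ card D" using D by (intro power_increasing) auto
        then have "1 \<le> (2 ^ card D / 2 ^ (2 * k) :: real)" by simp
        moreover have "1 / (\<Prod>p\<in>D. real p) \<ge> 0" by (simp add: prod_nonneg)
        ultimately show ?thesis by (metis mult_1 mult_right_mono)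
      qed
      also have "\<dots> = (\<Prod>p\<in>D. 2 / real p) / 2 ^ (2 * k)" by (simp add: prod_dividef)
      finally show "\<bar>(-1) ^ card D / real (\<Prod>D)\<bar> \<le> (\<Prod>p\<in>D. 2 / real p) / 2 ^ (2 * k)" .
    qed
    also have "\<dots> \<le> (\<Sum>D\<in>Pow Z. (\<Prod>p\<in>D. 2 / real p) / 2 ^ (2 * k))"
      using assms(1) by (intro sum_mono2) (auto intro!: divide_nonneg_nonneg prod_nonneg)
    also have "\<dots> = (\<Prod>p\<in>Z. 2 / real p + 1) / 2 ^ (2 * k)"
      by (subst prod_add[OF assms(1)]) (simp add: sum_divide_distrib)
    also have "\<dots> \<le> exp (\<Sum>p\<in>Z. 2 / real p) / 2 ^ (2 * k)"
      using prod_le_exp_sum[of Z "\<lambda>p. 2 / real p"] by (intro divide_right_mono) (auto simp: add.commute)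
    finally show ?thesis by (simp add: sum_distrib_left)
  qed
  ultimately show ?thesis using full by linarith
qed

text \<open>A subset with at most 2k elements is read off a word of length 2k over \<open>Z\<close>
  and one padding letter \<open>None\<close>, whence the base \<open>card Z + 1\<close>.\<close>

lemma brun_size_le:
  assumes "finite Z"
  shows "brun_size Z k \<le> (card Z + 1) ^ (2 * k)"
proof -
  have "{D. D \<subseteq> Z \<and> card D \<le> 2 * k} \<subseteq> (\<lambda>xs. the ` (set xs - {None})) ` {xs. set xs \<subseteq> insert None (Some ` Z) \<and> length xs = 2 * k}"
  proof
    fix D assume "D \<in> {D. D \<subseteq> Z \<and> card D \<le> 2 * k}"
    then have D: "D \<subseteq> Z" "card D \<le> 2 * k" by auto
    obtain ys where ys: "set ys = D" "distinct ys" using finite_distinct_list finite_subset[OF D(1) assms] by auto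
    let ?xs = "map Some ys @ replicate (2 * k - card D) None"
    have "length ys = card D" using ys distinct_card by fastforce
    then have "set ?xs \<subseteq> insert None (Some ` Z)" "length ?xs = 2 * k"
      using D ys by auto
    moreover have "D = the ` (set ?xs - {None})" using ys by (force simp: image_iff)
    ultimately show "D \<in> (\<lambda>xs. the ` (set xs - {None})) ` {xs. set xs \<subseteq> insert None (Some ` Z) \<and> length xs = 2 * k}" by blast
  qed
  then have "brun_size Z k \<le> card ((\<lambda>xs. the ` (set xs - {None})) ` {xs. set xs \<subseteq> insert None (Some ` Z) \<and> length xs = 2 * k})"
    unfolding brun_size_def using assms by (intro card_mono) (auto intro!: finite_imageI finite_lists_length_eq)
  also have "\<dots> \<le> card {xs. set xs \<subseteq> insert None (Some ` Z) \<and> length xs = 2 * k}"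
    using assms by (intro card_image_le finite_lists_length_eq) auto
  also have "\<dots> = (card Z + 1) ^ (2 * k)"
    using assms by (subst card_lists_length_eq) (auto simp: card_image)
  finally show ?thesis .
qed

section \<open>Sums over primes\<close>

lemma finite_primes_le [simp]: "finite {p. prime p \<and> real p \<le> w}"
proof (rule finite_subset)
  show "{p. prime p \<and> real p \<le> w} \<subseteq> {..nat \<lfloor>w\<rfloor>}" by (auto simp: le_nat_floor)
qed simp

text \<open>Chebyshev's argument: the primes in (N, 2N] divide (2N)! but not N!, so their product
  divides the central binomial coefficient, which is at most 4^N.\<close>

lemma card_primes_dyadic:
  assumes "N > 0"
  shows "N ^ card {p. prime p \<and> N < p \<and> p \<le> 2 * N} \<le> 4 ^ (N::nat)"
proof -
  let ?S = "{p. prime p \<and> N < p \<and> p \<le> 2 * N}"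
  have fin: "finite ?S" by (rule finite_subset[of _ "{..2*N}"]) auto
  have "[(2 * N choose N) = 0] (mod (\<Prod>p\<in>?S. p))"
  proof (rule cong_cong_prod_coprime_nat)
    show "\<forall>p\<in>?S. [2 * N choose N = 0] (mod p)"
    proof
      fix p assume p: "p \<in> ?S"
      have "fact N * fact N * (2 * N choose N) = (fact (2 * N) :: nat)"
        using binomial_fact_lemma[of N "2 * N"] by simp
      moreover have "p dvd (fact (2 * N) :: nat)" using p prime_dvd_fact_iff[of p "2*N"] by simp
      moreover have "\<not> p dvd (fact N :: nat)" using p prime_dvd_fact_iff[of p N] by simp
      ultimately have "p dvd (2 * N choose N)" using p by (metis (no_types, lifting) mem_Collect_eq prime_dvd_mult_iff)
      then show "[2 * N choose N = 0] (mod p)" by (simp add: cong_0_iff)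
    qed
    show "\<forall>i\<in>?S. \<forall>j\<in>?S. i \<noteq> j \<longrightarrow> coprime i j" using primes_coprime by blast
  qed
  then have "(\<Prod>p\<in>?S. p) dvd (2 * N choose N)" by (simp add: cong_0_iff)
  then have "(\<Prod>p\<in>?S. p) \<le> (2 * N choose N)" by (rule dvd_imp_le) simp
  also have "\<dots> \<le> 2 ^ (2 * N)" by (rule binomial_le_pow2)
  also have "\<dots> = 4 ^ N" by (simp add: power_mult)
  finally have "(\<Prod>p\<in>?S. p) \<le> 4 ^ N" .
  moreover have "(\<Prod>p\<in>?S. N) \<le> (\<Prod>p\<in>?S. p)" by (intro prod_mono) auto
  ultimately show ?thesis by simp
qed

text \<open>With N = 2^j, Chebyshev's bound leaves at most 2 N / j primes in the block, each with
  reciprocal below 1 / N.\<close>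

lemma sum_recip_primes_dyadic:
  assumes "j \<ge> 1"
  shows "(\<Sum>p | prime p \<and> 2 ^ j < p \<and> p \<le> 2 ^ Suc j. 1 / real p) \<le> 2 / real j"
proof -
  let ?N = "2 ^ j :: nat"
  let ?S = "{p. prime p \<and> ?N < p \<and> p \<le> 2 ^ Suc j}"
  have fin: "finite ?S" by (rule finite_subset[of _ "{..2 ^ Suc j}"]) auto
  have "(2::nat) ^ (j * card ?S) \<le> 2 ^ (2 * ?N)"
    using card_primes_dyadic[of ?N] by (simp add: power_mult)
  then have "j * card ?S \<le> 2 * ?N" using power_le_imp_le_exp[of 2] by simp
  then have c: "real (card ?S) \<le> 2 * real ?N / real j"
  proof -
    have "real (j * card ?S) \<le> real (2 * ?N)" using \<open>j * card ?S \<le> 2 * ?N\<close> by (rule of_nat_mono)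
    then show ?thesis using assms by (simp add: pos_le_divide_eq mult.commute)
  qed
  have "(\<Sum>p\<in>?S. 1 / real p) \<le> (\<Sum>p\<in>?S. 1 / real ?N)"
  proof (rule sum_mono)
    fix p assume "p \<in> ?S"
    then have "real ?N \<le> real p" by (simp only: of_nat_le_iff) simp
    moreover have "real ?N > 0" by simp
    ultimately show "1 / real p \<le> 1 / real ?N" by (intro divide_left_mono mult_pos_pos) linarith+
  qed
  also have "\<dots> = real (card ?S) / real ?N" by simp
  also have "\<dots> \<le> (2 * real ?N / real j) / real ?N" using c by (intro divide_right_mono) auto
  finally show ?thesis by simp
qed

lemma sum_recip_primes_pow2:
  "(\<Sum>p | prime p \<and> p \<le> 2 ^ Suc m. 1 / real p) \<le> 1 / 2 + 2 * (\<Sum>j=1..m. 1 / real j)"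
proof (induction m)
  case 0
  have "{p. prime p \<and> p \<le> (2::nat) ^ Suc 0} = {2}" using prime_ge_2_nat by (auto simp: le_antisym)
  then show ?case by simp
next
  case (Suc m)
  let ?A = "{p. prime p \<and> p \<le> (2::nat) ^ Suc m}"
  let ?B = "{p. prime p \<and> 2 ^ Suc m < p \<and> p \<le> (2::nat) ^ Suc (Suc m)}"
  have eq: "{p. prime p \<and> p \<le> (2::nat) ^ Suc (Suc m)} = ?A \<union> ?B" by auto
  have fin: "finite ?A" "finite ?B" by (rule finite_subset[of _ "{..2 ^ Suc (Suc m)}"], auto)+
  have "(\<Sum>p | prime p \<and> p \<le> 2 ^ Suc (Suc m). 1 / real p) = (\<Sum>p\<in>?A. 1 / real p) + (\<Sum>p\<in>?B. 1 / real p)"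
    unfolding eq using fin by (intro sum.union_disjoint) auto
  also have "\<dots> \<le> (1 / 2 + 2 * (\<Sum>j=1..m. 1 / real j)) + 2 / real (Suc m)"
    using Suc.IH sum_recip_primes_dyadic[of "Suc m"] by (intro add_mono) auto
  also have "\<dots> = 1 / 2 + 2 * (\<Sum>j=1..Suc m. 1 / real j)" by (simp add: algebra_simps)
  finally show ?case .
qed

lemma sum_recip_le_ln:
  assumes "m \<ge> 1"
  shows "(\<Sum>j=1..m. 1 / real j) \<le> 1 + ln (real m)"
  using assms
proof (induction m rule: dec_induct)
  case (step n)
  have "ln (real n / real (Suc n)) \<le> real n / real (Suc n) - 1" using step by (intro ln_le_minus_one) auto
  also have "\<dots> = - (1 / real (Suc n))" by (simp add: field_simps)
  finally have "1 / real (Suc n) \<le> ln (real (Suc n)) - ln (real n)" using step by (simp add: ln_div)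
  then show ?case using step by simp
qed simp

text \<open>A weak form of Mertens' theorem by dyadic blocks. Having 2 instead of 1 in front of the
  iterated logarithm only affects powers of logarithms later on.\<close>

lemma sum_recip_primes_le:
  assumes "w \<ge> 2"
  shows "(\<Sum>p | prime p \<and> real p \<le> w. 1 / real p) \<le> 5 + 2 * ln (ln w)"
proof -
  define m where "m = nat \<lceil>ln w / ln 2\<rceil>"
  have l2: "ln (2::real) > 0" "ln 2 \<le> ln w" using assms by auto
  have m1: "real m \<ge> ln w / ln 2" unfolding m_def by linarith
  have "ln w / ln 2 \<ge> 1" using l2 by simp
  then have m2: "real m \<le> ln w / ln 2 + 1" "m \<ge> 1" unfolding m_def by linarith+
  have ln2: "ln (2::real) \<ge> 2 / 3" using ln2_ge_two_thirds .
  have m3: "real m \<le> 3 * ln w"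
  proof -
    have "ln w / ln 2 + 1 \<le> 2 * (ln w / ln 2)" using \<open>ln w / ln 2 \<ge> 1\<close> by linarith
    also have "\<dots> \<le> 2 * (ln w / (2 / 3))" using ln2 l2 by (intro mult_left_mono divide_left_mono) linarith+
    finally show ?thesis using m2 by simp
  qed
  have "w \<le> 2 ^ Suc m"
  proof -
    have "ln w \<le> real m * ln 2" using m1 l2 by (simp add: field_simps)
    also have "\<dots> = ln (2 ^ m)" by (simp add: ln_realpow)
    finally have "w \<le> 2 ^ m" using assms by simp
    then show ?thesis using assms by simp
  qed
  then have "{p. prime p \<and> real p \<le> w} \<subseteq> {p. prime p \<and> p \<le> 2 ^ Suc m}"
    by (auto simp: of_nat_le_iff[symmetric, where 'a=real] simp del: of_nat_le_iff)
  moreover have "finite {p. prime p \<and> p \<le> (2::nat) ^ Suc m}"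
    by (rule finite_subset[of _ "{..2 ^ Suc m}"]) auto
  ultimately have "(\<Sum>p | prime p \<and> real p \<le> w. 1 / real p) \<le> (\<Sum>p | prime p \<and> p \<le> 2 ^ Suc m. 1 / real p)"
    by (intro sum_mono2) auto
  also have "\<dots> \<le> 1 / 2 + 2 * (\<Sum>j=1..m. 1 / real j)" by (rule sum_recip_primes_pow2)
  also have "\<dots> \<le> 1 / 2 + 2 * (1 + ln (real m))" using sum_recip_le_ln[OF m2(2)] by simp
  also have "\<dots> \<le> 1 / 2 + 2 * (1 + ln (3 * ln w))" using m2 m3 by simp
  also have "\<dots> = 5 / 2 + 2 * ln 3 + 2 * ln (ln w)" 
    using assms ln_mult[of 3 "ln w"] by simp
  also have "\<dots> \<le> 5 + 2 * ln (ln w)"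
  proof -
    \<comment> \<open>This gives 2 ln 3 \<le> 5/2, so that the constants add up to 5.\<close>
    have "(3::real) \<le> exp (5/4)"
    proof -
      have "1 + 5/4 + (5/4)\<^sup>2 / 2 \<le> exp (5/4::real)" by (rule exp_lower_Taylor_quadratic) simp
      then show ?thesis by (simp add: power2_eq_square)
    qed
    then have "ln (3::real) \<le> ln (exp (5/4))" by (subst ln_le_cancel_iff) auto
    then show ?thesis by simp
  qed
  finally show ?thesis .
qed

text \<open>The cut-off at \<open>N\<close> keeps the Euler product argument finite.\<close>

definition smooth_upto :: "nat set \<Rightarrow> nat \<Rightarrow> nat set" where
  "smooth_upto P N = {n\<in>{1..N}. \<forall>p. prime p \<longrightarrow> p dvd n \<longrightarrow> p \<in> P}"

text \<open>Euler's product, as an inequality proved by adding one prime at a time: a number smooth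
  over \<open>insert p P\<close> is either smooth over \<open>P\<close> or \<open>p\<close> times a
  number smooth over \<open>insert p P\<close>, and the latter still lies below the cut-off.\<close>

lemma sum_smooth_le:
  assumes "finite P" "\<And>p. p \<in> P \<Longrightarrow> prime p"
  shows "(\<Prod>p\<in>P. 1 - 1 / real p) * (\<Sum>n\<in>smooth_upto P N. 1 / real n) \<le> 1"
  using assms
proof (induction P rule: finite_induct)
  case empty
  have "smooth_upto {} N \<subseteq> {1}" unfolding smooth_upto_def using prime_factor_nat by auto
  then have "(\<Sum>n\<in>smooth_upto {} N. 1 / real n) \<le> (\<Sum>n\<in>{1}. 1 / real n)" by (intro sum_mono2) auto
  then show ?case by simp
next
  case (insert p P)
  then have p: "prime p" by simp
  then have p1: "real p \<ge> 2" using prime_ge_2_nat[of p] by linarith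
  let ?S = "smooth_upto (insert p P) N" let ?T = "smooth_upto P N"
  have fin: "finite ?S" "finite ?T" unfolding smooth_upto_def by auto
  have sub: "?S \<subseteq> ?T \<union> (\<lambda>n. p * n) ` ?S"
  proof
    fix n assume n: "n \<in> ?S"
    show "n \<in> ?T \<union> (\<lambda>n. p * n) ` ?S"
    proof (cases "p dvd n")
      case True
      then obtain k where k: "n = p * k" by (elim dvdE)
      then have "k \<ge> 1" "k \<le> n" using n p unfolding smooth_upto_def by (auto intro: Suc_leI gr0I prime_gt_0_nat)
      moreover from n have "n \<le> N" unfolding smooth_upto_def by simp
      ultimately have "k \<le> N" "1 \<le> k" by simp_all
      then have "k \<in> ?S" using n k unfolding smooth_upto_def by auto
      then show ?thesis using k by auto
    next
      case False
      then show ?thesis using n unfolding smooth_upto_def by auto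
    qed
  qed
  have "(\<Sum>n\<in>?S. 1 / real n) \<le> (\<Sum>n\<in>?T \<union> (\<lambda>n. p * n) ` ?S. 1 / real n)"
    using fin sub by (intro sum_mono2) auto
  also have "\<dots> \<le> (\<Sum>n\<in>?T. 1 / real n) + (\<Sum>n\<in>(\<lambda>n. p * n) ` ?S. 1 / real n)"
    using fin by (subst sum_Un) (auto intro!: sum_nonneg)
  also have "(\<Sum>n\<in>(\<lambda>n. p * n) ` ?S. 1 / real n) = (1 / real p) * (\<Sum>n\<in>?S. 1 / real n)"
    using p by (subst sum.reindex) (auto simp: inj_on_def sum_distrib_left prime_gt_0_nat)
  finally have "(1 - 1 / real p) * (\<Sum>n\<in>?S. 1 / real n) \<le> (\<Sum>n\<in>?T. 1 / real n)"
    by (simp add: algebra_simps)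
  moreover have "(\<Prod>p\<in>P. 1 - 1 / real p) \<ge> 0"
    using insert.prems by (intro prod_nonneg) (auto simp: divide_le_eq_1 dest: prime_ge_1_nat)
  ultimately have "(\<Prod>p\<in>P. 1 - 1 / real p) * ((1 - 1 / real p) * (\<Sum>n\<in>?S. 1 / real n)) \<le> 
      (\<Prod>p\<in>P. 1 - 1 / real p) * (\<Sum>n\<in>?T. 1 / real n)" by (rule mult_left_mono)
  also have "\<dots> \<le> 1" using insert by auto
  finally show ?case using insert.hyps by (simp add: mult.commute mult.left_commute mult.assoc)
qed

lemma ln_le_sum_recip: "ln (real (Suc N)) \<le> (\<Sum>n=1..N. 1 / real n)"
proof (induction N)
  case (Suc N)
  have "ln (real (Suc (Suc N)) / real (Suc N)) \<le> real (Suc (Suc N)) / real (Suc N) - 1"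
    by (intro ln_le_minus_one) auto
  also have "\<dots> = 1 / real (Suc N)" by (simp add: field_simps)
  finally have "ln (real (Suc (Suc N))) - ln (real (Suc N)) \<le> 1 / real (Suc N)" by (simp add: ln_div)
  then show ?case using Suc.IH by simp
qed simp

text \<open>Every n \<le> w is smooth over the primes up to w, so the smooth sum dominates a
  harmonic sum and hence ln w.\<close>

lemma prod_primes_le:
  assumes "w > 1"
  shows "(\<Prod>p | prime p \<and> real p \<le> w. 1 - 1 / real p) \<le> 1 / ln w"
proof -
  let ?P = "{p. prime p \<and> real p \<le> w}"
  define N where "N = nat \<lfloor>w\<rfloor>"
  have N: "real N \<le> w" "w < real (Suc N)" unfolding N_def using assms by linarith+
  have "{1..N} \<subseteq> smooth_upto ?P N"
    unfolding smooth_upto_def using N by (auto dest!: dvd_imp_le)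
  then have "(\<Sum>n=1..N. 1 / real n) \<le> (\<Sum>n\<in>smooth_upto ?P N. 1 / real n)"
    unfolding smooth_upto_def by (intro sum_mono2) auto
  then have 1: "ln w \<le> (\<Sum>n\<in>smooth_upto ?P N. 1 / real n)"
    using ln_le_sum_recip[of N] N assms by (smt (verit) ln_le_cancel_iff)
  have 2: "(\<Prod>p\<in>?P. 1 - 1 / real p) \<ge> 0"
    by (intro prod_nonneg) (auto simp: divide_le_eq_1 dest: prime_ge_1_nat)
  have "(\<Prod>p\<in>?P. 1 - 1 / real p) * ln w \<le> (\<Prod>p\<in>?P. 1 - 1 / real p) * (\<Sum>n\<in>smooth_upto ?P N. 1 / real n)"
    using 1 2 by (rule mult_left_mono)
  also have "\<dots> \<le> 1" by (intro sum_smooth_le) auto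
  finally show ?thesis using assms by (simp add: pos_le_divide_eq)
qed

section \<open>A large sieve inequality for sets with a well-distributed majorant\<close>

lemma residue_eq_iff: 
  assumes "0 \<le> r" "r < int p"
  shows "[n = r] (mod int p) \<longleftrightarrow> n mod int p = r"
  using mod_pos_pos_trivial[OF assms] by (simp only: unique_euclidean_semiring_class.cong_def)

lemma sum_residues:
  fixes f :: "int \<Rightarrow> real" and g :: "int \<Rightarrow> real"
  assumes "finite X" "p > 0"
  shows "(\<Sum>n\<in>X. f n * g (n mod int p)) = (\<Sum>r\<in>{0..<int p}. g r * (\<Sum>n | n \<in> X \<and> [n = r] (mod int p). f n))"
proof -
  have "(\<Sum>n\<in>X. f n * g (n mod int p)) = (\<Sum>r\<in>{0..<int p}. \<Sum>n | n \<in> X \<and> n mod int p = r. f n * g (n mod int p))"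
    by (rule sum.group[symmetric]) (use assms in auto)
  also have "\<dots> = (\<Sum>r\<in>{0..<int p}. g r * (\<Sum>n | n \<in> X \<and> [n = r] (mod int p). f n))"
    by (intro sum.cong refl) (auto simp: sum_distrib_left residue_eq_iff intro!: sum.cong)
  finally show ?thesis .
qed

definition class_dev :: "int set \<Rightarrow> (int \<Rightarrow> real) \<Rightarrow> nat \<Rightarrow> int \<Rightarrow> real" where
  "class_dev \<Omega> \<alpha> p r = (\<Sum>\<omega> | \<omega> \<in> \<Omega> \<and> [\<omega> = r] (mod int p). \<alpha> \<omega>) - (\<Sum>\<omega>\<in>\<Omega>. \<alpha> \<omega>) / real p"

lemma sum_class_dev:
  assumes "finite \<Omega>" "p > 0"
  shows "(\<Sum>r\<in>{0..<int p}. class_dev \<Omega> \<alpha> p r) = 0"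
proof -
  have "(\<Sum>\<omega>\<in>\<Omega>. \<alpha> \<omega>) = (\<Sum>r\<in>{0..<int p}. (\<Sum>n | n \<in> \<Omega> \<and> [n = r] (mod int p). \<alpha> n))"
    using sum_residues[OF assms, of \<alpha> "\<lambda>_. 1"] by simp
  then show ?thesis using assms(2) unfolding class_dev_def sum_subtractf by simp
qed

lemma class_dev_mod: "class_dev \<Omega> \<alpha> p (r mod int p) = class_dev \<Omega> \<alpha> p r"
  unfolding class_dev_def by (simp add: cong_def)

text \<open>A class sum is its deviation plus a constant, and constants are orthogonal to the
  deviations by \<open>sum_class_dev\<close>. The quadratic quantity thereby becomes linear in the
  outer \<alpha>, ready for Cauchy-Schwarz.\<close>

lemma sum_class_dev_square:
  assumes "finite \<Omega>" "p > 0"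
  shows "(\<Sum>r\<in>{0..<int p}. (class_dev \<Omega> \<alpha> p r)\<^sup>2) = (\<Sum>\<omega>\<in>\<Omega>. \<alpha> \<omega> * class_dev \<Omega> \<alpha> p \<omega>)"
proof -
  have "(\<Sum>\<omega>\<in>\<Omega>. \<alpha> \<omega> * class_dev \<Omega> \<alpha> p \<omega>) = (\<Sum>\<omega>\<in>\<Omega>. \<alpha> \<omega> * class_dev \<Omega> \<alpha> p (\<omega> mod int p))"
    by (simp add: class_dev_mod)
  also have "\<dots> = (\<Sum>r\<in>{0..<int p}. class_dev \<Omega> \<alpha> p r * (\<Sum>n | n \<in> \<Omega> \<and> [n = r] (mod int p). \<alpha> n))"
    by (rule sum_residues[OF assms])
  also have "\<dots> = (\<Sum>r\<in>{0..<int p}. (class_dev \<Omega> \<alpha> p r)\<^sup>2 + class_dev \<Omega> \<alpha> p r * ((\<Sum>\<omega>\<in>\<Omega>. \<alpha> \<omega>) / real p))"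
    by (intro sum.cong refl) (simp add: class_dev_def power2_eq_square algebra_simps)
  also have "\<dots> = (\<Sum>r\<in>{0..<int p}. (class_dev \<Omega> \<alpha> p r)\<^sup>2)"
  proof -
    have "(\<Sum>r\<in>{0..<int p}. class_dev \<Omega> \<alpha> p r * ((\<Sum>\<omega>\<in>\<Omega>. \<alpha> \<omega>) / real p)) = 0"
      using sum_class_dev[OF assms, of \<alpha>] sum_distrib_right[of "class_dev \<Omega> \<alpha> p" "{0..<int p}"] by (metis mult_zero_left)
    then show ?thesis unfolding sum.distrib by simp
  qed
  finally show ?thesis by simp
qed

text \<open>The dual form: bounding the left side by itself through Cauchy--Schwarz lets the sum over
  \<open>\<Omega>\<close> be replaced by one over the majorant, where the classes are equidistributed.\<close>

lemma large_sieve_majorant: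
  fixes \<alpha> \<theta> :: "int \<Rightarrow> real"
  assumes fin: "finite X" "\<Omega> \<subseteq> X" "finite P" and primes: "\<And>p. p \<in> P \<Longrightarrow> prime p"
    and theta: "\<And>n. n \<in> X \<Longrightarrow> \<theta> n \<ge> 0" "\<And>n. n \<in> \<Omega> \<Longrightarrow> \<theta> n \<ge> 1"
    and equi: "\<And>F r. F \<subseteq> P \<Longrightarrow> \<bar>(\<Sum>n | n \<in> X \<and> in_class F r n. \<theta> n) - Y / real (\<Prod>F)\<bar> \<le> E"
    and Y: "Y \<ge> 0"
  shows "(\<Sum>p\<in>P. real p * (\<Sum>r\<in>{0..<int p}. (class_dev \<Omega> \<alpha> p r)\<^sup>2)) 
     \<le> (Y + E * (\<Sum>p\<in>P. (real p)\<^sup>2)) * (\<Sum>\<omega>\<in>\<Omega>. (\<alpha> \<omega>)\<^sup>2)" (is "?T \<le> ?c * ?A")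
proof -
  let ?D = "class_dev \<Omega> \<alpha>"
  have fO: "finite \<Omega>" using fin finite_subset by auto
  have E: "E \<ge> 0" using equi[of "{}"] by (meson abs_ge_zero empty_subsetI order_trans)
  have p0: "p > 0" if "p \<in> P" for p using primes[OF that] prime_gt_0_nat by auto
  \<comment> \<open>The dual function: by \<open>sum_class_dev_square\<close> the left side is the
    sum of \<alpha> times \<open>G\<close> over \<Omega>.\<close>
  define G where "G n = (\<Sum>p\<in>P. real p * ?D p n)" for n
  define B where "B p = (\<Sum>r\<in>{0..<int p}. \<bar>?D p r\<bar>)" for p
  \<comment> \<open>Only the diagonal carries a main term. For distinct primes the main term factors
    into two full sums of deviations, and these vanish.\<close>
  have pair: "(\<Sum>n\<in>X. \<theta> n * (?D p n * ?D q n)) \<le> 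
      (if p = q then Y / real p * (\<Sum>r\<in>{0..<int p}. (?D p r)\<^sup>2) else 0) + E * (B p * B q)"
    if "p \<in> P" "q \<in> P" for p q
  proof (cases "p = q")
    case True
    have "(\<Sum>n\<in>X. \<theta> n * (?D p n * ?D q n)) = (\<Sum>n\<in>X. \<theta> n * (?D p (n mod int p))\<^sup>2)"
      using True by (simp add: class_dev_mod power2_eq_square)
    also have "\<dots> = (\<Sum>r\<in>{0..<int p}. (?D p r)\<^sup>2 * (\<Sum>n | n \<in> X \<and> [n = r] (mod int p). \<theta> n))"
      using sum_residues[OF fin(1) p0[OF that(1)], of \<theta> "\<lambda>r. (?D p r)\<^sup>2"] by simp
    also have "\<dots> \<le> (\<Sum>r\<in>{0..<int p}. (?D p r)\<^sup>2 * (Y / real p + E))"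
    proof (intro sum_mono mult_left_mono)
      fix r show "(\<Sum>n | n \<in> X \<and> [n = r] (mod int p). \<theta> n) \<le> Y / real p + E"
        using equi[of "{p}" "\<lambda>_. r"] that(1) by (simp add: in_class_def abs_le_iff)
    qed auto
    also have "\<dots> = Y / real p * (\<Sum>r\<in>{0..<int p}. (?D p r)\<^sup>2) + E * (\<Sum>r\<in>{0..<int p}. (?D p r)\<^sup>2)"
      by (simp add: algebra_simps sum.distrib sum_distrib_left sum_divide_distrib)
    also have "\<dots> \<le> Y / real p * (\<Sum>r\<in>{0..<int p}. (?D p r)\<^sup>2) + E * (B p)\<^sup>2"
    proof -
      have "(\<Sum>r\<in>{0..<int p}. \<bar>?D p r\<bar> * \<bar>?D p r\<bar>) \<le> (\<Sum>r\<in>{0..<int p}. \<bar>?D p r\<bar> * B p)"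
        unfolding B_def by (intro sum_mono mult_left_mono member_le_sum) auto
      also have "\<dots> = (B p)\<^sup>2" by (simp add: B_def power2_eq_square sum_distrib_right)
      finally have "(\<Sum>r\<in>{0..<int p}. (?D p r)\<^sup>2) \<le> (B p)\<^sup>2" by (simp add: power2_eq_square)
      then show ?thesis using E by (intro add_left_mono mult_left_mono)
    qed
    finally show ?thesis unfolding True[symmetric] power2_eq_square by (simp only: if_True refl)
  next
    case False
    define h where "h r s = (\<Sum>n | n \<in> X \<and> in_class {p,q} (\<lambda>u. if u = p then r else s) n. \<theta> n)" for r s
    have "(\<Sum>n\<in>X. \<theta> n * (?D p n * ?D q n)) = (\<Sum>n\<in>X. (\<theta> n * ?D p n) * ?D q (n mod int q))"
      by (simp add: class_dev_mod mult.assoc)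
    also have "\<dots> = (\<Sum>s\<in>{0..<int q}. ?D q s * (\<Sum>n | n \<in> X \<and> [n = s] (mod int q). \<theta> n * ?D p (n mod int p)))"
      using sum_residues[OF fin(1) p0[OF that(2)], of "\<lambda>n. \<theta> n * ?D p n" "?D q"] by (simp add: class_dev_mod)
    also have "\<dots> = (\<Sum>s\<in>{0..<int q}. ?D q s * (\<Sum>r\<in>{0..<int p}. ?D p r * h r s))"
    proof (rule sum.cong[OF refl])
      fix s
      have "(\<Sum>n | n \<in> X \<and> [n = s] (mod int q). \<theta> n * ?D p (n mod int p)) =
         (\<Sum>r\<in>{0..<int p}. ?D p r * (\<Sum>n | n \<in> {n. n \<in> X \<and> [n = s] (mod int q)} \<and> [n = r] (mod int p). \<theta> n))"
        by (rule sum_residues) (use fin p0[OF that(1)] in auto)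
      also have "\<dots> = (\<Sum>r\<in>{0..<int p}. ?D p r * h r s)"
        unfolding h_def using False by (intro sum.cong refl arg_cong2[where f="(*)"]) (auto simp: in_class_def)
      finally show "?D q s * (\<Sum>n | n \<in> X \<and> [n = s] (mod int q). \<theta> n * ?D p (n mod int p)) 
         = ?D q s * (\<Sum>r\<in>{0..<int p}. ?D p r * h r s)" by simp
    qed
    also have "\<dots> = (\<Sum>s\<in>{0..<int q}. \<Sum>r\<in>{0..<int p}. ?D q s * ?D p r * h r s)"
      by (simp add: sum_distrib_left mult.assoc)
    also have "\<dots> \<le> (\<Sum>s\<in>{0..<int q}. \<Sum>r\<in>{0..<int p}. ?D q s * ?D p r * (Y / real (p * q)) + \<bar>?D q s\<bar> * \<bar>?D p r\<bar> * E)"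
    proof (intro sum_mono)
      fix s r
      have "\<bar>h r s - Y / real (p * q)\<bar> \<le> E"
        using equi[of "{p,q}" "\<lambda>u. if u = p then r else s"] that False unfolding h_def by simp
      then have "\<bar>?D q s * ?D p r * (h r s - Y / real (p * q))\<bar> \<le> \<bar>?D q s\<bar> * \<bar>?D p r\<bar> * E"
        unfolding abs_mult by (intro mult_left_mono) auto
      then show "?D q s * ?D p r * h r s \<le> ?D q s * ?D p r * (Y / real (p * q)) + \<bar>?D q s\<bar> * \<bar>?D p r\<bar> * E"
        by (simp add: right_diff_distrib abs_le_iff del: of_nat_mult)
    qed
    also have "\<dots> = (\<Sum>s\<in>{0..<int q}. ?D q s) * (\<Sum>r\<in>{0..<int p}. ?D p r) * (Y / real (p * q)) + B q * B p * E"
      unfolding B_def sum.distrib sum_product by (simp only: sum_distrib_right)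
    also have "\<dots> = E * (B p * B q)" using sum_class_dev[OF fO p0[OF that(1)], of \<alpha>] by simp
    finally show ?thesis using False by simp
  qed
  have T: "?T = (\<Sum>\<omega>\<in>\<Omega>. \<alpha> \<omega> * G \<omega>)"
  proof -
    have "?T = (\<Sum>p\<in>P. real p * (\<Sum>\<omega>\<in>\<Omega>. \<alpha> \<omega> * ?D p \<omega>))"
      using sum_class_dev_square[OF fO p0] by simp
    also have "\<dots> = (\<Sum>\<omega>\<in>\<Omega>. \<alpha> \<omega> * G \<omega>)"
      unfolding G_def sum_distrib_left by (subst sum.swap) (simp add: mult.left_commute)
    finally show ?thesis .
  qed
  have T0: "?T \<ge> 0" by (intro sum_nonneg mult_nonneg_nonneg) auto
  have G2: "(\<Sum>\<omega>\<in>\<Omega>. (G \<omega>)\<^sup>2) \<le> ?c * ?T"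
  proof -
    have "(\<Sum>\<omega>\<in>\<Omega>. (G \<omega>)\<^sup>2) \<le> (\<Sum>\<omega>\<in>\<Omega>. \<theta> \<omega> * (G \<omega>)\<^sup>2)"
      using theta(2) by (intro sum_mono) (metis mult_1 mult_right_mono zero_le_power2)
    also have "\<dots> \<le> (\<Sum>n\<in>X. \<theta> n * (G n)\<^sup>2)"
      using fin theta(1) by (intro sum_mono2) auto
    also have "\<dots> = (\<Sum>n\<in>X. \<Sum>p\<in>P. \<Sum>q\<in>P. real p * real q * (\<theta> n * (?D p n * ?D q n)))"
    proof (rule sum.cong[OF refl])
      fix n
      have "(G n)\<^sup>2 = (\<Sum>p\<in>P. \<Sum>q\<in>P. (real p * ?D p n) * (real q * ?D q n))"
        unfolding G_def power2_eq_square sum_product ..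
      then show "\<theta> n * (G n)\<^sup>2 = (\<Sum>p\<in>P. \<Sum>q\<in>P. real p * real q * (\<theta> n * (?D p n * ?D q n)))"
        by (simp only: sum_distrib_left) (simp add: mult_ac)
    qed
    also have "\<dots> = (\<Sum>p\<in>P. \<Sum>q\<in>P. real p * real q * (\<Sum>n\<in>X. \<theta> n * (?D p n * ?D q n)))"
      unfolding sum_distrib_left by (subst sum.swap, intro sum.cong refl, subst sum.swap) simp
    also have "\<dots> \<le> (\<Sum>p\<in>P. \<Sum>q\<in>P. real p * real q * ((if p = q then Y / real p * (\<Sum>r\<in>{0..<int p}. (?D p r)\<^sup>2) else 0) 
        + E * (B p * B q)))"
      using pair by (intro sum_mono mult_left_mono) auto
    also have "\<dots> = (\<Sum>p\<in>P. \<Sum>q\<in>P. (if p = q then real p * real q * (Y / real p * (\<Sum>r\<in>{0..<int p}. (?D p r)\<^sup>2)) else 0)) 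
        + E * (\<Sum>p\<in>P. real p * B p)\<^sup>2"
    proof -
      have "real p * real q * ((if p = q then Y / real p * (\<Sum>r\<in>{0..<int p}. (?D p r)\<^sup>2) else 0) + E * (B p * B q))
         = (if p = q then real p * real q * (Y / real p * (\<Sum>r\<in>{0..<int p}. (?D p r)\<^sup>2)) else 0) 
            + E * ((real p * B p) * (real q * B q))" for p q
        by (simp add: distrib_left)
      moreover have "E * (\<Sum>p\<in>P. real p * B p)\<^sup>2 = (\<Sum>p\<in>P. \<Sum>q\<in>P. E * ((real p * B p) * (real q * B q)))"
        unfolding power2_eq_square sum_product by (simp only: sum_distrib_left)
      ultimately show ?thesis by (simp only: sum.distrib)
    qed
    also have "(\<Sum>p\<in>P. \<Sum>q\<in>P. (if p = q then real p * real q * (Y / real p * (\<Sum>r\<in>{0..<int p}. (?D p r)\<^sup>2)) else 0)) = Y * ?T"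
      using fin(3) p0 by (auto simp: sum_distrib_left intro!: sum.cong)
    finally have le: "(\<Sum>\<omega>\<in>\<Omega>. (G \<omega>)\<^sup>2) \<le> Y * ?T + E * (\<Sum>p\<in>P. real p * B p)\<^sup>2" .
    have "(\<Sum>p\<in>P. real p * B p)\<^sup>2 \<le> (\<Sum>p\<in>P. (real p)\<^sup>2) * ?T"
    proof -
      \<comment> \<open>Cauchy-Schwarz over pairs (p, r) with the weight p split into two square
        roots. The first factor becomes the sum of p over all pairs, that is, of p^2 over the
        primes; the second is again \<open>?T\<close>.\<close>
      let ?I = "Sigma P (\<lambda>p. {0..<int p})"
      have "(\<Sum>p\<in>P. real p * B p) = (\<Sum>(p,r)\<in>?I. sqrt (real p) * (sqrt (real p) * \<bar>?D p r\<bar>))"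
        unfolding B_def sum_distrib_left using fin(3) 
        by (subst sum.Sigma) (auto intro!: sum.cong simp: mult.assoc[symmetric])
      also have "\<dots> = (\<Sum>x\<in>?I. sqrt (real (fst x)) * (sqrt (real (fst x)) * \<bar>?D (fst x) (snd x)\<bar>))"
        by (simp add: case_prod_beta)
      finally have eq: "(\<Sum>p\<in>P. real p * B p) = \<dots>" .
      have "(\<Sum>p\<in>P. real p * B p)\<^sup>2 \<le> (\<Sum>x\<in>?I. (sqrt (real (fst x)))\<^sup>2) * (\<Sum>x\<in>?I. (sqrt (real (fst x)) * \<bar>?D (fst x) (snd x)\<bar>)\<^sup>2)"
        unfolding eq by (rule Cauchy_Schwarz_ineq_sum)
      also have "(\<Sum>x\<in>?I. (sqrt (real (fst x)))\<^sup>2) = (\<Sum>(p,r)\<in>?I. real p)" by (auto intro!: sum.cong)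
      also have "\<dots> = (\<Sum>p\<in>P. (real p)\<^sup>2)" using fin(3) by (subst sum.Sigma[symmetric]) (auto simp: power2_eq_square)
      also have "(\<Sum>x\<in>?I. (sqrt (real (fst x)) * \<bar>?D (fst x) (snd x)\<bar>)\<^sup>2) = (\<Sum>(p,r)\<in>?I. real p * (?D p r)\<^sup>2)"
        by (auto intro!: sum.cong simp: power_mult_distrib)
      also have "\<dots> = ?T" using fin(3) by (subst sum.Sigma[symmetric]) (auto simp: sum_distrib_left)
      finally show ?thesis .
    qed
    then have "E * (\<Sum>p\<in>P. real p * B p)\<^sup>2 \<le> E * ((\<Sum>p\<in>P. (real p)\<^sup>2) * ?T)"
      using E by (rule mult_left_mono)
    with le have "(\<Sum>\<omega>\<in>\<Omega>. (G \<omega>)\<^sup>2) \<le> Y * ?T + E * ((\<Sum>p\<in>P. (real p)\<^sup>2) * ?T)" by linarith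
    then show ?thesis unfolding distrib_right by (simp only: mult.assoc)
  qed
  have "?T\<^sup>2 \<le> ?A * (\<Sum>\<omega>\<in>\<Omega>. (G \<omega>)\<^sup>2)" unfolding T by (rule Cauchy_Schwarz_ineq_sum)
  also have "\<dots> \<le> ?A * (?c * ?T)" using G2 by (intro mult_left_mono) (auto intro: sum_nonneg)
  \<comment> \<open>The left side occurs on the right to the first power and cancels unless it is
    zero.\<close>
  finally have fin: "?T * ?T \<le> (?c * ?A) * ?T" by (simp add: power2_eq_square mult_ac)
  show ?thesis
  proof (cases "?T = 0")
    case True
    moreover have "?c * ?A \<ge> 0" using Y E by (intro mult_nonneg_nonneg add_nonneg_nonneg sum_nonneg) auto
    ultimately show ?thesis by linarith
  next
    case False
    then have "?T > 0" using T0 by linarith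
    then show ?thesis using fin mult_le_cancel_right_pos by blast
  qed
qed

section \<open>The variance of products of local factors\<close>

text \<open>One abstract setting for both sums. The term with index \<open>a\<close> attached to
  \<omega> is \<open>c a * \<omega> + d a\<close>: for the sum over n, \<omega> runs over an
  interval and the slope is 1; for the sum over primes, \<omega> is the prime and the slope is the
  offset \<open>a\<close>. \<open>A \<omega>\<close> collects the indices whose terms survive the
  small primes, \<open>Bs p\<close> the values open to the random residue at p (all of them, or only
  those that let a given n survive), and \<open>m\<close> corrects the normalisation of the weights.
  In the applications \<open>P0\<close> is H^M, \<open>P1\<close> is H^8 and \<open>j\<close> is of
  order H. The losses are recorded by \<open>L\<close> and \<eta> for counts in classes, \<Lambda>
  for the large sieve, and \<open>ov\<close> with total at most \<open>t\<close> for coinciding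
  removed classes.\<close>

locale local_factors =
  fixes P :: "nat set" and Bs I :: "nat \<Rightarrow> int set" and \<Omega> T :: "int set" and A :: "int \<Rightarrow> int set"
    and c d :: "int \<Rightarrow> int" and m :: "int \<Rightarrow> real" and ov :: "nat \<Rightarrow> int \<Rightarrow> real"
    and j b P0 P1 L \<eta> \<Lambda> t :: real
  assumes finP: "finite P" and primeP: "\<And>p. p \<in> P \<Longrightarrow> prime p" and P0: "P0 \<ge> 2" "\<And>p. p \<in> P \<Longrightarrow> P0 \<le> real p"
    and P1: "P1 \<ge> 2"
    and Bs: "\<And>p. p \<in> P \<Longrightarrow> Bs p \<subseteq> {0..<int p}" "\<And>p. p \<in> P \<Longrightarrow> real p \<le> 2 * real (card (Bs p))"
    and finI: "\<And>p. p \<in> P \<Longrightarrow> finite (I p)" "\<And>p. p \<in> P \<Longrightarrow> real (card (I p)) \<le> b"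
    and fin\<Omega>: "finite \<Omega>" and finT: "finite T" and A: "\<And>\<omega>. \<omega> \<in> \<Omega> \<Longrightarrow> A \<omega> \<subseteq> T"
    and j: "real (card T) * b \<le> j" "64 * j\<^sup>2 \<le> P0" "j \<ge> 1"
    and cop: "\<And>p a. p \<in> P \<Longrightarrow> a \<in> T \<Longrightarrow> coprime (c a) (int p)"
    and m: "\<And>\<omega>. \<omega> \<in> \<Omega> \<Longrightarrow> 0 \<le> m \<omega>" "\<And>\<omega>. \<omega> \<in> \<Omega> \<Longrightarrow> m \<omega> \<le> 2"
    and L: "L \<ge> 1" and \<eta>: "\<eta> \<ge> 0" and t: "t \<ge> 0" and \<Lambda>: "\<Lambda> \<ge> 0"
    and count: "\<And>D r. D \<subseteq> P \<Longrightarrow> real (card {\<omega>\<in>\<Omega>. in_class D r \<omega>}) \<le> real (card \<Omega>) * (L * (\<Prod>p\<in>D. 2 / real p) + \<eta>)"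
    and sieve: "\<And>\<alpha>. (\<And>\<omega>. \<omega> \<in> \<Omega> \<Longrightarrow> \<bar>\<alpha> \<omega>\<bar> \<le> 2) \<Longrightarrow>
       (\<Sum>p | p \<in> P \<and> real p \<le> P1. real p * (\<Sum>r\<in>{0..<int p}. (class_dev \<Omega> \<alpha> p r)\<^sup>2)) \<le> \<Lambda> * (real (card \<Omega>))\<^sup>2"
    and ov0: "\<And>p \<omega>. p \<in> P \<Longrightarrow> \<omega> \<in> \<Omega> \<Longrightarrow> 
       (\<Sum>\<beta>\<in>Bs p. real (card {x \<in> A \<omega> \<times> I p. [c (fst x) * \<omega> + d (fst x) - snd x = \<beta>] (mod int p)}) 
          - of_bool (\<exists>x \<in> A \<omega> \<times> I p. [c (fst x) * \<omega> + d (fst x) - snd x = \<beta>] (mod int p))) \<le> ov p \<omega>"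
    and ovt: "\<And>\<omega>. \<omega> \<in> \<Omega> \<Longrightarrow> (\<Sum>p\<in>P. ov p \<omega> / real p) \<le> t"
begin

text \<open>A pair (a, i) here says that term \<open>a\<close> falls into the removed class
  \<open>i\<close> when the random residue at \<open>p\<close> is \<beta>.\<close>

definition hits :: "nat \<Rightarrow> int \<Rightarrow> int \<Rightarrow> (int \<times> int) set" where
  "hits p \<omega> \<beta> = {x \<in> A \<omega> \<times> I p. [c (fst x) * \<omega> + d (fst x) - snd x = \<beta>] (mod int p)}"

definition N :: "nat \<Rightarrow> int \<Rightarrow> int \<Rightarrow> real" where
  "N p \<omega> \<beta> = real (card (hits p \<omega> \<beta>))"

definition U :: "nat \<Rightarrow> int \<Rightarrow> int set" where
  "U p \<omega> = {\<beta>\<in>Bs p. \<exists>x \<in> A \<omega> \<times> I p. [c (fst x) * \<omega> + d (fst x) - snd x = \<beta>] (mod int p)}"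

definition u :: "nat \<Rightarrow> int \<Rightarrow> real" where
  "u p \<omega> = real (card (U p \<omega>)) / real (card (Bs p))"

definition g :: "nat \<Rightarrow> int \<Rightarrow> int \<Rightarrow> real" where
  "g p \<omega> \<beta> = (if \<beta> \<in> U p \<omega> then 0 else 1 / (1 - u p \<omega>))"

definition \<kappa> :: "nat \<Rightarrow> int \<Rightarrow> int \<Rightarrow> real" where
  "\<kappa> p \<omega> \<omega>' = (\<Sum>\<beta>\<in>Bs p. g p \<omega> \<beta> * g p \<omega>' \<beta>) / real (card (Bs p)) - 1"

text \<open>Taken over all residues rather than \<open>Bs p\<close>, so that its averages do not
  depend on the conditioning.\<close>

definition coll :: "nat \<Rightarrow> int \<Rightarrow> int \<Rightarrow> real" where
  "coll p \<omega> \<omega>' = (\<Sum>\<beta>\<in>{0..<int p}. N p \<omega> \<beta> * N p \<omega>' \<beta>)"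

text \<open>The residue of \<omega> modulo \<open>p\<close> at which the pair \<open>x\<close> hits
  \<beta>; it exists because the slope is invertible. It turns hits into congruence conditions on
  \<omega>.\<close>

definition sol :: "nat \<Rightarrow> int \<Rightarrow> int \<times> int \<Rightarrow> int" where
  "sol p \<beta> x = (SOME r. [c (fst x) * r + d (fst x) - snd x = \<beta>] (mod int p))"

lemma p_pos: "p \<in> P \<Longrightarrow> p > 0" using primeP prime_gt_0_nat by auto

lemma finBs: "p \<in> P \<Longrightarrow> finite (Bs p)" using Bs(1) finite_subset by blast

lemma cardBs_pos: "p \<in> P \<Longrightarrow> real (card (Bs p)) > 0" using Bs(2)[of p] p_pos[of p] by linarith

lemma finA: "\<omega> \<in> \<Omega> \<Longrightarrow> finite (A \<omega>)" using A finT finite_subset by blast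

lemma b_nonneg: "p \<in> P \<Longrightarrow> b \<ge> 0" using finI(2)[of p] by linarith

lemma card_TI: assumes "p \<in> P" shows "real (card (T \<times> I p)) \<le> j"
proof -
  have "real (card (T \<times> I p)) = real (card T) * real (card (I p))" by (simp add: card_cartesian_product)
  also have "\<dots> \<le> real (card T) * b" using finI(2)[OF assms] by (intro mult_left_mono) auto
  finally show ?thesis using j by linarith
qed

lemma fin_hits: "p \<in> P \<Longrightarrow> \<omega> \<in> \<Omega> \<Longrightarrow> finite (hits p \<omega> \<beta>)"
  unfolding hits_def using finA finI by auto

lemma sol_iff:
  assumes "p \<in> P" "x \<in> T \<times> I p"
  shows "[c (fst x) * \<omega> + d (fst x) - snd x = \<beta>] (mod int p) \<longleftrightarrow> [\<omega> = sol p \<beta> x] (mod int p)"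
proof -
  have cp: "coprime (c (fst x)) (int p)" using cop assms by auto
  obtain s where s: "[c (fst x) * s = 1] (mod int p)" using cong_solve_coprime_int[OF cp] by auto
  have "[c (fst x) * (s * (\<beta> - d (fst x) + snd x)) + d (fst x) - snd x = 1 * (\<beta> - d (fst x) + snd x) + d (fst x) - snd x] (mod int p)"
    unfolding mult.assoc[symmetric] by (intro cong_add cong_diff cong_mult s cong_refl)
  then have ex: "[c (fst x) * (s * (\<beta> - d (fst x) + snd x)) + d (fst x) - snd x = \<beta>] (mod int p)" by simp
  have sol: "[c (fst x) * sol p \<beta> x + d (fst x) - snd x = \<beta>] (mod int p)"
    unfolding sol_def by (rule someI[of _ "s * (\<beta> - d (fst x) + snd x)"]) (rule ex)
  show ?thesis
  proof
    assume "[c (fst x) * \<omega> + d (fst x) - snd x = \<beta>] (mod int p)"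
    then have "[c (fst x) * \<omega> + d (fst x) - snd x = c (fst x) * sol p \<beta> x + d (fst x) - snd x] (mod int p)"
      using sol cong_sym cong_trans by blast
    then have "int p dvd c (fst x) * (\<omega> - sol p \<beta> x)" by (simp add: cong_iff_dvd_diff algebra_simps)
    then have "int p dvd \<omega> - sol p \<beta> x" using cp by (simp add: coprime_commute coprime_dvd_mult_right_iff)
    then show "[\<omega> = sol p \<beta> x] (mod int p)" by (simp add: cong_iff_dvd_diff)
  next
    assume "[\<omega> = sol p \<beta> x] (mod int p)"
    then have "[c (fst x) * \<omega> + d (fst x) - snd x = c (fst x) * sol p \<beta> x + d (fst x) - snd x] (mod int p)"
      by (intro cong_add cong_diff cong_mult cong_refl)
    then show "[c (fst x) * \<omega> + d (fst x) - snd x = \<beta>] (mod int p)" using sol cong_trans by blast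
  qed
qed

lemma N_nonneg: "N p \<omega> \<beta> \<ge> 0" unfolding N_def by simp

text \<open>Enlarging \<open>A \<omega>\<close> to \<open>T\<close> removes the dependence of the
  index set on \<omega>, leaving only congruence conditions.\<close>

lemma N_le:
  assumes "p \<in> P" "\<omega> \<in> \<Omega>"
  shows "N p \<omega> \<beta> \<le> (\<Sum>x\<in>T \<times> I p. of_bool [\<omega> = sol p \<beta> x] (mod int p))"
proof -
  have "hits p \<omega> \<beta> \<subseteq> {x\<in>T \<times> I p. [\<omega> = sol p \<beta> x] (mod int p)}"
    unfolding hits_def using sol_iff[OF assms(1)] A[OF assms(2)] by auto
  then have "card (hits p \<omega> \<beta>) \<le> card {x\<in>T \<times> I p. [\<omega> = sol p \<beta> x] (mod int p)}"
    using finT finI assms by (intro card_mono) auto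
  then show ?thesis unfolding N_def using finT finI assms by (simp add: Int_def of_bool_def sum.If_cases)
qed

text \<open>A given pair hits exactly one residue, so the sets of hits are disjoint subsets of
  \<open>T \<times> I p\<close>.\<close>

lemma sum_N_le:
  assumes "p \<in> P" "\<omega> \<in> \<Omega>"
  shows "(\<Sum>\<beta>\<in>{0..<int p}. N p \<omega> \<beta>) \<le> j"
proof -
  have "(\<Sum>\<beta>\<in>{0..<int p}. card (hits p \<omega> \<beta>)) = card (\<Union>\<beta>\<in>{0..<int p}. hits p \<omega> \<beta>)"
  proof (rule card_UN_disjoint[symmetric])
    show "\<forall>i\<in>{0..<int p}. \<forall>k\<in>{0..<int p}. i \<noteq> k \<longrightarrow> hits p \<omega> i \<inter> hits p \<omega> k = {}"
    proof (intro ballI impI)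
      fix i k assume ik: "i \<in> {0..<int p}" "k \<in> {0..<int p}" "i \<noteq> k"
      { fix x assume "x \<in> hits p \<omega> i" "x \<in> hits p \<omega> k"
        then have "[c (fst x) * \<omega> + d (fst x) - snd x = i] (mod int p)" "[c (fst x) * \<omega> + d (fst x) - snd x = k] (mod int p)"
          unfolding hits_def by simp_all
        then have "[i = k] (mod int p)" using cong_sym cong_trans by blast
        then have False using ik cong_less_imp_eq_int[of i "int p" k] by simp }
      then show "hits p \<omega> i \<inter> hits p \<omega> k = {}" by auto
    qed
  qed (use fin_hits assms in auto)
  also have "\<dots> \<le> card (T \<times> I p)" using finT finI A[OF assms(2)] assms unfolding hits_def by (intro card_mono) auto
  finally have "real (\<Sum>\<beta>\<in>{0..<int p}. card (hits p \<omega> \<beta>)) \<le> real (card (T \<times> I p))" by (rule of_nat_mono)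
  then show ?thesis using card_TI[OF assms(1)] unfolding N_def by simp
qed

lemma sum_N_Bs_le:
  assumes "p \<in> P" "\<omega> \<in> \<Omega>"
  shows "(\<Sum>\<beta>\<in>Bs p. N p \<omega> \<beta>) \<le> j"
proof -
  have "(\<Sum>\<beta>\<in>Bs p. N p \<omega> \<beta>) \<le> (\<Sum>\<beta>\<in>{0..<int p}. N p \<omega> \<beta>)"
    using Bs(1)[OF assms(1)] N_nonneg by (intro sum_mono2) auto
  then show ?thesis using sum_N_le[OF assms] by linarith
qed

lemma U_iff: "\<beta> \<in> U p \<omega> \<longleftrightarrow> \<beta> \<in> Bs p \<and> hits p \<omega> \<beta> \<noteq> {}"
  unfolding U_def hits_def by blast

lemma chi_le_N: 
  assumes "p \<in> P" "\<omega> \<in> \<Omega>" 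
  shows "of_bool (\<beta> \<in> U p \<omega>) \<le> N p \<omega> \<beta>"
proof (cases "\<beta> \<in> U p \<omega>")
  case True
  then have "card (hits p \<omega> \<beta>) \<noteq> 0" using U_iff fin_hits[OF assms] by auto
  then show ?thesis using True unfolding N_def by simp
qed (simp add: N_nonneg)

lemma card_U: 
  assumes "p \<in> P"
  shows "real (card (U p \<omega>)) = (\<Sum>\<beta>\<in>Bs p. of_bool (\<beta> \<in> U p \<omega>))"
proof -
  have "{\<beta> \<in> Bs p. \<beta> \<in> U p \<omega>} = U p \<omega>" unfolding U_def by auto
  then show ?thesis using finBs[OF assms] by (simp add: of_bool_def sum.If_cases Int_def)
qed

lemma u_le:
  assumes "p \<in> P" "\<omega> \<in> \<Omega>"
  shows "0 \<le> u p \<omega>" "u p \<omega> \<le> 2 * j / real p" "u p \<omega> \<le> 1 / 2"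
proof -
  show 0: "0 \<le> u p \<omega>" unfolding u_def by simp
  have "real (card (U p \<omega>)) \<le> (\<Sum>\<beta>\<in>Bs p. N p \<omega> \<beta>)"
    unfolding card_U[OF assms(1)] by (intro sum_mono chi_le_N assms)
  then have "real (card (U p \<omega>)) \<le> j" using sum_N_Bs_le[OF assms] by linarith
  then have "u p \<omega> \<le> j / real (card (Bs p))" unfolding u_def by (intro divide_right_mono) auto
  also have "\<dots> \<le> j / (real p / 2)" using Bs(2)[OF assms(1)] cardBs_pos[OF assms(1)] p_pos[OF assms(1)] j
    by (intro divide_left_mono) auto
  finally show 1: "u p \<omega> \<le> 2 * j / real p" by (simp add: mult.commute)
  have "j \<le> j\<^sup>2" using j by (simp add: power2_eq_square)
  then have "64 * j \<le> real p" using P0(2)[OF assms(1)] j by linarith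
  then have "2 * j / real p \<le> 1 / 2" using p_pos[OF assms(1)] by (simp add: field_simps)
  then show "u p \<omega> \<le> 1 / 2" using 1 by linarith
qed

lemma mean_g:
  assumes "p \<in> P" "\<omega> \<in> \<Omega>"
  shows "(\<Sum>\<beta>\<in>Bs p. g p \<omega> \<beta>) = real (card (Bs p))"
proof -
  have sub: "U p \<omega> \<subseteq> Bs p" unfolding U_def by auto
  have "(\<Sum>\<beta>\<in>Bs p. g p \<omega> \<beta>) = (\<Sum>\<beta>\<in>Bs p - U p \<omega>. 1 / (1 - u p \<omega>))"
    unfolding g_def using finBs[OF assms(1)] by (intro sum.mono_neutral_cong_right) auto
  also have "\<dots> = (real (card (Bs p)) - real (card (U p \<omega>))) / (1 - u p \<omega>)"
    using sub finBs[OF assms(1)] finite_subset[OF sub] card_mono[OF _ sub] by (simp add: card_Diff_subset of_nat_diff)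
  also have "real (card (Bs p)) - real (card (U p \<omega>)) = real (card (Bs p)) * (1 - u p \<omega>)"
    using cardBs_pos[OF assms(1)] by (simp add: u_def field_simps)
  finally show ?thesis using u_le[OF assms] by simp
qed

text \<open>Multiplying out (1 - 1_U)(1 - 1_U') cancels the first-order terms. What remains is the
  covariance of the two events of removal, divided by both survival probabilities.\<close>

lemma \<kappa>_eq:
  assumes "p \<in> P" "\<omega> \<in> \<Omega>" "\<omega>' \<in> \<Omega>"
  shows "\<kappa> p \<omega> \<omega>' = ((\<Sum>\<beta>\<in>Bs p. of_bool (\<beta> \<in> U p \<omega>) * of_bool (\<beta> \<in> U p \<omega>')) / real (card (Bs p)) - u p \<omega> * u p \<omega>') 
     / ((1 - u p \<omega>) * (1 - u p \<omega>'))"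
proof -
  let ?w = "(1 - u p \<omega>) * (1 - u p \<omega>')" and ?n = "real (card (Bs p))"
  let ?x = "\<lambda>\<beta>. of_bool (\<beta> \<in> U p \<omega>) :: real" and ?y = "\<lambda>\<beta>. of_bool (\<beta> \<in> U p \<omega>') :: real"
  have w: "?w \<noteq> 0" using u_le[OF assms(1,2)] u_le[OF assms(1,3)] by auto
  have n: "?n > 0" using cardBs_pos[OF assms(1)] .
  have "(\<Sum>\<beta>\<in>Bs p. g p \<omega> \<beta> * g p \<omega>' \<beta>) = (\<Sum>\<beta>\<in>Bs p. (1 - ?x \<beta> - ?y \<beta> + ?x \<beta> * ?y \<beta>) / ?w)"
    by (intro sum.cong refl) (simp add: g_def)
  also have "\<dots> = (?n - ?n * u p \<omega> - ?n * u p \<omega>' + (\<Sum>\<beta>\<in>Bs p. ?x \<beta> * ?y \<beta>)) / ?w"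
    unfolding sum_divide_distrib[symmetric] sum.distrib sum_subtractf card_U[OF assms(1), symmetric]
    using n by (simp add: u_def)
  finally have "(\<Sum>\<beta>\<in>Bs p. g p \<omega> \<beta> * g p \<omega>' \<beta>) / ?n = 
      (?n - ?n * u p \<omega> - ?n * u p \<omega>' + (\<Sum>\<beta>\<in>Bs p. ?x \<beta> * ?y \<beta>)) / ?n / ?w" by (simp only: divide_divide_eq_left mult.commute)
  also have "(?n - ?n * u p \<omega> - ?n * u p \<omega>' + (\<Sum>\<beta>\<in>Bs p. ?x \<beta> * ?y \<beta>)) / ?n = ?w + ((\<Sum>\<beta>\<in>Bs p. ?x \<beta> * ?y \<beta>) / ?n - u p \<omega> * u p \<omega>')"
    using n by (simp add: field_simps)
  also have "\<dots> / ?w = 1 + ((\<Sum>\<beta>\<in>Bs p. ?x \<beta> * ?y \<beta>) / ?n - u p \<omega> * u p \<omega>') / ?w"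
    using w by (simp add: add_divide_distrib)
  finally show ?thesis unfolding \<kappa>_def by simp
qed

lemma coll_nonneg: "coll p \<omega> \<omega>' \<ge> 0" unfolding coll_def using N_nonneg by (intro sum_nonneg) auto

lemma sum_chi_le:
  assumes "p \<in> P" "\<omega> \<in> \<Omega>" "\<omega>' \<in> \<Omega>"
  shows "(\<Sum>\<beta>\<in>Bs p. of_bool (\<beta> \<in> U p \<omega>) * of_bool (\<beta> \<in> U p \<omega>')) \<le> (\<Sum>\<beta>\<in>Bs p. N p \<omega> \<beta> * N p \<omega>' \<beta>)"
  using assms by (intro sum_mono mult_mono chi_le_N N_nonneg) auto

lemma sum_NN_le:
  assumes "p \<in> P"
  shows "(\<Sum>\<beta>\<in>Bs p. N p \<omega> \<beta> * N p \<omega>' \<beta>) / real (card (Bs p)) \<le> 2 * coll p \<omega> \<omega>' / real p"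
proof -
  have "(\<Sum>\<beta>\<in>Bs p. N p \<omega> \<beta> * N p \<omega>' \<beta>) \<le> coll p \<omega> \<omega>'"
    unfolding coll_def using Bs(1)[OF assms] N_nonneg by (intro sum_mono2) auto
  then have "(\<Sum>\<beta>\<in>Bs p. N p \<omega> \<beta> * N p \<omega>' \<beta>) / real (card (Bs p)) \<le> coll p \<omega> \<omega>' / real (card (Bs p))" 
    by (intro divide_right_mono) auto
  also have "\<dots> \<le> coll p \<omega> \<omega>' / (real p / 2)" using Bs(2)[OF assms] p_pos[OF assms] cardBs_pos[OF assms] coll_nonneg
    by (intro divide_left_mono) auto
  finally show ?thesis by (simp add: mult.commute)
qed

text \<open>A nonnegative majorant of |\<kappa>|, so that products over primes can be averaged. One
  part stems from joint hits, the other from the product of the means; the constants combine 4 from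
  (1-u)(1-u') \<ge> 1/4 with 2 from \<open>card (Bs p)\<close> \<ge> p/2, once per mean.\<close>

definition y :: "nat \<Rightarrow> int \<Rightarrow> int \<Rightarrow> real" where
  "y p \<omega> \<omega>' = 8 / real p * coll p \<omega> \<omega>' + 16 * j\<^sup>2 / (real p)\<^sup>2"

lemma y_nonneg: "y p \<omega> \<omega>' \<ge> 0" unfolding y_def using coll_nonneg by simp

lemma inv_le_4:
  fixes u v :: real
  assumes "u \<le> 1/2" "v \<le> 1/2"
  shows "1 / ((1 - u) * (1 - v)) \<le> 4" "0 < (1 - u) * (1 - v)"
proof -
  have "1/2 * (1/2) \<le> (1 - u) * (1 - v)" using assms by (intro mult_mono) auto
  then show "1 / ((1 - u) * (1 - v)) \<le> 4" "0 < (1 - u) * (1 - v)" by (auto simp: divide_le_eq)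
qed

lemma abs_\<kappa>_le:
  assumes "p \<in> P" "\<omega> \<in> \<Omega>" "\<omega>' \<in> \<Omega>"
  shows "\<bar>\<kappa> p \<omega> \<omega>'\<bar> \<le> y p \<omega> \<omega>'"
proof -
  let ?v = "(\<Sum>\<beta>\<in>Bs p. of_bool (\<beta> \<in> U p \<omega>) * of_bool (\<beta> \<in> U p \<omega>')) / real (card (Bs p)) :: real"
  let ?w = "(1 - u p \<omega>) * (1 - u p \<omega>')"
  note u = u_le[OF assms(1,2)] and u' = u_le[OF assms(1,3)]
  have "?v \<le> 2 * coll p \<omega> \<omega>' / real p"
    using divide_right_mono[OF sum_chi_le[OF assms], of "real (card (Bs p))"] sum_NN_le[OF assms(1), of \<omega> \<omega>'] by simp
  moreover have "?v \<ge> 0" by (intro divide_nonneg_nonneg sum_nonneg) auto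
  moreover have "u p \<omega> * u p \<omega>' \<le> (2 * j / real p) * (2 * j / real p)" using u u' j by (intro mult_mono) auto
  moreover have "u p \<omega> * u p \<omega>' \<ge> 0" using u u' by simp
  ultimately have "\<bar>?v - u p \<omega> * u p \<omega>'\<bar> \<le> 2 * coll p \<omega> \<omega>' / real p + 4 * j\<^sup>2 / (real p)\<^sup>2"
    by (simp add: power2_eq_square)
  then have "\<bar>?v - u p \<omega> * u p \<omega>'\<bar> * (1 / ?w) \<le> (2 * coll p \<omega> \<omega>' / real p + 4 * j\<^sup>2 / (real p)\<^sup>2) * 4"
    using inv_le_4[OF u(3) u'(3)] by (intro mult_mono) auto
  then show ?thesis unfolding \<kappa>_eq[OF assms] y_def using inv_le_4(2)[OF u(3) u'(3)] by (simp add: abs_divide)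
qed

subsection \<open>Averages of collision counts\<close>

text \<open>Multiplying out, one chooses at every p in \<open>D\<close> a residue and a pair hitting
  it. Each choice confines \<omega>' to one class modulo \<open>\<Prod>D\<close>, which
  \<open>count\<close> estimates, while summing the choices on the side of \<omega> costs at most
  j^2 per prime.\<close>

lemma sum_prod_coll_le:
  assumes "D \<subseteq> P" "\<omega> \<in> \<Omega>"
  shows "(\<Sum>\<omega>'\<in>\<Omega>. \<Prod>p\<in>D. coll p \<omega> \<omega>') \<le> 
     real (card \<Omega>) * (L * (\<Prod>p\<in>D. 2 * j\<^sup>2 / real p) + \<eta> * (\<Prod>p\<in>D. j\<^sup>2))"
proof -
  have finD: "finite D" using assms finP finite_subset by auto
  let ?F = "\<lambda>p. {0..<int p} \<times> (T \<times> I p)"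
  have finF: "finite (?F p)" if "p \<in> D" for p using finT finI that assms by auto
  have "(\<Sum>\<omega>'\<in>\<Omega>. \<Prod>p\<in>D. coll p \<omega> \<omega>') \<le> (\<Sum>\<omega>'\<in>\<Omega>. \<Prod>p\<in>D. \<Sum>f\<in>?F p. N p \<omega> (fst f) * of_bool [\<omega>' = sol p (fst f) (snd f)] (mod int p))"
  proof (intro sum_mono prod_mono conjI coll_nonneg)
    fix \<omega>' p assume "\<omega>' \<in> \<Omega>" "p \<in> D"
    then have "coll p \<omega> \<omega>' \<le> (\<Sum>\<beta>\<in>{0..<int p}. N p \<omega> \<beta> * (\<Sum>x\<in>T \<times> I p. of_bool [\<omega>' = sol p \<beta> x] (mod int p)))"
      unfolding coll_def using assms N_nonneg by (intro sum_mono mult_left_mono N_le) auto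
    also have "\<dots> = (\<Sum>f\<in>?F p. N p \<omega> (fst f) * of_bool [\<omega>' = sol p (fst f) (snd f)] (mod int p))"
      unfolding sum_distrib_left sum.cartesian_product by (simp add: case_prod_beta)
    finally show "coll p \<omega> \<omega>' \<le> \<dots>" .
  qed
  also have "\<dots> = (\<Sum>\<omega>'\<in>\<Omega>. \<Sum>f\<in>PiE D ?F. \<Prod>p\<in>D. N p \<omega> (fst (f p)) * of_bool [\<omega>' = sol p (fst (f p)) (snd (f p))] (mod int p))"
    using finD finF by (subst sum_PiE_prod[symmetric]) auto
  also have "\<dots> = (\<Sum>f\<in>PiE D ?F. (\<Prod>p\<in>D. N p \<omega> (fst (f p))) * real (card {\<omega>'\<in>\<Omega>. in_class D (\<lambda>p. sol p (fst (f p)) (snd (f p))) \<omega>'}))"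
  proof (subst sum.swap, intro sum.cong refl)
    fix f
    have "(\<Sum>\<omega>'\<in>\<Omega>. \<Prod>p\<in>D. N p \<omega> (fst (f p)) * of_bool [\<omega>' = sol p (fst (f p)) (snd (f p))] (mod int p))
       = (\<Sum>\<omega>'\<in>\<Omega>. (\<Prod>p\<in>D. N p \<omega> (fst (f p))) * of_bool (in_class D (\<lambda>p. sol p (fst (f p)) (snd (f p))) \<omega>'))"
    proof (intro sum.cong refl)
      fix \<omega>'
      have "(\<Prod>p\<in>D. of_bool [\<omega>' = sol p (fst (f p)) (snd (f p))] (mod int p)) = (of_bool (in_class D (\<lambda>p. sol p (fst (f p)) (snd (f p))) \<omega>') :: real)"
        unfolding in_class_def using finD by (induction D rule: finite_induct) auto
      then show "(\<Prod>p\<in>D. N p \<omega> (fst (f p)) * of_bool [\<omega>' = sol p (fst (f p)) (snd (f p))] (mod int p)) = 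
          (\<Prod>p\<in>D. N p \<omega> (fst (f p))) * of_bool (in_class D (\<lambda>p. sol p (fst (f p)) (snd (f p))) \<omega>')"
        by (simp add: prod.distrib)
    qed
    also have "\<dots> = (\<Prod>p\<in>D. N p \<omega> (fst (f p))) * (\<Sum>\<omega>'\<in>\<Omega>. of_bool (in_class D (\<lambda>p. sol p (fst (f p)) (snd (f p))) \<omega>'))"
      by (rule sum_distrib_left[symmetric])
    also have "(\<Sum>\<omega>'\<in>\<Omega>. of_bool (in_class D (\<lambda>p. sol p (fst (f p)) (snd (f p))) \<omega>')) = 
        real (card {\<omega>'\<in>\<Omega>. in_class D (\<lambda>p. sol p (fst (f p)) (snd (f p))) \<omega>'})"
      using fin\<Omega> by (simp add: of_bool_def sum.If_cases Int_def)
    finally show "(\<Sum>\<omega>'\<in>\<Omega>. \<Prod>p\<in>D. N p \<omega> (fst (f p)) * of_bool [\<omega>' = sol p (fst (f p)) (snd (f p))] (mod int p)) = 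
        (\<Prod>p\<in>D. N p \<omega> (fst (f p))) * real (card {\<omega>'\<in>\<Omega>. in_class D (\<lambda>p. sol p (fst (f p)) (snd (f p))) \<omega>'})" .
  qed
  also have "\<dots> \<le> (\<Sum>f\<in>PiE D ?F. (\<Prod>p\<in>D. N p \<omega> (fst (f p))) * (real (card \<Omega>) * (L * (\<Prod>p\<in>D. 2 / real p) + \<eta>)))"
    by (intro sum_mono mult_left_mono count assms prod_nonneg) (simp add: N_nonneg)
  also have "\<dots> = (\<Sum>f\<in>PiE D ?F. \<Prod>p\<in>D. N p \<omega> (fst (f p))) * (real (card \<Omega>) * (L * (\<Prod>p\<in>D. 2 / real p) + \<eta>))"
    by (rule sum_distrib_right[symmetric])
  also have "(\<Sum>f\<in>PiE D ?F. \<Prod>p\<in>D. N p \<omega> (fst (f p))) = (\<Prod>p\<in>D. \<Sum>f\<in>?F p. N p \<omega> (fst f))"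
    using finD finF sum_PiE_prod[of D ?F "\<lambda>p x. N p \<omega> (fst x)"] by simp
  also have "\<dots> * (real (card \<Omega>) * (L * (\<Prod>p\<in>D. 2 / real p) + \<eta>)) \<le> 
      (\<Prod>p\<in>D. j\<^sup>2) * (real (card \<Omega>) * (L * (\<Prod>p\<in>D. 2 / real p) + \<eta>))"
  proof (intro mult_right_mono prod_mono conjI sum_nonneg N_nonneg)
    fix p assume "p \<in> D"
    then have p: "p \<in> P" using assms by auto
    have "(\<Sum>f\<in>?F p. N p \<omega> (fst f)) = (\<Sum>\<beta>\<in>{0..<int p}. \<Sum>x\<in>T \<times> I p. N p \<omega> \<beta>)"
      unfolding sum.cartesian_product by (simp add: case_prod_beta)
    also have "\<dots> = real (card (T \<times> I p)) * (\<Sum>\<beta>\<in>{0..<int p}. N p \<omega> \<beta>)" by (simp add: sum_distrib_left)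
    also have "\<dots> \<le> j * j" using card_TI[OF p] sum_N_le[OF p assms(2)] N_nonneg j by (intro mult_mono sum_nonneg) auto
    finally show "(\<Sum>f\<in>?F p. N p \<omega> (fst f)) \<le> j\<^sup>2" by (simp add: power2_eq_square)
  next
    show "0 \<le> real (card \<Omega>) * (L * (\<Prod>p\<in>D. 2 / real p) + \<eta>)"
      using L \<eta> by (intro mult_nonneg_nonneg add_nonneg_nonneg prod_nonneg) auto
  qed
  also have "\<dots> = real (card \<Omega>) * (L * (\<Prod>p\<in>D. 2 * j\<^sup>2 / real p) + \<eta> * (\<Prod>p\<in>D. j\<^sup>2))"
  proof -
    have "(\<Prod>p\<in>D. 2 * j\<^sup>2 / real p) = (\<Prod>p\<in>D. j\<^sup>2) * (\<Prod>p\<in>D. 2 / real p)"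
      unfolding prod.distrib[symmetric] by (simp add: mult.commute)
    then show ?thesis by (simp only: algebra_simps)
  qed
  finally show ?thesis .
qed

text \<open>On average a factor \<open>y\<close> is of size j^2 / p^2 in the main term, but only j^2
  / p next to \<eta>, which therefore has to be tiny.\<close>

lemma sum_prod_y_le:
  assumes "D \<subseteq> P" "\<omega> \<in> \<Omega>"
  shows "(\<Sum>\<omega>'\<in>\<Omega>. \<Prod>p\<in>D. y p \<omega> \<omega>') \<le> 
     real (card \<Omega>) * (L * (\<Prod>p\<in>D. 32 * j\<^sup>2 / (real p)\<^sup>2) + \<eta> * (\<Prod>p\<in>D. 32 * j\<^sup>2 / real p))"
proof -
  have finD: "finite D" using assms finP finite_subset by auto
  let ?z = "\<lambda>p. 16 * j\<^sup>2 / (real p)\<^sup>2"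
  have "(\<Sum>\<omega>'\<in>\<Omega>. \<Prod>p\<in>D. y p \<omega> \<omega>') = (\<Sum>E\<in>Pow D. (\<Prod>p\<in>E. 8 / real p) * (\<Prod>p\<in>D-E. ?z p) * (\<Sum>\<omega>'\<in>\<Omega>. \<Prod>p\<in>E. coll p \<omega> \<omega>'))"
    unfolding y_def prod_add[OF finD] prod.distrib
    by (subst sum.swap) (auto simp: sum_distrib_left intro!: sum.cong)
  also have "\<dots> \<le> (\<Sum>E\<in>Pow D. (\<Prod>p\<in>E. 8 / real p) * (\<Prod>p\<in>D-E. ?z p) * 
      (real (card \<Omega>) * (L * (\<Prod>p\<in>E. 2 * j\<^sup>2 / real p) + \<eta> * (\<Prod>p\<in>E. j\<^sup>2))))"
    using assms by (intro sum_mono mult_left_mono sum_prod_coll_le mult_nonneg_nonneg prod_nonneg) auto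
  also have "\<dots> = (\<Sum>E\<in>Pow D. real (card \<Omega>) * L * ((\<Prod>p\<in>E. 16 * j\<^sup>2 / (real p)\<^sup>2) * (\<Prod>p\<in>D-E. ?z p)) 
       + real (card \<Omega>) * \<eta> * ((\<Prod>p\<in>E. 8 * j\<^sup>2 / real p) * (\<Prod>p\<in>D-E. ?z p)))"
  proof (intro sum.cong refl)
    fix E
    have 1: "(\<Prod>p\<in>E. 16 * j\<^sup>2 / (real p)\<^sup>2) = (\<Prod>p\<in>E. 8 / real p) * (\<Prod>p\<in>E. 2 * j\<^sup>2 / real p)"
      unfolding prod.distrib[symmetric] by (intro prod.cong refl) (simp add: power2_eq_square)
    have 2: "(\<Prod>p\<in>E. 8 * j\<^sup>2 / real p) = (\<Prod>p\<in>E. 8 / real p) * (\<Prod>p\<in>E. j\<^sup>2)"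
      unfolding prod.distrib[symmetric] by (intro prod.cong refl) simp
    show "(\<Prod>p\<in>E. 8 / real p) * (\<Prod>p\<in>D-E. ?z p) * 
      (real (card \<Omega>) * (L * (\<Prod>p\<in>E. 2 * j\<^sup>2 / real p) + \<eta> * (\<Prod>p\<in>E. j\<^sup>2))) = 
       real (card \<Omega>) * L * ((\<Prod>p\<in>E. 16 * j\<^sup>2 / (real p)\<^sup>2) * (\<Prod>p\<in>D-E. ?z p)) 
       + real (card \<Omega>) * \<eta> * ((\<Prod>p\<in>E. 8 * j\<^sup>2 / real p) * (\<Prod>p\<in>D-E. ?z p))"
      unfolding 1 2 by (simp only: algebra_simps)
  qed
  also have "\<dots> = real (card \<Omega>) * L * (\<Prod>p\<in>D. 16 * j\<^sup>2 / (real p)\<^sup>2 + ?z p) + real (card \<Omega>) * \<eta> * (\<Prod>p\<in>D. 8 * j\<^sup>2 / real p + ?z p)"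
    unfolding sum.distrib sum_distrib_left[symmetric] prod_add[OF finD] ..
  also have "\<dots> \<le> real (card \<Omega>) * L * (\<Prod>p\<in>D. 32 * j\<^sup>2 / (real p)\<^sup>2) + real (card \<Omega>) * \<eta> * (\<Prod>p\<in>D. 32 * j\<^sup>2 / real p)"
  proof (intro add_mono mult_left_mono prod_mono conjI)
    fix p assume "p \<in> D"
    then have p: "real p \<ge> 1" using assms p_pos by force
    have "16 * j\<^sup>2 / (real p)\<^sup>2 \<le> 16 * j\<^sup>2 / real p"
      using p by (intro divide_left_mono) (auto simp: power2_eq_square)
    moreover have "8 * j\<^sup>2 / real p \<le> 16 * j\<^sup>2 / real p" by (intro divide_right_mono) auto
    ultimately show "8 * j\<^sup>2 / real p + ?z p \<le> 32 * j\<^sup>2 / real p" by simp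
  qed (use L \<eta> in auto)
  finally show ?thesis by (simp only: algebra_simps)
qed

lemma sum_N_\<omega>_le:
  assumes "p \<in> P"
  shows "(\<Sum>\<omega>'\<in>\<Omega>. N p \<omega>' \<beta>) \<le> real (card \<Omega>) * (j * (2 * L / real p + \<eta>))"
proof -
  have "(\<Sum>\<omega>'\<in>\<Omega>. N p \<omega>' \<beta>) \<le> (\<Sum>\<omega>'\<in>\<Omega>. \<Sum>x\<in>T \<times> I p. of_bool [\<omega>' = sol p \<beta> x] (mod int p))"
    using assms by (intro sum_mono N_le)
  also have "\<dots> = (\<Sum>x\<in>T \<times> I p. real (card {\<omega>'\<in>\<Omega>. in_class {p} (\<lambda>_. sol p \<beta> x) \<omega>'}))"
    using fin\<Omega> by (subst sum.swap) (simp add: of_bool_def sum.If_cases Int_def in_class_def)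
  also have "\<dots> \<le> (\<Sum>x\<in>T \<times> I p. real (card \<Omega>) * (L * (\<Prod>p\<in>{p}. 2 / real p) + \<eta>))"
    using assms by (intro sum_mono count) auto
  also have "\<dots> = real (card (T \<times> I p)) * (real (card \<Omega>) * (2 * L / real p + \<eta>))" by (simp add: mult.commute)
  also have "\<dots> \<le> j * (real (card \<Omega>) * (2 * L / real p + \<eta>))"
    using card_TI[OF assms] L \<eta> by (intro mult_right_mono mult_nonneg_nonneg add_nonneg_nonneg) auto
  finally show ?thesis by (simp only: algebra_simps)
qed

end

text \<open>Comparison with the telescoping 1 / (n (n-1)); the factor 2 comes from X - 1 \<ge> X /
  2.\<close>

lemma sum_recip_squares_le:
  assumes "finite S" "X \<ge> 2" "\<And>n. n \<in> S \<Longrightarrow> X \<le> real n"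
  shows "(\<Sum>n\<in>S. 1 / (real n)\<^sup>2) \<le> 2 / X"
proof -
  define k where "k = nat \<lceil>X\<rceil>"
  have k: "X \<le> real k" "k \<ge> 2" unfolding k_def using assms(2) by linarith+
  have tel: "(\<Sum>n=k..<k + m. 1 / (real n)\<^sup>2) \<le> 1 / (real k - 1) - 1 / (real (k + m) - 1)" for m
  proof (induction m)
    case (Suc m)
    have r: "real (k + m) \<ge> 2" using k by linarith
    have "1 / (real (k + m))\<^sup>2 \<le> 1 / (real (k + m) * (real (k + m) - 1))"
      using r by (intro divide_left_mono) (auto simp: power2_eq_square intro!: mult_left_mono mult_pos_pos)
    also have "\<dots> = 1 / (real (k + m) - 1) - 1 / (real (k + Suc m) - 1)"
      using r by (simp add: field_simps)
    finally show ?case using Suc.IH by simp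
  qed simp
  obtain m where m: "S \<subseteq> {k..<k + m}"
  proof -
    have "S \<subseteq> {k..<k + (Max (insert 0 S) + 1)}"
    proof
      fix n assume n: "n \<in> S"
      then have "k \<le> n" using assms(3)[OF n] unfolding k_def by linarith
      moreover have "n \<le> Max (insert 0 S)" using n assms(1) by simp
      ultimately show "n \<in> {k..<k + (Max (insert 0 S) + 1)}" by simp
    qed
    then show ?thesis using that by blast
  qed
  have "(\<Sum>n\<in>S. 1 / (real n)\<^sup>2) \<le> (\<Sum>n=k..<k + m. 1 / (real n)\<^sup>2)" using m by (intro sum_mono2) auto
  also have "\<dots> \<le> 1 / (real k - 1)"
  proof -
    have "1 / (real (k + m) - 1) \<ge> 0" using k by simp
    then show ?thesis using tel[of m] by linarith
  qed
  also have "\<dots> \<le> 1 / (X / 2)" using k assms(2) by (intro divide_left_mono) auto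
  finally show ?thesis by simp
qed

text \<open>Isolates the linear terms at the primes of \<open>Q\<close>, which get a separate
  treatment from all other terms of the expansion.\<close>

lemma sum_Pow_split:
  fixes f :: "'a \<Rightarrow> 'b::comm_semiring_1"
  assumes "finite P" "Q \<subseteq> P"
  shows "(\<Prod>p\<in>P. 1 + f p) = 1 + (\<Sum>p\<in>Q. f p) + (\<Sum>D\<in>Pow P - insert {} ((\<lambda>p. {p}) ` Q). \<Prod>p\<in>D. f p)"
proof -
  let ?X = "insert {} ((\<lambda>p. {p}) ` Q)"
  have finQ: "finite Q" using assms finite_subset by blast
  have "(\<Prod>p\<in>P. 1 + f p) = (\<Prod>p\<in>P. f p + 1)" by (simp add: add.commute)
  also have "\<dots> = (\<Sum>D\<in>Pow P. \<Prod>p\<in>D. f p)" by (subst prod_add[OF assms(1)]) simp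
  also have "Pow P = ?X \<union> (Pow P - ?X)" using assms by auto
  also have "(\<Sum>D\<in>?X \<union> (Pow P - ?X). \<Prod>p\<in>D. f p) = (\<Sum>D\<in>?X. \<Prod>p\<in>D. f p) + (\<Sum>D\<in>Pow P - ?X. \<Prod>p\<in>D. f p)"
    using assms finQ by (intro sum.union_disjoint) auto
  also have "(\<Sum>D\<in>?X. \<Prod>p\<in>D. f p) = 1 + (\<Sum>p\<in>Q. f p)"
    using finQ by (subst sum.insert) (auto simp: sum.reindex)
  finally show ?thesis .
qed

context local_factors
begin

definition P' :: "nat set" where "P' = {p\<in>P. real p \<le> P1}"
text \<open>Besides the products of at least two primes this keeps the singletons above
  \<open>P1\<close>, which are small enough for the trivial estimate.\<close>

definition rest :: "nat set set" where "rest = Pow P - insert {} ((\<lambda>p. {p}) ` P')"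
definition Em :: "nat \<Rightarrow> (int \<Rightarrow> real) \<Rightarrow> real" where "Em p f = (\<Sum>\<beta>\<in>Bs p. f \<beta>) / real (card (Bs p))"
text \<open>Multiplicity of hits in excess of 1, the local form of overlap; \<open>ov\<close> bounds
  its sum over \<open>Bs p\<close>.\<close>

definition \<nu> :: "nat \<Rightarrow> int \<Rightarrow> int \<Rightarrow> real" where "\<nu> p \<omega> \<beta> = N p \<omega> \<beta> - of_bool (\<beta> \<in> U p \<omega>)"

lemma P'_sub: "P' \<subseteq> P" "finite P'" unfolding P'_def using finP by auto

text \<open>All products of the \<open>g\<close> have mean 1, so the cross terms cancel against the
  constant, and independence factors the mixed moments.\<close>

lemma variance_eq:
  "(\<Sum>\<beta>\<in>PiE P Bs. (\<Sum>\<omega>\<in>\<Omega>. m \<omega> * ((\<Prod>p\<in>P. g p \<omega> (\<beta> p)) - 1))\<^sup>2) =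
    (\<Prod>p\<in>P. real (card (Bs p))) * (\<Sum>\<omega>\<in>\<Omega>. \<Sum>\<omega>'\<in>\<Omega>. m \<omega> * m \<omega>' * ((\<Prod>p\<in>P. 1 + \<kappa> p \<omega> \<omega>') - 1))"
proof -
  let ?C = "\<Prod>p\<in>P. real (card (Bs p))"
  let ?G = "\<lambda>\<omega> \<beta>. \<Prod>p\<in>P. g p \<omega> (\<beta> p)"
  have mean: "(\<Sum>\<beta>\<in>PiE P Bs. ?G \<omega> \<beta>) = ?C" if "\<omega> \<in> \<Omega>" for \<omega>
    using sum_PiE_prod[where f="\<lambda>p. g p \<omega>", OF finP finBs] mean_g[OF _ that] by simp
  have one: "(\<Sum>\<beta>\<in>PiE P Bs. 1::real) = ?C"
    using sum_PiE_prod[where f="\<lambda>p _. 1::real", OF finP finBs] by simp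
  have two: "(\<Sum>\<beta>\<in>PiE P Bs. ?G \<omega> \<beta> * ?G \<omega>' \<beta>) = ?C * (\<Prod>p\<in>P. 1 + \<kappa> p \<omega> \<omega>')" for \<omega> \<omega>'
  proof -
    have "(\<Sum>\<beta>\<in>PiE P Bs. ?G \<omega> \<beta> * ?G \<omega>' \<beta>) = (\<Prod>p\<in>P. \<Sum>\<beta>\<in>Bs p. g p \<omega> \<beta> * g p \<omega>' \<beta>)"
      unfolding prod.distrib[symmetric] by (rule sum_PiE_prod[OF finP finBs])
    also have "\<dots> = (\<Prod>p\<in>P. real (card (Bs p)) * (1 + \<kappa> p \<omega> \<omega>'))"
    proof (intro prod.cong refl)
      fix p assume "p \<in> P"
      then have "real (card (Bs p)) \<noteq> 0" using cardBs_pos by force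
      then show "(\<Sum>\<beta>\<in>Bs p. g p \<omega> \<beta> * g p \<omega>' \<beta>) = real (card (Bs p)) * (1 + \<kappa> p \<omega> \<omega>')"
        unfolding \<kappa>_def by simp
    qed
    finally show ?thesis by (simp add: prod.distrib)
  qed
  have "(\<Sum>\<beta>\<in>PiE P Bs. (\<Sum>\<omega>\<in>\<Omega>. m \<omega> * (?G \<omega> \<beta> - 1))\<^sup>2) = 
     (\<Sum>\<beta>\<in>PiE P Bs. \<Sum>\<omega>\<in>\<Omega>. \<Sum>\<omega>'\<in>\<Omega>. m \<omega> * m \<omega>' * (?G \<omega> \<beta> * ?G \<omega>' \<beta> - ?G \<omega> \<beta> - ?G \<omega>' \<beta> + 1))"
    unfolding power2_eq_square sum_product by (intro sum.cong refl) (simp add: algebra_simps)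
  also have "\<dots> = (\<Sum>\<omega>\<in>\<Omega>. \<Sum>\<omega>'\<in>\<Omega>. \<Sum>\<beta>\<in>PiE P Bs. m \<omega> * m \<omega>' * (?G \<omega> \<beta> * ?G \<omega>' \<beta> - ?G \<omega> \<beta> - ?G \<omega>' \<beta> + 1))"
    by (subst sum.swap, intro sum.cong refl, subst sum.swap) (rule refl)
  also have "\<dots> = (\<Sum>\<omega>\<in>\<Omega>. \<Sum>\<omega>'\<in>\<Omega>. ?C * (m \<omega> * m \<omega>' * ((\<Prod>p\<in>P. 1 + \<kappa> p \<omega> \<omega>') - 1)))"
  proof (intro sum.cong refl)
    fix \<omega> \<omega>' assume o: "\<omega> \<in> \<Omega>" "\<omega>' \<in> \<Omega>"
    show "(\<Sum>\<beta>\<in>PiE P Bs. m \<omega> * m \<omega>' * (?G \<omega> \<beta> * ?G \<omega>' \<beta> - ?G \<omega> \<beta> - ?G \<omega>' \<beta> + 1)) = 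
       ?C * (m \<omega> * m \<omega>' * ((\<Prod>p\<in>P. 1 + \<kappa> p \<omega> \<omega>') - 1))"
      unfolding sum_distrib_left[symmetric] sum.distrib sum_subtractf mean[OF o(1)] mean[OF o(2)] one two by (simp add: algebra_simps)
  qed
  also have "\<dots> = ?C * (\<Sum>\<omega>\<in>\<Omega>. \<Sum>\<omega>'\<in>\<Omega>. m \<omega> * m \<omega>' * ((\<Prod>p\<in>P. 1 + \<kappa> p \<omega> \<omega>') - 1))"
    by (simp only: sum_distrib_left)
  finally show ?thesis .
qed

lemma mm_le: 
  assumes "\<omega> \<in> \<Omega>" "\<omega>' \<in> \<Omega>" 
  shows "0 \<le> m \<omega> * m \<omega>'" "m \<omega> * m \<omega>' \<le> 4"
proof -
  show "0 \<le> m \<omega> * m \<omega>'" using m assms by simp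
  have "m \<omega> * m \<omega>' \<le> 2 * 2" using m assms by (intro mult_mono) auto
  then show "m \<omega> * m \<omega>' \<le> 4" by simp
qed

text \<open>Here absolute values suffice: the sum over \<open>rest\<close> of averaged products of
  \<open>y\<close> is an Euler product without its constant term and its linear terms over
  \<open>P'\<close>.\<close>

lemma crude_bound:
  "(\<Sum>\<omega>\<in>\<Omega>. \<Sum>\<omega>'\<in>\<Omega>. m \<omega> * m \<omega>' * (\<Sum>D\<in>rest. \<Prod>p\<in>D. \<kappa> p \<omega> \<omega>'))
   \<le> (real (card \<Omega>))\<^sup>2 * (4 * L * ((64 * j\<^sup>2 / P0)\<^sup>2 + 64 * j\<^sup>2 / P1) + 4 * \<eta> * exp (32 * j\<^sup>2 * (\<Sum>p\<in>P. 1 / real p)))"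
proof -
  let ?a = "\<lambda>p. 32 * j\<^sup>2 / (real p)\<^sup>2" and ?a' = "\<lambda>p. 32 * j\<^sup>2 / real p"
  have finrest: "finite rest" unfolding rest_def using finP by auto
  have "(\<Sum>\<omega>\<in>\<Omega>. \<Sum>\<omega>'\<in>\<Omega>. m \<omega> * m \<omega>' * (\<Sum>D\<in>rest. \<Prod>p\<in>D. \<kappa> p \<omega> \<omega>'))
    \<le> (\<Sum>\<omega>\<in>\<Omega>. \<Sum>\<omega>'\<in>\<Omega>. 4 * (\<Sum>D\<in>rest. \<Prod>p\<in>D. y p \<omega> \<omega>'))"
  proof (intro sum_mono)
    fix \<omega> \<omega>' assume o: "\<omega> \<in> \<Omega>" "\<omega>' \<in> \<Omega>"
    have "(\<Sum>D\<in>rest. \<Prod>p\<in>D. \<kappa> p \<omega> \<omega>') \<le> (\<Sum>D\<in>rest. \<Prod>p\<in>D. y p \<omega> \<omega>')"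
    proof (intro sum_mono)
      fix D assume "D \<in> rest"
      then have D: "D \<subseteq> P" unfolding rest_def by auto
      have "(\<Prod>p\<in>D. \<kappa> p \<omega> \<omega>') \<le> \<bar>\<Prod>p\<in>D. \<kappa> p \<omega> \<omega>'\<bar>" by simp
      also have "\<dots> = (\<Prod>p\<in>D. \<bar>\<kappa> p \<omega> \<omega>'\<bar>)" by (rule abs_prod)
      also have "\<dots> \<le> (\<Prod>p\<in>D. y p \<omega> \<omega>')" using abs_\<kappa>_le o D by (intro prod_mono) auto
      finally show "(\<Prod>p\<in>D. \<kappa> p \<omega> \<omega>') \<le> (\<Prod>p\<in>D. y p \<omega> \<omega>')" .
    qed
    then have "m \<omega> * m \<omega>' * (\<Sum>D\<in>rest. \<Prod>p\<in>D. \<kappa> p \<omega> \<omega>') \<le> m \<omega> * m \<omega>' * (\<Sum>D\<in>rest. \<Prod>p\<in>D. y p \<omega> \<omega>')"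
      using mm_le[OF o] by (intro mult_left_mono) auto
    also have "\<dots> \<le> 4 * (\<Sum>D\<in>rest. \<Prod>p\<in>D. y p \<omega> \<omega>')"
      using mm_le[OF o] y_nonneg by (intro mult_right_mono sum_nonneg prod_nonneg) auto
    finally show "m \<omega> * m \<omega>' * (\<Sum>D\<in>rest. \<Prod>p\<in>D. \<kappa> p \<omega> \<omega>') \<le> 4 * (\<Sum>D\<in>rest. \<Prod>p\<in>D. y p \<omega> \<omega>')" .
  qed
  also have "\<dots> = (\<Sum>\<omega>\<in>\<Omega>. 4 * (\<Sum>D\<in>rest. \<Sum>\<omega>'\<in>\<Omega>. \<Prod>p\<in>D. y p \<omega> \<omega>'))"
    unfolding sum_distrib_left[symmetric] by (intro arg_cong2[where f="(*)"] sum.cong refl, subst sum.swap) (rule refl)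
  also have "\<dots> \<le> (\<Sum>\<omega>\<in>\<Omega>. 4 * (\<Sum>D\<in>rest. real (card \<Omega>) * (L * (\<Prod>p\<in>D. ?a p) + \<eta> * (\<Prod>p\<in>D. ?a' p))))"
    by (intro sum_mono mult_left_mono sum_prod_y_le) (auto simp: rest_def)
  also have "\<dots> = (real (card \<Omega>))\<^sup>2 * (4 * (L * (\<Sum>D\<in>rest. \<Prod>p\<in>D. ?a p) + \<eta> * (\<Sum>D\<in>rest. \<Prod>p\<in>D. ?a' p)))"
    unfolding sum_distrib_left[symmetric] sum.distrib by (simp add: power2_eq_square algebra_simps)
  also have "\<dots> \<le> (real (card \<Omega>))\<^sup>2 * (4 * (L * ((64 * j\<^sup>2 / P0)\<^sup>2 + 64 * j\<^sup>2 / P1) + \<eta> * exp (32 * j\<^sup>2 * (\<Sum>p\<in>P. 1 / real p))))"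
  proof (intro mult_left_mono add_mono)
    define s where "s = (\<Sum>p\<in>P. ?a p)"
    have s0: "s \<ge> 0" unfolding s_def by (intro sum_nonneg) auto
    have "s = 32 * j\<^sup>2 * (\<Sum>p\<in>P. 1 / (real p)\<^sup>2)" unfolding s_def by (simp add: sum_distrib_left)
    also have "\<dots> \<le> 32 * j\<^sup>2 * (2 / P0)" using finP P0 by (intro mult_left_mono sum_recip_squares_le) auto
    finally have s: "s \<le> 64 * j\<^sup>2 / P0" by simp
    also have "\<dots> \<le> 1" using j(2) P0(1) by (simp add: divide_le_eq)
    finally have s1: "s \<le> 1" .
    have fr: "(\<Prod>p\<in>P. 1 + ?a p) = 1 + (\<Sum>p\<in>P'. ?a p) + (\<Sum>D\<in>rest. \<Prod>p\<in>D. ?a p)"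
      unfolding rest_def using finP P'_sub by (intro sum_Pow_split) auto
    have "(\<Sum>p\<in>P - P'. ?a p) = 32 * j\<^sup>2 * (\<Sum>p\<in>P-P'. 1 / (real p)\<^sup>2)" by (simp add: sum_distrib_left)
    also have "\<dots> \<le> 32 * j\<^sup>2 * (2 / P1)" using finP P1 unfolding P'_def by (intro mult_left_mono sum_recip_squares_le) auto
    finally have q: "(\<Sum>p\<in>P - P'. ?a p) \<le> 64 * j\<^sup>2 / P1" by simp
    have sp: "s = (\<Sum>p\<in>P'. ?a p) + (\<Sum>p\<in>P - P'. ?a p)"
      unfolding s_def using sum.subset_diff[OF P'_sub(1) finP] by (simp add: add.commute)
    have "(\<Prod>p\<in>P. 1 + ?a p) \<le> exp s" unfolding s_def by (rule prod_le_exp_sum) auto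
    \<comment> \<open>The constant and the linear terms over \<open>P'\<close> cancel, leaving s^2
      and the linear terms above \<open>P1\<close>. With \<open>P0\<close> = H^M the square is of
      order H^(4-2M), which is at most H^(-M) precisely for M \<ge> 4.\<close>
    also have "\<dots> \<le> 1 + s + s\<^sup>2" using exp_bound[OF s0 s1] .
    finally have "(\<Sum>D\<in>rest. \<Prod>p\<in>D. ?a p) \<le> s\<^sup>2 + (\<Sum>p\<in>P - P'. ?a p)" using fr sp by linarith
    also have "\<dots> \<le> (64 * j\<^sup>2 / P0)\<^sup>2 + 64 * j\<^sup>2 / P1" using s s0 q by (intro add_mono power_mono) auto
    finally show "(\<Sum>D\<in>rest. \<Prod>p\<in>D. ?a p) \<le> (64 * j\<^sup>2 / P0)\<^sup>2 + 64 * j\<^sup>2 / P1" .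
    have "(\<Prod>p\<in>P. 1 + ?a' p) = 1 + (\<Sum>p\<in>P'. ?a' p) + (\<Sum>D\<in>rest. \<Prod>p\<in>D. ?a' p)"
      unfolding rest_def using finP P'_sub by (intro sum_Pow_split) auto
    moreover have "(\<Sum>p\<in>P'. ?a' p) \<ge> 0" by (intro sum_nonneg) auto
    moreover have "(\<Prod>p\<in>P. 1 + ?a' p) \<le> exp (\<Sum>p\<in>P. ?a' p)" by (rule prod_le_exp_sum) auto
    ultimately show "(\<Sum>D\<in>rest. \<Prod>p\<in>D. ?a' p) \<le> exp (32 * j\<^sup>2 * (\<Sum>p\<in>P. 1 / real p))"
      by (simp add: sum_distrib_left)
  qed (use L \<eta> in auto)
  finally show ?thesis by (simp only: algebra_simps)
qed

subsection \<open>The first-order terms\<close>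

lemma Em_nonneg: "(\<And>\<beta>. \<beta> \<in> Bs p \<Longrightarrow> f \<beta> \<ge> 0) \<Longrightarrow> Em p f \<ge> 0"
  unfolding Em_def by (intro divide_nonneg_nonneg sum_nonneg) auto

lemma Em_mono: "(\<And>\<beta>. \<beta> \<in> Bs p \<Longrightarrow> f \<beta> \<le> h \<beta>) \<Longrightarrow> Em p f \<le> Em p h"
  unfolding Em_def by (intro divide_right_mono sum_mono) auto

lemma Em_add: "Em p (\<lambda>\<beta>. f \<beta> + h \<beta>) = Em p f + Em p h"
  unfolding Em_def by (simp add: sum.distrib add_divide_distrib)

lemma Em_diff: "Em p (\<lambda>\<beta>. f \<beta> - h \<beta>) = Em p f - Em p h"
  unfolding Em_def by (simp add: sum_subtractf diff_divide_distrib)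

lemma Em_sum: "(\<Sum>x\<in>X. Em p (f x)) = Em p (\<lambda>\<beta>. \<Sum>x\<in>X. f x \<beta>)"
  unfolding Em_def sum_divide_distrib[symmetric] by (subst sum.swap) simp

lemma Em_cmult: "Em p (\<lambda>\<beta>. k * f \<beta>) = k * Em p f"
  unfolding Em_def by (simp add: sum_distrib_left)

lemma \<nu>_nonneg: "p \<in> P \<Longrightarrow> \<omega> \<in> \<Omega> \<Longrightarrow> \<nu> p \<omega> \<beta> \<ge> 0"
  unfolding \<nu>_def using chi_le_N by simp

lemma u_Em: "p \<in> P \<Longrightarrow> u p \<omega> = Em p (\<lambda>\<beta>. of_bool (\<beta> \<in> U p \<omega>))"
  unfolding u_def Em_def card_U by simp

lemma EmN_le:
  assumes "p \<in> P" "\<omega> \<in> \<Omega>"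
  shows "Em p (N p \<omega>) \<le> 2 * j / real p"
proof -
  have "Em p (N p \<omega>) \<le> j / real (card (Bs p))" 
    unfolding Em_def using sum_N_Bs_le[OF assms] by (intro divide_right_mono) auto
  also have "\<dots> \<le> j / (real p / 2)" using Bs(2)[OF assms(1)] cardBs_pos[OF assms(1)] p_pos[OF assms(1)] j
    by (intro divide_left_mono) auto
  finally show ?thesis by (simp add: mult.commute)
qed

lemma Em\<nu>_le:
  assumes "p \<in> P" "\<omega> \<in> \<Omega>"
  shows "Em p (\<nu> p \<omega>) \<le> 2 * ov p \<omega> / real p" "ov p \<omega> \<ge> 0"
proof -
  have "(\<Sum>\<beta>\<in>Bs p. \<nu> p \<omega> \<beta>) \<le> ov p \<omega>"
    using ov0[OF assms] unfolding \<nu>_def N_def hits_def U_def by simp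
  moreover have "(\<Sum>\<beta>\<in>Bs p. \<nu> p \<omega> \<beta>) \<ge> 0" using \<nu>_nonneg[OF assms] by (intro sum_nonneg) auto
  ultimately show 0: "ov p \<omega> \<ge> 0" by linarith
  have "Em p (\<nu> p \<omega>) \<le> ov p \<omega> / real (card (Bs p))" 
    unfolding Em_def using \<open>(\<Sum>\<beta>\<in>Bs p. \<nu> p \<omega> \<beta>) \<le> ov p \<omega>\<close> by (intro divide_right_mono) auto
  also have "\<dots> \<le> ov p \<omega> / (real p / 2)" using Bs(2)[OF assms(1)] cardBs_pos[OF assms(1)] p_pos[OF assms(1)] 0
    by (intro divide_left_mono) auto
  finally show "Em p (\<nu> p \<omega>) \<le> 2 * ov p \<omega> / real p" by (simp add: mult.commute)
qed

text \<open>Unlike \<kappa>, this is bilinear in the hit counts, so that summing it over both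
  variables gives a variance.\<close>

definition Cov :: "nat \<Rightarrow> int \<Rightarrow> int \<Rightarrow> real" where
  "Cov p \<omega> \<omega>' = Em p (\<lambda>\<beta>. N p \<omega> \<beta> * N p \<omega>' \<beta>) - Em p (N p \<omega>) * Em p (N p \<omega>')"

text \<open>The passage changes two things: the denominators (1-u)(1-u'), at a relative cost O(j /
  p), and the indicators into multiplicities, at a cost measured by \<nu>.\<close>

lemma \<kappa>_Cov:
  assumes "p \<in> P" "\<omega> \<in> \<Omega>" "\<omega>' \<in> \<Omega>"
  shows "\<bar>\<kappa> p \<omega> \<omega>' - Cov p \<omega> \<omega>'\<bar> \<le> 
     16 * j / real p * (Em p (\<lambda>\<beta>. N p \<omega> \<beta> * N p \<omega>' \<beta>) + Em p (N p \<omega>) * Em p (N p \<omega>'))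
     + Em p (\<lambda>\<beta>. \<nu> p \<omega> \<beta> * N p \<omega>' \<beta>) + Em p (\<lambda>\<beta>. N p \<omega> \<beta> * \<nu> p \<omega>' \<beta>)
     + Em p (\<nu> p \<omega>) * Em p (N p \<omega>') + Em p (N p \<omega>) * Em p (\<nu> p \<omega>')"
proof -
  let ?x = "Em p (\<lambda>\<beta>. of_bool (\<beta> \<in> U p \<omega>) * of_bool (\<beta> \<in> U p \<omega>'))"
  let ?NN = "Em p (\<lambda>\<beta>. N p \<omega> \<beta> * N p \<omega>' \<beta>)"
  let ?n = "Em p (N p \<omega>)" and ?n' = "Em p (N p \<omega>')"
  let ?u = "u p \<omega>" and ?u' = "u p \<omega>'"
  let ?w = "(1 - ?u) * (1 - ?u')"
  note u = u_le[OF assms(1,2)] and u' = u_le[OF assms(1,3)]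
  have x0: "?x \<ge> 0" by (rule Em_nonneg) simp
  have xN: "?x \<le> ?NN" using assms by (intro Em_mono mult_mono chi_le_N N_nonneg) auto
  have un: "?u \<le> ?n" "?u' \<le> ?n'" unfolding u_Em[OF assms(1)] using assms by (auto intro!: Em_mono chi_le_N)
  have \<nu>: "Em p (\<nu> p \<omega>) = ?n - ?u" "Em p (\<nu> p \<omega>') = ?n' - ?u'"
    unfolding u_Em[OF assms(1)] \<nu>_def Em_diff by auto
  have k: "\<kappa> p \<omega> \<omega>' = (?x - ?u * ?u') / ?w" unfolding \<kappa>_eq[OF assms] Em_def ..
  have w: "?w > 0" "1 / ?w \<le> 4" using inv_le_4[OF u(3) u'(3)] by auto
  \<comment> \<open>This is X / w - X = X (1 - w) / w with 1 - w = u + u' - u u'.\<close>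
  have k1: "\<kappa> p \<omega> \<omega>' - (?x - ?u * ?u') = (?x - ?u * ?u') * ((?u + ?u' - ?u * ?u') * (1 / ?w))"
    unfolding k using w(1) u u' by (simp add: field_simps)
  have k2: "\<bar>(?x - ?u * ?u') * ((?u + ?u' - ?u * ?u') * (1 / ?w))\<bar> \<le> (?NN + ?n * ?n') * (16 * j / real p)"
    unfolding abs_mult[of "?x - ?u * ?u'"]
  proof (intro mult_mono)
    have "?u * ?u' \<le> ?n * ?n'" using un u u' by (intro mult_mono) auto
    moreover have "?u * ?u' \<ge> 0" using u u' by simp
    ultimately show "\<bar>?x - ?u * ?u'\<bar> \<le> ?NN + ?n * ?n'" using x0 xN by linarith
    have "?u * ?u' \<le> ?u * 1" using u u' by (intro mult_left_mono) auto
    then have "0 \<le> ?u + ?u' - ?u * ?u'" using u u' by linarith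
    then have "\<bar>(?u + ?u' - ?u * ?u') * (1 / ?w)\<bar> = (?u + ?u' - ?u * ?u') * (1 / ?w)" using w by simp
    also have "\<dots> \<le> (?u + ?u' - ?u * ?u') * 4" using w \<open>0 \<le> ?u + ?u' - ?u * ?u'\<close> by (intro mult_left_mono) auto
    also have "\<dots> \<le> (2 * j / real p + 2 * j / real p) * 4"
    proof (rule mult_right_mono)
      show "?u + ?u' - ?u * ?u' \<le> 2 * j / real p + 2 * j / real p" using u u' \<open>?u * ?u' \<ge> 0\<close> by linarith
    qed simp
    finally show "\<bar>(?u + ?u' - ?u * ?u') * (1 / ?w)\<bar> \<le> 16 * j / real p" by simp
    have "?n \<ge> 0" "?n' \<ge> 0" using un u u' by linarith+
    then show "0 \<le> ?NN + ?n * ?n'" using x0 xN by (intro add_nonneg_nonneg) auto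
  qed simp
  have 1: "\<bar>\<kappa> p \<omega> \<omega>' - (?x - ?u * ?u')\<bar> \<le> 16 * j / real p * (?NN + ?n * ?n')"
    using k2 unfolding k1 mult.commute[of "16 * j / real p"] .
  have "?NN - ?x = Em p (\<lambda>\<beta>. N p \<omega> \<beta> * N p \<omega>' \<beta> - of_bool (\<beta> \<in> U p \<omega>) * of_bool (\<beta> \<in> U p \<omega>'))"
    by (simp only: Em_diff)
  also have "\<dots> \<le> Em p (\<lambda>\<beta>. \<nu> p \<omega> \<beta> * N p \<omega>' \<beta> + N p \<omega> \<beta> * \<nu> p \<omega>' \<beta>)"
  proof (rule Em_mono)
    fix \<beta>
    have 1: "N p \<omega> \<beta> * N p \<omega>' \<beta> - of_bool (\<beta> \<in> U p \<omega>) * of_bool (\<beta> \<in> U p \<omega>') = 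
       \<nu> p \<omega> \<beta> * N p \<omega>' \<beta> + of_bool (\<beta> \<in> U p \<omega>) * \<nu> p \<omega>' \<beta>"
      by (simp add: \<nu>_def algebra_simps)
    have 2: "of_bool (\<beta> \<in> U p \<omega>) * \<nu> p \<omega>' \<beta> \<le> N p \<omega> \<beta> * \<nu> p \<omega>' \<beta>"
      using assms by (intro mult_right_mono chi_le_N \<nu>_nonneg)
    show "N p \<omega> \<beta> * N p \<omega>' \<beta> - of_bool (\<beta> \<in> U p \<omega>) * of_bool (\<beta> \<in> U p \<omega>') \<le>
       \<nu> p \<omega> \<beta> * N p \<omega>' \<beta> + N p \<omega> \<beta> * \<nu> p \<omega>' \<beta>" using 1 2 by linarith
  qed
  finally have 2: "?NN - ?x \<le> Em p (\<lambda>\<beta>. \<nu> p \<omega> \<beta> * N p \<omega>' \<beta>) + Em p (\<lambda>\<beta>. N p \<omega> \<beta> * \<nu> p \<omega>' \<beta>)"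
    by (simp only: Em_add)
  have "?n * ?n' - ?u * ?u' = (?n - ?u) * ?n' + ?u * (?n' - ?u')" by (simp add: algebra_simps)
  also have "\<dots> \<le> (?n - ?u) * ?n' + ?n * (?n' - ?u')"
    using un by (intro add_left_mono mult_right_mono) auto
  finally have 3: "?n * ?n' - ?u * ?u' \<le> Em p (\<nu> p \<omega>) * ?n' + ?n * Em p (\<nu> p \<omega>')" unfolding \<nu> .
  have 4: "?u * ?u' \<le> ?n * ?n'" using un u u' by (intro mult_mono) auto
  show ?thesis unfolding Cov_def using 1 2 3 4 xN by linarith
qed

text \<open>In each error term one hit count is first summed over its index; the result is bounded
  uniformly in \<beta> by \<open>?Z\<close>. The other factor is then averaged over
  \<open>Bs p\<close> and gives j / p or the overlap.\<close>

lemma sum_\<kappa>_Cov: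
  assumes "p \<in> P"
  shows "(\<Sum>\<omega>\<in>\<Omega>. \<Sum>\<omega>'\<in>\<Omega>. \<bar>\<kappa> p \<omega> \<omega>' - Cov p \<omega> \<omega>'\<bar>) \<le> 
     real (card \<Omega>) * (j * (2 * L / P0 + \<eta>)) * (\<Sum>\<omega>\<in>\<Omega>. 64 * j\<^sup>2 / (real p)\<^sup>2 + 8 * ov p \<omega> / real p)"
proof -
  let ?Z = "real (card \<Omega>) * (j * (2 * L / P0 + \<eta>))"
  have "j * (2 * L / real p + \<eta>) \<le> j * (2 * L / P0 + \<eta>)"
    using j L P0(1) P0(2)[OF assms] by (intro mult_left_mono add_right_mono divide_left_mono) auto
  then have Z: "(\<Sum>\<omega>'\<in>\<Omega>. N p \<omega>' \<beta>) \<le> ?Z" for \<beta>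
    using sum_N_\<omega>_le[OF assms, of \<beta>] by (meson mult_left_mono of_nat_0_le_iff order_trans)
  have Z0: "?Z \<ge> 0" using j L \<eta> P0 by auto
  have gen: "(\<Sum>\<omega>'\<in>\<Omega>. Em p (\<lambda>\<beta>. f \<beta> * N p \<omega>' \<beta>)) \<le> ?Z * Em p f" 
    "(\<Sum>\<omega>'\<in>\<Omega>. Em p f * Em p (N p \<omega>')) \<le> ?Z * Em p f"
    if "\<And>\<beta>. f \<beta> \<ge> 0" for f
  proof -
    have "(\<Sum>\<omega>'\<in>\<Omega>. Em p (\<lambda>\<beta>. f \<beta> * N p \<omega>' \<beta>)) = Em p (\<lambda>\<beta>. f \<beta> * (\<Sum>\<omega>'\<in>\<Omega>. N p \<omega>' \<beta>))"
      unfolding Em_sum sum_distrib_left ..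
    also have "\<dots> \<le> Em p (\<lambda>\<beta>. ?Z * f \<beta>)" 
      using that Z by (intro Em_mono) (metis mult.commute mult_left_mono)
    finally show "(\<Sum>\<omega>'\<in>\<Omega>. Em p (\<lambda>\<beta>. f \<beta> * N p \<omega>' \<beta>)) \<le> ?Z * Em p f" unfolding Em_cmult .
    have "(\<Sum>\<omega>'\<in>\<Omega>. Em p f * Em p (N p \<omega>')) = Em p f * Em p (\<lambda>\<beta>. \<Sum>\<omega>'\<in>\<Omega>. N p \<omega>' \<beta>)"
      unfolding sum_distrib_left[symmetric] Em_sum ..
    also have "\<dots> \<le> Em p f * Em p (\<lambda>\<beta>. ?Z)" using that Z by (intro mult_left_mono Em_mono Em_nonneg) auto
    also have "Em p (\<lambda>\<beta>. ?Z) = ?Z" unfolding Em_def using cardBs_pos[OF assms] by simp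
    finally show "(\<Sum>\<omega>'\<in>\<Omega>. Em p f * Em p (N p \<omega>')) \<le> ?Z * Em p f" by (simp only: mult.commute)
  qed
  have sym1: "(\<Sum>\<omega>\<in>\<Omega>. \<Sum>\<omega>'\<in>\<Omega>. Em p (\<lambda>\<beta>. N p \<omega> \<beta> * \<nu> p \<omega>' \<beta>)) = (\<Sum>\<omega>\<in>\<Omega>. \<Sum>\<omega>'\<in>\<Omega>. Em p (\<lambda>\<beta>. \<nu> p \<omega> \<beta> * N p \<omega>' \<beta>))"
    by (subst sum.swap) (simp only: mult.commute)
  have sym2: "(\<Sum>\<omega>\<in>\<Omega>. \<Sum>\<omega>'\<in>\<Omega>. Em p (N p \<omega>) * Em p (\<nu> p \<omega>')) = (\<Sum>\<omega>\<in>\<Omega>. \<Sum>\<omega>'\<in>\<Omega>. Em p (\<nu> p \<omega>) * Em p (N p \<omega>'))"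
    by (subst sum.swap) (intro sum.cong refl mult.commute)
  let ?f = "\<lambda>\<omega> \<omega>'. Em p (\<lambda>\<beta>. N p \<omega> \<beta> * N p \<omega>' \<beta>)" and ?h = "\<lambda>\<omega> \<omega>'. Em p (N p \<omega>) * Em p (N p \<omega>')"
  let ?f1 = "\<lambda>\<omega> \<omega>'. Em p (\<lambda>\<beta>. \<nu> p \<omega> \<beta> * N p \<omega>' \<beta>)" and ?h1 = "\<lambda>\<omega> \<omega>'. Em p (\<nu> p \<omega>) * Em p (N p \<omega>')"
  have "(\<Sum>\<omega>\<in>\<Omega>. \<Sum>\<omega>'\<in>\<Omega>. \<bar>\<kappa> p \<omega> \<omega>' - Cov p \<omega> \<omega>'\<bar>) \<le> (\<Sum>\<omega>\<in>\<Omega>. \<Sum>\<omega>'\<in>\<Omega>. 16 * j / real p * (?f \<omega> \<omega>' + ?h \<omega> \<omega>')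
     + ?f1 \<omega> \<omega>' + Em p (\<lambda>\<beta>. N p \<omega> \<beta> * \<nu> p \<omega>' \<beta>) + ?h1 \<omega> \<omega>' + Em p (N p \<omega>) * Em p (\<nu> p \<omega>'))"
    by (intro sum_mono \<kappa>_Cov assms)
  also have "\<dots> = (\<Sum>\<omega>\<in>\<Omega>. 16 * j / real p * ((\<Sum>\<omega>'\<in>\<Omega>. ?f \<omega> \<omega>') + (\<Sum>\<omega>'\<in>\<Omega>. ?h \<omega> \<omega>')) 
      + 2 * (\<Sum>\<omega>'\<in>\<Omega>. ?f1 \<omega> \<omega>') + 2 * (\<Sum>\<omega>'\<in>\<Omega>. ?h1 \<omega> \<omega>'))"
    unfolding sum.distrib sym1 sym2 by (simp add: sum_distrib_left sum.distrib distrib_left)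
  also have "\<dots> \<le> (\<Sum>\<omega>\<in>\<Omega>. ?Z * (64 * j\<^sup>2 / (real p)\<^sup>2 + 8 * ov p \<omega> / real p))"
  proof (rule sum_mono)
    fix \<omega> assume o: "\<omega> \<in> \<Omega>"
    have "(\<Sum>\<omega>'\<in>\<Omega>. ?f \<omega> \<omega>') + (\<Sum>\<omega>'\<in>\<Omega>. ?h \<omega> \<omega>') \<le> ?Z * Em p (N p \<omega>) + ?Z * Em p (N p \<omega>)"
      by (intro add_mono gen N_nonneg)
    also have "\<dots> \<le> ?Z * (2 * j / real p) + ?Z * (2 * j / real p)"
      using Z0 EmN_le[OF assms o] by (intro add_mono mult_left_mono)
    finally have 1: "16 * j / real p * ((\<Sum>\<omega>'\<in>\<Omega>. ?f \<omega> \<omega>') + (\<Sum>\<omega>'\<in>\<Omega>. ?h \<omega> \<omega>')) \<le> 16 * j / real p * (?Z * (2 * j / real p) + ?Z * (2 * j / real p))"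
      using j by (intro mult_left_mono) auto
    have 2: "(\<Sum>\<omega>'\<in>\<Omega>. ?f1 \<omega> \<omega>') \<le> ?Z * (2 * ov p \<omega> / real p)"
      using gen(1)[of "\<nu> p \<omega>", OF \<nu>_nonneg[OF assms o]] mult_left_mono[OF Em\<nu>_le(1)[OF assms o] Z0] by linarith
    have 3: "(\<Sum>\<omega>'\<in>\<Omega>. ?h1 \<omega> \<omega>') \<le> ?Z * (2 * ov p \<omega> / real p)"
      using gen(2)[of "\<nu> p \<omega>", OF \<nu>_nonneg[OF assms o]] mult_left_mono[OF Em\<nu>_le(1)[OF assms o] Z0] by linarith
    have 4: "16 * j / real p * (?Z * (2 * j / real p) + ?Z * (2 * j / real p)) + 2 * (?Z * (2 * ov p \<omega> / real p)) + 2 * (?Z * (2 * ov p \<omega> / real p))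
       = ?Z * (64 * j\<^sup>2 / (real p)\<^sup>2 + 8 * ov p \<omega> / real p)"
      using p_pos[OF assms] by (simp add: field_simps power2_eq_square)
    show "16 * j / real p * ((\<Sum>\<omega>'\<in>\<Omega>. ?f \<omega> \<omega>') + (\<Sum>\<omega>'\<in>\<Omega>. ?h \<omega> \<omega>')) 
      + 2 * (\<Sum>\<omega>'\<in>\<Omega>. ?f1 \<omega> \<omega>') + 2 * (\<Sum>\<omega>'\<in>\<Omega>. ?h1 \<omega> \<omega>') \<le> ?Z * (64 * j\<^sup>2 / (real p)\<^sup>2 + 8 * ov p \<omega> / real p)"
      unfolding 4[symmetric] using 1 2 3 by linarith
  qed
  also have "\<dots> = ?Z * (\<Sum>\<omega>\<in>\<Omega>. 64 * j\<^sup>2 / (real p)\<^sup>2 + 8 * ov p \<omega> / real p)" by (rule sum_distrib_left[symmetric])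
  finally show ?thesis .
qed

lemma N_eq:
  assumes "p \<in> P" "\<omega> \<in> \<Omega>"
  shows "N p \<omega> \<beta> = (\<Sum>x\<in>T \<times> I p. of_bool (fst x \<in> A \<omega>) * of_bool [\<omega> = sol p \<beta> x] (mod int p))"
proof -
  have "hits p \<omega> \<beta> = {x\<in>T \<times> I p. fst x \<in> A \<omega> \<and> [\<omega> = sol p \<beta> x] (mod int p)}"
    unfolding hits_def using sol_iff[OF assms(1)] A[OF assms(2)] by auto
  then have "N p \<omega> \<beta> = (\<Sum>x\<in>T \<times> I p. of_bool (fst x \<in> A \<omega> \<and> [\<omega> = sol p \<beta> x] (mod int p)))"
    unfolding N_def using finT finI[OF assms(1)] by (simp add: of_bool_def sum.If_cases Int_def)
  then show ?thesis by (simp only: of_bool_conj)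
qed

text \<open>The coefficients fed to the large sieve, one sequence per index \<open>a\<close>: they
  pick the \<omega> whose term \<open>a\<close> survives the small primes.\<close>

definition \<alpha> :: "int \<Rightarrow> int \<Rightarrow> real" where "\<alpha> a \<omega> = m \<omega> * of_bool (a \<in> A \<omega>)"

text \<open>As the residue varies, its solution runs through distinct classes modulo
  \<open>p\<close>, the linear map being invertible.\<close>

lemma sum_sol_le:
  assumes "p \<in> P" "x \<in> T \<times> I p"
  shows "(\<Sum>r\<in>{0..<int p}. (class_dev \<Omega> f p (sol p r x))\<^sup>2) \<le> (\<Sum>r\<in>{0..<int p}. (class_dev \<Omega> f p r)\<^sup>2)"
proof -
  let ?h = "\<lambda>r. sol p r x mod int p"
  have pp: "int p > 0" using p_pos[OF assms(1)] by simp
  have inj: "inj_on ?h {0..<int p}"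
  proof (rule inj_onI)
    fix r s assume rs: "r \<in> {0..<int p}" "s \<in> {0..<int p}" "?h r = ?h s"
    then have "[sol p r x = sol p s x] (mod int p)" by (simp add: unique_euclidean_semiring_class.cong_def)
    then have "[c (fst x) * sol p r x + d (fst x) - snd x = s] (mod int p)" 
      using sol_iff[OF assms, of "sol p r x" s] by simp
    moreover have "[c (fst x) * sol p r x + d (fst x) - snd x = r] (mod int p)" 
      using sol_iff[OF assms, of "sol p r x" r] by simp
    ultimately have "[r = s] (mod int p)" using cong_sym cong_trans by blast
    then show "r = s" using rs cong_less_imp_eq_int[of r "int p" s] by simp
  qed
  have "(\<Sum>r\<in>{0..<int p}. (class_dev \<Omega> f p (sol p r x))\<^sup>2) = (\<Sum>r\<in>{0..<int p}. (class_dev \<Omega> f p (?h r))\<^sup>2)"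
    by (simp only: class_dev_mod)
  also have "\<dots> = (\<Sum>r\<in>?h ` {0..<int p}. (class_dev \<Omega> f p r)\<^sup>2)" using inj by (subst sum.reindex) simp_all
  also have "\<dots> \<le> (\<Sum>r\<in>{0..<int p}. (class_dev \<Omega> f p r)\<^sup>2)" using pp by (intro sum_mono2) auto
  finally show ?thesis .
qed

text \<open>The left side is the variance of \<open>G\<close> over \<open>Bs p\<close>, at most its
  second moment about any constant. For \<open>k\<close> one takes the value that perfect
  equidistribution of \<Omega> would produce; then \<open>G - k\<close> is a sum of class
  deviations.\<close>

lemma sum_Cov_le:
  assumes "p \<in> P"
  shows "(\<Sum>\<omega>\<in>\<Omega>. \<Sum>\<omega>'\<in>\<Omega>. m \<omega> * m \<omega>' * Cov p \<omega> \<omega>') \<le> 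
     2 * j * b / P0\<^sup>2 * (\<Sum>a\<in>T. real p * (\<Sum>r\<in>{0..<int p}. (class_dev \<Omega> (\<alpha> a) p r)\<^sup>2))"
proof -
  define G where "G \<beta> = (\<Sum>\<omega>\<in>\<Omega>. m \<omega> * N p \<omega> \<beta>)" for \<beta>
  define k where "k = (\<Sum>x\<in>T \<times> I p. (\<Sum>\<omega>\<in>\<Omega>. \<alpha> (fst x) \<omega>) / real p)"
  let ?S = "\<lambda>a. \<Sum>r\<in>{0..<int p}. (class_dev \<Omega> (\<alpha> a) p r)\<^sup>2"
  have b0: "b \<ge> 0" using b_nonneg[OF assms] .
  have GG: "Em p (\<lambda>\<beta>. (G \<beta>)\<^sup>2) = (\<Sum>\<omega>\<in>\<Omega>. \<Sum>\<omega>'\<in>\<Omega>. m \<omega> * m \<omega>' * Em p (\<lambda>\<beta>. N p \<omega> \<beta> * N p \<omega>' \<beta>))"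
  proof -
    have "(G \<beta>)\<^sup>2 = (\<Sum>\<omega>\<in>\<Omega>. \<Sum>\<omega>'\<in>\<Omega>. m \<omega> * m \<omega>' * (N p \<omega> \<beta> * N p \<omega>' \<beta>))" for \<beta>
      unfolding G_def power2_eq_square sum_product by (intro sum.cong refl) (simp only: mult_ac)
    then show ?thesis by (simp only: Em_sum[symmetric] Em_cmult)
  qed
  have G1: "Em p G = (\<Sum>\<omega>\<in>\<Omega>. m \<omega> * Em p (N p \<omega>))"
    unfolding G_def[abs_def] Em_sum[symmetric] Em_cmult ..
  have "(\<Sum>\<omega>\<in>\<Omega>. \<Sum>\<omega>'\<in>\<Omega>. m \<omega> * m \<omega>' * Cov p \<omega> \<omega>') = Em p (\<lambda>\<beta>. (G \<beta>)\<^sup>2) - (Em p G)\<^sup>2"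
    unfolding GG G1 unfolding Cov_def power2_eq_square sum_product right_diff_distrib sum_subtractf by (simp add: mult_ac)
  also have "\<dots> \<le> Em p (\<lambda>\<beta>. (G \<beta>)\<^sup>2) - (Em p G)\<^sup>2 + (Em p G - k)\<^sup>2" by simp
  also have "\<dots> = Em p (\<lambda>\<beta>. (G \<beta>)\<^sup>2 - 2 * k * G \<beta> + k\<^sup>2)"
  proof -
    have "Em p (\<lambda>\<beta>. k\<^sup>2) = k\<^sup>2" unfolding Em_def using cardBs_pos[OF assms] by simp
    then show ?thesis unfolding Em_add Em_diff Em_cmult by (simp add: power2_eq_square algebra_simps)
  qed
  also have "\<dots> = Em p (\<lambda>\<beta>. (G \<beta> - k)\<^sup>2)"
    by (intro arg_cong[where f="Em p"] ext) (simp add: power2_eq_square algebra_simps)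
  also have "\<dots> \<le> (\<Sum>\<beta>\<in>{0..<int p}. (G \<beta> - k)\<^sup>2) / (real p / 2)"
    unfolding Em_def using Bs[OF assms] p_pos[OF assms] by (intro frac_le sum_mono2 sum_nonneg) auto
  also have "(\<Sum>\<beta>\<in>{0..<int p}. (G \<beta> - k)\<^sup>2) \<le> j * b * (\<Sum>a\<in>T. ?S a)"
  proof -
    have Gk: "G \<beta> - k = (\<Sum>x\<in>T \<times> I p. class_dev \<Omega> (\<alpha> (fst x)) p (sol p \<beta> x))" for \<beta>
    proof -
      have "G \<beta> = (\<Sum>\<omega>\<in>\<Omega>. \<Sum>x\<in>T \<times> I p. \<alpha> (fst x) \<omega> * of_bool [\<omega> = sol p \<beta> x] (mod int p))"
        unfolding G_def \<alpha>_def using N_eq[OF assms] by (intro sum.cong refl) (simp add: sum_distrib_left mult.assoc)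
      also have "\<dots> = (\<Sum>x\<in>T \<times> I p. \<Sum>\<omega> | \<omega> \<in> \<Omega> \<and> [\<omega> = sol p \<beta> x] (mod int p). \<alpha> (fst x) \<omega>)"
        using fin\<Omega> by (subst sum.swap) (auto simp: of_bool_def if_distrib sum.If_cases Int_def intro!: sum.cong cong: if_cong)
      finally show ?thesis unfolding k_def class_dev_def sum_subtractf by simp
    qed
    have "(\<Sum>\<beta>\<in>{0..<int p}. (G \<beta> - k)\<^sup>2) \<le> (\<Sum>\<beta>\<in>{0..<int p}. real (card (T \<times> I p)) * (\<Sum>x\<in>T \<times> I p. (class_dev \<Omega> (\<alpha> (fst x)) p (sol p \<beta> x))\<^sup>2))"
      unfolding Gk mult.commute[of "real (card (T \<times> I p))"] by (intro sum_mono sum_squared_le_sum_of_squares)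
    also have "\<dots> = real (card (T \<times> I p)) * (\<Sum>x\<in>T \<times> I p. \<Sum>\<beta>\<in>{0..<int p}. (class_dev \<Omega> (\<alpha> (fst x)) p (sol p \<beta> x))\<^sup>2)"
      unfolding sum_distrib_left[symmetric] by (subst sum.swap) (rule refl)
    also have "\<dots> \<le> j * (\<Sum>x\<in>T \<times> I p. ?S (fst x))"
      using card_TI[OF assms] by (intro mult_mono sum_mono sum_sol_le[OF assms]) (auto intro!: sum_nonneg)
    also have "(\<Sum>x\<in>T \<times> I p. ?S (fst x)) = (\<Sum>a\<in>T. \<Sum>i\<in>I p. ?S a)"
      by (subst sum.cartesian_product[of "\<lambda>a i. ?S a"]) (simp add: case_prod_beta)
    also have "\<dots> = real (card (I p)) * (\<Sum>a\<in>T. ?S a)" by (simp add: sum_distrib_left)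
    also have "j * \<dots> \<le> j * (b * (\<Sum>a\<in>T. ?S a))"
      using finI(2)[OF assms] j by (intro mult_left_mono mult_right_mono sum_nonneg) auto
    finally show ?thesis by (simp add: mult.assoc)
  qed
  then have "(\<Sum>\<beta>\<in>{0..<int p}. (G \<beta> - k)\<^sup>2) / (real p / 2) \<le> j * b * (\<Sum>a\<in>T. ?S a) / (real p / 2)"
    by (intro divide_right_mono) auto
  also have "\<dots> = 2 * j * b * (\<Sum>a\<in>T. ?S a) * (1 / real p)" by simp
  \<comment> \<open>The factor 1 / p is traded for p / P0^2 because the large sieve controls
    deviations with weight p.\<close>
  also have "\<dots> \<le> 2 * j * b * (\<Sum>a\<in>T. ?S a) * (real p / P0\<^sup>2)"
  proof (rule mult_left_mono)
    have "P0\<^sup>2 \<le> real p * real p" unfolding power2_eq_square using P0(1) P0(2)[OF assms] by (intro mult_mono) auto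
    then show "1 / real p \<le> real p / P0\<^sup>2" using P0(1) p_pos[OF assms] by (simp add: field_simps)
    show "0 \<le> 2 * j * b * (\<Sum>a\<in>T. ?S a)" using b0 j by (intro mult_nonneg_nonneg sum_nonneg) auto
  qed
  also have "\<dots> = 2 * j * b / P0\<^sup>2 * (\<Sum>a\<in>T. real p * ?S a)" by (simp add: sum_distrib_left mult_ac)
  finally show ?thesis by simp
qed

lemma first_order_bound:
  "(\<Sum>\<omega>\<in>\<Omega>. \<Sum>\<omega>'\<in>\<Omega>. m \<omega> * m \<omega>' * (\<Sum>p\<in>P'. \<kappa> p \<omega> \<omega>')) \<le> 
    (real (card \<Omega>))\<^sup>2 * (2 * j\<^sup>2 * \<Lambda> / P0\<^sup>2 + j * (2 * L / P0 + \<eta>) * (512 * j\<^sup>2 / P0 + 32 * t))"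
\<comment> \<open>Nonnegativity of \<open>b\<close> is read off from a prime, so the empty case is
  separate.\<close>
proof (cases "P' = {}")
  case True
  have "0 \<le> (real (card \<Omega>))\<^sup>2 * (2 * j\<^sup>2 * \<Lambda> / P0\<^sup>2 + j * (2 * L / P0 + \<eta>) * (512 * j\<^sup>2 / P0 + 32 * t))"
    using j L \<eta> t \<Lambda> P0(1) by (intro mult_nonneg_nonneg add_nonneg_nonneg divide_nonneg_nonneg) auto
  then show ?thesis using True by simp
next
  case False
  then have b0: "b \<ge> 0" using b_nonneg P'_sub by blast
  let ?X = "j * (2 * L / P0 + \<eta>)"
  have X0: "?X \<ge> 0" using j L \<eta> P0 by auto
  have cov: "(\<Sum>p\<in>P'. \<Sum>\<omega>\<in>\<Omega>. \<Sum>\<omega>'\<in>\<Omega>. m \<omega> * m \<omega>' * Cov p \<omega> \<omega>') \<le> (real (card \<Omega>))\<^sup>2 * (2 * j\<^sup>2 * \<Lambda> / P0\<^sup>2)"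
  proof -
    have "(\<Sum>p\<in>P'. \<Sum>\<omega>\<in>\<Omega>. \<Sum>\<omega>'\<in>\<Omega>. m \<omega> * m \<omega>' * Cov p \<omega> \<omega>') \<le> 
       (\<Sum>p\<in>P'. 2 * j * b / P0\<^sup>2 * (\<Sum>a\<in>T. real p * (\<Sum>r\<in>{0..<int p}. (class_dev \<Omega> (\<alpha> a) p r)\<^sup>2)))"
      using P'_sub by (intro sum_mono sum_Cov_le) auto
    also have "\<dots> = 2 * j * b / P0\<^sup>2 * (\<Sum>a\<in>T. \<Sum>p\<in>P'. real p * (\<Sum>r\<in>{0..<int p}. (class_dev \<Omega> (\<alpha> a) p r)\<^sup>2))"
      by (subst sum.swap[of _ P' T]) (rule sum_distrib_left[symmetric])
    also have "\<dots> \<le> 2 * j * b / P0\<^sup>2 * (\<Sum>a\<in>T. \<Lambda> * (real (card \<Omega>))\<^sup>2)"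
    proof (intro mult_left_mono sum_mono)
      fix a
      have "\<bar>\<alpha> a \<omega>\<bar> \<le> 2" if "\<omega> \<in> \<Omega>" for \<omega> using m that unfolding \<alpha>_def by (auto simp: of_bool_def)
      then show "(\<Sum>p\<in>P'. real p * (\<Sum>r\<in>{0..<int p}. (class_dev \<Omega> (\<alpha> a) p r)\<^sup>2)) \<le> \<Lambda> * (real (card \<Omega>))\<^sup>2"
        unfolding P'_def by (rule sieve)
    qed (use j b0 in auto)
    also have "\<dots> = 2 * j / P0\<^sup>2 * (real (card T) * b) * (\<Lambda> * (real (card \<Omega>))\<^sup>2)" by simp
    also have "\<dots> \<le> 2 * j / P0\<^sup>2 * j * (\<Lambda> * (real (card \<Omega>))\<^sup>2)"
      using j \<Lambda> by (intro mult_right_mono mult_left_mono) auto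
    finally show ?thesis by (simp add: power2_eq_square mult_ac)
  qed
  have err: "(\<Sum>p\<in>P'. \<Sum>\<omega>\<in>\<Omega>. \<Sum>\<omega>'\<in>\<Omega>. \<bar>\<kappa> p \<omega> \<omega>' - Cov p \<omega> \<omega>'\<bar>) \<le> (real (card \<Omega>))\<^sup>2 * (?X * (128 * j\<^sup>2 / P0 + 8 * t))"
  proof -
    have "(\<Sum>p\<in>P'. \<Sum>\<omega>\<in>\<Omega>. \<Sum>\<omega>'\<in>\<Omega>. \<bar>\<kappa> p \<omega> \<omega>' - Cov p \<omega> \<omega>'\<bar>) \<le>
       (\<Sum>p\<in>P'. real (card \<Omega>) * ?X * (\<Sum>\<omega>\<in>\<Omega>. 64 * j\<^sup>2 / (real p)\<^sup>2 + 8 * ov p \<omega> / real p))"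
      using P'_sub by (intro sum_mono sum_\<kappa>_Cov) auto
    also have "\<dots> \<le> (\<Sum>p\<in>P. real (card \<Omega>) * ?X * (\<Sum>\<omega>\<in>\<Omega>. 64 * j\<^sup>2 / (real p)\<^sup>2 + 8 * ov p \<omega> / real p))"
      using P'_sub finP j L \<eta> P0(1) Em\<nu>_le(2) by (intro sum_mono2 mult_nonneg_nonneg sum_nonneg add_nonneg_nonneg) auto
    also have "\<dots> = real (card \<Omega>) * ?X * (\<Sum>\<omega>\<in>\<Omega>. 64 * j\<^sup>2 * (\<Sum>p\<in>P. 1 / (real p)\<^sup>2) + 8 * (\<Sum>p\<in>P. ov p \<omega> / real p))"
      unfolding sum_distrib_left[symmetric] by (subst sum.swap) (simp add: sum.distrib sum_distrib_left)
    also have "\<dots> \<le> real (card \<Omega>) * ?X * (\<Sum>\<omega>\<in>\<Omega>. 64 * j\<^sup>2 * (2 / P0) + 8 * t)"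
      using j L \<eta> finP P0 ovt by (intro mult_left_mono sum_mono add_mono sum_recip_squares_le mult_nonneg_nonneg add_nonneg_nonneg) auto
    finally show ?thesis by (simp add: power2_eq_square mult_ac)
  qed
  have "(\<Sum>\<omega>\<in>\<Omega>. \<Sum>\<omega>'\<in>\<Omega>. m \<omega> * m \<omega>' * (\<Sum>p\<in>P'. \<kappa> p \<omega> \<omega>')) = (\<Sum>p\<in>P'. \<Sum>\<omega>\<in>\<Omega>. \<Sum>\<omega>'\<in>\<Omega>. m \<omega> * m \<omega>' * \<kappa> p \<omega> \<omega>')"
  proof -
    have "(\<Sum>\<omega>'\<in>\<Omega>. \<Sum>p\<in>P'. m \<omega> * m \<omega>' * \<kappa> p \<omega> \<omega>') = (\<Sum>p\<in>P'. \<Sum>\<omega>'\<in>\<Omega>. m \<omega> * m \<omega>' * \<kappa> p \<omega> \<omega>')" for \<omega>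
      by (rule sum.swap)
    then show ?thesis unfolding sum_distrib_left by (simp only:) (rule sum.swap)
  qed
  also have "\<dots> \<le> (\<Sum>p\<in>P'. \<Sum>\<omega>\<in>\<Omega>. \<Sum>\<omega>'\<in>\<Omega>. m \<omega> * m \<omega>' * Cov p \<omega> \<omega>' + 4 * \<bar>\<kappa> p \<omega> \<omega>' - Cov p \<omega> \<omega>'\<bar>)"
  proof (intro sum_mono)
    fix p \<omega> \<omega>' assume o: "\<omega> \<in> \<Omega>" "\<omega>' \<in> \<Omega>"
    have "m \<omega> * m \<omega>' * (\<kappa> p \<omega> \<omega>' - Cov p \<omega> \<omega>') \<le> m \<omega> * m \<omega>' * \<bar>\<kappa> p \<omega> \<omega>' - Cov p \<omega> \<omega>'\<bar>"
      using mm_le[OF o] by (intro mult_left_mono) auto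
    also have "\<dots> \<le> 4 * \<bar>\<kappa> p \<omega> \<omega>' - Cov p \<omega> \<omega>'\<bar>" using mm_le[OF o] by (intro mult_right_mono) auto
    finally show "m \<omega> * m \<omega>' * \<kappa> p \<omega> \<omega>' \<le> m \<omega> * m \<omega>' * Cov p \<omega> \<omega>' + 4 * \<bar>\<kappa> p \<omega> \<omega>' - Cov p \<omega> \<omega>'\<bar>"
      by (simp add: right_diff_distrib)
  qed
  also have "\<dots> = (\<Sum>p\<in>P'. \<Sum>\<omega>\<in>\<Omega>. \<Sum>\<omega>'\<in>\<Omega>. m \<omega> * m \<omega>' * Cov p \<omega> \<omega>') + 4 * (\<Sum>p\<in>P'. \<Sum>\<omega>\<in>\<Omega>. \<Sum>\<omega>'\<in>\<Omega>. \<bar>\<kappa> p \<omega> \<omega>' - Cov p \<omega> \<omega>'\<bar>)"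
    by (simp only: sum.distrib sum_distrib_left)
  also have "\<dots> \<le> (real (card \<Omega>))\<^sup>2 * (2 * j\<^sup>2 * \<Lambda> / P0\<^sup>2) + 4 * ((real (card \<Omega>))\<^sup>2 * (?X * (128 * j\<^sup>2 / P0 + 8 * t)))"
    using cov err by linarith
  also have "\<dots> = (real (card \<Omega>))\<^sup>2 * (2 * j\<^sup>2 * \<Lambda> / P0\<^sup>2 + ?X * (4 * (128 * j\<^sup>2 / P0 + 8 * t)))"
    by (simp only: algebra_simps)
  also have "4 * (128 * j\<^sup>2 / P0 + 8 * t) = 512 * j\<^sup>2 / P0 + 32 * t" by simp
  finally show ?thesis .
qed

definition vbound :: real where
  "vbound = 2 * j\<^sup>2 * \<Lambda> / P0\<^sup>2 + j * (2 * L / P0 + \<eta>) * (512 * j\<^sup>2 / P0 + 32 * t)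
     + 4 * L * ((64 * j\<^sup>2 / P0)\<^sup>2 + 64 * j\<^sup>2 / P1) + 4 * \<eta> * exp (32 * j\<^sup>2 * (\<Sum>p\<in>P. 1 / real p))"

lemma centred_bound:
  "(\<Sum>\<beta>\<in>PiE P Bs. (\<Sum>\<omega>\<in>\<Omega>. m \<omega> * ((\<Prod>p\<in>P. g p \<omega> (\<beta> p)) - 1))\<^sup>2) \<le>
    (\<Prod>p\<in>P. real (card (Bs p))) * ((real (card \<Omega>))\<^sup>2 * vbound)"
  unfolding variance_eq
proof (rule mult_left_mono)
  have "(\<Prod>p\<in>P. 1 + \<kappa> p \<omega> \<omega>') - 1 = (\<Sum>p\<in>P'. \<kappa> p \<omega> \<omega>') + (\<Sum>D\<in>rest. \<Prod>p\<in>D. \<kappa> p \<omega> \<omega>')" for \<omega> \<omega>'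
    unfolding rest_def using sum_Pow_split[OF finP P'_sub(1), of "\<lambda>p. \<kappa> p \<omega> \<omega>'"] by simp
  then have "(\<Sum>\<omega>\<in>\<Omega>. \<Sum>\<omega>'\<in>\<Omega>. m \<omega> * m \<omega>' * ((\<Prod>p\<in>P. 1 + \<kappa> p \<omega> \<omega>') - 1)) = 
     (\<Sum>\<omega>\<in>\<Omega>. \<Sum>\<omega>'\<in>\<Omega>. m \<omega> * m \<omega>' * (\<Sum>p\<in>P'. \<kappa> p \<omega> \<omega>')) + (\<Sum>\<omega>\<in>\<Omega>. \<Sum>\<omega>'\<in>\<Omega>. m \<omega> * m \<omega>' * (\<Sum>D\<in>rest. \<Prod>p\<in>D. \<kappa> p \<omega> \<omega>'))"
    by (simp only: distrib_left sum.distrib)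
  also have "\<dots> \<le> (real (card \<Omega>))\<^sup>2 * vbound"
    using first_order_bound crude_bound unfolding vbound_def by (simp add: algebra_simps)
  finally show "(\<Sum>\<omega>\<in>\<Omega>. \<Sum>\<omega>'\<in>\<Omega>. m \<omega> * m \<omega>' * ((\<Prod>p\<in>P. 1 + \<kappa> p \<omega> \<omega>') - 1)) \<le> (real (card \<Omega>))\<^sup>2 * vbound" .
qed (intro prod_nonneg, simp)

text \<open>Recentring: the mean of a summand is \<open>m \<omega>\<close> and not 1, which adds the
  square of the shift \<mu>.\<close>

theorem second_moment_bound:
  assumes "\<And>\<omega>. \<omega> \<in> \<Omega> \<Longrightarrow> \<bar>m \<omega> - 1\<bar> \<le> \<mu>"
  shows "(\<Sum>\<beta>\<in>PiE P Bs. (\<Sum>\<omega>\<in>\<Omega>. m \<omega> * (\<Prod>p\<in>P. g p \<omega> (\<beta> p)) - 1)\<^sup>2) \<le>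
    (\<Prod>p\<in>P. real (card (Bs p))) * ((real (card \<Omega>))\<^sup>2 * (2 * vbound + 2 * \<mu>\<^sup>2))"
proof -
  let ?W = "\<lambda>\<beta>. \<Sum>\<omega>\<in>\<Omega>. m \<omega> * ((\<Prod>p\<in>P. g p \<omega> (\<beta> p)) - 1)"
  let ?k = "\<Sum>\<omega>\<in>\<Omega>. m \<omega> - 1"
  have "\<bar>?k\<bar> \<le> (\<Sum>\<omega>\<in>\<Omega>. \<bar>m \<omega> - 1\<bar>)" by (rule sum_abs)
  also have "\<dots> \<le> (\<Sum>\<omega>\<in>\<Omega>. \<mu>)" by (intro sum_mono assms)
  finally have "\<bar>?k\<bar> \<le> real (card \<Omega>) * \<mu>" by simp
  then have k: "?k\<^sup>2 \<le> (real (card \<Omega>) * \<mu>)\<^sup>2" by (metis abs_ge_zero power2_abs power_mono)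
  have "(\<Sum>\<beta>\<in>PiE P Bs. (\<Sum>\<omega>\<in>\<Omega>. m \<omega> * (\<Prod>p\<in>P. g p \<omega> (\<beta> p)) - 1)\<^sup>2) \<le> (\<Sum>\<beta>\<in>PiE P Bs. 2 * (?W \<beta>)\<^sup>2 + 2 * (real (card \<Omega>) * \<mu>)\<^sup>2)"
  proof (rule sum_mono)
    fix \<beta>
    have "(\<Sum>\<omega>\<in>\<Omega>. m \<omega> * (\<Prod>p\<in>P. g p \<omega> (\<beta> p)) - 1) = ?W \<beta> + ?k"
      unfolding sum.distrib[symmetric] by (intro sum.cong refl) (simp add: algebra_simps)
    moreover have "(?W \<beta> + ?k)\<^sup>2 \<le> 2 * (?W \<beta>)\<^sup>2 + 2 * ?k\<^sup>2"
      using zero_le_power2[of "?W \<beta> - ?k"] by (simp add: power2_eq_square algebra_simps)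
    ultimately show "(\<Sum>\<omega>\<in>\<Omega>. m \<omega> * (\<Prod>p\<in>P. g p \<omega> (\<beta> p)) - 1)\<^sup>2 \<le> 2 * (?W \<beta>)\<^sup>2 + 2 * (real (card \<Omega>) * \<mu>)\<^sup>2"
      using k by simp
  qed
  also have "\<dots> = 2 * (\<Sum>\<beta>\<in>PiE P Bs. (?W \<beta>)\<^sup>2) + (\<Prod>p\<in>P. real (card (Bs p))) * (2 * (real (card \<Omega>) * \<mu>)\<^sup>2)"
    using finP by (simp add: sum.distrib sum_distrib_left card_PiE)
  also have "\<dots> \<le> 2 * ((\<Prod>p\<in>P. real (card (Bs p))) * ((real (card \<Omega>))\<^sup>2 * vbound)) + (\<Prod>p\<in>P. real (card (Bs p))) * (2 * (real (card \<Omega>) * \<mu>)\<^sup>2)"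
    using centred_bound by simp
  finally show ?thesis by (simp add: power_mult_distrib algebra_simps)
qed

end

section \<open>From local factors to the sieve weights\<close>

text \<open>One representative per image value is fixed. Any other element is the first entry of a
  pair with equal images, and the representatives with image in \<open>B\<close> are counted by the
  image.\<close>

lemma card_diff_image_le:
  assumes "finite X"
  shows "card X \<le> card (\<phi> ` X \<inter> B) + card {x\<in>X. \<phi> x \<notin> B} + card {(x, x'). x \<in> X \<and> x' \<in> X \<and> x \<noteq> x' \<and> \<phi> x = \<phi> x'}"
proof -
  let ?P = "{(x, x'). x \<in> X \<and> x' \<in> X \<and> x \<noteq> x' \<and> \<phi> x = \<phi> x'}"
  have finP: "finite ?P" by (rule finite_subset[of _ "X \<times> X"]) (use assms in auto)
  define rp where "rp = inv_into X \<phi>"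
  let ?R = "rp ` (\<phi> ` X \<inter> B)"
  have rp: "rp (\<phi> x) \<in> X" "\<phi> (rp (\<phi> x)) = \<phi> x" if "x \<in> X" for x
    unfolding rp_def using that by (auto intro: inv_into_into f_inv_into_f)
  have "X \<subseteq> ?R \<union> {x\<in>X. \<phi> x \<notin> B} \<union> fst ` ?P"
  proof
    fix x assume x: "x \<in> X"
    show "x \<in> ?R \<union> {x\<in>X. \<phi> x \<notin> B} \<union> fst ` ?P"
    proof (cases "x = rp (\<phi> x)")
      case True
      then show ?thesis using x by (cases "\<phi> x \<in> B") auto
    next
      case False
      then have "(x, rp (\<phi> x)) \<in> ?P" using x rp[OF x] by auto
      from imageI[OF this, of fst] show ?thesis by simp
    qed
  qed
  then have "card X \<le> card (?R \<union> {x\<in>X. \<phi> x \<notin> B} \<union> fst ` ?P)"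
    using assms finP by (intro card_mono) auto
  also have "\<dots> \<le> card ?R + card {x\<in>X. \<phi> x \<notin> B} + card (fst ` ?P)"
    by (meson add_mono card_Un_le le_refl order_trans)
  also have "\<dots> \<le> card (\<phi> ` X \<inter> B) + card {x\<in>X. \<phi> x \<notin> B} + card ?P"
    using assms finP by (intro add_mono card_image_le) auto
  finally show ?thesis .
qed

lemma one_minus_sum_le_prod:
  fixes f :: "'a \<Rightarrow> real"
  assumes "finite A" "\<And>x. x \<in> A \<Longrightarrow> 0 \<le> f x" "\<And>x. x \<in> A \<Longrightarrow> f x \<le> 1"
  shows "1 - (\<Sum>x\<in>A. f x) \<le> (\<Prod>x\<in>A. 1 - f x)"
  using assms
proof (induction A rule: finite_induct)
  case (insert a A)
  have le1: "(\<Prod>x\<in>A. 1 - f x) \<le> 1" using insert.prems by (intro prod_le_1) auto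
  have "1 - (\<Sum>x\<in>insert a A. f x) = 1 - f a - (\<Sum>x\<in>A. f x)" using insert.hyps by simp
  also have "\<dots> \<le> (\<Prod>x\<in>A. 1 - f x) - f a" using insert by auto
  also have "\<dots> \<le> (\<Prod>x\<in>A. 1 - f x) - f a * (\<Prod>x\<in>A. 1 - f x)"
    using mult_left_mono[OF le1, of "f a"] insert.prems by simp
  also have "\<dots> = (\<Prod>x\<in>insert a A. 1 - f x)" using insert.hyps by (simp add: algebra_simps)
  finally show ?case .
qed simp

text \<open>\<open>q j \<equiv> i - i'\<close> modulo \<open>p\<close> makes the classes removed by \<open>i\<close> and \<open>i'\<close> coincide at two
  terms, \<open>j\<close> apart, of a progression with difference \<open>q\<close>.\<close>

definition overlaps :: "(nat \<Rightarrow> int set) \<Rightarrow> int \<Rightarrow> nat \<Rightarrow> int \<Rightarrow> (int \<times> int \<times> int) set" where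
  "overlaps I J p q = {(j, i, i'). j \<in> {-J..J} - {0} \<and> i \<in> I p \<and> i' \<in> I p \<and> [q * j = i - i'] (mod int p)}"

text \<open>The weight \<lambda> once the residues at the small primes are frozen: \<open>E\<close>
  is what they leave of the progression, and \<open>\<beta> p\<close> is the residue of the shift b
  modulo p.\<close>

definition local_weight :: "nat set \<Rightarrow> (nat \<Rightarrow> int set) \<Rightarrow> int set \<Rightarrow> (nat \<Rightarrow> int) \<Rightarrow> real" where
  "local_weight P I E \<beta> = (1 / (\<Prod>p\<in>P. 1 - real (card (I p)) / real p)) ^ card E *
     of_bool (\<forall>p\<in>P. \<forall>n\<in>E. (n - \<beta> p) mod int p \<notin> I p)"

text \<open>The quantity \<open>vbound\<close> of the locale with its parameters made explicit, so
  that it can be used in statements outside.\<close>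

definition variance_bound :: "nat set \<Rightarrow> real \<Rightarrow> real \<Rightarrow> real \<Rightarrow> real \<Rightarrow> real \<Rightarrow> real \<Rightarrow> real \<Rightarrow> real" where
  "variance_bound P j P0 P1 L \<eta> \<Lambda> t = 2 * j\<^sup>2 * \<Lambda> / P0\<^sup>2 + j * (2 * L / P0 + \<eta>) * (512 * j\<^sup>2 / P0 + 32 * t)
     + 4 * L * ((64 * j\<^sup>2 / P0)\<^sup>2 + 64 * j\<^sup>2 / P1) + 4 * \<eta> * exp (32 * j\<^sup>2 * (\<Sum>p\<in>P. 1 / real p))"

text \<open>Compares the true survival probability 1 - U/n of k terms with the product (1 - i/p)^k
  that the weight assumes. Without overlaps U is k i, so the upper error is governed by
  \<open>ov\<close>; the lower one is of second order, from expanding the power and from n being p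
  up to b.\<close>

lemma local_factor_bounds:
  fixes n U k i p b ov j :: real
  assumes p: "p > 0" "p - b \<le> n" "n \<le> p" "b \<ge> 1" "b \<le> j" "64 * j\<^sup>2 \<le> p"
    and U: "0 \<le> U" "U \<le> k * i" "k * i - U \<le> ov" and ki: "0 \<le> i" "i \<le> b" "k * i \<le> j" "k = real k'" "ov \<ge> 0"
  shows "(1 - U / n) / (1 - i / p) ^ k' \<le> 1 + 2 * ov / p" "1 - 5 * j\<^sup>2 / p\<^sup>2 \<le> (1 - U / n) / (1 - i / p) ^ k'"
proof -
  have j1: "j \<ge> 1" using p by linarith
  have "j \<le> j\<^sup>2" using j1 by (simp add: power2_eq_square)
  then have pj: "64 * j \<le> p" using p by linarith
  then have n: "n > 0" "n \<ge> p / 2" using p j1 by linarith+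
  define X where "X = k * i / p"
  have X: "0 \<le> X" "X \<le> j / p" "X \<le> 1/2"
  proof -
    show "0 \<le> X" unfolding X_def using ki p by simp
    show "X \<le> j / p" unfolding X_def using ki p by (intro divide_right_mono) auto
    also have "j / p \<le> 1/2" using pj p by (simp add: divide_le_eq)
    finally show "X \<le> 1/2" .
  qed
  have ip: "0 \<le> i / p" "i / p \<le> 1/2" using ki p pj by (auto simp: divide_le_eq)
  have ip1: "0 \<le> 1 - i / p" "1 - i / p \<le> exp (- (i / p))" using ip exp_ge_add_one_self[of "- (i / p)"] by linarith+
  have pow1: "1 - X \<le> (1 - i / p) ^ k'"
  proof -
    have "1 + real k' * (- (i / p)) \<le> (1 + (- (i / p))) ^ k'" using ip by (intro Bernoulli_inequality) linarith
    then show ?thesis unfolding X_def ki(4) by simp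
  qed
  have pow2: "(1 - i / p) ^ k' * (1 + X) \<le> 1"
  proof -
    have "(1 - i / p) ^ k' \<le> (exp (- (i / p))) ^ k'" using ip1 by (intro power_mono)
    also have "\<dots> = exp (- X)" unfolding X_def ki(4) by (simp add: exp_of_nat_mult[symmetric])
    finally have "(1 - i / p) ^ k' * (1 + X) \<le> exp (- X) * exp X" using X(1) exp_ge_add_one_self[of X]
      by (intro mult_mono) auto
    then show ?thesis by (simp add: exp_minus)
  qed
  have pos: "(1 - i / p) ^ k' > 0" using pow1 X by linarith
  have "(k * i - ov) / p \<le> U / n"
  proof (cases "k * i - ov \<ge> 0")
    case True
    have "(k * i - ov) / p \<le> U / p" using U p by (intro divide_right_mono) auto
    also have "\<dots> \<le> U / n" using U p n by (intro divide_left_mono) auto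
    finally show ?thesis .
  next
    case False
    then have "(k * i - ov) / p \<le> 0" using p by (simp add: divide_nonpos_pos)
    then show ?thesis using U n by (meson divide_nonneg_pos order_trans)
  qed
  then have "1 - U / n \<le> (1 - X) + ov / p" unfolding X_def by (simp add: diff_divide_distrib)
  also have "\<dots> \<le> (1 + 2 * ov / p) * (1 - X)"
  proof -
    have "ov / p * 1 \<le> ov / p * (2 * (1 - X))" using ki p X by (intro mult_left_mono) auto
    moreover have "(1 + 2 * ov / p) * (1 - X) = (1 - X) + ov / p * (2 * (1 - X))" by (simp add: distrib_right)
    ultimately show ?thesis by linarith
  qed
  also have "\<dots> \<le> (1 + 2 * ov / p) * (1 - i / p) ^ k'" using pow1 ki p by (intro mult_left_mono) auto
  finally show "(1 - U / n) / (1 - i / p) ^ k' \<le> 1 + 2 * ov / p" using pos by (simp add: pos_divide_le_eq)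
  have Un: "U / n \<le> X * (1 + 2 * b / p)"
  proof -
    have "U / n \<le> k * i / (p - b)" using U p n pj j1 by (intro frac_le) auto
    also have "\<dots> = X * (p / (p - b))" unfolding X_def using p by simp
    also have "p / (p - b) \<le> 1 + 2 * b / p"
    proof -
      have "(1 + 2 * b / p) * (p - b) = p + b - 2 * b\<^sup>2 / p" using p by (simp add: field_simps power2_eq_square)
      moreover have "2 * b\<^sup>2 / p \<le> b" using p pj j1 by (simp add: divide_le_eq power2_eq_square)
      ultimately have "p \<le> (1 + 2 * b / p) * (p - b)" by linarith
      then show ?thesis using p pj j1 by (simp add: pos_divide_le_eq)
    qed
    finally show ?thesis using X by (simp add: mult_left_mono)
  qed
  have "1 - 5 * j\<^sup>2 / p\<^sup>2 \<le> (1 - X * (1 + 2 * b / p)) * (1 + X)"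
  proof -
    have "(1 - X * (1 + 2 * b / p)) * (1 + X) = 1 - X * X - 2 * (b / p) * (X * (1 + X))" by (simp add: algebra_simps add_divide_distrib)
    moreover have "X * X \<le> (j / p) * (j / p)" using X by (intro mult_mono) auto
    moreover have "(b / p) * (X * (1 + X)) \<le> (j / p) * ((j / p) * 2)" 
      using X p j1 by (intro mult_mono divide_right_mono) auto
    ultimately show ?thesis by (simp add: power2_eq_square)
  qed
  also have "\<dots> \<le> (1 - U / n) * (1 + X)" using Un X by (intro mult_right_mono) auto
  finally have "1 - 5 * j\<^sup>2 / p\<^sup>2 \<le> (1 - U / n) * (1 + X)" .
  moreover have "1 - U / n \<ge> 0"
  proof -
    have "U \<le> n" using U ki n pj j1 by linarith
    then show ?thesis using n by simp
  qed
  ultimately show "1 - 5 * j\<^sup>2 / p\<^sup>2 \<le> (1 - U / n) / (1 - i / p) ^ k'"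
  proof -
    assume a: "1 - 5 * j\<^sup>2 / p\<^sup>2 \<le> (1 - U / n) * (1 + X)" and b: "0 \<le> 1 - U / n"
    have "(1 - U / n) * ((1 - i / p) ^ k' * (1 + X)) \<le> (1 - U / n) * 1" using pow2 b by (rule mult_left_mono)
    then have "(1 - U / n) * (1 + X) \<le> (1 - U / n) / (1 - i / p) ^ k'"
      using pos by (simp add: pos_le_divide_eq) (simp add: mult_ac)
    then show ?thesis using a by linarith
  qed
qed

text \<open>Each weight is \<open>m \<omega>\<close> times the product of the normalised factors
  \<open>g\<close>, where \<open>m \<omega>\<close> is the product of the quotients in
  \<open>local_factor_bounds\<close> and thus close to 1. The terms form a progression with base
  \<open>base \<omega>\<close> and difference \<open>qf \<omega>\<close>. The index 0 is left out of
  \<open>T\<close>, since survival of the base itself may already be built into \<open>Bs\<close>,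
  which is what \<open>compl\<close> expresses.\<close>

theorem weight_second_moment:
  fixes P :: "nat set" and I Bs :: "nat \<Rightarrow> int set" and \<Omega> T V :: "int set" and c d base qf :: "int \<Rightarrow> int"
    and b P0 P1 L \<eta> \<Lambda> t :: real and J :: nat
  defines "A \<equiv> \<lambda>\<omega>. {a\<in>T. c a * \<omega> + d a \<in> V}"
  defines "j \<equiv> real J * b"
  assumes finP: "finite P" and primeP: "\<And>p. p \<in> P \<Longrightarrow> prime p" and P0: "P0 \<ge> 2" "\<And>p. p \<in> P \<Longrightarrow> P0 \<le> real p"
    and P1: "P1 \<ge> 2"
    and Bs: "\<And>p. p \<in> P \<Longrightarrow> Bs p \<subseteq> {0..<int p}" "\<And>p. p \<in> P \<Longrightarrow> real p - b \<le> real (card (Bs p))"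
    and I: "\<And>p. p \<in> P \<Longrightarrow> I p \<subseteq> {0..<int p}" "\<And>p. p \<in> P \<Longrightarrow> real (card (I p)) \<le> b" and b: "b \<ge> 1"
    and fin\<Omega>: "finite \<Omega>" 
    and T: "T \<subseteq> {- int J..int J} - {0}" "\<And>a a'. a \<in> T \<Longrightarrow> a' \<in> T \<Longrightarrow> \<bar>a - a'\<bar> \<le> int J" "card T \<le> J"
    and j: "64 * j\<^sup>2 \<le> P0" "J \<ge> 1"
    and cop: "\<And>p a. p \<in> P \<Longrightarrow> a \<in> T \<Longrightarrow> coprime (c a) (int p)"
    and lin: "\<And>a \<omega>. a \<in> T \<Longrightarrow> \<omega> \<in> \<Omega> \<Longrightarrow> c a * \<omega> + d a = base \<omega> + qf \<omega> * a"
    and copq: "\<And>p \<omega>. p \<in> P \<Longrightarrow> \<omega> \<in> \<Omega> \<Longrightarrow> coprime (qf \<omega>) (int p)"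
    and compl: "\<And>p \<beta> \<omega>. p \<in> P \<Longrightarrow> \<omega> \<in> \<Omega> \<Longrightarrow> \<beta> \<in> {0..<int p} - Bs p \<Longrightarrow> \<exists>i\<in>I p. [base \<omega> - i = \<beta>] (mod int p)"
    and L: "L \<ge> 1" and \<eta>: "\<eta> \<ge> 0" and t: "t \<ge> 0" "t \<le> 1/6" and \<Lambda>: "\<Lambda> \<ge> 0"
    and count: "\<And>D r. D \<subseteq> P \<Longrightarrow> real (card {\<omega>\<in>\<Omega>. in_class D r \<omega>}) \<le> real (card \<Omega>) * (L * (\<Prod>p\<in>D. 2 / real p) + \<eta>)"
    and sieve: "\<And>\<alpha>. (\<And>\<omega>. \<omega> \<in> \<Omega> \<Longrightarrow> \<bar>\<alpha> \<omega>\<bar> \<le> 2) \<Longrightarrow>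
       (\<Sum>p | p \<in> P \<and> real p \<le> P1. real p * (\<Sum>r\<in>{0..<int p}. (class_dev \<Omega> \<alpha> p r)\<^sup>2)) \<le> \<Lambda> * (real (card \<Omega>))\<^sup>2"
    and good: "\<And>\<omega>. \<omega> \<in> \<Omega> \<Longrightarrow> (\<Sum>p\<in>P. real (J + 1) * real (card (overlaps I (int J) p (qf \<omega>))) / real p) \<le> t"
  shows "(\<Sum>\<beta>\<in>PiE P Bs. (\<Sum>\<omega>\<in>\<Omega>. local_weight P I ((\<lambda>a. c a * \<omega> + d a) ` A \<omega>) \<beta> - 1)\<^sup>2) \<le>
    (\<Prod>p\<in>P. real (card (Bs p))) * ((real (card \<Omega>))\<^sup>2 * (2 * variance_bound P j P0 P1 L \<eta> \<Lambda> t + 2 * (6 * t + 10 * j\<^sup>2 / P0)\<^sup>2))"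
proof -
  define ov where "ov p \<omega> = real (J + 1) * real (card (overlaps I (int J) p (qf \<omega>)))" for p \<omega>
  define e where "e a \<omega> = c a * \<omega> + d a" for a \<omega>
  have p0: "p > 0" if "p \<in> P" for p using primeP[OF that] prime_gt_0_nat by auto
  have finT: "finite T" using T(1) finite_subset by blast
  have finI: "finite (I p)" if "p \<in> P" for p using I(1)[OF that] finite_subset by blast
  have j1: "j \<ge> 1" unfolding j_def using j(2) b mult_mono[of 1 "real J" 1 b] by auto
  have bj: "b \<le> j" unfolding j_def using j(2) b mult_right_mono[of 1 "real J" b] by auto
  have jj: "j \<le> j\<^sup>2" using j1 by (simp add: power2_eq_square)
  have pb: "2 * b \<le> real p" if "p \<in> P" for p using P0(2)[OF that] j(1) jj bj j1 by linarith
  have half: "real p \<le> 2 * real (card (Bs p))" if "p \<in> P" for p using Bs(2)[OF that] pb[OF that] by linarith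
  have finBs: "finite (Bs p)" if "p \<in> P" for p using Bs(1)[OF that] finite_subset by blast
  have finov: "finite (overlaps I (int J) p q)" if "p \<in> P" for p q
    by (rule finite_subset[of _ "{- int J..int J} \<times> I p \<times> I p"]) (use finI[OF that] in \<open>auto simp: overlaps_def\<close>)
  have Aprop: "A \<omega> \<subseteq> T" for \<omega> unfolding A_def by auto
  define U where "U p \<omega> = {\<beta>\<in>Bs p. \<exists>x \<in> A \<omega> \<times> I p. [c (fst x) * \<omega> + d (fst x) - snd x = \<beta>] (mod int p)}" for p \<omega>
  \<comment> \<open>A pair fails to contribute a new element of \<open>U\<close> for one of two
    reasons. Its residue may lie outside \<open>Bs p\<close>; by \<open>compl\<close> it then meets
    a removed class of the base, which gives one overlap. Or it shares its residue with another
    pair, and then an overlap arises from at most J positions. Hence the factor \<open>J + 1\<close>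
    in \<open>ov\<close>.\<close>
  have main_ov: "real (card (A \<omega> \<times> I p)) - real (card (U p \<omega>)) \<le> ov p \<omega>" if p: "p \<in> P" and o: "\<omega> \<in> \<Omega>" for p \<omega>
  proof -
    let ?X = "A \<omega> \<times> I p" let ?q = "qf \<omega>"
    define \<phi> where "\<phi> x = (e (fst x) \<omega> - snd x) mod int p" for x
    have finX: "finite ?X" using finI[OF p] finite_subset[OF Aprop finT] by (intro finite_cartesian_product)
    have ee: "e a \<omega> = base \<omega> + ?q * a" if "a \<in> T" for a unfolding e_def using lin[OF that o] .
    have \<phi>_cong: "\<phi> x = \<beta> \<longleftrightarrow> [e (fst x) \<omega> - snd x = \<beta>] (mod int p)" if "\<beta> \<in> {0..<int p}" for x \<beta>
      unfolding \<phi>_def using that residue_eq_iff[of \<beta> p] by auto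
    have \<phi>_range: "\<phi> x \<in> {0..<int p}" for x unfolding \<phi>_def using p0[OF p] by auto
    have img: "\<phi> ` ?X \<inter> Bs p = U p \<omega>"
    proof (rule set_eqI)
      fix \<beta>
      show "\<beta> \<in> \<phi> ` ?X \<inter> Bs p \<longleftrightarrow> \<beta> \<in> U p \<omega>"
      proof (cases "\<beta> \<in> Bs p")
        case True
        then have r: "\<beta> \<in> {0..<int p}" using Bs(1)[OF p] by auto
        have "\<beta> \<in> \<phi> ` ?X \<longleftrightarrow> (\<exists>x\<in>?X. \<phi> x = \<beta>)" by (simp only: image_iff eq_commute)
        also have "\<dots> \<longleftrightarrow> (\<exists>x\<in>?X. [e (fst x) \<omega> - snd x = \<beta>] (mod int p))" by (simp only: \<phi>_cong[OF r])
        finally have "\<beta> \<in> \<phi> ` ?X \<longleftrightarrow> (\<exists>x\<in>?X. [e (fst x) \<omega> - snd x = \<beta>] (mod int p))" .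
        then show ?thesis using True unfolding U_def e_def by (simp only: mem_Collect_eq Int_iff simp_thms)
      qed (simp add: U_def)
    qed
    let ?ov = "overlaps I (int J) p ?q"
    have c1: "card {x\<in>?X. \<phi> x \<notin> Bs p} \<le> card ?ov"
    proof -
      define f where "f x = (SOME i'. i' \<in> I p \<and> [base \<omega> - i' = \<phi> x] (mod int p))" for x
      have f: "f x \<in> I p" "[base \<omega> - f x = \<phi> x] (mod int p)" if "\<phi> x \<notin> Bs p" for x
        using someI_ex[of "\<lambda>i'. i' \<in> I p \<and> [base \<omega> - i' = \<phi> x] (mod int p)"] compl[OF p o, of "\<phi> x"] \<phi>_range that
        unfolding f_def by blast+
      have sub: "(\<lambda>x. (fst x, snd x, f x)) ` {x\<in>?X. \<phi> x \<notin> Bs p} \<subseteq> ?ov"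
      proof
        fix y assume "y \<in> (\<lambda>x. (fst x, snd x, f x)) ` {x\<in>?X. \<phi> x \<notin> Bs p}"
        then obtain x where x: "x \<in> ?X" "\<phi> x \<notin> Bs p" "y = (fst x, snd x, f x)" by auto
        have xT: "fst x \<in> T" using x(1) subsetD[OF Aprop[of \<omega>]] by auto
        have "[e (fst x) \<omega> - snd x = \<phi> x] (mod int p)" using \<phi>_cong[OF \<phi>_range] by blast
        then have "[e (fst x) \<omega> - snd x = base \<omega> - f x] (mod int p)" using f(2)[OF x(2)] cong_sym cong_trans by blast
        then have "[?q * fst x = snd x - f x] (mod int p)" unfolding ee[OF xT] cong_iff_dvd_diff by (simp add: algebra_simps)
        moreover have "fst x \<in> {- int J..int J} - {0}" using T(1) xT by blast
        ultimately show "y \<in> ?ov" using x f(1)[OF x(2)] unfolding overlaps_def by auto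
      qed
      have "inj_on (\<lambda>x. (fst x, snd x, f x)) {x\<in>?X. \<phi> x \<notin> Bs p}" by (auto simp: inj_on_def)
      then show ?thesis using card_inj_on_le[OF _ sub finov[OF p]] by blast
    qed
    have c2: "card {(x, x'). x \<in> ?X \<and> x' \<in> ?X \<and> x \<noteq> x' \<and> \<phi> x = \<phi> x'} \<le> J * card ?ov"
    proof -
      let ?Y = "{(x, x'). x \<in> ?X \<and> x' \<in> ?X \<and> x \<noteq> x' \<and> \<phi> x = \<phi> x'}"
      let ?f = "\<lambda>y. (fst (snd y), (fst (fst y) - fst (snd y), snd (fst y), snd (snd y)))"
      have sub: "?f ` ?Y \<subseteq> T \<times> ?ov"
      proof
        fix y assume "y \<in> ?f ` ?Y"
        then obtain v where v: "y = ?f v" "v \<in> ?Y" by (rule imageE)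
        obtain a i a' i' where v': "v = ((a, i), (a', i'))" by (metis surj_pair)
        have y: "y = (a', (a - a', i, i'))" using v(1) unfolding v' by (simp only: fst_conv snd_conv)
        have y': "a \<in> A \<omega>" "a' \<in> A \<omega>" "i \<in> I p" "i' \<in> I p" "\<not> (a = a' \<and> i = i')" "\<phi> (a,i) = \<phi> (a',i')"
          using v(2) unfolding v' by (simp_all)
        have aT: "a \<in> T" "a' \<in> T" using y' subsetD[OF Aprop[of \<omega>]] by auto
        have "[e a \<omega> - i = e a' \<omega> - i'] (mod int p)" using y'(6) unfolding \<phi>_def unique_euclidean_semiring_class.cong_def by simp
        then have cg: "[?q * (a - a') = i - i'] (mod int p)" unfolding ee[OF aT(1)] ee[OF aT(2)] cong_iff_dvd_diff by (simp add: algebra_simps)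
        have "a \<noteq> a'"
        proof
          assume "a = a'"
          then have "[i = i'] (mod int p)" using cg by (simp add: cong_iff_dvd_diff dvd_diff_commute)
          then have "i = i'" using y' I(1)[OF p] cong_less_imp_eq_int[of i "int p" i'] by (auto simp: subset_iff)
          then show False using y' \<open>a = a'\<close> by simp
        qed
        moreover have "a - a' \<in> {- int J..int J}" using T(2)[OF aT] by (simp add: abs_le_iff)
        ultimately show "y \<in> T \<times> ?ov" using y y' cg aT unfolding overlaps_def by auto
      qed
      have "inj_on ?f ?Y" by (auto simp: inj_on_def)
      then have "card ?Y \<le> card (T \<times> ?ov)" using card_inj_on_le[OF _ sub] finT finov[OF p] by blast
      also have "\<dots> \<le> J * card ?ov" using T(3) by (simp add: card_cartesian_product)
      finally show ?thesis .
    qed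
    have "card ?X \<le> card (U p \<omega>) + card ?ov + J * card ?ov"
      using card_diff_image_le[OF finX, of \<phi> "Bs p"] c1 c2 unfolding img by linarith
    then have "real (card ?X) \<le> real (card (U p \<omega>) + card ?ov + J * card ?ov)" by (rule of_nat_mono)
    then show ?thesis unfolding ov_def by (simp add: algebra_simps)
  qed
  have cardA: "real (card (A \<omega>)) * real (card (I p)) \<le> j" if "p \<in> P" for p \<omega>
  proof -
    have "card (A \<omega>) \<le> J" using card_mono[OF finT Aprop] T(3) le_trans by blast
    then show ?thesis unfolding j_def using I(2)[OF that] by (intro mult_mono) auto
  qed
  have lf: "local_factors P Bs I \<Omega> T A c d mm ov j b P0 P1 L \<eta> \<Lambda> t" 
    if mm: "\<And>\<omega>. \<omega> \<in> \<Omega> \<Longrightarrow> 0 \<le> mm \<omega>" "\<And>\<omega>. \<omega> \<in> \<Omega> \<Longrightarrow> mm \<omega> \<le> 2" for mm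
  proof unfold_locales
    show "real (card T) * b \<le> j" unfolding j_def using T(3) b by (intro mult_right_mono) auto
    fix p \<omega> assume p: "p \<in> P" and o: "\<omega> \<in> \<Omega>"
    let ?h = "\<lambda>\<beta>. {x \<in> A \<omega> \<times> I p. [c (fst x) * \<omega> + d (fst x) - snd x = \<beta>] (mod int p)}"
    have finX: "finite (A \<omega> \<times> I p)" using finI[OF p] finite_subset[OF Aprop finT] by (intro finite_cartesian_product)
    have "(\<Sum>\<beta>\<in>Bs p. card (?h \<beta>)) = card (\<Union>\<beta>\<in>Bs p. ?h \<beta>)"
    proof (rule card_UN_disjoint[symmetric])
      show "\<forall>i\<in>Bs p. \<forall>k\<in>Bs p. i \<noteq> k \<longrightarrow> ?h i \<inter> ?h k = {}"
      proof (intro ballI impI)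
        fix i k assume ik: "i \<in> Bs p" "k \<in> Bs p" "i \<noteq> k"
        then have ik': "i \<in> {0..<int p}" "k \<in> {0..<int p}" using Bs(1)[OF p] by auto
        { fix x assume "x \<in> ?h i" "x \<in> ?h k"
          then have "[c (fst x) * \<omega> + d (fst x) - snd x = i] (mod int p)" "[c (fst x) * \<omega> + d (fst x) - snd x = k] (mod int p)"
            by simp_all
          then have "[i = k] (mod int p)" using cong_sym cong_trans by blast
          then have False using ik ik' cong_less_imp_eq_int[of i "int p" k] by simp }
        then show "?h i \<inter> ?h k = {}" by blast
      qed
    qed (use finX finBs[OF p] in auto)
    also have "\<dots> \<le> card (A \<omega> \<times> I p)" using finX by (intro card_mono) auto
    finally have 1: "real (\<Sum>\<beta>\<in>Bs p. card (?h \<beta>)) \<le> real (card (A \<omega> \<times> I p))" by (rule of_nat_mono)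
    have 2: "(\<Sum>\<beta>\<in>Bs p. of_bool (\<exists>x \<in> A \<omega> \<times> I p. [c (fst x) * \<omega> + d (fst x) - snd x = \<beta>] (mod int p))) = real (card (U p \<omega>))"
      unfolding U_def using finBs[OF p] by (simp add: of_bool_def sum.If_cases Int_def)
    show "(\<Sum>\<beta>\<in>Bs p. real (card (?h \<beta>)) 
          - of_bool (\<exists>x \<in> A \<omega> \<times> I p. [c (fst x) * \<omega> + d (fst x) - snd x = \<beta>] (mod int p))) \<le> ov p \<omega>"
      unfolding sum_subtractf 2 using main_ov[OF p o] 1 by simp
  qed (use assms(3-) finT finI half Aprop j1 mm ov_def in auto)
  \<comment> \<open>A first instance with trivial \<open>m\<close>, needed because the correct
    \<open>m\<close> is defined through \<open>u\<close>; the notion \<open>u\<close> does not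
    involve \<open>m\<close>.\<close>
  interpret B: local_factors P Bs I \<Omega> T A c d "\<lambda>_. 1" ov j b P0 P1 L \<eta> \<Lambda> t
    by (rule lf) auto
  define s where "s p = real (card (I p)) / real p" for p
  define m where "m \<omega> = (\<Prod>p\<in>P. (1 - B.u p \<omega>) / (1 - s p) ^ card (A \<omega>))" for \<omega>
  have s: "0 \<le> s p" "s p \<le> 1/2" if "p \<in> P" for p
    unfolding s_def using I(2)[OF that] pb[OF that] p0[OF that] by (auto simp: divide_le_eq)
  have ovn: "ov p \<omega> \<ge> 0" for p \<omega> unfolding ov_def by simp
  have fb: "(1 - B.u p \<omega>) / (1 - s p) ^ card (A \<omega>) \<le> 1 + 2 * ov p \<omega> / real p"
     "1 - 5 * j\<^sup>2 / (real p)\<^sup>2 \<le> (1 - B.u p \<omega>) / (1 - s p) ^ card (A \<omega>)" if "p \<in> P" "\<omega> \<in> \<Omega>" for p \<omega>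
  proof -
    have U: "B.U p \<omega> = U p \<omega>" unfolding B.U_def U_def ..
    have cU: "real (card (U p \<omega>)) \<le> real (card (A \<omega>)) * real (card (I p))"
    proof -
      have "real (card (U p \<omega>)) \<le> (\<Sum>\<beta>\<in>Bs p. B.N p \<omega> \<beta>)"
        unfolding B.card_U[OF that(1), of \<omega>, unfolded U] using B.chi_le_N[OF that, unfolded U] by (intro sum_mono) auto
      also have "\<dots> = real (\<Sum>\<beta>\<in>Bs p. card (B.hits p \<omega> \<beta>))" unfolding B.N_def by simp
      also have "(\<Sum>\<beta>\<in>Bs p. card (B.hits p \<omega> \<beta>)) = card (\<Union>\<beta>\<in>Bs p. B.hits p \<omega> \<beta>)"
      proof (rule card_UN_disjoint[symmetric])
        show "\<forall>i\<in>Bs p. \<forall>k\<in>Bs p. i \<noteq> k \<longrightarrow> B.hits p \<omega> i \<inter> B.hits p \<omega> k = {}"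
        proof (intro ballI impI)
          fix i k assume ik: "i \<in> Bs p" "k \<in> Bs p" "i \<noteq> k"
          then have ik': "i \<in> {0..<int p}" "k \<in> {0..<int p}" using Bs(1)[OF that(1)] by auto
          { fix x assume "x \<in> B.hits p \<omega> i" "x \<in> B.hits p \<omega> k"
            then have "[c (fst x) * \<omega> + d (fst x) - snd x = i] (mod int p)" "[c (fst x) * \<omega> + d (fst x) - snd x = k] (mod int p)"
              unfolding B.hits_def by simp_all
            then have "[i = k] (mod int p)" using cong_sym cong_trans by blast
            then have False using ik ik' cong_less_imp_eq_int[of i "int p" k] by simp }
          then show "B.hits p \<omega> i \<inter> B.hits p \<omega> k = {}" by blast
        qed
      qed (use finBs[OF that(1)] B.fin_hits[OF that] in auto)
      also have "real \<dots> \<le> real (card (A \<omega> \<times> I p))"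
        using finI[OF that(1)] finite_subset[OF Aprop finT] by (intro of_nat_mono card_mono) (auto simp: B.hits_def)
      finally show ?thesis by (simp add: card_cartesian_product)
    qed
    have m1: "real (card (A \<omega>)) * real (card (I p)) - real (card (U p \<omega>)) \<le> ov p \<omega>"
      using main_ov[OF that] by (simp add: card_cartesian_product)
    have cB: "real (card (Bs p)) \<le> real p" using card_mono[OF _ Bs(1)[OF that(1)]] by simp
    have pp: "real p > 0" "64 * j\<^sup>2 \<le> real p" using p0[OF that(1)] P0(2)[OF that(1)] j(1) by linarith+
    note * = local_factor_bounds[OF pp(1) Bs(2)[OF that(1)] cB b bj pp(2) _ cU m1 _ I(2)[OF that(1)] cardA[OF that(1)] refl ovn]
    show "(1 - B.u p \<omega>) / (1 - s p) ^ card (A \<omega>) \<le> 1 + 2 * ov p \<omega> / real p"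
     "1 - 5 * j\<^sup>2 / (real p)\<^sup>2 \<le> (1 - B.u p \<omega>) / (1 - s p) ^ card (A \<omega>)"
      unfolding B.u_def U s_def using * by simp_all
  qed
  have f0: "0 \<le> (1 - B.u p \<omega>) / (1 - s p) ^ card (A \<omega>)" if "p \<in> P" "\<omega> \<in> \<Omega>" for p \<omega>
    using B.u_le(3)[OF that] s[OF that(1)] by (intro divide_nonneg_nonneg zero_le_power) auto
  have mb: "\<bar>m \<omega> - 1\<bar> \<le> 6 * t + 10 * j\<^sup>2 / P0" "0 \<le> m \<omega>" "m \<omega> \<le> 2" if o: "\<omega> \<in> \<Omega>" for \<omega>
  proof -
    show "0 \<le> m \<omega>" unfolding m_def using f0 o by (intro prod_nonneg) auto
    have "m \<omega> \<le> (\<Prod>p\<in>P. 1 + 2 * (ov p \<omega> / real p))" unfolding m_def using f0 fb(1) o by (intro prod_mono) auto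
    also have "\<dots> \<le> exp (\<Sum>p\<in>P. 2 * (ov p \<omega> / real p))" using ovn by (intro prod_le_exp_sum) auto
    also have "\<dots> \<le> exp (2 * t)" using good[OF o] unfolding sum_distrib_left[symmetric] ov_def by simp
    finally have me: "m \<omega> \<le> exp (2 * t)" .
    have "exp (2 * t) \<le> 1 + 2 * t + (2 * t)\<^sup>2" using t by (intro exp_bound) auto
    also have "(2 * t)\<^sup>2 \<le> 4 * t * 1" using t mult_left_mono[of t 1 "4 * t"] by (simp add: power2_eq_square)
    finally have up: "m \<omega> - 1 \<le> 6 * t" using me by linarith
    \<comment> \<open>The bound 1/6 on \<open>t\<close> is set for this.\<close>
    then show "m \<omega> \<le> 2" using t by linarith
    have small: "5 * j\<^sup>2 / (real p)\<^sup>2 \<le> 1" if "p \<in> P" for p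
    proof -
      have "real p \<ge> 64 * j\<^sup>2" "real p \<ge> 1" using P0(2)[OF that] j(1) P0(1) by linarith+
      then have "64 * j\<^sup>2 * 1 \<le> real p * real p" by (intro mult_mono) auto
      then have "5 * j\<^sup>2 \<le> (real p)\<^sup>2" unfolding power2_eq_square[of "real p"] using zero_le_power2[of j] by linarith
      then show ?thesis using p0[OF that] by (simp add: divide_le_eq)
    qed
    have "1 - (\<Sum>p\<in>P. 5 * j\<^sup>2 / (real p)\<^sup>2) \<le> (\<Prod>p\<in>P. 1 - 5 * j\<^sup>2 / (real p)\<^sup>2)"
      using finP small by (intro one_minus_sum_le_prod) auto
    also have "\<dots> \<le> m \<omega>" unfolding m_def using fb(2) small o by (intro prod_mono) auto
    finally have "1 - m \<omega> \<le> 5 * j\<^sup>2 * (\<Sum>p\<in>P. 1 / (real p)\<^sup>2)" by (simp add: sum_distrib_left)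
    also have "\<dots> \<le> 5 * j\<^sup>2 * (2 / P0)" using finP P0 by (intro mult_left_mono sum_recip_squares_le) auto
    finally have low: "1 - m \<omega> \<le> 10 * j\<^sup>2 / P0" by simp
    have "10 * j\<^sup>2 / P0 \<ge> 0" using P0(1) by simp
    then show "\<bar>m \<omega> - 1\<bar> \<le> 6 * t + 10 * j\<^sup>2 / P0" using up low t by linarith
  qed
  have w: "local_weight P I ((\<lambda>a. c a * \<omega> + d a) ` A \<omega>) \<beta> = m \<omega> * (\<Prod>p\<in>P. B.g p \<omega> (\<beta> p))" 
    if o: "\<omega> \<in> \<Omega>" and bb: "\<beta> \<in> PiE P Bs" for \<omega> \<beta>
  proof (cases "P = {}")
    case True
    then show ?thesis unfolding local_weight_def m_def by simp
  next
    case False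
    then obtain p' where p': "p' \<in> P" by auto
    have inj: "inj_on (\<lambda>a. c a * \<omega> + d a) (A \<omega>)"
    proof (rule inj_onI)
      fix a a' assume a: "a \<in> A \<omega>" "a' \<in> A \<omega>" "c a * \<omega> + d a = c a' * \<omega> + d a'"
      then have "a \<in> T" "a' \<in> T" using subsetD[OF Aprop[of \<omega>]] by auto
      then have "qf \<omega> * a = qf \<omega> * a'" using lin[of a \<omega>, OF _ o] lin[of a' \<omega>, OF _ o] a(3) by (metis add_left_cancel)
      moreover have "qf \<omega> \<noteq> 0"
      proof
        assume "qf \<omega> = 0"
        then show False using copq[OF p' o] primeP[OF p'] by (auto dest: prime_gt_1_nat)
      qed
      ultimately show "a = a'" by simp
    qed
    have hit: "(\<exists>a\<in>A \<omega>. (c a * \<omega> + d a - \<beta> p) mod int p \<in> I p) \<longleftrightarrow> \<beta> p \<in> B.U p \<omega>" if p: "p \<in> P" for p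
    proof
      assume "\<exists>a\<in>A \<omega>. (c a * \<omega> + d a - \<beta> p) mod int p \<in> I p"
      then obtain a where a: "a \<in> A \<omega>" "(c a * \<omega> + d a - \<beta> p) mod int p \<in> I p" by auto
      have "[c a * \<omega> + d a - (c a * \<omega> + d a - \<beta> p) mod int p = c a * \<omega> + d a - (c a * \<omega> + d a - \<beta> p)] (mod int p)"
        by (intro cong_diff cong_refl) (simp add: unique_euclidean_semiring_class.cong_def)
      then have "[c a * \<omega> + d a - (c a * \<omega> + d a - \<beta> p) mod int p = \<beta> p] (mod int p)" by simp
      then show "\<beta> p \<in> B.U p \<omega>" unfolding B.U_def using a bb p 
        by (auto intro!: bexI[of _ "(a, (c a * \<omega> + d a - \<beta> p) mod int p)"])
    next
      assume "\<beta> p \<in> B.U p \<omega>"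
      then obtain a i where a: "a \<in> A \<omega>" "i \<in> I p" "[c a * \<omega> + d a - i = \<beta> p] (mod int p)" unfolding B.U_def by auto
      have "[c a * \<omega> + d a - \<beta> p = i] (mod int p)" using a(3) unfolding cong_iff_dvd_diff
        by (metis (no_types, lifting) add_diff_cancel_left' diff_diff_eq2 diff_diff_add add.commute)
      moreover have "i \<in> {0..<int p}" using I(1)[OF p] a by auto
      ultimately have "(c a * \<omega> + d a - \<beta> p) mod int p = i" using residue_eq_iff[of i p] by auto
      then show "\<exists>a\<in>A \<omega>. (c a * \<omega> + d a - \<beta> p) mod int p \<in> I p" using a by auto
    qed
    have ob: "of_bool (\<forall>p\<in>P. \<forall>n\<in>(\<lambda>a. c a * \<omega> + d a) ` A \<omega>. (n - \<beta> p) mod int p \<notin> I p) = (\<Prod>p\<in>P. of_bool (\<beta> p \<notin> B.U p \<omega>) :: real)"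
    proof -
      have "(\<forall>p\<in>P. \<forall>n\<in>(\<lambda>a. c a * \<omega> + d a) ` A \<omega>. (n - \<beta> p) mod int p \<notin> I p) \<longleftrightarrow> (\<forall>p\<in>P. \<beta> p \<notin> B.U p \<omega>)"
        using hit by auto
      moreover have "of_bool (\<forall>p\<in>P. \<beta> p \<notin> B.U p \<omega>) = (\<Prod>p\<in>P. of_bool (\<beta> p \<notin> B.U p \<omega>) :: real)"
        using finP by (induction P rule: finite_induct) auto
      ultimately show ?thesis by simp
    qed
    have "m \<omega> * (\<Prod>p\<in>P. B.g p \<omega> (\<beta> p)) = (\<Prod>p\<in>P. (1 / (1 - s p)) ^ card (A \<omega>) * of_bool (\<beta> p \<notin> B.U p \<omega>))"
      unfolding m_def prod.distrib[symmetric]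
    proof (intro prod.cong refl)
      fix p assume p: "p \<in> P"
      have "1 - B.u p \<omega> \<noteq> 0" using B.u_le(3)[OF p o] by linarith
      then show "(1 - B.u p \<omega>) / (1 - s p) ^ card (A \<omega>) * B.g p \<omega> (\<beta> p) = (1 / (1 - s p)) ^ card (A \<omega>) * of_bool (\<beta> p \<notin> B.U p \<omega>)"
        unfolding B.g_def by (simp add: power_one_over)
    qed
    also have "\<dots> = (\<Prod>p\<in>P. 1 / (1 - s p)) ^ card (A \<omega>) * (\<Prod>p\<in>P. of_bool (\<beta> p \<notin> B.U p \<omega>))"
      by (simp add: prod.distrib prod_power_distrib)
    also have "(\<Prod>p\<in>P. 1 / (1 - s p)) = 1 / (\<Prod>p\<in>P. 1 - s p)" by (simp add: prod_dividef)
    finally show ?thesis unfolding local_weight_def ob card_image[OF inj] s_def by simp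
  qed
  let ?\<mu> = "6 * t + 10 * j\<^sup>2 / P0"
  let ?B = "variance_bound P j P0 P1 L \<eta> \<Lambda> t"
  interpret C: local_factors P Bs I \<Omega> T A c d m ov j b P0 P1 L \<eta> \<Lambda> t
    by (rule lf) (rule mb, assumption)+
  have "(\<Sum>\<beta>\<in>PiE P Bs. (\<Sum>\<omega>\<in>\<Omega>. local_weight P I ((\<lambda>a. c a * \<omega> + d a) ` A \<omega>) \<beta> - 1)\<^sup>2) = 
     (\<Sum>\<beta>\<in>PiE P Bs. (\<Sum>\<omega>\<in>\<Omega>. m \<omega> * (\<Prod>p\<in>P. C.g p \<omega> (\<beta> p)) - 1)\<^sup>2)"
    using w by (intro sum.cong refl arg_cong[where f="\<lambda>x. x\<^sup>2"]) (auto intro!: sum.cong)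
  also have "\<dots> \<le> (\<Prod>p\<in>P. real (card (Bs p))) * ((real (card \<Omega>))\<^sup>2 * (2 * C.vbound + 2 * ?\<mu>\<^sup>2))"
    by (rule C.second_moment_bound) (rule mb)
  also have "C.vbound = ?B" unfolding C.vbound_def variance_bound_def ..
  finally show ?thesis .
qed

section \<open>Distribution of the index sets in residue classes\<close>

lemma brun_size_mono: "finite Z \<Longrightarrow> Z' \<subseteq> Z \<Longrightarrow> brun_size Z' k \<le> brun_size Z k"
  unfolding brun_size_def by (intro card_mono) auto

text \<open>The members of \<open>Q\<close> exceed all primes of \<open>Z\<close> and so survive the
  sieve. Primes of \<open>D\<close> have their residue prescribed and are taken out of the sieve;
  each costs at most a factor 2, as 1 - 1/p \<ge> 1/2. This is the origin of 2 / p in place of 1 /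
  p.\<close>

lemma prime_family_count:
  fixes Q Z D :: "nat set" and N :: int
  assumes Q: "finite Q" "\<And>q. q \<in> Q \<Longrightarrow> prime q" "\<And>q. q \<in> Q \<Longrightarrow> int q \<le> N"
    and Z: "finite Z" "\<And>p. p \<in> Z \<Longrightarrow> prime p" "\<And>p q. p \<in> Z \<Longrightarrow> q \<in> Q \<Longrightarrow> p < q"
    and D: "finite D" "\<And>p. p \<in> D \<Longrightarrow> prime p" and N: "N \<ge> 0"
  shows "real (card {\<omega>\<in>int ` Q. in_class D r \<omega>}) \<le>
     real_of_int N * ((\<Prod>p\<in>Z. 1 - 1 / real p) + exp (2 * (\<Sum>p\<in>Z. 1 / real p)) / 2 ^ (2 * k)) * (\<Prod>p\<in>D. 2 / real p) + real (brun_size Z k)"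
proof -
  let ?X = "{n\<in>{0<..N}. in_class D r n}" and ?W = "brun_weight (Z - D) k"
  let ?V = "\<Prod>p\<in>Z. 1 - 1 / real p" and ?e = "exp (2 * (\<Sum>p\<in>Z. 1 / real p)) / 2 ^ (2 * k)"
  have f01: "0 \<le> 1 - 1 / real p" "1 - 1 / real p \<le> 1" "1 / 2 \<le> 1 - 1 / real p" if "prime p" for p
    using prime_ge_2_nat[OF that] by (auto simp: field_simps)
  have "real (card {\<omega>\<in>int ` Q. in_class D r \<omega>}) = (\<Sum>\<omega> | \<omega> \<in> int ` Q \<and> in_class D r \<omega>. 1)" by simp
  also have "\<dots> = (\<Sum>\<omega> | \<omega> \<in> int ` Q \<and> in_class D r \<omega>. ?W \<omega>)"
  proof (intro sum.cong refl brun_weight_eq_1[symmetric])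
    fix \<omega> p assume "\<omega> \<in> {\<omega>. \<omega> \<in> int ` Q \<and> in_class D r \<omega>}" "p \<in> Z - D"
    then obtain q where q: "\<omega> = int q" "q \<in> Q" "p \<in> Z" by auto
    show "\<not> int p dvd \<omega>"
    proof
      assume "int p dvd \<omega>"
      then have "p dvd q" using q by simp
      then have "p = q" using primes_dvd_imp_eq Z(2)[OF q(3)] Q(2)[OF q(2)] by blast
      then show False using Z(3)[OF q(3) q(2)] by simp
    qed
  qed
  also have "\<dots> \<le> (\<Sum>n\<in>?X. ?W n)"
  proof (intro sum_mono2 brun_weight_nonneg)
    show "finite ?X" by (rule finite_subset[of _ "{0<..N}"]) auto
    show "{\<omega>. \<omega> \<in> int ` Q \<and> in_class D r \<omega>} \<subseteq> ?X"
    proof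
      fix \<omega> assume "\<omega> \<in> {\<omega>. \<omega> \<in> int ` Q \<and> in_class D r \<omega>}"
      then obtain q where q: "\<omega> = int q" "q \<in> Q" "in_class D r \<omega>" by auto
      have "0 < \<omega>" using q prime_gt_0_nat[OF Q(2)[OF q(2)]] by simp
      then show "\<omega> \<in> ?X" using q Q(3)[OF q(2)] by simp
    qed
  qed (use Z(1) in auto)
  also have "\<dots> \<le> real_of_int N * brun_density (Z - D) k / real (\<Prod>D) + real (brun_size (Z - D) k)"
  proof -
    have "\<And>p. p \<in> (Z - D) \<union> D \<Longrightarrow> prime p" "(Z - D) \<inter> D = {}" using Z(2) D(2) by auto
    from sum_brun_weight_class[OF finite_Diff[OF Z(1)] D(1) this N, of k r] show ?thesis by (simp add: abs_le_iff)
  qed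
  also have "\<dots> \<le> real_of_int N * (2 ^ card D * (?V + ?e)) / real (\<Prod>D) + real (brun_size Z k)"
  proof (intro add_mono divide_right_mono mult_left_mono)
    have "brun_density (Z - D) k \<le> (\<Prod>p\<in>Z-D. 1 - 1 / real p) + exp (2 * (\<Sum>p\<in>Z-D. 1 / real p)) / 2 ^ (2 * k)"
      using Z prime_gt_0_nat by (intro brun_density_le) auto
    also have "\<dots> \<le> 2 ^ card D * ?V + ?e"
    proof (intro add_mono divide_right_mono)
      have "?V = (\<Prod>p\<in>Z-D. 1 - 1 / real p) * (\<Prod>p\<in>Z\<inter>D. 1 - 1 / real p)"
        using Z(1) by (subst prod.union_disjoint[symmetric]) (auto intro!: prod.cong)
      moreover have "(1/2) ^ card D \<le> (\<Prod>p\<in>Z\<inter>D. 1 - 1 / real p)"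
      proof -
        have "(1/2::real) ^ card D \<le> (1/2) ^ card (Z \<inter> D)" using D(1) by (intro power_decreasing card_mono) auto
        also have "\<dots> = (\<Prod>p\<in>Z\<inter>D. 1/2)" by simp
        also have "\<dots> \<le> (\<Prod>p\<in>Z\<inter>D. 1 - 1 / real p)" using f01 Z(2) by (intro prod_mono) auto
        finally show ?thesis .
      qed
      moreover have "(\<Prod>p\<in>Z-D. 1 - 1 / real p) \<ge> 0" using f01 Z(2) by (intro prod_nonneg) auto
      ultimately have "(\<Prod>p\<in>Z-D. 1 - 1 / real p) * (1/2) ^ card D \<le> ?V" by (simp add: mult_left_mono)
      then show "(\<Prod>p\<in>Z-D. 1 - 1 / real p) \<le> 2 ^ card D * ?V" by (simp add: power_one_over field_simps)
      have "(\<Sum>p\<in>Z-D. 1 / real p) \<le> (\<Sum>p\<in>Z. 1 / real p)" using Z(1) by (intro sum_mono2) auto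
      then show "exp (2 * (\<Sum>p\<in>Z-D. 1 / real p)) \<le> exp (2 * (\<Sum>p\<in>Z. 1 / real p))" by simp
    qed simp
    also have "\<dots> \<le> 2 ^ card D * (?V + ?e)"
      using mult_right_mono[of 1 "2 ^ card D" ?e] by (simp add: distrib_left)
    finally show "brun_density (Z - D) k \<le> 2 ^ card D * (?V + ?e)" .
    show "real (brun_size (Z - D) k) \<le> real (brun_size Z k)" using brun_size_mono[OF Z(1)] by simp
  qed (use N in \<open>auto intro: prod_nonneg\<close>)
  also have "real_of_int N * (2 ^ card D * (?V + ?e)) / real (\<Prod>D) = real_of_int N * (?V + ?e) * (\<Prod>p\<in>D. 2 / real p)"
    by (simp add: prod_dividef)
  finally show ?thesis .
qed

lemma sum_squares_le_cube:
  assumes "finite P" "\<And>p. p \<in> P \<Longrightarrow> 0 < p \<and> real p \<le> P1" "P1 \<ge> 0"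
  shows "(\<Sum>p\<in>P. (real p)\<^sup>2) \<le> P1 ^ 3"
proof -
  have "(\<Sum>p\<in>P. (real p)\<^sup>2) \<le> (\<Sum>p\<in>P. P1\<^sup>2)" using assms by (intro sum_mono power_mono) auto
  also have "\<dots> = real (card P) * P1\<^sup>2" by simp
  also have "real (card P) \<le> P1"
  proof -
    have "P \<subseteq> {1..nat \<lfloor>P1\<rfloor>}" using assms by (fastforce simp: le_nat_floor)
    then have "card P \<le> nat \<lfloor>P1\<rfloor>" using card_mono[of "{1..nat \<lfloor>P1\<rfloor>}" P] by simp
    then show ?thesis using assms(3) by linarith
  qed
  then have "real (card P) * P1\<^sup>2 \<le> P1 * P1\<^sup>2" by (intro mult_right_mono) auto
  finally show ?thesis by (simp add: power3_eq_cube power2_eq_square)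
qed

text \<open>The large sieve with the Brun weight as majorant. Keeping \<open>P\<close> disjoint from
  \<open>Z\<close> makes the weight equidistributed modulo the primes of \<open>P\<close> without
  any loss in density.\<close>

lemma prime_family_sieve:
  fixes Q Z P :: "nat set" and N :: int
  assumes Q: "finite Q" "\<And>q. q \<in> Q \<Longrightarrow> prime q" "\<And>q. q \<in> Q \<Longrightarrow> int q \<le> N"
    and Z: "finite Z" "\<And>p. p \<in> Z \<Longrightarrow> prime p" "\<And>p q. p \<in> Z \<Longrightarrow> q \<in> Q \<Longrightarrow> p < q"
    and P: "finite P" "\<And>p. p \<in> P \<Longrightarrow> prime p" "\<And>p. p \<in> P \<Longrightarrow> real p \<le> P1" "P \<inter> Z = {}" and N: "N \<ge> 0" and P1: "P1 \<ge> 0"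
  shows "(\<Sum>p\<in>P. real p * (\<Sum>r\<in>{0..<int p}. (class_dev (int ` Q) \<alpha> p r)\<^sup>2)) 
     \<le> (real_of_int N * ((\<Prod>p\<in>Z. 1 - 1 / real p) + exp (2 * (\<Sum>p\<in>Z. 1 / real p)) / 2 ^ (2 * k)) + real (brun_size Z k) * P1 ^ 3)
        * (\<Sum>\<omega>\<in>int ` Q. (\<alpha> \<omega>)\<^sup>2)"
proof -
  let ?X = "{0<..N}" and ?W = "brun_weight Z k"
  let ?V = "(\<Prod>p\<in>Z. 1 - 1 / real p) + exp (2 * (\<Sum>p\<in>Z. 1 / real p)) / 2 ^ (2 * k)"
  \<comment> \<open>The large sieve asks for a nonnegative main term, while the truncated density
    could be negative. In that case the nonnegative class sums lie below the remainder, and 0 serves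
    as main term.\<close>
  define Y where "Y = max 0 (real_of_int N * brun_density Z k)"
  let ?E = "real (brun_size Z k)"
  have V0: "0 \<le> (\<Prod>p\<in>Z. 1 - 1 / real p)" using Z(2) by (intro prod_nonneg) (auto simp: divide_le_eq_1 dest: prime_ge_1_nat)
  have YV: "Y \<le> real_of_int N * ?V"
  proof -
    have "brun_density Z k \<le> ?V" using Z prime_gt_0_nat by (intro brun_density_le) auto
    then have "real_of_int N * brun_density Z k \<le> real_of_int N * ?V" using N by (intro mult_left_mono) auto
    moreover have "0 \<le> real_of_int N * ?V" using N V0 by (intro mult_nonneg_nonneg add_nonneg_nonneg) auto
    ultimately show ?thesis unfolding Y_def by simp
  qed
  have "(\<Sum>p\<in>P. real p * (\<Sum>r\<in>{0..<int p}. (class_dev (int ` Q) \<alpha> p r)\<^sup>2)) 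
     \<le> (Y + ?E * (\<Sum>p\<in>P. (real p)\<^sup>2)) * (\<Sum>\<omega>\<in>int ` Q. (\<alpha> \<omega>)\<^sup>2)"
  proof (rule large_sieve_majorant[where X = ?X and \<theta> = ?W])
    show "int ` Q \<subseteq> ?X"
    proof
      fix \<omega> assume "\<omega> \<in> int ` Q"
      then obtain q where q: "\<omega> = int q" "q \<in> Q" by auto
      have "0 < \<omega>" using q prime_gt_0_nat[OF Q(2)[OF q(2)]] by simp
      then show "\<omega> \<in> ?X" using q Q(3)[OF q(2)] by simp
    qed
    show "?W n \<ge> 0" for n using brun_weight_nonneg[OF Z(1)] .
    show "?W \<omega> \<ge> 1" if o: "\<omega> \<in> int ` Q" for \<omega>
    proof -
      obtain q where q: "\<omega> = int q" "q \<in> Q" using o by auto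
      have "\<not> int p dvd \<omega>" if "p \<in> Z" for p
      proof
        assume "int p dvd \<omega>"
        then have "p dvd q" using q by simp
        then have "p = q" using primes_dvd_imp_eq Z(2)[OF that] Q(2)[OF q(2)] by blast
        then show False using Z(3)[OF that q(2)] by simp
      qed
      then show ?thesis using brun_weight_eq_1[of Z \<omega> k] by simp
    qed
    fix F r assume F: "F \<subseteq> P"
    have finF: "finite F" using F P(1) finite_subset by blast
    have Fpos: "real (\<Prod>F) > 0" using F P(2) prime_gt_0_nat by (auto intro!: prod_pos simp: subset_iff)
    let ?S = "\<Sum>n | n \<in> ?X \<and> in_class F r n. ?W n"
    have 1: "\<bar>?S - real_of_int N * brun_density Z k / real (\<Prod>F)\<bar> \<le> ?E"
    proof -
      have "\<And>p. p \<in> Z \<union> F \<Longrightarrow> prime p" "Z \<inter> F = {}" using Z(2) P(2,4) F by auto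
      from sum_brun_weight_class[OF Z(1) finF this N, of k r] show ?thesis by simp
    qed
    have S0: "?S \<ge> 0" by (intro sum_nonneg brun_weight_nonneg Z(1))
    show "\<bar>?S - Y / real (\<Prod>F)\<bar> \<le> ?E"
    proof (cases "real_of_int N * brun_density Z k \<ge> 0")
      case True
      then show ?thesis using 1 unfolding Y_def by simp
    next
      case False
      then have "real_of_int N * brun_density Z k / real (\<Prod>F) \<le> 0" using Fpos by (intro divide_nonpos_pos) auto
      then have "\<bar>?S\<bar> \<le> ?E" using 1 S0 by linarith
      then show ?thesis using False unfolding Y_def by simp
    qed
  qed (use P Y_def in auto)
  also have "\<dots> \<le> (real_of_int N * ?V + ?E * P1 ^ 3) * (\<Sum>\<omega>\<in>int ` Q. (\<alpha> \<omega>)\<^sup>2)"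
    using YV sum_squares_le_cube[of P P1] P P1 prime_gt_0_nat
    by (intro mult_right_mono add_mono mult_left_mono sum_nonneg) auto
  finally show ?thesis .
qed

text \<open>Stated with the wasteful 2 / p so as to share its format with the count for
  primes.\<close>

lemma interval_count:
  assumes D: "finite D" "\<And>p. p \<in> D \<Longrightarrow> prime p" and ab: "a < b"
  shows "real (card {\<omega>\<in>{a<..b}. in_class D r \<omega>}) \<le> real (card {a<..b}) * (1 * (\<Prod>p\<in>D. 2 / real p) + 1 / real (card {a<..b}))"
proof -
  have N: "real (card {a<..b}) = real_of_int (b - a)" "real_of_int (b - a) > 0" using ab by auto
  have "real (card {\<omega>\<in>{a<..b}. in_class D r \<omega>}) \<le> real_of_int (b - a) / real (\<Prod>D) + 1"
    using card_in_class_interval[OF D, of a b r] ab by (simp add: abs_le_iff)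
  also have "real_of_int (b - a) / real (\<Prod>D) = real_of_int (b - a) * (\<Prod>p\<in>D. 1 / real p)" by (simp add: prod_dividef)
  also have "\<dots> \<le> real_of_int (b - a) * (\<Prod>p\<in>D. 2 / real p)"
    using N by (intro mult_left_mono prod_mono) (auto intro!: divide_right_mono)
  finally show ?thesis unfolding N(1) using N(2) by (simp add: distrib_left)
qed

lemma interval_sieve:
  assumes P: "finite P" "\<And>p. p \<in> P \<Longrightarrow> prime p" "\<And>p. p \<in> P \<Longrightarrow> real p \<le> P1" "P1 \<ge> 0" and ab: "a < b"
  shows "(\<Sum>p\<in>P. real p * (\<Sum>r\<in>{0..<int p}. (class_dev {a<..b} \<alpha> p r)\<^sup>2)) 
     \<le> (real (card {a<..b}) + P1 ^ 3) * (\<Sum>\<omega>\<in>{a<..b}. (\<alpha> \<omega>)\<^sup>2)"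
proof -
  have "(\<Sum>p\<in>P. real p * (\<Sum>r\<in>{0..<int p}. (class_dev {a<..b} \<alpha> p r)\<^sup>2)) 
     \<le> (real_of_int (b - a) + 1 * (\<Sum>p\<in>P. (real p)\<^sup>2)) * (\<Sum>\<omega>\<in>{a<..b}. (\<alpha> \<omega>)\<^sup>2)"
  proof (rule large_sieve_majorant[where X = "{a<..b}" and \<theta> = "\<lambda>_. 1"])
    fix F r assume "F \<subseteq> P"
    then have "finite F" "\<And>p. p \<in> F \<Longrightarrow> prime p" using P finite_subset by auto
    from card_in_class_interval[OF this, of a b r] 
    show "\<bar>(\<Sum>n | n \<in> {a<..b} \<and> in_class F r n. 1) - real_of_int (b - a) / real (\<Prod>F)\<bar> \<le> 1" using ab by simp
  qed (use P ab in auto)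
  also have "\<dots> \<le> (real (card {a<..b}) + P1 ^ 3) * (\<Sum>\<omega>\<in>{a<..b}. (\<alpha> \<omega>)\<^sup>2)"
    using sum_squares_le_cube[of P P1] P prime_gt_0_nat ab by (intro mult_right_mono add_mono sum_nonneg) auto
  finally show ?thesis .
qed

text \<open>For a fixed triple (j, i, i') the offset j is invertible modulo p > J, so an overlap
  puts q into one class modulo p, which \<open>count\<close> bounds by a proportion 2 L / p +
  \<eta>. Together with the weight 1 / p the sum over primes converges like 1 / P0.\<close>

lemma sum_overlaps_le:
  fixes Q P :: "nat set"
  assumes P: "finite P" "\<And>p. p \<in> P \<Longrightarrow> prime p" "\<And>p. p \<in> P \<Longrightarrow> P0 \<le> real p" "P0 \<ge> 2" "\<And>p. p \<in> P \<Longrightarrow> J < p"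
    and I: "\<And>p. p \<in> P \<Longrightarrow> finite (I p)" "\<And>p. p \<in> P \<Longrightarrow> real (card (I p)) \<le> b" and b: "b \<ge> 0"
    and Q: "finite Q" and L: "L \<ge> 0" "\<eta> \<ge> 0" and J: "J \<ge> 1"
    and count: "\<And>D r. D \<subseteq> P \<Longrightarrow> real (card {\<omega>\<in>int ` Q. in_class D r \<omega>}) \<le> real (card Q) * (L * (\<Prod>p\<in>D. 2 / real p) + \<eta>)"
  shows "(\<Sum>q\<in>Q. \<Sum>p\<in>P. real (J + 1) * real (card (overlaps I (int J) p (int q))) / real p) \<le>
     real (card Q) * (4 * (real J * b)\<^sup>2 * (4 * L / P0 + \<eta> * (\<Sum>p\<in>P. 1 / real p)))"
proof -
  have one: "(\<Sum>q\<in>Q. real (card (overlaps I (int J) p (int q)))) \<le> real (card Q) * (2 * real J * b\<^sup>2 * (2 * L / real p + \<eta>))"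
    if p: "p \<in> P" for p
  proof -
    let ?T = "({- int J..int J} - {0}) \<times> I p \<times> I p"
    have finT: "finite ?T" using I(1)[OF p] by auto
    have ov: "real (card (overlaps I (int J) p q)) = (\<Sum>x\<in>?T. of_bool [q * fst x = fst (snd x) - snd (snd x)] (mod int p))" for q
    proof -
      have "overlaps I (int J) p q = {x\<in>?T. [q * fst x = fst (snd x) - snd (snd x)] (mod int p)}"
        unfolding overlaps_def by auto
      then show ?thesis using finT by (simp add: of_bool_def sum.If_cases Int_def)
    qed
    have "(\<Sum>q\<in>Q. real (card (overlaps I (int J) p (int q)))) = 
       (\<Sum>x\<in>?T. \<Sum>q\<in>Q. of_bool [int q * fst x = fst (snd x) - snd (snd x)] (mod int p))"
      unfolding ov by (rule sum.swap)
    also have "\<dots> \<le> (\<Sum>x\<in>?T. real (card Q) * (2 * L / real p + \<eta>))"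
    proof (rule sum_mono)
      fix x assume x: "x \<in> ?T"
      have "\<not> int p dvd fst x"
      proof
        assume "int p dvd fst x"
        moreover have "fst x \<noteq> 0" "\<bar>fst x\<bar> \<le> int J" using x by (auto simp: abs_le_iff)
        ultimately have "int p \<le> \<bar>fst x\<bar>" using dvd_imp_le_int[of "fst x" "int p"] by simp
        then show False using \<open>\<bar>fst x\<bar> \<le> int J\<close> P(5)[OF p] by simp
      qed
      then have cp: "coprime (fst x) (int p)" using P(2)[OF p] by (simp add: prime_imp_coprime coprime_commute)
      then obtain s where s: "[fst x * s = 1] (mod int p)" using cong_solve_coprime_int by blast
      define r where "r = s * (fst (snd x) - snd (snd x))"
      have "{\<omega>\<in>int ` Q. [\<omega> * fst x = fst (snd x) - snd (snd x)] (mod int p)} \<subseteq> {\<omega>\<in>int ` Q. in_class {p} (\<lambda>_. r) \<omega>}"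
      proof (rule subsetI)
        fix \<omega> assume o: "\<omega> \<in> {\<omega>\<in>int ` Q. [\<omega> * fst x = fst (snd x) - snd (snd x)] (mod int p)}"
        then have "[\<omega> * fst x = fst (snd x) - snd (snd x)] (mod int p)" by simp
        then have "[\<omega> * fst x * s = (fst (snd x) - snd (snd x)) * s] (mod int p)" by (rule cong_scalar_right)
        moreover have "[\<omega> * (fst x * s) = \<omega> * 1] (mod int p)" using s by (rule cong_scalar_left)
        ultimately have "[\<omega> = (fst (snd x) - snd (snd x)) * s] (mod int p)" 
          by (metis cong_sym cong_trans mult.assoc mult.right_neutral)
        then show "\<omega> \<in> {\<omega>\<in>int ` Q. in_class {p} (\<lambda>_. r) \<omega>}" using o unfolding in_class_def r_def by (simp add: mult.commute)
      qed
      then have "card {\<omega>\<in>int ` Q. [\<omega> * fst x = fst (snd x) - snd (snd x)] (mod int p)} \<le> card {\<omega>\<in>int ` Q. in_class {p} (\<lambda>_. r) \<omega>}"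
        using Q by (intro card_mono) auto
      moreover have "real (card {\<omega>\<in>int ` Q. in_class {p} (\<lambda>_. r) \<omega>}) \<le> real (card Q) * (2 * L / real p + \<eta>)"
        using count[of "{p}" "\<lambda>_. r"] p by (simp add: mult.commute)
      ultimately have le: "real (card {\<omega>\<in>int ` Q. [\<omega> * fst x = fst (snd x) - snd (snd x)] (mod int p)}) \<le> real (card Q) * (2 * L / real p + \<eta>)"
        by linarith
      have "(\<Sum>q\<in>Q. of_bool [int q * fst x = fst (snd x) - snd (snd x)] (mod int p)) = 
          (\<Sum>\<omega>\<in>int ` Q. of_bool [\<omega> * fst x = fst (snd x) - snd (snd x)] (mod int p) :: real)"
        by (subst sum.reindex) auto
      also have "\<dots> = real (card {\<omega>\<in>int ` Q. [\<omega> * fst x = fst (snd x) - snd (snd x)] (mod int p)})"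
        using Q by (simp add: of_bool_def sum.If_cases Int_def)
      finally show "(\<Sum>q\<in>Q. of_bool [int q * fst x = fst (snd x) - snd (snd x)] (mod int p)) \<le> real (card Q) * (2 * L / real p + \<eta>)"
        using le by simp
    qed
    also have "\<dots> = real (card ?T) * (real (card Q) * (2 * L / real p + \<eta>))" by simp
    also have "\<dots> \<le> (2 * real J * b\<^sup>2) * (real (card Q) * (2 * L / real p + \<eta>))"
    proof (rule mult_right_mono)
      have "card ({- int J..int J} - {0}) = 2 * J" by (subst card_Diff_subset) auto
      then have "real (card ?T) = 2 * real J * (real (card (I p)) * real (card (I p)))" by (simp add: card_cartesian_product)
      also have "\<dots> \<le> 2 * real J * (b * b)" using I(2)[OF p] b by (intro mult_left_mono mult_mono) auto
      finally show "real (card ?T) \<le> 2 * real J * b\<^sup>2" by (simp add: power2_eq_square)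
    qed (use L in auto)
    finally show ?thesis by (simp add: mult_ac)
  qed
  have "(\<Sum>q\<in>Q. \<Sum>p\<in>P. real (J + 1) * real (card (overlaps I (int J) p (int q))) / real p) = 
     (\<Sum>p\<in>P. real (J + 1) / real p * (\<Sum>q\<in>Q. real (card (overlaps I (int J) p (int q)))))"
    by (subst sum.swap) (simp add: sum_distrib_left)
  also have "\<dots> \<le> (\<Sum>p\<in>P. (2 * real J) / real p * (real (card Q) * (2 * real J * b\<^sup>2 * (2 * L / real p + \<eta>))))"
    using one J b L by (intro sum_mono mult_mono divide_right_mono sum_nonneg) auto
  also have "\<dots> = (\<Sum>p\<in>P. real (card Q) * (4 * (real J * b)\<^sup>2) * (2 * L * (1 / (real p)\<^sup>2) + \<eta> * (1 / real p)))"
  proof (intro sum.cong refl)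
    fix p assume "p \<in> P"
    then have "real p > 0" using P(2) prime_gt_0_nat by auto
    then show "(2 * real J) / real p * (real (card Q) * (2 * real J * b\<^sup>2 * (2 * L / real p + \<eta>))) = 
      real (card Q) * (4 * (real J * b)\<^sup>2) * (2 * L * (1 / (real p)\<^sup>2) + \<eta> * (1 / real p))"
      by (simp add: field_simps power2_eq_square)
  qed
  also have "\<dots> = real (card Q) * (4 * (real J * b)\<^sup>2) * (2 * L * (\<Sum>p\<in>P. 1 / (real p)\<^sup>2) + \<eta> * (\<Sum>p\<in>P. 1 / real p))"
    by (simp only: sum_distrib_left[symmetric] sum.distrib)
  also have "\<dots> \<le> real (card Q) * (4 * (real J * b)\<^sup>2) * (2 * L * (2 / P0) + \<eta> * (\<Sum>p\<in>P. 1 / real p))"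
    using P L by (intro mult_left_mono add_mono sum_recip_squares_le) auto
  finally show ?thesis by (simp add: mult.assoc)
qed

section \<open>Moments over random residue classes\<close>

text \<open>A finite set \<open>Hs\<close> of scales with families \<open>Qg\<close> of primes, all
  estimates at these scales being hypotheses. \<open>J H\<close> is the integer length of a
  progression and \<open>PH H\<close> the set of primes with random local factors; they are
  parameters with defining equations because the remaining hypotheses already mention them.\<close>

locale random_sieve =
  fixes I :: "nat \<Rightarrow> int set" and b M z :: real and K :: nat and y :: int and Hs :: "real set"
    and Qg :: "real \<Rightarrow> nat set" and L \<eta> \<Lambda> t v :: real
  fixes J :: "real \<Rightarrow> nat" and PH :: "real \<Rightarrow> nat set"
  assumes J_def: "J = (\<lambda>H. nat \<lfloor>real K * H\<rfloor>)" 
    and PH_def: "PH = (\<lambda>H. {p. prime p \<and> H powr M < real p \<and> real p \<le> z})"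
  assumes sys: "sieving_system I" and nondeg: "non_degenerate I" and bdd: "bounded_by b I" and b: "b \<ge> 1"
    and Hs: "finite Hs" "\<And>H. H \<in> Hs \<Longrightarrow> H \<ge> 2" "\<And>H. H \<in> Hs \<Longrightarrow> 64 * (real (J H) * b)\<^sup>2 \<le> H powr M" 
      "\<And>H. H \<in> Hs \<Longrightarrow> H powr M \<le> z" "\<And>H. H \<in> Hs \<Longrightarrow> H powr M \<ge> 2"
    and K: "K \<ge> 1" and y: "y \<ge> 1"
    and Qg: "\<And>H. H \<in> Hs \<Longrightarrow> finite (Qg H)" "\<And>H q. H \<in> Hs \<Longrightarrow> q \<in> Qg H \<Longrightarrow> prime q" 
      "\<And>H q. H \<in> Hs \<Longrightarrow> q \<in> Qg H \<Longrightarrow> z < real q" "\<And>H q. H \<in> Hs \<Longrightarrow> q \<in> Qg H \<Longrightarrow> real q * H \<le> real_of_int y"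
    and L: "L \<ge> 1" and \<eta>: "\<eta> \<ge> 0" and t: "t \<ge> 0" "t \<le> 1/6" and \<Lambda>: "\<Lambda> \<ge> 8"
    and count: "\<And>H D r. H \<in> Hs \<Longrightarrow> D \<subseteq> PH H \<Longrightarrow> 
      real (card {\<omega>\<in>int ` Qg H. in_class D r \<omega>}) \<le> real (card (Qg H)) * (L * (\<Prod>p\<in>D. 2 / real p) + \<eta>)"
    and sieve: "\<And>H \<alpha>. H \<in> Hs \<Longrightarrow> (\<And>\<omega>. \<omega> \<in> int ` Qg H \<Longrightarrow> \<bar>\<alpha> \<omega>\<bar> \<le> 2) \<Longrightarrow>
       (\<Sum>p | p \<in> PH H \<and> real p \<le> H ^ 8. real p * (\<Sum>r\<in>{0..<int p}. (class_dev (int ` Qg H) \<alpha> p r)\<^sup>2)) \<le> \<Lambda> * (real (card (Qg H)))\<^sup>2"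
    and good: "\<And>H q. H \<in> Hs \<Longrightarrow> q \<in> Qg H \<Longrightarrow> 
       (\<Sum>p\<in>PH H. real (J H + 1) * real (card (overlaps I (int (J H)) p (int q))) / real p) \<le> t"
    and N: "1 / real_of_int y \<le> \<eta>" "\<And>H. H \<in> Hs \<Longrightarrow> (H ^ 8) ^ 3 \<le> real_of_int y"
    and v: "\<And>H. H \<in> Hs \<Longrightarrow> 2 * variance_bound (PH H) (real (J H) * b) (H powr M) (H ^ 8) L \<eta> \<Lambda> t 
         + 2 * (6 * t + 10 * (real (J H) * b)\<^sup>2 / H powr M)\<^sup>2 \<le> v"
begin

definition Pz :: "nat set" where "Pz = {p. prime p \<and> real p \<le> z}"
definition Ps :: "real \<Rightarrow> nat set" where "Ps H = {p. prime p \<and> real p \<le> H powr M}"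
definition V :: "real \<Rightarrow> (nat \<Rightarrow> int) \<Rightarrow> int set" where "V H \<beta> = {n. \<forall>p\<in>Ps H. (n - \<beta> p) mod int p \<notin> I p}"
definition S :: "(nat \<Rightarrow> int) \<Rightarrow> int set" where "S \<beta> = {n. \<forall>p\<in>Pz. (n - \<beta> p) mod int p \<notin> I p}"
definition ap :: "real \<Rightarrow> (nat \<Rightarrow> int) \<Rightarrow> nat \<Rightarrow> int \<Rightarrow> int set" where
  "ap H \<beta> q n = (\<lambda>h. n + int q * h) ` {1..int (J H)} \<inter> V H \<beta>"
definition W :: "real \<Rightarrow> (nat \<Rightarrow> int) \<Rightarrow> nat \<Rightarrow> int \<Rightarrow> real" where
  "W H \<beta> q n = local_weight (PH H) I (ap H \<beta> q n) \<beta>"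
definition \<sigma>2 :: "real \<Rightarrow> real" where "\<sigma>2 H = (\<Prod>p\<in>PH H. 1 - real (card (I p)) / real p)"
definition \<sigma> :: real where "\<sigma> = (\<Prod>p\<in>Pz. 1 - real (card (I p)) / real p)"
definition full :: "(nat \<Rightarrow> int) set" where "full = PiE Pz (\<lambda>p. {0..<int p})"
text \<open>Restricting every residue to these sets realises the event n \<in> S, see
  \<open>PiE_allowed\<close>; it keeps the residues independent.\<close>

definition allowed :: "int \<Rightarrow> nat \<Rightarrow> int set" where "allowed n p = {\<beta>\<in>{0..<int p}. (n - \<beta>) mod int p \<notin> I p}"
definition NN :: real where "NN = (real K + 1) * real_of_int y"

lemma prime_I: "prime p \<Longrightarrow> I p \<subseteq> {0..<int p}" "prime p \<Longrightarrow> real (card (I p)) \<le> b" "prime p \<Longrightarrow> card (I p) < p" "prime p \<Longrightarrow> finite (I p)"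
proof -
  assume p: "prime p"
  show 1: "I p \<subseteq> {0..<int p}" using sys p unfolding sieving_system_def by blast
  show "real (card (I p)) \<le> b" using bdd p unfolding bounded_by_def by blast
  have "card (I p) \<le> p - 1" using nondeg p unfolding non_degenerate_def by blast
  then show "card (I p) < p" using prime_gt_0_nat[OF p] by linarith
  show "finite (I p)" using 1 finite_subset by blast
qed

lemma fin_Pz: "finite Pz" unfolding Pz_def by (rule finite_primes_le)
lemma fin_Ps: "finite (Ps H)" unfolding Ps_def by (rule finite_primes_le)
lemma fin_PH: "finite (PH H)" unfolding PH_def by (rule finite_subset[OF _ finite_primes_le[of z]]) auto

lemma Pz_split: assumes "H \<in> Hs" shows "Pz = Ps H \<union> PH H" "Ps H \<inter> PH H = {}"
  using Hs(4)[OF assms] unfolding Pz_def Ps_def PH_def by auto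

lemma PH_prime: "p \<in> PH H \<Longrightarrow> prime p" unfolding PH_def by simp

lemma \<sigma>2_pos: "\<sigma>2 H > 0"
  unfolding \<sigma>2_def
proof (rule prod_pos)
  fix p assume "p \<in> PH H"
  then have "card (I p) < p" by (intro prime_I(3) PH_prime)
  then show "0 < 1 - real (card (I p)) / real p" by (simp add: divide_less_eq_1)
qed

lemma \<sigma>_pos: "\<sigma> > 0"
  unfolding \<sigma>_def Pz_def using prime_I(3) by (intro prod_pos) (auto simp: divide_less_eq_1)

text \<open>The reflection \<beta> to n - \<beta> modulo p is an involution carrying these residues
  to the complement of \<open>I p\<close>.\<close>

lemma card_allowed:
  assumes p: "prime p"
  shows "real (card (allowed n p)) = real p - real (card (I p))"
proof -
  let ?f = "\<lambda>\<beta>. (n - \<beta>) mod int p"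
  have pp: "int p > 0" using prime_gt_0_nat[OF p] by simp
  have inv: "?f (?f \<beta>) = \<beta>" if "\<beta> \<in> {0..<int p}" for \<beta>
  proof -
    have "?f (?f \<beta>) = (n - (n - \<beta>)) mod int p" by (rule mod_diff_right_eq)
    then show ?thesis using that by simp
  qed
  have "bij_betw ?f (allowed n p) ({0..<int p} - I p)"
  proof (rule bij_betw_byWitness[where f' = ?f])
    show "\<forall>\<beta>\<in>allowed n p. ?f (?f \<beta>) = \<beta>" using inv unfolding allowed_def by auto
    show "\<forall>\<beta>\<in>{0..<int p} - I p. ?f (?f \<beta>) = \<beta>" using inv by auto
    show "?f ` allowed n p \<subseteq> {0..<int p} - I p" unfolding allowed_def using pp by auto
    show "?f ` ({0..<int p} - I p) \<subseteq> allowed n p"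
    proof
      fix x assume "x \<in> ?f ` ({0..<int p} - I p)"
      then obtain \<beta> where \<beta>: "x = ?f \<beta>" "\<beta> \<in> {0..<int p}" "\<beta> \<notin> I p" by auto
      then have "?f x = \<beta>" using inv by simp
      then show "x \<in> allowed n p" unfolding allowed_def using \<beta> pp by simp
    qed
  qed
  then have "card (allowed n p) = card ({0..<int p} - I p)" by (rule bij_betw_same_card)
  also have "\<dots> = p - card (I p)" using prime_I(1,4)[OF p] by (subst card_Diff_subset) auto
  finally show ?thesis using prime_I(3)[OF p] by simp
qed

lemma card_full: "real (card full) = (\<Prod>p\<in>Pz. real p)"
  unfolding full_def using fin_Pz by (simp add: card_PiE)

lemma card_full_pos: "real (card full) > 0"
  unfolding card_full Pz_def using prime_gt_0_nat by (intro prod_pos) auto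

lemma fin_full: "finite full" unfolding full_def using fin_Pz by (intro finite_PiE) auto

lemma prod_allowed: "(\<Prod>p\<in>Pz. real (card (allowed n p))) = \<sigma> * real (card full)"
  unfolding \<sigma>_def card_full prod.distrib[symmetric]
proof (intro prod.cong refl)
  fix p assume "p \<in> Pz"
  then have p: "prime p" unfolding Pz_def by simp
  show "real (card (allowed n p)) = (1 - real (card (I p)) / real p) * real p"
    unfolding card_allowed[OF p] using prime_gt_0_nat[OF p] by (simp add: field_simps)
qed

lemma PiE_allowed: "PiE Pz (allowed n) = {\<beta>\<in>full. n \<in> S \<beta>}"
  unfolding full_def S_def allowed_def by (auto simp: PiE_def Pi_def)

lemma J_less: 
  assumes "H \<in> Hs" "p \<in> PH H" 
  shows "J H < p" "H powr M \<le> real p" "J H \<ge> 1" "prime p"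
proof -
  show hp: "H powr M \<le> real p" "prime p" using assms(2) unfolding PH_def by auto
  have "1 * 2 \<le> real K * H" using K Hs(2)[OF assms(1)] by (intro mult_mono) auto
  then show J1: "J H \<ge> 1" unfolding J_def by linarith
  have "real (J H) * 1 \<le> real (J H) * b" using b by (intro mult_left_mono) auto
  then have j1: "1 \<le> real (J H) * b" "real (J H) \<le> real (J H) * b" using J1 by linarith+
  have "real (J H) * b \<le> (real (J H) * b)\<^sup>2" using j1 unfolding power2_eq_square by (simp add: mult_le_cancel_left1)
  then have "real (J H) < H powr M" using Hs(3)[OF assms(1)] j1 by linarith
  then show "J H < p" using hp by linarith
qed

lemma J_ge_1: assumes "H \<in> Hs" shows "J H \<ge> 1"
proof -
  have "1 * 2 \<le> real K * H" using K Hs(2)[OF assms(1)] by (intro mult_mono) auto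
  then show J1: "J H \<ge> 1" unfolding J_def by linarith
qed

lemma coprime_small:
  assumes "prime p" "a \<noteq> 0" "\<bar>a\<bar> < int p"
  shows "coprime a (int p)"
proof -
  have "\<not> int p dvd a" using assms dvd_imp_le_int[of a "int p"] by auto
  moreover have "prime (int p)" using assms(1) by simp
  ultimately show ?thesis using prime_imp_coprime coprime_commute by blast
qed

lemma coprime_q:
  assumes "H \<in> Hs" "p \<in> PH H" "q \<in> Qg H"
  shows "coprime (int q) (int p)"
proof -
  have "prime p" "real p \<le> z" using assms(2) unfolding PH_def by auto
  moreover have "prime q" "z < real q" using Qg assms by auto
  ultimately have "coprime q p" using primes_coprime[of q p] by auto
  then show ?thesis by (simp add: coprime_int_iff)
qed

text \<open>Residues at small primes act only through \<open>V\<close>, those at large primes only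
  through the local weight. For fixed \<beta>1 the set of terms is thus deterministic.\<close>

lemma W_override:
  assumes "H \<in> Hs"
  shows "W H (override_on \<beta>2 \<beta>1 (Ps H)) q n = local_weight (PH H) I ((\<lambda>h. n + int q * h) ` {1..int (J H)} \<inter> V H \<beta>1) \<beta>2"
proof -
  have "V H (override_on \<beta>2 \<beta>1 (Ps H)) = V H \<beta>1" unfolding V_def by auto
  moreover have "override_on \<beta>2 \<beta>1 (Ps H) p = \<beta>2 p" if "p \<in> PH H" for p
  proof -
    have "p \<notin> Ps H" using that Pz_split(2)[OF assms] by blast
    then show ?thesis by simp
  qed
  ultimately show ?thesis unfolding W_def ap_def local_weight_def by simp
qed

text \<open>The prime q is fixed and \<omega> = n varies over the interval: slope 1, offset q a,
  base n. The residues range over all values, so nothing is conditioned and \<open>compl\<close> is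
  vacuous.\<close>

lemma moment_interval:
  assumes H: "H \<in> Hs" and q: "q \<in> Qg H"
  shows "(\<Sum>\<beta>\<in>full. (\<Sum>n\<in>{- int K * y<..y}. W H \<beta> q n - 1)\<^sup>2) \<le> real (card full) * (NN\<^sup>2 * v)"
proof -
  let ?\<Omega> = "{- int K * y<..y}" let ?P = "PH H" let ?Bs = "\<lambda>p. {0..<int p}" let ?T = "{1..int (J H)}"
  have Ky: "- int K * y < y" using y K by (simp add: minus_mult_left[symmetric]) (smt (verit) mult_nonneg_nonneg of_nat_0_le_iff)
  have card\<Omega>: "real (card ?\<Omega>) = NN" unfolding NN_def using Ky y by (simp add: algebra_simps)
  have cy: "real_of_int y \<le> real (card ?\<Omega>)" unfolding card\<Omega> NN_def using y by simp
  have H8: "H ^ 8 \<ge> 2"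
  proof -
    have "2 ^ 1 \<le> (2::real) ^ 8" by simp
    also have "(2::real) ^ 8 \<le> H ^ 8" using Hs(2)[OF H] by (intro power_mono) auto
    finally show ?thesis by simp
  qed
  have inner: "(\<Sum>\<beta>2\<in>PiE ?P ?Bs. (\<Sum>n\<in>?\<Omega>. local_weight ?P I ((\<lambda>h. n + int q * h) ` ?T \<inter> V H \<beta>1) \<beta>2 - 1)\<^sup>2) \<le> 
     (\<Prod>p\<in>?P. real p) * (NN\<^sup>2 * v)" for \<beta>1
  proof -
    have img: "(\<lambda>a. 1 * \<omega> + int q * a) ` {a\<in>?T. 1 * \<omega> + int q * a \<in> V H \<beta>1} = (\<lambda>h. \<omega> + int q * h) ` ?T \<inter> V H \<beta>1" for \<omega>
      by auto
    have "(\<Sum>\<beta>2\<in>PiE ?P ?Bs. (\<Sum>\<omega>\<in>?\<Omega>. local_weight ?P I ((\<lambda>a. 1 * \<omega> + int q * a) ` {a\<in>?T. 1 * \<omega> + int q * a \<in> V H \<beta>1}) \<beta>2 - 1)\<^sup>2) \<le>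
      (\<Prod>p\<in>?P. real (card (?Bs p))) * ((real (card ?\<Omega>))\<^sup>2 * (2 * variance_bound ?P (real (J H) * b) (H powr M) (H ^ 8) L \<eta> \<Lambda> t 
        + 2 * (6 * t + 10 * (real (J H) * b)\<^sup>2 / H powr M)\<^sup>2))"
    proof (rule weight_second_moment[where base = "\<lambda>\<omega>. \<omega>" and qf = "\<lambda>_. int q"])
      fix D r assume D: "D \<subseteq> ?P"
      have "real (card {\<omega>\<in>?\<Omega>. in_class D r \<omega>}) \<le> real (card ?\<Omega>) * (1 * (\<Prod>p\<in>D. 2 / real p) + 1 / real (card ?\<Omega>))"
        using D fin_PH finite_subset Ky J_less(4)[OF H] by (intro interval_count) blast+
      also have "\<dots> \<le> real (card ?\<Omega>) * (L * (\<Prod>p\<in>D. 2 / real p) + \<eta>)"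
      proof (intro mult_left_mono add_mono mult_right_mono)
        have "1 / real (card ?\<Omega>) \<le> 1 / real_of_int y" using cy y by (intro divide_left_mono mult_pos_pos) linarith+
        then show "1 / real (card ?\<Omega>) \<le> \<eta>" using N(1) by linarith
      qed (use L in \<open>auto intro: prod_nonneg\<close>)
      finally show "real (card {\<omega>\<in>?\<Omega>. in_class D r \<omega>}) \<le> real (card ?\<Omega>) * (L * (\<Prod>p\<in>D. 2 / real p) + \<eta>)" .
    next
      fix \<alpha> :: "int \<Rightarrow> real" assume \<alpha>: "\<And>\<omega>. \<omega> \<in> ?\<Omega> \<Longrightarrow> \<bar>\<alpha> \<omega>\<bar> \<le> 2"
      let ?P' = "{p. p \<in> ?P \<and> real p \<le> H ^ 8}"
      have "(\<Sum>p\<in>?P'. real p * (\<Sum>r\<in>{0..<int p}. (class_dev ?\<Omega> \<alpha> p r)\<^sup>2)) \<le> (real (card ?\<Omega>) + (H ^ 8) ^ 3) * (\<Sum>\<omega>\<in>?\<Omega>. (\<alpha> \<omega>)\<^sup>2)"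
      proof (rule interval_sieve)
        show "finite ?P'" using fin_PH by (rule finite_subset[rotated]) auto
      qed (use Ky H8 J_less(4)[OF H] in auto)
      \<comment> \<open>A factor 2 absorbs the remainder H^24 and a factor 4 comes from |\<alpha>|
        \<le> 2; together they are the 8 required of \<Lambda>.\<close>
      also have "\<dots> \<le> (2 * real (card ?\<Omega>)) * (\<Sum>\<omega>\<in>?\<Omega>. 2\<^sup>2)"
      proof (intro mult_mono sum_mono)
        show "real (card ?\<Omega>) + (H ^ 8) ^ 3 \<le> 2 * real (card ?\<Omega>)" using N(2)[OF H] cy by linarith
        show "(\<alpha> \<omega>)\<^sup>2 \<le> 2\<^sup>2" if "\<omega> \<in> ?\<Omega>" for \<omega> using power_mono[OF \<alpha>[OF that], of 2] by simp
      qed (auto intro: sum_nonneg)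
      also have "\<dots> = 8 * (real (card ?\<Omega>))\<^sup>2" by (simp add: power2_eq_square)
      also have "\<dots> \<le> \<Lambda> * (real (card ?\<Omega>))\<^sup>2" using \<Lambda> by (intro mult_right_mono) auto
      finally show "(\<Sum>p\<in>?P'. real p * (\<Sum>r\<in>{0..<int p}. (class_dev ?\<Omega> \<alpha> p r)\<^sup>2)) \<le> \<Lambda> * (real (card ?\<Omega>))\<^sup>2" .
    next
      show "1 * \<omega> + int q * a = \<omega> + int q * a" for \<omega> a by simp
      show "coprime 1 (int p)" for p by simp
      show "(\<Sum>p\<in>?P. real (J H + 1) * real (card (overlaps I (int (J H)) p (int q))) / real p) \<le> t" by (rule good[OF H q])
      show "coprime (int q) (int p)" if "p \<in> ?P" for p by (rule coprime_q[OF H that q])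
      show "\<bar>a - a'\<bar> \<le> int (J H)" if "a \<in> ?T" "a' \<in> ?T" for a a' using that by auto
      show "card ?T \<le> J H" by simp
      show "?T \<subseteq> {- int (J H)..int (J H)} - {0}" by auto
      show "real p - b \<le> real (card {0..<int p})" for p using b by simp
    qed (use fin_PH J_less[OF H] Hs(3,5)[OF H] H8 prime_I b L \<eta> t \<Lambda> J_ge_1[OF H] in auto)
    also have "\<dots> \<le> (\<Prod>p\<in>?P. real (card (?Bs p))) * ((real (card ?\<Omega>))\<^sup>2 * v)"
      using v[OF H] by (intro mult_left_mono prod_nonneg) auto
    finally show ?thesis unfolding img card\<Omega> by simp
  qed
  have "(\<Sum>\<beta>\<in>full. (\<Sum>n\<in>?\<Omega>. W H \<beta> q n - 1)\<^sup>2) = (\<Sum>\<beta>1\<in>PiE (Ps H) ?Bs. \<Sum>\<beta>2\<in>PiE ?P ?Bs. 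
     (\<Sum>n\<in>?\<Omega>. local_weight ?P I ((\<lambda>h. n + int q * h) ` ?T \<inter> V H \<beta>1) \<beta>2 - 1)\<^sup>2)"
    unfolding full_def Pz_split(1)[OF H] sum_PiE_Un[OF fin_Ps fin_PH Pz_split(2)[OF H]] W_override[OF H] ..
  also have "\<dots> \<le> (\<Sum>\<beta>1\<in>PiE (Ps H) ?Bs. (\<Prod>p\<in>?P. real p) * (NN\<^sup>2 * v))"
    by (intro sum_mono inner)
  also have "\<dots> = (\<Prod>p\<in>Ps H. real p) * (\<Prod>p\<in>?P. real p) * (NN\<^sup>2 * v)"
    using fin_Ps by (simp add: card_PiE)
  also have "(\<Prod>p\<in>Ps H. real p) * (\<Prod>p\<in>?P. real p) = real (card full)"
    unfolding card_full Pz_split(1)[OF H] using fin_Ps fin_PH Pz_split(2)[OF H] by (subst prod.union_disjoint) auto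
  finally show ?thesis .
qed

text \<open>The predicted value of the sum in (iii) at one scale for n \<in> S. A single factor
  1/\<sigma>2 remains because n is one of the terms of each progression and is known to
  survive.\<close>

definition \<mu> :: "real \<Rightarrow> real" where "\<mu> H = real (card (Qg H)) * real (J H) / \<sigma>2 H"

text \<open>Now n is fixed with n \<in> S, and \<omega> = q varies over the primes: for each shift h
  the terms are n + q a with a = k - h, so the slope is a and the base n. Conditioning on n \<in> S
  restricts the residues to \<open>allowed n\<close>.\<close>

lemma moment_points:
  assumes H: "H \<in> Hs"
  shows "(\<Sum>\<beta> | \<beta> \<in> full \<and> n \<in> S \<beta>. ((\<Sum>q\<in>Qg H. \<Sum>h\<in>{1..int (J H)}. W H \<beta> q (n - int q * h)) - \<mu> H)\<^sup>2) \<le> 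
    \<sigma> * real (card full) * ((\<mu> H)\<^sup>2 * v)"
proof -
  let ?\<Omega> = "int ` Qg H" let ?P = "PH H" let ?Bs = "allowed n"
  let ?h = "{1..int (J H)}"
  let ?T = "\<lambda>h. {1 - h..int (J H) - h} - {0}"
  have card\<Omega>: "real (card ?\<Omega>) = real (card (Qg H))" by (simp add: card_image)
  have H8: "H ^ 8 \<ge> 2"
  proof -
    have "2 ^ 1 \<le> (2::real) ^ 8" by simp
    also have "(2::real) ^ 8 \<le> H ^ 8" using Hs(2)[OF H] by (intro power_mono) auto
    finally show ?thesis by simp
  qed
  \<comment> \<open>The factor \<open>\<sigma>2 H\<close> undoes the contribution of the term k = h,
    which is n itself; what is left is the weight of the other terms, of mean close to 1.\<close>
  define X where "X \<beta>1 h \<beta>2 = (\<Sum>q\<in>Qg H. \<sigma>2 H * local_weight ?P I ((\<lambda>k. n - int q * h + int q * k) ` ?h \<inter> V H \<beta>1) \<beta>2 - 1)" for \<beta>1 \<beta>2 h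
  have inner: "(\<Sum>\<beta>2\<in>PiE ?P ?Bs. (X \<beta>1 h \<beta>2)\<^sup>2) \<le> (\<Prod>p\<in>?P. real (card (?Bs p))) * ((real (card (Qg H)))\<^sup>2 * v)" 
    if \<beta>1: "\<beta>1 \<in> PiE (Ps H) ?Bs" and h: "h \<in> ?h" for \<beta>1 h
  proof -
    have nV: "n \<in> V H \<beta>1" using \<beta>1 unfolding V_def allowed_def by (auto simp: PiE_def Pi_def)
    let ?A = "\<lambda>\<omega>. {a\<in>?T h. a * \<omega> + n \<in> V H \<beta>1}"
    have w: "\<sigma>2 H * local_weight ?P I ((\<lambda>k. n - int q * h + int q * k) ` ?h \<inter> V H \<beta>1) \<beta>2 = 
       local_weight ?P I ((\<lambda>a. a * int q + n) ` ?A (int q)) \<beta>2" if q: "q \<in> Qg H" and \<beta>2: "\<beta>2 \<in> PiE ?P ?Bs" for q \<beta>2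
    proof -
      have q0: "int q \<noteq> 0" using Qg(2)[OF H q] prime_gt_0_nat by auto
      let ?E = "(\<lambda>a. a * int q + n) ` ?A (int q)"
      have "(\<lambda>k. n - int q * h + int q * k) ` ?h \<inter> V H \<beta>1 = insert n ?E"
      proof (intro equalityI subsetI)
        fix x assume x: "x \<in> (\<lambda>k. n - int q * h + int q * k) ` ?h \<inter> V H \<beta>1"
        then obtain k where k: "x = n - int q * h + int q * k" "k \<in> ?h" "x \<in> V H \<beta>1" by blast
        then have xk: "x = (k - h) * int q + n" by (simp add: algebra_simps)
        show "x \<in> insert n ?E"
        proof (cases "k = h")
          case False
          then have "k - h \<in> ?A (int q)" using k xk by auto
          then show ?thesis using xk by blast
        qed (use xk in simp)
      next
        fix x assume "x \<in> insert n ?E"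
        then consider "x = n" | a where "a \<in> ?A (int q)" "x = a * int q + n" by blast
        then show "x \<in> (\<lambda>k. n - int q * h + int q * k) ` ?h \<inter> V H \<beta>1"
        proof cases
          case 1
          then show ?thesis using nV h by (auto intro!: image_eqI[of _ _ h])
        next
          case 2
          then show ?thesis by (auto intro!: image_eqI[of _ _ "a + h"] simp: algebra_simps)
        qed
      qed
      moreover have "n \<notin> ?E" using q0 by auto
      moreover have "finite ?E"
      proof (rule finite_imageI)
        show "finite (?A (int q))" by (rule finite_subset[of _ "{1 - h..int (J H) - h}"]) auto
      qed
      moreover have "(\<forall>p\<in>?P. \<forall>k\<in>insert n ?E. (k - \<beta>2 p) mod int p \<notin> I p) \<longleftrightarrow> (\<forall>p\<in>?P. \<forall>k\<in>?E. (k - \<beta>2 p) mod int p \<notin> I p)"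
        using \<beta>2 unfolding allowed_def by (auto simp: PiE_def Pi_def)
      ultimately show ?thesis unfolding local_weight_def \<sigma>2_def[symmetric] using \<sigma>2_pos[of H] by simp
    qed
    have inj: "inj_on int (Qg H)" by (simp add: inj_on_def)
    have "(\<Sum>\<beta>2\<in>PiE ?P ?Bs. (X \<beta>1 h \<beta>2)\<^sup>2) = 
       (\<Sum>\<beta>2\<in>PiE ?P ?Bs. (\<Sum>\<omega>\<in>?\<Omega>. local_weight ?P I ((\<lambda>a. a * \<omega> + n) ` ?A \<omega>) \<beta>2 - 1)\<^sup>2)"
      unfolding X_def sum.reindex[OF inj] o_def using w 
      by (intro sum.cong refl arg_cong[where f="\<lambda>x. x\<^sup>2"]) auto
    also have "\<dots> \<le> (\<Prod>p\<in>?P. real (card (?Bs p))) * ((real (card ?\<Omega>))\<^sup>2 * (2 * variance_bound ?P (real (J H) * b) (H powr M) (H ^ 8) L \<eta> \<Lambda> t 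
        + 2 * (6 * t + 10 * (real (J H) * b)\<^sup>2 / H powr M)\<^sup>2))"
    proof (rule weight_second_moment[where c = "\<lambda>a. a" and d = "\<lambda>a. n" and base = "\<lambda>_. n" and qf = "\<lambda>\<omega>. \<omega>"])
      show "real (card {\<omega>\<in>?\<Omega>. in_class D r \<omega>}) \<le> real (card ?\<Omega>) * (L * (\<Prod>p\<in>D. 2 / real p) + \<eta>)" if "D \<subseteq> ?P" for D r
        unfolding card\<Omega> by (rule count[OF H that])
      show "(\<Sum>p | p \<in> ?P \<and> real p \<le> H ^ 8. real p * (\<Sum>r\<in>{0..<int p}. (class_dev ?\<Omega> \<alpha> p r)\<^sup>2)) \<le> \<Lambda> * (real (card ?\<Omega>))\<^sup>2"
        if "\<And>\<omega>. \<omega> \<in> ?\<Omega> \<Longrightarrow> \<bar>\<alpha> \<omega>\<bar> \<le> 2" for \<alpha> unfolding card\<Omega> by (rule sieve[OF H that])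
      show "a * \<omega> + n = n + \<omega> * a" for a \<omega> by simp
      show "finite ?\<Omega>" using Qg(1)[OF H] by simp
      show "?T h \<subseteq> {- int (J H)..int (J H)} - {0}" using h by auto
      show "\<bar>a - a'\<bar> \<le> int (J H)" if "a \<in> ?T h" "a' \<in> ?T h" for a a' using that by auto
      show "card (?T h) \<le> J H"
      proof -
        have "card (?T h) \<le> card {1 - h..int (J H) - h}" by (intro card_mono) auto
        then show ?thesis by simp
      qed
      show "coprime a (int p)" if "p \<in> ?P" "a \<in> ?T h" for p a
        using that h J_less[OF H that(1)] by (intro coprime_small) auto
      show "coprime \<omega> (int p)" if "p \<in> ?P" "\<omega> \<in> ?\<Omega>" for p \<omega> using that coprime_q[OF H] by auto
      show "(\<Sum>p\<in>?P. real (J H + 1) * real (card (overlaps I (int (J H)) p \<omega>)) / real p) \<le> t" if "\<omega> \<in> ?\<Omega>" for \<omega>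
        using that good[OF H] by auto
      show "real p - b \<le> real (card (?Bs p))" if "p \<in> ?P" for p
        using card_allowed prime_I(2) J_less(4)[OF H that] by simp
      show "\<exists>i\<in>I p. [n - i = \<beta>] (mod int p)" if "p \<in> ?P" "\<beta> \<in> {0..<int p} - ?Bs p" for p \<beta>
      proof (intro bexI)
        show "(n - \<beta>) mod int p \<in> I p" using that unfolding allowed_def by auto
        have "[n - (n - \<beta>) mod int p = n - (n - \<beta>)] (mod int p)"
          by (intro cong_diff cong_refl) (simp add: unique_euclidean_semiring_class.cong_def)
        then show "[n - (n - \<beta>) mod int p = \<beta>] (mod int p)" by simp
      qed
      show "?Bs p \<subseteq> {0..<int p}" for p unfolding allowed_def by auto
    qed (use fin_PH J_less[OF H] Hs(3,5)[OF H] H8 prime_I b L \<eta> t \<Lambda> J_ge_1[OF H] in auto)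
    also have "\<dots> \<le> (\<Prod>p\<in>?P. real (card (?Bs p))) * ((real (card ?\<Omega>))\<^sup>2 * v)"
      using v[OF H] by (intro mult_left_mono prod_nonneg) auto
    finally show ?thesis unfolding card\<Omega> .
  qed
  have F: "(\<Sum>q\<in>Qg H. \<Sum>h\<in>?h. W H (override_on \<beta>2 \<beta>1 (Ps H)) q (n - int q * h)) - \<mu> H = (1 / \<sigma>2 H) * (\<Sum>h\<in>?h. X \<beta>1 h \<beta>2)" for \<beta>1 \<beta>2
  proof -
    have "(\<Sum>h\<in>?h. X \<beta>1 h \<beta>2) = \<sigma>2 H * (\<Sum>h\<in>?h. \<Sum>q\<in>Qg H. W H (override_on \<beta>2 \<beta>1 (Ps H)) q (n - int q * h)) - real (J H) * real (card (Qg H))"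
      unfolding X_def W_override[OF H] by (simp add: sum_subtractf sum_distrib_left)
    also have "(\<Sum>h\<in>?h. \<Sum>q\<in>Qg H. W H (override_on \<beta>2 \<beta>1 (Ps H)) q (n - int q * h)) = 
       (\<Sum>q\<in>Qg H. \<Sum>h\<in>?h. W H (override_on \<beta>2 \<beta>1 (Ps H)) q (n - int q * h))" by (rule sum.swap)
    finally show ?thesis unfolding \<mu>_def using \<sigma>2_pos[of H] by (simp add: field_simps)
  qed
  have "(\<Sum>\<beta> | \<beta> \<in> full \<and> n \<in> S \<beta>. ((\<Sum>q\<in>Qg H. \<Sum>h\<in>?h. W H \<beta> q (n - int q * h)) - \<mu> H)\<^sup>2) = 
     (\<Sum>\<beta>1\<in>PiE (Ps H) ?Bs. \<Sum>\<beta>2\<in>PiE ?P ?Bs. ((1 / \<sigma>2 H) * (\<Sum>h\<in>?h. X \<beta>1 h \<beta>2))\<^sup>2)"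
    unfolding PiE_allowed[symmetric] Pz_split(1)[OF H] sum_PiE_Un[OF fin_Ps fin_PH Pz_split(2)[OF H]] F ..
  \<comment> \<open>Cauchy-Schwarz over the J shifts h, at no loss relative to J^2 because all
    shifts satisfy the same bound.\<close>
  also have "\<dots> \<le> (\<Sum>\<beta>1\<in>PiE (Ps H) ?Bs. \<Sum>\<beta>2\<in>PiE ?P ?Bs. (1 / \<sigma>2 H)\<^sup>2 * (real (J H) * (\<Sum>h\<in>?h. (X \<beta>1 h \<beta>2)\<^sup>2)))"
  proof (intro sum_mono)
    fix \<beta>1 \<beta>2
    have "(\<Sum>h\<in>?h. X \<beta>1 h \<beta>2)\<^sup>2 \<le> (\<Sum>h\<in>?h. (X \<beta>1 h \<beta>2)\<^sup>2) * real (card ?h)" by (rule sum_squared_le_sum_of_squares)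
    then show "((1 / \<sigma>2 H) * (\<Sum>h\<in>?h. X \<beta>1 h \<beta>2))\<^sup>2 \<le> (1 / \<sigma>2 H)\<^sup>2 * (real (J H) * (\<Sum>h\<in>?h. (X \<beta>1 h \<beta>2)\<^sup>2))"
      unfolding power_mult_distrib by (intro mult_left_mono) (auto simp: mult.commute)
  qed
  also have "\<dots> = (\<Sum>\<beta>1\<in>PiE (Ps H) ?Bs. (1 / \<sigma>2 H)\<^sup>2 * (real (J H) * (\<Sum>h\<in>?h. \<Sum>\<beta>2\<in>PiE ?P ?Bs. (X \<beta>1 h \<beta>2)\<^sup>2)))"
    unfolding sum_distrib_left[symmetric] by (intro sum.cong refl arg_cong2[where f="(*)"] sum.swap)
  also have "\<dots> \<le> (\<Sum>\<beta>1\<in>PiE (Ps H) ?Bs. (1 / \<sigma>2 H)\<^sup>2 * (real (J H) * (\<Sum>h\<in>?h. (\<Prod>p\<in>?P. real (card (?Bs p))) * ((real (card (Qg H)))\<^sup>2 * v))))"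
    by (intro sum_mono mult_left_mono inner) auto
  also have "\<dots> = (\<Prod>p\<in>Ps H. real (card (?Bs p))) * (\<Prod>p\<in>?P. real (card (?Bs p))) * ((\<mu> H)\<^sup>2 * v)"
    using fin_Ps by (simp add: card_PiE \<mu>_def power2_eq_square)
  also have "(\<Prod>p\<in>Ps H. real (card (?Bs p))) * (\<Prod>p\<in>?P. real (card (?Bs p))) = \<sigma> * real (card full)"
    unfolding prod_allowed[of n, symmetric] Pz_split(1)[OF H] using fin_Ps fin_PH Pz_split(2)[OF H] by (subst prod.union_disjoint) auto
  finally show ?thesis .
qed


definition F :: "real \<Rightarrow> (nat \<Rightarrow> int) \<Rightarrow> nat \<Rightarrow> real" where
  "F H \<beta> q = (\<Sum>n\<in>{- int K * y<..y}. W H \<beta> q n)"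
definition Qp :: "real \<Rightarrow> (nat \<Rightarrow> int) \<Rightarrow> real \<Rightarrow> nat set" where
  "Qp \<tau> \<beta> H = {q\<in>Qg H. \<bar>F H \<beta> q - NN\<bar> \<le> \<tau> * NN}"

lemma W_nonneg: "W H \<beta> q n \<ge> 0"
  unfolding W_def local_weight_def \<sigma>2_def[symmetric] using \<sigma>2_pos[of H] by simp

lemma NN_pos: "NN > 0" unfolding NN_def using y by (intro mult_pos_pos) auto

lemma sum_W_minus_1: "(\<Sum>n\<in>{- int K * y<..y}. W H \<beta> q n - 1) = F H \<beta> q - NN"
proof -
  have "0 \<le> int K * y" using y by simp
  then have "real (card {- int K * y<..y}) = NN" unfolding NN_def using y by (simp add: algebra_simps)
  then show ?thesis unfolding F_def by (simp add: sum_subtractf)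
qed

text \<open>Since q H \<le> y, a shift by q h with h \<le> K H moves [1, y] inside (-K y, y]. This
  is why the sum in (ii) extends so far to the left.\<close>

lemma shifted_sum_le:
  assumes H: "H \<in> Hs" and q: "q \<in> Qg H"
  shows "(\<Sum>n\<in>{1..y}. \<Sum>h\<in>{1..int (J H)}. W H \<beta> q (n - int q * h)) \<le> real (J H) * F H \<beta> q"
proof -
  have "(\<Sum>n\<in>{1..y}. W H \<beta> q (n - int q * h)) \<le> F H \<beta> q" if h: "h \<in> {1..int (J H)}" for h
  proof -
    have "real (J H) \<le> real K * H" unfolding J_def using Hs(2)[OF H] K by (intro of_nat_floor) auto
    moreover have "real_of_int h \<le> real_of_int (int (J H))" using h by (intro of_int_le_iff[THEN iffD2]) simp
    ultimately have hK: "real_of_int h \<le> real K * H" by simp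
    have "real_of_int (int q * h) = real q * real_of_int h" by simp
    also have "\<dots> \<le> real q * (real K * H)" using hK by (intro mult_left_mono) auto
    also have "\<dots> = real K * (real q * H)" by simp
    also have "\<dots> \<le> real K * real_of_int y" using Qg(4)[OF H q] by (intro mult_left_mono) auto
    also have "\<dots> = real_of_int (int K * y)" by simp
    finally have qh: "int q * h \<le> int K * y" by (simp only: of_int_le_iff)
    have qh0: "0 \<le> int q * h" using h by simp
    have "(\<Sum>n\<in>{1..y}. W H \<beta> q (n - int q * h)) = (\<Sum>n\<in>(\<lambda>n. n - int q * h) ` {1..y}. W H \<beta> q n)"
      by (subst sum.reindex) (auto simp: inj_on_def)
    also have "\<dots> \<le> F H \<beta> q" unfolding F_def
      using qh qh0 W_nonneg by (intro sum_mono2) (auto simp: minus_mult_left[symmetric])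
    finally show ?thesis .
  qed
  then have "(\<Sum>h\<in>{1..int (J H)}. \<Sum>n\<in>{1..y}. W H \<beta> q (n - int q * h)) \<le> (\<Sum>h\<in>{1..int (J H)}. F H \<beta> q)"
    by (rule sum_mono)
  then show ?thesis by (subst sum.swap) simp
qed

text \<open>Discarding bad primes removes their whole mass from (iii), so they are weighted by
  \<open>F\<close>. For a bad prime the deviation exceeds \<tau> times \<open>NN\<close>, which lets
  both the deviation and \<open>NN\<close> be bounded by its square over NN \<tau>^2.\<close>

lemma bad_primes_moment:
  assumes \<tau>: "0 < \<tau>" "\<tau> \<le> 1" and H: "H \<in> Hs" and q: "q \<in> Qg H"
  shows "(\<Sum>\<beta>\<in>full. of_bool (q \<notin> Qp \<tau> \<beta> H) * F H \<beta> q) \<le> real (card full) * (2 * v * NN / \<tau>\<^sup>2)"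
proof -
  have "of_bool (q \<notin> Qp \<tau> \<beta> H) * F H \<beta> q \<le> 2 / (NN * \<tau>\<^sup>2) * (\<Sum>n\<in>{- int K * y<..y}. W H \<beta> q n - 1)\<^sup>2" for \<beta>
  proof (cases "q \<in> Qp \<tau> \<beta> H")
    case True
    then show ?thesis using NN_pos \<tau> by simp
  next
    case False
    let ?D = "\<bar>F H \<beta> q - NN\<bar>"
    have D: "\<tau> * NN < ?D" using False q unfolding Qp_def by simp
    then have D0: "?D > 0" using NN_pos \<tau> by (smt (verit) mult_pos_pos)
    have "?D * (NN * \<tau>\<^sup>2) \<le> ?D * (NN * \<tau>)" using \<tau> NN_pos D0 by (intro mult_left_mono) (auto simp: power2_eq_square)
    also have "\<dots> \<le> ?D * ?D" using D D0 by (intro mult_left_mono) (auto simp: mult.commute)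
    finally have 1: "?D * (NN * \<tau>\<^sup>2) \<le> ?D\<^sup>2" by (simp only: power2_eq_square)
    have "(\<tau> * NN)\<^sup>2 \<le> ?D\<^sup>2" using D NN_pos \<tau> by (intro power_mono) auto
    then have 2: "NN * (NN * \<tau>\<^sup>2) \<le> ?D\<^sup>2" by (simp add: power2_eq_square mult_ac)
    have "F H \<beta> q * (NN * \<tau>\<^sup>2) \<le> (?D + NN) * (NN * \<tau>\<^sup>2)" using NN_pos \<tau> by (intro mult_right_mono) auto
    also have "\<dots> \<le> 2 * ?D\<^sup>2" using 1 2 by (simp add: distrib_right)
    finally have "F H \<beta> q \<le> 2 * ?D\<^sup>2 / (NN * \<tau>\<^sup>2)" using NN_pos \<tau> by (simp add: pos_le_divide_eq)
    then show ?thesis using False unfolding sum_W_minus_1 by simp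
  qed
  then have "(\<Sum>\<beta>\<in>full. of_bool (q \<notin> Qp \<tau> \<beta> H) * F H \<beta> q) \<le> (\<Sum>\<beta>\<in>full. 2 / (NN * \<tau>\<^sup>2) * (\<Sum>n\<in>{- int K * y<..y}. W H \<beta> q n - 1)\<^sup>2)"
    by (rule sum_mono)
  also have "\<dots> = 2 / (NN * \<tau>\<^sup>2) * (\<Sum>\<beta>\<in>full. (\<Sum>n\<in>{- int K * y<..y}. W H \<beta> q n - 1)\<^sup>2)"
    by (rule sum_distrib_left[symmetric])
  also have "\<dots> \<le> 2 / (NN * \<tau>\<^sup>2) * (real (card full) * (NN\<^sup>2 * v))"
    using NN_pos \<tau> by (intro mult_left_mono moment_interval[OF H q]) auto
  also have "\<dots> = real (card full) * (2 * v * NN / \<tau>\<^sup>2)" using NN_pos by (simp add: power2_eq_square)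
  finally show ?thesis .
qed

text \<open>Three nonnegative statistics are controlled at once: the size of S, the mass
  \<open>R2\<close> of bad primes, and the squared deviations \<open>R3\<close> at points of S. An
  exceptional n has either a large contribution of bad primes or a large deviation of the full sum,
  each above \<tau> times \<open>NN\<close>; hence the tolerance 2 \<tau>. Two Cauchy-Schwarz losses
  produce the square of \<open>card Hs\<close>.\<close>

theorem selection:
  assumes \<tau>: "0 < \<tau>" "\<tau> \<le> 1" and v0: "v > 0" and \<mu>: "\<And>H. H \<in> Hs \<Longrightarrow> \<mu> H \<le> NN"
    and s0: "(\<Sum>H\<in>Hs. real (card (Qg H)) * real (J H)) > 0"
  obtains \<beta> where "\<beta> \<in> full" "real (card (S \<beta> \<inter> {1..y})) \<le> 2 * \<sigma> * real_of_int y"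
    "real (card {n\<in>S \<beta> \<inter> {1..y}. \<not> \<bar>(\<Sum>H\<in>Hs. \<Sum>q\<in>Qp \<tau> \<beta> H. \<Sum>h\<in>{1..int (J H)}. W H \<beta> q (n - int q * h)) - (\<Sum>H\<in>Hs. \<mu> H)\<bar> \<le> 2 * \<tau> * NN})
      \<le> 16 * v / \<tau> ^ 3 * (\<Sum>H\<in>Hs. real (card (Qg H)) * real (J H)) + 8 * (real (card Hs))\<^sup>2 * \<sigma> * real_of_int y * v / \<tau>\<^sup>2"
proof -
  let ?s = "\<Sum>H\<in>Hs. real (card (Qg H)) * real (J H)"
  define D where "D H \<beta> n = (\<Sum>q\<in>Qg H. \<Sum>h\<in>{1..int (J H)}. W H \<beta> q (n - int q * h)) - \<mu> H" for H \<beta> n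
  define R where "R H \<beta> n = (\<Sum>q\<in>Qg H - Qp \<tau> \<beta> H. \<Sum>h\<in>{1..int (J H)}. W H \<beta> q (n - int q * h))" for H \<beta> n
  define R1 where "R1 \<beta> = real (card (S \<beta> \<inter> {1..y}))" for \<beta>
  define R2 where "R2 \<beta> = (\<Sum>H\<in>Hs. \<Sum>q\<in>Qg H. real (J H) * (of_bool (q \<notin> Qp \<tau> \<beta> H) * F H \<beta> q))" for \<beta>
  define R3 where "R3 \<beta> = (\<Sum>n\<in>{1..y}. of_bool (n \<in> S \<beta>) * (\<Sum>H\<in>Hs. (D H \<beta> n)\<^sup>2))" for \<beta>
  define e1 where "e1 = \<sigma> * real_of_int y"
  define e2 where "e2 = ?s * (2 * v * NN / \<tau>\<^sup>2)"
  define e3 where "e3 = real (card Hs) * \<sigma> * real_of_int y * NN\<^sup>2 * v"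
  let ?C = "real (card full)"
  have Hs0: "card Hs > 0" using s0 Hs(1) by (auto simp: card_gt_0_iff)
  have F0: "F H \<beta> q \<ge> 0" for H \<beta> q unfolding F_def by (intro sum_nonneg W_nonneg)
  have e1: "e1 > 0" unfolding e1_def using \<sigma>_pos y by simp
  have e2: "e2 > 0" unfolding e2_def using s0 v0 NN_pos \<tau> by simp
  have e3: "e3 > 0" unfolding e3_def using Hs0 \<sigma>_pos y NN_pos v0 by simp
  have inS: "(\<Sum>\<beta>\<in>full. of_bool (n \<in> S \<beta>) * f \<beta>) = (\<Sum>\<beta> | \<beta> \<in> full \<and> n \<in> S \<beta>. f \<beta>)" for n and f :: "(nat \<Rightarrow> int) \<Rightarrow> real"
    using fin_full by (intro sum.mono_neutral_cong_right) auto
  have m1: "(\<Sum>\<beta>\<in>full. R1 \<beta>) = ?C * e1"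
  proof -
    have "R1 \<beta> = (\<Sum>n\<in>{1..y}. of_bool (n \<in> S \<beta>) * 1)" for \<beta>
      unfolding R1_def by (simp add: of_bool_def sum.If_cases Int_commute)
    then have "(\<Sum>\<beta>\<in>full. R1 \<beta>) = (\<Sum>n\<in>{1..y}. \<Sum>\<beta>\<in>full. of_bool (n \<in> S \<beta>) * 1)" by (simp only:) (rule sum.swap)
    also have "\<dots> = (\<Sum>n\<in>{1..y}. \<sigma> * ?C)"
    proof (rule sum.cong[OF refl])
      fix n
      have "(\<Sum>\<beta>\<in>full. of_bool (n \<in> S \<beta>) * 1) = real (card {\<beta>\<in>full. n \<in> S \<beta>})" unfolding inS by simp
      also have "\<dots> = \<sigma> * ?C" unfolding PiE_allowed[symmetric] prod_allowed[of n, symmetric] using fin_Pz by (simp add: card_PiE)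
      finally show "(\<Sum>\<beta>\<in>full. of_bool (n \<in> S \<beta>) * 1) = \<sigma> * ?C" .
    qed
    finally show ?thesis using y by (simp add: e1_def)
  qed
  have m2: "(\<Sum>\<beta>\<in>full. R2 \<beta>) \<le> ?C * e2"
  proof -
    have "(\<Sum>\<beta>\<in>full. R2 \<beta>) = (\<Sum>H\<in>Hs. \<Sum>q\<in>Qg H. real (J H) * (\<Sum>\<beta>\<in>full. of_bool (q \<notin> Qp \<tau> \<beta> H) * F H \<beta> q))"
      unfolding R2_def by (subst sum.swap, intro sum.cong refl, subst sum.swap) (simp only: sum_distrib_left)
    also have "\<dots> \<le> (\<Sum>H\<in>Hs. \<Sum>q\<in>Qg H. real (J H) * (?C * (2 * v * NN / \<tau>\<^sup>2)))"
      by (intro sum_mono mult_left_mono bad_primes_moment \<tau>) auto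
    also have "\<dots> = ?C * e2" unfolding e2_def by (simp add: sum_distrib_left sum_distrib_right mult_ac sum_divide_distrib)
    finally show ?thesis .
  qed
  have m3: "(\<Sum>\<beta>\<in>full. R3 \<beta>) \<le> ?C * e3"
  proof -
    have "(\<Sum>\<beta>\<in>full. R3 \<beta>) = (\<Sum>n\<in>{1..y}. \<Sum>\<beta>\<in>full. of_bool (n \<in> S \<beta>) * (\<Sum>H\<in>Hs. (D H \<beta> n)\<^sup>2))"
      unfolding R3_def by (rule sum.swap)
    also have "\<dots> = (\<Sum>n\<in>{1..y}. \<Sum>H\<in>Hs. \<Sum>\<beta> | \<beta> \<in> full \<and> n \<in> S \<beta>. (D H \<beta> n)\<^sup>2)"
      unfolding inS by (intro sum.cong refl sum.swap)
    also have "\<dots> \<le> (\<Sum>n\<in>{1..y}. \<Sum>H\<in>Hs. \<sigma> * ?C * (NN\<^sup>2 * v))"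
    proof (intro sum_mono)
      fix n H assume H: "H \<in> Hs"
      have "(\<Sum>\<beta> | \<beta> \<in> full \<and> n \<in> S \<beta>. (D H \<beta> n)\<^sup>2) \<le> \<sigma> * ?C * ((\<mu> H)\<^sup>2 * v)"
        unfolding D_def by (rule moment_points[OF H])
      also have "\<dots> \<le> \<sigma> * ?C * (NN\<^sup>2 * v)"
      proof (intro mult_left_mono mult_right_mono power_mono)
        show "0 \<le> \<mu> H" unfolding \<mu>_def using \<sigma>2_pos[of H] by simp
      qed (use \<mu>[OF H] v0 \<sigma>_pos in auto)
      finally show "(\<Sum>\<beta> | \<beta> \<in> full \<and> n \<in> S \<beta>. (D H \<beta> n)\<^sup>2) \<le> \<sigma> * ?C * (NN\<^sup>2 * v)" .
    qed
    also have "\<dots> = ?C * e3" unfolding e3_def using y by simp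
    finally show ?thesis .
  qed
  \<comment> \<open>The three means are at most 1/2, 1/8 and 1/8, with total 3/4 < 1. Only the first
    constant is prescribed, by the factor 2 in (i).\<close>
  have "\<exists>\<beta>\<in>full. R1 \<beta> / (2 * e1) + R2 \<beta> / (8 * e2) + R3 \<beta> / (8 * e3) < 1"
  proof (rule ccontr)
    assume "\<not> ?thesis"
    then have "(\<Sum>\<beta>\<in>full. 1) \<le> (\<Sum>\<beta>\<in>full. R1 \<beta> / (2 * e1) + R2 \<beta> / (8 * e2) + R3 \<beta> / (8 * e3))"
      by (intro sum_mono) (meson not_less)
    also have "\<dots> = (\<Sum>\<beta>\<in>full. R1 \<beta>) / (2 * e1) + (\<Sum>\<beta>\<in>full. R2 \<beta>) / (8 * e2) + (\<Sum>\<beta>\<in>full. R3 \<beta>) / (8 * e3)"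
      by (simp add: sum.distrib sum_divide_distrib)
    also have "\<dots> \<le> ?C * e1 / (2 * e1) + ?C * e2 / (8 * e2) + ?C * e3 / (8 * e3)"
      using m1 m2 m3 e1 e2 e3 by (intro add_mono divide_right_mono) auto
    also have "\<dots> = ?C * (3 / 4)" using e1 e2 e3 by simp
    finally show False using card_full_pos by simp
  qed
  then obtain \<beta> where \<beta>: "\<beta> \<in> full" "R1 \<beta> / (2 * e1) + R2 \<beta> / (8 * e2) + R3 \<beta> / (8 * e3) < 1" by blast
  have nn: "R1 \<beta> / (2 * e1) \<ge> 0" "R2 \<beta> / (8 * e2) \<ge> 0" "R3 \<beta> / (8 * e3) \<ge> 0"
    using e1 e2 e3 F0 unfolding R1_def R2_def R3_def by (auto intro!: divide_nonneg_pos sum_nonneg)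
  have "R1 \<beta> / (2 * e1) \<le> 1" "R2 \<beta> / (8 * e2) \<le> 1" "R3 \<beta> / (8 * e3) \<le> 1" using \<beta>(2) nn by linarith+
  then have R: "R1 \<beta> \<le> 2 * e1" "R2 \<beta> \<le> 8 * e2" "R3 \<beta> \<le> 8 * e3" using e1 e2 e3 by (auto simp: pos_divide_le_eq)
  have R0: "R H \<beta> n \<ge> 0" for H n unfolding R_def by (intro sum_nonneg W_nonneg)
  have diff: "(\<Sum>H\<in>Hs. \<Sum>q\<in>Qp \<tau> \<beta> H. \<Sum>h\<in>{1..int (J H)}. W H \<beta> q (n - int q * h)) - (\<Sum>H\<in>Hs. \<mu> H) = (\<Sum>H\<in>Hs. D H \<beta> n) - (\<Sum>H\<in>Hs. R H \<beta> n)" for n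
  proof -
    have "(\<Sum>q\<in>Qg H. \<Sum>h\<in>{1..int (J H)}. W H \<beta> q (n - int q * h)) = 
       R H \<beta> n + (\<Sum>q\<in>Qp \<tau> \<beta> H. \<Sum>h\<in>{1..int (J H)}. W H \<beta> q (n - int q * h))" if "H \<in> Hs" for H
      unfolding R_def using Qg(1)[OF that] by (intro sum.subset_diff) (auto simp: Qp_def)
    then have "(\<Sum>q\<in>Qp \<tau> \<beta> H. \<Sum>h\<in>{1..int (J H)}. W H \<beta> q (n - int q * h)) = D H \<beta> n + \<mu> H - R H \<beta> n" if "H \<in> Hs" for H
      unfolding D_def using that by simp
    then have "(\<Sum>H\<in>Hs. \<Sum>q\<in>Qp \<tau> \<beta> H. \<Sum>h\<in>{1..int (J H)}. W H \<beta> q (n - int q * h)) = (\<Sum>H\<in>Hs. D H \<beta> n + \<mu> H - R H \<beta> n)"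
      by (intro sum.cong) auto
    then show ?thesis by (simp add: sum.distrib sum_subtractf)
  qed
  let ?Ex = "{n\<in>S \<beta> \<inter> {1..y}. \<not> \<bar>(\<Sum>H\<in>Hs. \<Sum>q\<in>Qp \<tau> \<beta> H. \<Sum>h\<in>{1..int (J H)}. W H \<beta> q (n - int q * h)) - (\<Sum>H\<in>Hs. \<mu> H)\<bar> \<le> 2 * \<tau> * NN}"
  let ?E2 = "{n\<in>{1..y}. (\<Sum>H\<in>Hs. R H \<beta> n) > \<tau> * NN}"
  let ?E3 = "{n\<in>{1..y}. n \<in> S \<beta> \<and> \<bar>\<Sum>H\<in>Hs. D H \<beta> n\<bar> > \<tau> * NN}"
  have tN: "\<tau> * NN > 0" using \<tau> NN_pos by simp
  have "?Ex \<subseteq> ?E2 \<union> ?E3"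
  proof
    fix n assume n: "n \<in> ?Ex"
    then have "\<not> \<bar>(\<Sum>H\<in>Hs. D H \<beta> n) - (\<Sum>H\<in>Hs. R H \<beta> n)\<bar> \<le> 2 * \<tau> * NN" unfolding diff by simp
    moreover have "(\<Sum>H\<in>Hs. R H \<beta> n) \<ge> 0" by (intro sum_nonneg R0)
    moreover have "2 * \<tau> * NN = \<tau> * NN + \<tau> * NN" by simp
    ultimately have "(\<Sum>H\<in>Hs. R H \<beta> n) > \<tau> * NN \<or> \<bar>\<Sum>H\<in>Hs. D H \<beta> n\<bar> > \<tau> * NN" by linarith
    then show "n \<in> ?E2 \<union> ?E3" using n by auto
  qed
  moreover have "finite ?E2" "finite ?E3" by (rule finite_subset[of _ "{1..y}"], auto)+
  ultimately have "card ?Ex \<le> card (?E2 \<union> ?E3)" by (intro card_mono finite_UnI)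
  also have "\<dots> \<le> card ?E2 + card ?E3" by (rule card_Un_le)
  finally have cE: "real (card ?Ex) \<le> real (card ?E2) + real (card ?E3)" by linarith
  have "real (card ?E2) * (\<tau> * NN) = (\<Sum>n\<in>?E2. \<tau> * NN)" by simp
  also have "\<dots> \<le> (\<Sum>n\<in>?E2. \<Sum>H\<in>Hs. R H \<beta> n)" by (intro sum_mono) auto
  also have "\<dots> \<le> (\<Sum>n\<in>{1..y}. \<Sum>H\<in>Hs. R H \<beta> n)" by (intro sum_mono2 sum_nonneg R0) auto
  also have "\<dots> = (\<Sum>H\<in>Hs. \<Sum>q\<in>Qg H - Qp \<tau> \<beta> H. \<Sum>n\<in>{1..y}. \<Sum>h\<in>{1..int (J H)}. W H \<beta> q (n - int q * h))"
    unfolding R_def by (subst sum.swap, intro sum.cong refl sum.swap)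
  also have "\<dots> \<le> (\<Sum>H\<in>Hs. \<Sum>q\<in>Qg H - Qp \<tau> \<beta> H. real (J H) * F H \<beta> q)"
    by (intro sum_mono shifted_sum_le) auto
  also have "\<dots> = R2 \<beta>"
    unfolding R2_def
  proof (rule sum.cong[OF refl])
    fix H assume H: "H \<in> Hs"
    show "(\<Sum>q\<in>Qg H - Qp \<tau> \<beta> H. real (J H) * F H \<beta> q) = (\<Sum>q\<in>Qg H. real (J H) * (of_bool (q \<notin> Qp \<tau> \<beta> H) * F H \<beta> q))"
      using Qg(1)[OF H] by (intro sum.mono_neutral_cong_left) auto
  qed
  finally have "real (card ?E2) \<le> 8 * e2 / (\<tau> * NN)" using R(2) tN by (simp add: pos_le_divide_eq)
  also have "\<dots> = 16 * v / \<tau> ^ 3 * ?s" unfolding e2_def using NN_pos \<tau> by (simp add: power3_eq_cube power2_eq_square mult_ac)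
  finally have c2: "real (card ?E2) \<le> 16 * v / \<tau> ^ 3 * ?s" .
  have "real (card ?E3) * (\<tau> * NN)\<^sup>2 = (\<Sum>n\<in>?E3. (\<tau> * NN)\<^sup>2)" by simp
  also have "\<dots> \<le> (\<Sum>n\<in>?E3. of_bool (n \<in> S \<beta>) * ((\<Sum>H\<in>Hs. (D H \<beta> n)\<^sup>2) * real (card Hs)))"
  proof (intro sum_mono)
    fix n assume n: "n \<in> ?E3"
    have "(\<tau> * NN)\<^sup>2 \<le> \<bar>\<Sum>H\<in>Hs. D H \<beta> n\<bar>\<^sup>2" using n tN by (intro power_mono) auto
    also have "\<dots> \<le> (\<Sum>H\<in>Hs. (D H \<beta> n)\<^sup>2) * real (card Hs)" unfolding power2_abs by (rule sum_squared_le_sum_of_squares)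
    finally show "(\<tau> * NN)\<^sup>2 \<le> of_bool (n \<in> S \<beta>) * ((\<Sum>H\<in>Hs. (D H \<beta> n)\<^sup>2) * real (card Hs))" using n by simp
  qed
  also have "\<dots> \<le> (\<Sum>n\<in>{1..y}. of_bool (n \<in> S \<beta>) * ((\<Sum>H\<in>Hs. (D H \<beta> n)\<^sup>2) * real (card Hs)))"
    by (intro sum_mono2) (auto intro!: mult_nonneg_nonneg sum_nonneg)
  also have "\<dots> = R3 \<beta> * real (card Hs)" unfolding R3_def by (subst sum_distrib_right) (simp only: mult.assoc)
  also have "\<dots> \<le> 8 * e3 * real (card Hs)" using R(3) by (intro mult_right_mono) auto
  finally have "real (card ?E3) \<le> 8 * e3 * real (card Hs) / (\<tau> * NN)\<^sup>2"
    using zero_less_power[OF tN, of 2] by (simp only: pos_le_divide_eq)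
  also have "\<dots> = 8 * (real (card Hs))\<^sup>2 * \<sigma> * real_of_int y * v / \<tau>\<^sup>2" 
    unfolding e3_def using NN_pos \<tau> by (simp add: power2_eq_square)
  finally have c3: "real (card ?E3) \<le> 8 * (real (card Hs))\<^sup>2 * \<sigma> * real_of_int y * v / \<tau>\<^sup>2" .
  show thesis
  proof (rule that[OF \<beta>(1)])
    show "real (card (S \<beta> \<inter> {1..y})) \<le> 2 * \<sigma> * real_of_int y" using R(1) unfolding R1_def e1_def by simp
    show "real (card ?Ex) \<le> 16 * v / \<tau> ^ 3 * ?s + 8 * (real (card Hs))\<^sup>2 * \<sigma> * real_of_int y * v / \<tau>\<^sup>2"
      using cE c2 c3 by linarith
  qed
qed

end

section \<open>Numerical estimates\<close>

text \<open>Drops elements as long as the target is still reached; as no element exceeds 1, the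
  overshoot is at most 1. Serves to trim \<open>C_2\<close>.\<close>

lemma subset_sum_between:
  fixes f :: "'a \<Rightarrow> real"
  assumes "finite X" "\<And>x. x \<in> X \<Longrightarrow> 0 \<le> f x" "\<And>x. x \<in> X \<Longrightarrow> f x \<le> 1" "T \<le> (\<Sum>x\<in>X. f x)" "T \<ge> 0"
  shows "\<exists>Y\<subseteq>X. T \<le> (\<Sum>x\<in>Y. f x) \<and> (\<Sum>x\<in>Y. f x) \<le> T + 1"
  using assms
proof (induction X rule: finite_induct)
  case (insert a X)
  show ?case
  proof (cases "T \<le> (\<Sum>x\<in>X. f x)")
    case True
    then obtain Y where "Y \<subseteq> X" "T \<le> (\<Sum>x\<in>Y. f x)" "(\<Sum>x\<in>Y. f x) \<le> T + 1" using insert by auto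
    then show ?thesis by blast
  next
    case False
    moreover have "(\<Sum>x\<in>insert a X. f x) = f a + (\<Sum>x\<in>X. f x)" using insert.hyps by simp
    ultimately show ?thesis using insert.prems(2)[of a] insert.prems(3) by (intro exI[of _ "insert a X"]) auto
  qed
qed auto

lemma exp_le_one_minus:
  fixes u :: real
  assumes "0 \<le> u" "u \<le> 1/2"
  shows "exp (- 2 * u) \<le> 1 - u"
proof -
  have "u * (2 * u) \<le> u * 1" using assms by (intro mult_left_mono) auto
  then have "1 \<le> (1 - u) * (1 + 2 * u)" by (simp add: algebra_simps)
  also have "\<dots> \<le> (1 - u) * exp (2 * u)" using assms exp_ge_add_one_self[of "2 * u"] by (intro mult_left_mono) auto
  finally show ?thesis by (simp add: exp_minus field_simps)
qed

text \<open>Chosen so that 4^k beats the Rankin factor exp(10 + 4 ln l) by a further factor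
  l.\<close>

definition brun_level :: "real \<Rightarrow> nat" where "brun_level l = nat \<lceil>10 + 5 * ln l\<rceil>"
text \<open>Its power with exponent 4k is at most exp(l/2), the square root of x = exp l; this
  bounds the remainder of the sieve.\<close>

definition brun_limit :: "real \<Rightarrow> real" where "brun_limit l = exp (l / (8 * (real (brun_level l) + 1)))"
text \<open>The lower limit leaves the primes up to H^8 \<le> l^4 free for the large sieve.\<close>

definition brun_primes :: "real \<Rightarrow> nat set" where "brun_primes l = {p. prime p \<and> l ^ 4 < real p \<and> real p \<le> brun_limit l}"

lemma finite_brun_primes: "finite (brun_primes l)"
  unfolding brun_primes_def by (rule finite_subset[OF _ finite_primes_le[of "brun_limit l"]]) auto

text \<open>The product over all primes up to the limit is at most 8 (k+1) / l. Removing the primes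
  up to l^4 costs about (ln l)^4, and k is about 5 ln l, so the density is of order (ln l)^5 / l;
  the sixth power absorbs all constants.\<close>

lemma brun_numerics:
  assumes c: "c > 0"
  shows "\<forall>\<^sub>F l in at_top. (\<Prod>p\<in>brun_primes l. 1 - 1 / real p) 
       + exp (2 * (\<Sum>p\<in>brun_primes l. 1 / real p)) / 2 ^ (2 * brun_level l) \<le> c * (ln l) ^ 6 / l
     \<and> real (brun_size (brun_primes l) (brun_level l)) \<le> exp (l / 2) \<and> brun_limit l \<le> exp (l / 2)"
proof -
  have 1: "\<forall>\<^sub>F l::real in at_top. 8 * (12 + 5 * ln l) * (exp 10 * (4 * ln l) ^ 4) + 1 \<le> c * (ln l) ^ 6"
    using c by real_asymp
  have 2: "\<forall>\<^sub>F l::real in at_top. 4 * ln l \<le> l / (8 * (12 + 5 * ln l))" by real_asymp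
  have 3: "\<forall>\<^sub>F l::real in at_top. l \<ge> 100" by (rule eventually_ge_at_top)
  show ?thesis using 1 2 3
  proof eventually_elim
    case (elim l)
    let ?k = "brun_level l" let ?w = "brun_limit l" let ?Z = "brun_primes l"
    have lnl: "ln l > 0" "ln l \<ge> 1"
    proof -
      have "exp (1::real) \<le> 3" by (rule exp_le)
      then have "exp 1 \<le> l" using elim(3) by linarith
      then have "ln (exp 1) \<le> ln l" using elim(3) by (subst ln_le_cancel_iff) auto
      then show "ln l \<ge> 1" "ln l > 0" by auto
    qed
    have k: "10 + 5 * ln l \<le> real ?k" "real ?k + 1 \<le> 12 + 5 * ln l" unfolding brun_level_def using lnl by linarith+
    have lnw: "ln ?w = l / (8 * (real ?k + 1))" unfolding brun_limit_def by simp
    have lnw2: "4 * ln l \<le> ln ?w"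
    proof -
      have "l / (8 * (12 + 5 * ln l)) \<le> ln ?w" unfolding lnw using k elim(3) lnl by (intro divide_left_mono) auto
      then show ?thesis using elim(2) by linarith
    qed
    have wpos: "?w > 0" unfolding brun_limit_def by simp
    have w2: "?w \<ge> l ^ 4"
    proof -
      have "ln (l ^ 4) \<le> ln ?w" using lnw2 elim(3) by (simp add: ln_realpow)
      then show ?thesis using wpos elim(3) by (subst (asm) ln_le_cancel_iff) auto
    qed
    have l4: "l ^ 4 \<ge> 2"
    proof -
      have "2 ^ 1 \<le> (2::real) ^ 4" by simp
      also have "\<dots> \<le> l ^ 4" using elim(3) by (intro power_mono) auto
      finally show ?thesis by simp
    qed
    have wge2: "?w \<ge> 2" using w2 l4 by linarith
    have lnwl: "ln ?w \<le> l / 2"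
    proof -
      have "l / (8 * (real ?k + 1)) \<le> l / 2" using elim(3) by (intro divide_left_mono) auto
      then show ?thesis using lnw by simp
    qed
    have lim: "?w \<le> exp (l / 2)" using lnwl wpos by (simp add: ln_le_cancel_iff[symmetric] del: ln_le_cancel_iff)
    have S: "(\<Sum>p\<in>?Z. 1 / real p) \<le> 5 + 2 * ln l"
    proof -
      have "(\<Sum>p\<in>?Z. 1 / real p) \<le> (\<Sum>p | prime p \<and> real p \<le> ?w. 1 / real p)"
        unfolding brun_primes_def by (intro sum_mono2) auto
      also have "\<dots> \<le> 5 + 2 * ln (ln ?w)" by (rule sum_recip_primes_le[OF wge2])
      also have "ln (ln ?w) \<le> ln l" using lnw2 lnl lnwl elim(3) by (subst ln_le_cancel_iff) auto
      finally show ?thesis by simp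
    qed
    have tail: "exp (2 * (\<Sum>p\<in>?Z. 1 / real p)) / 2 ^ (2 * ?k) \<le> 1 / l"
    proof -
      have "exp (10 + 5 * ln l) \<le> exp (real ?k)" using k by simp
      also have "\<dots> = exp 1 ^ ?k" by (simp add: exp_of_nat_mult[symmetric])
      also have "\<dots> \<le> 4 ^ ?k" using exp_le by (intro power_mono) auto
      also have "\<dots> = 2 ^ (2 * ?k)" by (simp add: power_mult)
      finally have a: "exp (10 + 5 * ln l) \<le> 2 ^ (2 * ?k)" .
      have "exp (2 * (\<Sum>p\<in>?Z. 1 / real p)) / 2 ^ (2 * ?k) \<le> exp (10 + 4 * ln l) / exp (10 + 5 * ln l)"
        using S a by (intro frac_le) auto
      also have "\<dots> = exp (- ln l)" by (simp add: exp_diff[symmetric])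
      also have "\<dots> = 1 / l" using elim(3) by (simp add: exp_minus inverse_eq_divide)
      finally show ?thesis .
    qed
    let ?A = "{p. prime p \<and> real p \<le> l ^ 4}"
    have main: "(\<Prod>p\<in>?Z. 1 - 1 / real p) \<le> 8 * (12 + 5 * ln l) * (exp 10 * (4 * ln l) ^ 4) / l"
    proof -
      have eq: "{p. prime p \<and> real p \<le> ?w} = ?A \<union> ?Z" unfolding brun_primes_def using w2 by auto
      have prod: "(\<Prod>p | prime p \<and> real p \<le> ?w. 1 - 1 / real p) = (\<Prod>p\<in>?A. 1 - 1 / real p) * (\<Prod>p\<in>?Z. 1 - 1 / real p)"
        unfolding eq using finite_brun_primes by (intro prod.union_disjoint) (auto simp: brun_primes_def)
      have half: "1 / real p \<le> 1/2" if "prime p" for p using prime_ge_2_nat[OF that] by (simp add: field_simps)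
      have Z0: "(\<Prod>p\<in>?Z. 1 - 1 / real p) \<ge> 0"
      proof (rule prod_nonneg)
        fix p assume "p \<in> ?Z"
        then have "1 / real p \<le> 1/2" by (intro half) (simp add: brun_primes_def)
        then show "0 \<le> 1 - 1 / real p" by linarith
      qed
      have "exp (- (10 + 4 * ln (4 * ln l))) \<le> exp (- 2 * (\<Sum>p\<in>?A. 1 / real p))"
        using sum_recip_primes_le[OF l4] elim(3) by (simp add: ln_realpow)
      also have "\<dots> = (\<Prod>p\<in>?A. exp (- 2 * (1 / real p)))" by (simp only: sum_distrib_left exp_sum[OF finite_primes_le])
      also have "\<dots> \<le> (\<Prod>p\<in>?A. 1 - 1 / real p)" using half by (intro prod_mono conjI exp_le_one_minus) auto
      finally have lowA: "exp (- (10 + 4 * ln (4 * ln l))) \<le> (\<Prod>p\<in>?A. 1 - 1 / real p)" .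
      have "exp (- (10 + 4 * ln (4 * ln l))) * (\<Prod>p\<in>?Z. 1 - 1 / real p) \<le> (\<Prod>p\<in>?A. 1 - 1 / real p) * (\<Prod>p\<in>?Z. 1 - 1 / real p)"
        using lowA Z0 by (rule mult_right_mono)
      also have "\<dots> \<le> 1 / ln ?w" unfolding prod[symmetric] using wge2 by (intro prod_primes_le) auto
      finally have fz: "exp (- (10 + 4 * ln (4 * ln l))) * (\<Prod>p\<in>?Z. 1 - 1 / real p) \<le> 1 / ln ?w" .
      have cancel: "X = exp a * (exp (- a) * X)" for a X :: real by (simp add: mult.assoc[symmetric] flip: exp_add)
      have "(\<Prod>p\<in>?Z. 1 - 1 / real p) = 
          exp (10 + 4 * ln (4 * ln l)) * (exp (- (10 + 4 * ln (4 * ln l))) * (\<Prod>p\<in>?Z. 1 - 1 / real p))" by (rule cancel)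
      also have "\<dots> \<le> exp (10 + 4 * ln (4 * ln l)) * (1 / ln ?w)" using fz by (intro mult_left_mono) auto
      also have "exp (10 + 4 * ln (4 * ln l)) = exp 10 * (4 * ln l) ^ 4"
        using lnl by (simp add: exp_add exp_of_nat_mult[of 4, simplified])
      also have "1 / ln ?w = 8 * (real ?k + 1) / l" unfolding lnw by simp
      also have "exp 10 * (4 * ln l) ^ 4 * (8 * (real ?k + 1) / l) \<le> exp 10 * (4 * ln l) ^ 4 * (8 * (12 + 5 * ln l) / l)"
        using k elim(3) by (intro mult_left_mono divide_right_mono) auto
      finally show ?thesis by (simp add: mult_ac)
    qed
    have "(\<Prod>p\<in>?Z. 1 - 1 / real p) + exp (2 * (\<Sum>p\<in>?Z. 1 / real p)) / 2 ^ (2 * ?k) 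
        \<le> (8 * (12 + 5 * ln l) * (exp 10 * (4 * ln l) ^ 4) + 1) / l"
      using main tail by (simp add: add_divide_distrib)
    also have "\<dots> \<le> c * (ln l) ^ 6 / l" using elim(1,3) by (intro divide_right_mono) auto
    finally have A: "(\<Prod>p\<in>?Z. 1 - 1 / real p) + exp (2 * (\<Sum>p\<in>?Z. 1 / real p)) / 2 ^ (2 * ?k) \<le> c * (ln l) ^ 6 / l" .
    have "real (brun_size ?Z ?k) \<le> real ((card ?Z + 1) ^ (2 * ?k))" using brun_size_le[OF finite_brun_primes] by (rule of_nat_mono)
    also have "\<dots> = (real (card ?Z) + 1) ^ (2 * ?k)" by (simp add: add.commute)
    also have "\<dots> \<le> (?w * ?w) ^ (2 * ?k)"
    proof (intro power_mono)
      have "?Z \<subseteq> {1..nat \<lfloor>?w\<rfloor>}" unfolding brun_primes_def using prime_ge_1_nat by (auto simp: le_nat_floor)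
      then have "card ?Z \<le> nat \<lfloor>?w\<rfloor>" using card_mono[of "{1..nat \<lfloor>?w\<rfloor>}" ?Z] by simp
      then have "real (card ?Z) + 1 \<le> ?w + 1" using wpos by linarith
      also have "\<dots> \<le> 2 * ?w" using wge2 by linarith
      also have "\<dots> \<le> ?w * ?w" using wge2 by (intro mult_right_mono) auto
      finally show "real (card ?Z) + 1 \<le> ?w * ?w" .
    qed auto
    also have "\<dots> = exp (4 * real ?k * (l / (8 * (real ?k + 1))))"
    proof -
      have "(?w * ?w) ^ (2 * ?k) = ?w ^ (4 * ?k)" by (simp add: power_mult_distrib power_add[symmetric])
      also have "\<dots> = exp (real (4 * ?k) * (l / (8 * (real ?k + 1))))"
        unfolding brun_limit_def by (rule exp_of_nat_mult[symmetric])
      finally show ?thesis by simp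
    qed
    also have "\<dots> \<le> exp (l / 2)"
    proof -
      have "4 * real ?k * (l / (8 * (real ?k + 1))) \<le> 4 * (real ?k + 1) * (l / (8 * (real ?k + 1)))"
        using elim(3) by (intro mult_right_mono) auto
      also have "\<dots> = l / 2" by (simp add: field_simps)
      finally show ?thesis by simp
    qed
    finally show ?case using A lim by simp
  qed
qed

lemma variance_combine:
  fixes A1 A2 A3 A4 A5 X Y Z :: real
  assumes "A1 \<le> 16 * X" "A2 \<le> 1088 * X + 544 * Y" "A3 \<le> 17000 * X" "A4 \<le> 4 * Z" "A5 \<le> 256 * X" "X \<ge> 0"
  shows "2 * (A1 + A2 + A3 + A4) + 2 * A5 \<le> 100000 * X + 1088 * Y + 8 * Z"
proof -
  have "2 * (A1 + A2 + A3 + A4) + 2 * A5 \<le> 36720 * X + 1088 * Y + 8 * Z" using assms by argo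
  then show ?thesis using assms(6) by simp
qed

text \<open>Here R stands for H^(M/2), so \<open>P0\<close> is R^2, and the hypothesis H^2 \<le> R
  is where M \<ge> 4 enters. It makes j^2 / P0 at most a constant times t, and every term free of
  \<eta> becomes O(L t^2).\<close>

lemma variance_numerics:
  fixes H R \<kappa> j L \<eta> t :: real
  assumes H: "H \<ge> 1" "H\<^sup>2 \<le> R" "1 / R \<le> t" "1 / H ^ 6 \<le> t\<^sup>2" and t: "0 \<le> t" "t \<le> 1"
    and \<kappa>: "\<kappa> \<ge> 1" and j: "0 \<le> j" "j \<le> \<kappa> * H" and L: "L \<ge> 1" "\<eta> \<ge> 0"
  shows "2 * variance_bound P j (R\<^sup>2) (H ^ 8) L \<eta> (4 * (L + 1)) t + 2 * (6 * t + 10 * j\<^sup>2 / R\<^sup>2)\<^sup>2 \<le>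
    100000 * \<kappa> ^ 4 * L * t\<^sup>2 + 1088 * \<kappa> ^ 3 * H * \<eta> + 8 * \<eta> * exp (32 * (\<kappa> * H)\<^sup>2 * (\<Sum>p\<in>P. 1 / real p))"
proof -
  have H2: "H\<^sup>2 \<ge> H" "H\<^sup>2 \<ge> 1" using H(1) by (auto simp: power2_eq_square intro: mult_ge1_I)
  have R: "R \<ge> 1" "R \<ge> H" using H H2 by linarith+
  have HR4: "H ^ 4 \<le> R\<^sup>2" using power_mono[OF H(2), of 2] by (simp flip: power_mult)
  have iR2: "1 / R\<^sup>2 \<le> t\<^sup>2" using power_mono[OF H(3), of 2] R by (simp add: power_one_over)
  have j2: "j\<^sup>2 \<le> \<kappa>\<^sup>2 * H\<^sup>2" using power_mono[OF j(2,1), of 2] by (simp add: power_mult_distrib)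
  have k2: "\<kappa>\<^sup>2 \<ge> 1" "\<kappa> ^ 3 \<le> \<kappa> ^ 4" "\<kappa> \<le> \<kappa> ^ 4" "\<kappa>\<^sup>2 \<le> \<kappa> ^ 4" "1 \<le> \<kappa> ^ 4"
    using \<kappa> power_increasing[of 3 4 \<kappa>] power_increasing[of 1 4 \<kappa>] power_increasing[of 2 4 \<kappa>] power_increasing[of 0 4 \<kappa>] power_increasing[of 0 2 \<kappa>] by auto
  have jR: "j\<^sup>2 / R\<^sup>2 \<le> \<kappa>\<^sup>2 * t" "j\<^sup>2 / R\<^sup>2 \<le> \<kappa>\<^sup>2"
  proof -
    have "\<kappa>\<^sup>2 * H\<^sup>2 \<le> \<kappa>\<^sup>2 * R" using H(2) by (intro mult_left_mono) auto
    then have "j\<^sup>2 / R\<^sup>2 \<le> (\<kappa>\<^sup>2 * R) / R\<^sup>2" using j2 by (intro divide_right_mono) auto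
    also have "\<dots> = \<kappa>\<^sup>2 * (1 / R)" using R by (simp add: power2_eq_square)
    also have "\<dots> \<le> \<kappa>\<^sup>2 * t" using H(3) by (intro mult_left_mono) auto
    finally show "j\<^sup>2 / R\<^sup>2 \<le> \<kappa>\<^sup>2 * t" .
    also have "\<dots> \<le> \<kappa>\<^sup>2 * 1" using t by (intro mult_left_mono) auto
    finally show "j\<^sup>2 / R\<^sup>2 \<le> \<kappa>\<^sup>2" by simp
  qed
  have jR0: "j\<^sup>2 / R\<^sup>2 \<ge> 0" by simp
  have jjR: "j / R\<^sup>2 \<le> \<kappa> * t"
  proof -
    have "\<kappa> * H \<le> \<kappa> * R" using R \<kappa> by (intro mult_left_mono) auto
    then have "j / R\<^sup>2 \<le> (\<kappa> * R) / R\<^sup>2" using j by (intro divide_right_mono) auto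
    also have "\<dots> = \<kappa> * (1 / R)" using R by (simp add: power2_eq_square)
    also have "\<dots> \<le> \<kappa> * t" using H(3) \<kappa> by (intro mult_left_mono) auto
    finally show ?thesis .
  qed
  have a1: "2 * j\<^sup>2 * (4 * (L + 1)) / (R\<^sup>2)\<^sup>2 \<le> 16 * \<kappa> ^ 4 * L * t\<^sup>2"
  proof -
    have "2 * j\<^sup>2 * (4 * (L + 1)) / (R\<^sup>2)\<^sup>2 = 8 * (L + 1) * (j\<^sup>2 / R\<^sup>2) * (1 / R\<^sup>2)" by (simp add: power2_eq_square)
    also have "\<dots> \<le> 8 * (L + 1) * \<kappa>\<^sup>2 * t\<^sup>2" using jR iR2 L by (intro mult_mono) auto
    also have "\<dots> \<le> 8 * (2 * L) * \<kappa> ^ 4 * t\<^sup>2" using L k2 by (intro mult_mono) auto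
    finally show ?thesis by (simp add: mult_ac)
  qed
  have a2: "j * (2 * L / R\<^sup>2 + \<eta>) * (512 * j\<^sup>2 / R\<^sup>2 + 32 * t) \<le> 1088 * \<kappa> ^ 4 * L * t\<^sup>2 + 544 * \<kappa> ^ 3 * H * \<eta>"
  proof -
    have b1: "512 * j\<^sup>2 / R\<^sup>2 + 32 * t \<le> 544 * \<kappa>\<^sup>2 * t"
    proof -
      have "32 * t * 1 \<le> 32 * t * \<kappa>\<^sup>2" using t k2 by (intro mult_left_mono) auto
      moreover have "512 * j\<^sup>2 / R\<^sup>2 = 512 * (j\<^sup>2 / R\<^sup>2)" by simp
      moreover have "512 * (j\<^sup>2 / R\<^sup>2) \<le> 512 * (\<kappa>\<^sup>2 * t)" using jR by (intro mult_left_mono) auto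
      moreover have "512 * (\<kappa>\<^sup>2 * t) + 32 * t * \<kappa>\<^sup>2 = 544 * \<kappa>\<^sup>2 * t" by simp
      ultimately show ?thesis by linarith
    qed
    have b2: "j * (2 * L / R\<^sup>2 + \<eta>) \<le> 2 * L * (\<kappa> * t) + \<kappa> * H * \<eta>"
    proof -
      have "j * (2 * L / R\<^sup>2 + \<eta>) = 2 * L * (j / R\<^sup>2) + j * \<eta>" by (simp add: algebra_simps)
      also have "\<dots> \<le> 2 * L * (\<kappa> * t) + (\<kappa> * H) * \<eta>" using jjR j L by (intro add_mono mult_left_mono mult_right_mono) auto
      finally show ?thesis .
    qed
    have "j * (2 * L / R\<^sup>2 + \<eta>) * (512 * j\<^sup>2 / R\<^sup>2 + 32 * t) \<le> (2 * L * (\<kappa> * t) + \<kappa> * H * \<eta>) * (544 * \<kappa>\<^sup>2 * t)"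
      using b1 b2 j L t \<kappa> H(1) by (intro mult_mono) auto
    also have "\<dots> = 1088 * \<kappa> ^ 3 * L * t\<^sup>2 + 544 * \<kappa> ^ 3 * H * \<eta> * t" by (simp add: power2_eq_square power3_eq_cube algebra_simps)
    also have "\<dots> \<le> 1088 * \<kappa> ^ 4 * L * t\<^sup>2 + 544 * \<kappa> ^ 3 * H * \<eta> * 1" using L t k2 \<kappa> H(1) by (intro add_mono mult_mono mult_left_mono) auto
    finally show ?thesis by simp
  qed
  have a3: "4 * L * ((64 * j\<^sup>2 / R\<^sup>2)\<^sup>2 + 64 * j\<^sup>2 / H ^ 8) \<le> 17000 * \<kappa> ^ 4 * L * t\<^sup>2"
  proof -
    have "(64 * j\<^sup>2 / R\<^sup>2)\<^sup>2 = 4096 * (j\<^sup>2 / R\<^sup>2)\<^sup>2" by (simp add: power2_eq_square)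
    also have "\<dots> \<le> 4096 * (\<kappa>\<^sup>2 * t)\<^sup>2" using jR by (intro mult_left_mono power_mono) auto
    also have "\<dots> = 4096 * \<kappa> ^ 4 * t\<^sup>2" by (simp add: power_mult_distrib flip: power_mult)
    finally have c1: "(64 * j\<^sup>2 / R\<^sup>2)\<^sup>2 \<le> 4096 * \<kappa> ^ 4 * t\<^sup>2" .
    have "64 * j\<^sup>2 / H ^ 8 \<le> 64 * (\<kappa>\<^sup>2 * H\<^sup>2) / H ^ 8" using j2 H(1) by (intro divide_right_mono mult_left_mono) auto
    also have "\<dots> = 64 * \<kappa>\<^sup>2 * (1 / H ^ 6)" using H(1) by (simp add: field_simps flip: power_add)
    also have "\<dots> \<le> 64 * \<kappa> ^ 4 * t\<^sup>2" using H(4) k2 H(1) by (intro mult_mono) auto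
    finally have c2: "64 * j\<^sup>2 / H ^ 8 \<le> 64 * \<kappa> ^ 4 * t\<^sup>2" .
    have "4 * L * ((64 * j\<^sup>2 / R\<^sup>2)\<^sup>2 + 64 * j\<^sup>2 / H ^ 8) \<le> 4 * L * (4250 * (\<kappa> ^ 4 * t\<^sup>2))"
    proof (rule mult_left_mono)
      have "\<kappa> ^ 4 * t\<^sup>2 \<ge> 0" using k2 by simp
      then show "(64 * j\<^sup>2 / R\<^sup>2)\<^sup>2 + 64 * j\<^sup>2 / H ^ 8 \<le> 4250 * (\<kappa> ^ 4 * t\<^sup>2)" using c1 c2 by linarith
    qed (use L in auto)
    then show ?thesis by (simp add: mult_ac)
  qed
  have a4: "exp (32 * j\<^sup>2 * (\<Sum>p\<in>P. 1 / real p)) \<le> exp (32 * (\<kappa> * H)\<^sup>2 * (\<Sum>p\<in>P. 1 / real p))"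
    using power_mono[OF j(2,1), of 2] by (simp add: mult_right_mono sum_nonneg)
  have a5: "(6 * t + 10 * j\<^sup>2 / R\<^sup>2)\<^sup>2 \<le> 256 * \<kappa> ^ 4 * L * t\<^sup>2"
  proof -
    have "6 * t * 1 \<le> 6 * t * \<kappa>\<^sup>2" using t k2 by (intro mult_left_mono) auto
    moreover have "10 * j\<^sup>2 / R\<^sup>2 = 10 * (j\<^sup>2 / R\<^sup>2)" "16 * \<kappa>\<^sup>2 * t = 6 * t * \<kappa>\<^sup>2 + 10 * (\<kappa>\<^sup>2 * t)" by simp_all
    ultimately have "6 * t + 10 * j\<^sup>2 / R\<^sup>2 \<le> 16 * \<kappa>\<^sup>2 * t" using jR(1) by linarith
    then have "(6 * t + 10 * j\<^sup>2 / R\<^sup>2)\<^sup>2 \<le> (16 * \<kappa>\<^sup>2 * t)\<^sup>2" using t jR0 by (intro power_mono) auto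
    also have "\<dots> = 256 * (\<kappa> ^ 4 * t\<^sup>2) * 1" by (simp add: power_mult_distrib flip: power_mult)
    also have "\<dots> \<le> 256 * (\<kappa> ^ 4 * t\<^sup>2) * L" using L k2 by (intro mult_left_mono) auto
    finally show ?thesis by (simp add: mult_ac)
  qed
  have a6: "4 * \<eta> * exp (32 * j\<^sup>2 * (\<Sum>p\<in>P. 1 / real p)) \<le> 4 * \<eta> * exp (32 * (\<kappa> * H)\<^sup>2 * (\<Sum>p\<in>P. 1 / real p))"
    using a4 L by (intro mult_left_mono) auto
  have a7: "\<kappa> ^ 4 * L * t\<^sup>2 \<ge> 0" using k2 L by simp
  show ?thesis unfolding variance_bound_def
    using variance_combine[OF a1[unfolded mult.assoc] a2[unfolded mult.assoc] a3[unfolded mult.assoc] a6[unfolded mult.assoc] a5[unfolded mult.assoc] a7[unfolded mult.assoc]]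
    unfolding mult.assoc .
qed

section \<open>The large sieving primes at a given scale\<close>

text \<open>The sieve bounds the primes up to y / H by (ln l)^6 times the assumed size of the
  family, which gives the loss \<open>L\<close>. The remainder exp(l/2) is at most exp(-l/4) times
  the family even though the latter is only known to exceed exp l / l^2 up to a constant, and a
  further factor H^24 \<le> l^12 does no harm.\<close>

lemma prime_family_at_scale:
  fixes Q :: "nat set" and l c H z :: real and y :: int
  assumes brun: "(\<Prod>p\<in>brun_primes l. 1 - 1 / real p) 
       + exp (2 * (\<Sum>p\<in>brun_primes l. 1 / real p)) / 2 ^ (2 * brun_level l) \<le> c * (ln l) ^ 6 / l"
     "real (brun_size (brun_primes l) (brun_level l)) \<le> exp (l / 2)" "brun_limit l \<le> exp (l / 2)"
    and l: "l \<ge> 1" and c: "c > 0" and z: "exp (l / 2) \<le> z" and y: "exp l \<le> real_of_int y"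
    and H: "H \<ge> 1" "H\<^sup>2 \<le> l"
    and num: "exp (l/2) * l ^ 14 \<le> c * exp l" "exp (l/2) * l ^ 2 \<le> c * (exp l * exp (- l / 4))"
    and Q: "finite Q" "\<And>q. q \<in> Q \<Longrightarrow> prime q" "\<And>q. q \<in> Q \<Longrightarrow> z < real q" "\<And>q. q \<in> Q \<Longrightarrow> real q * H \<le> real_of_int y"
    and card: "c * (real_of_int y / (H * l)) \<le> real (card Q)"
  shows "\<And>D r. finite D \<Longrightarrow> (\<And>p. p \<in> D \<Longrightarrow> prime p) \<Longrightarrow> 
      real (card {\<omega>\<in>int ` Q. in_class D r \<omega>}) \<le> real (card Q) * ((ln l) ^ 6 * (\<Prod>p\<in>D. 2 / real p) + exp (- l / 4))"
   and "\<And>P \<alpha>. finite P \<Longrightarrow> (\<And>p. p \<in> P \<Longrightarrow> prime p) \<Longrightarrow> (\<And>p. p \<in> P \<Longrightarrow> real p \<le> H ^ 8) \<Longrightarrow>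
      (\<And>\<omega>. \<omega> \<in> int ` Q \<Longrightarrow> \<bar>\<alpha> \<omega>\<bar> \<le> 2) \<Longrightarrow>
      (\<Sum>p\<in>P. real p * (\<Sum>r\<in>{0..<int p}. (class_dev (int ` Q) \<alpha> p r)\<^sup>2)) \<le> 4 * ((ln l) ^ 6 + 1) * (real (card Q))\<^sup>2"
proof -
  define N where "N = \<lfloor>real_of_int y / H\<rfloor>"
  let ?Z = "brun_primes l" and ?k = "brun_level l"
  let ?V = "(\<Prod>p\<in>brun_primes l. 1 - 1 / real p) + exp (2 * (\<Sum>p\<in>brun_primes l. 1 / real p)) / 2 ^ (2 * brun_level l)"
  have y0: "real_of_int y > 0" using y exp_gt_zero[of l] by linarith
  have N0: "N \<ge> 0" unfolding N_def using y0 H by simp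
  have NH: "real_of_int N \<le> real_of_int y / H" unfolding N_def by linarith
  have Zp: "\<And>p. p \<in> ?Z \<Longrightarrow> prime p" unfolding brun_primes_def by simp
  have ZQ: "\<And>p q. p \<in> ?Z \<Longrightarrow> q \<in> Q \<Longrightarrow> p < q"
  proof -
    fix p q assume "p \<in> ?Z" "q \<in> Q"
    then have "real p \<le> brun_limit l" "z < real q" using Q(3) unfolding brun_primes_def by auto
    then have "real p < real q" using brun(3) z by linarith
    then show "p < q" by simp
  qed
  have QN: "\<And>q. q \<in> Q \<Longrightarrow> int q \<le> N"
  proof -
    fix q assume "q \<in> Q"
    then have "real q \<le> real_of_int y / H" using Q(4) H by (simp add: pos_le_divide_eq)
    then show "int q \<le> N" unfolding N_def by (simp add: le_floor_iff)
  qed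
  have Hl: "H \<le> l" using H by (smt (verit) power2_eq_square mult_left_mono mult_cancel_left1)
  have V0: "?V \<ge> 0"
  proof (intro add_nonneg_nonneg prod_nonneg)
    fix p assume "p \<in> ?Z"
    then have "1 \<le> real p" using prime_ge_1_nat[OF Zp] by simp
    then show "0 \<le> 1 - 1 / real p" by simp
  qed simp
  have NV: "real_of_int N * ?V \<le> (ln l) ^ 6 * real (card Q)"
  proof -
    have "real_of_int N * ?V \<le> (real_of_int y / H) * (c * (ln l) ^ 6 / l)" using NH N0 brun(1) V0 y0 H by (intro mult_mono) auto
    also have "\<dots> = (ln l) ^ 6 * (c * (real_of_int y / (H * l)))" by simp
    also have "\<dots> \<le> (ln l) ^ 6 * real (card Q)" using card l by (intro mult_left_mono) auto
    finally show ?thesis .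
  qed
  have cl: "c * (exp l / l ^ 2) \<le> real (card Q)"
  proof -
    have "exp l / l ^ 2 \<le> real_of_int y / (H * l)"
      using y y0 Hl l H by (intro frac_le) (auto simp: power2_eq_square intro: mult_right_mono)
    then show ?thesis using card c by (meson mult_left_mono less_imp_le order_trans)
  qed
  have size\<eta>: "real (brun_size ?Z ?k) \<le> exp (- l / 4) * real (card Q)"
  proof -
    have "exp (l / 2) \<le> exp (- l / 4) * (c * (exp l / l ^ 2))" using num(2) l by (simp add: field_simps)
    also have "\<dots> \<le> exp (- l / 4) * real (card Q)" using cl by (intro mult_left_mono) auto
    finally show ?thesis using brun(2) by linarith
  qed
  have size1: "real (brun_size ?Z ?k) * (H ^ 8) ^ 3 \<le> real (card Q)"
  proof -
    have "(H ^ 8) ^ 3 = (H\<^sup>2) ^ 12" by (simp flip: power_mult)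
    also have "\<dots> \<le> l ^ 12" using H by (intro power_mono) auto
    finally have "real (brun_size ?Z ?k) * (H ^ 8) ^ 3 \<le> exp (l / 2) * l ^ 12" using brun(2) H by (intro mult_mono) auto
    also have "\<dots> \<le> c * (exp l / l ^ 2)"
    proof -
      have "exp (l / 2) * l ^ 12 * l ^ 2 \<le> c * exp l" using num(1) by (simp add: mult.assoc flip: power_add)
      then show ?thesis using l by (simp add: pos_le_divide_eq)
    qed
    finally show ?thesis using cl by linarith
  qed
  show "real (card {\<omega>\<in>int ` Q. in_class D r \<omega>}) \<le> real (card Q) * ((ln l) ^ 6 * (\<Prod>p\<in>D. 2 / real p) + exp (- l / 4))"
    if D: "finite D" "\<And>p. p \<in> D \<Longrightarrow> prime p" for D r
  proof -
    have "real (card {\<omega>\<in>int ` Q. in_class D r \<omega>}) \<le> real_of_int N * ?V * (\<Prod>p\<in>D. 2 / real p) + real (brun_size ?Z ?k)"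
      by (rule prime_family_count[OF Q(1,2) QN finite_brun_primes Zp ZQ D N0])
    also have "\<dots> \<le> (ln l) ^ 6 * real (card Q) * (\<Prod>p\<in>D. 2 / real p) + exp (- l / 4) * real (card Q)"
      using NV size\<eta> by (intro add_mono mult_right_mono prod_nonneg) auto
    finally show ?thesis by (simp add: algebra_simps)
  qed
  show "(\<Sum>p\<in>P. real p * (\<Sum>r\<in>{0..<int p}. (class_dev (int ` Q) \<alpha> p r)\<^sup>2)) \<le> 4 * ((ln l) ^ 6 + 1) * (real (card Q))\<^sup>2"
    if P: "finite P" "\<And>p. p \<in> P \<Longrightarrow> prime p" "\<And>p. p \<in> P \<Longrightarrow> real p \<le> H ^ 8" and \<alpha>: "\<And>\<omega>. \<omega> \<in> int ` Q \<Longrightarrow> \<bar>\<alpha> \<omega>\<bar> \<le> 2" for P \<alpha>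
  proof -
    have "H ^ 8 = (H\<^sup>2) ^ 4" by (simp flip: power_mult)
    also have "\<dots> \<le> l ^ 4" using H by (intro power_mono) auto
    finally have H8: "H ^ 8 \<le> l ^ 4" .
    have disj: "P \<inter> ?Z = {}"
    proof -
      have False if "p \<in> P" "p \<in> ?Z" for p
      proof -
        have "l ^ 4 < real p" using that unfolding brun_primes_def by simp
        then show False using P(3)[OF that(1)] H8 by linarith
      qed
      then show ?thesis by blast
    qed
    have "(\<Sum>p\<in>P. real p * (\<Sum>r\<in>{0..<int p}. (class_dev (int ` Q) \<alpha> p r)\<^sup>2)) \<le> 
      (real_of_int N * ?V + real (brun_size ?Z ?k) * (H ^ 8) ^ 3) * (\<Sum>\<omega>\<in>int ` Q. (\<alpha> \<omega>)\<^sup>2)"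
      using H by (intro prime_family_sieve[OF Q(1,2) QN finite_brun_primes Zp ZQ P disj N0]) auto
    also have "\<dots> \<le> ((ln l) ^ 6 * real (card Q) + real (card Q)) * (\<Sum>\<omega>\<in>int ` Q. 4)"
    proof (rule mult_mono)
      show "real_of_int N * ?V + real (brun_size ?Z ?k) * (H ^ 8) ^ 3 \<le> (ln l) ^ 6 * real (card Q) + real (card Q)"
        using NV size1 by (rule add_mono)
      show "(\<Sum>\<omega>\<in>int ` Q. (\<alpha> \<omega>)\<^sup>2) \<le> (\<Sum>\<omega>\<in>int ` Q. 4)"
      proof (rule sum_mono)
        fix \<omega> assume "\<omega> \<in> int ` Q"
        then have "\<bar>\<alpha> \<omega>\<bar>\<^sup>2 \<le> 2\<^sup>2" by (intro power_mono \<alpha>) auto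
        then show "(\<alpha> \<omega>)\<^sup>2 \<le> 4" by simp
      qed
    qed (auto intro: sum_nonneg)
    also have "(\<Sum>\<omega>\<in>int ` Q. (4::real)) = 4 * real (card Q)" by (simp add: card_image)
    finally show ?thesis by (simp add: power2_eq_square algebra_simps)
  qed
qed

text \<open>Markov's inequality for the total overlap of q: when the mean is at most (1 - \<phi>) t,
  a proportion \<phi> of the primes stays below t.\<close>

lemma most_primes_good:
  fixes Q PH :: "nat set" and l c H z g t b \<kappa> \<phi> P0 :: real and y :: int and J :: nat
  assumes PH: "finite PH" "\<And>p. p \<in> PH \<Longrightarrow> prime p" "\<And>p. p \<in> PH \<Longrightarrow> P0 \<le> real p" "P0 \<ge> 2" "\<And>p. p \<in> PH \<Longrightarrow> J < p"
    and I: "\<And>p. p \<in> PH \<Longrightarrow> finite (I p)" "\<And>p. p \<in> PH \<Longrightarrow> real (card (I p)) \<le> b" and b: "b \<ge> 0" and J: "J \<ge> 1"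
    and Q: "finite Q" and L: "L \<ge> 0" "\<eta> \<ge> 0" and t: "t > 0"
    and count: "\<And>D r. D \<subseteq> PH \<Longrightarrow> real (card {\<omega>\<in>int ` Q. in_class D r \<omega>}) \<le> real (card Q) * (L * (\<Prod>p\<in>D. 2 / real p) + \<eta>)"
    and small: "4 * (real J * b)\<^sup>2 * (4 * L / P0 + \<eta> * (\<Sum>p\<in>PH. 1 / real p)) \<le> (1 - \<phi>) * t"
  shows "\<phi> * real (card Q) \<le> real (card {q\<in>Q. (\<Sum>p\<in>PH. real (J + 1) * real (card (overlaps I (int J) p (int q))) / real p) \<le> t})"
proof -
  let ?X = "\<lambda>q. \<Sum>p\<in>PH. real (J + 1) * real (card (overlaps I (int J) p (int q))) / real p"
  let ?B = "{q\<in>Q. \<not> ?X q \<le> t}" and ?G = "{q\<in>Q. ?X q \<le> t}"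
  have X0: "?X q \<ge> 0" for q by (intro sum_nonneg) auto
  have "real (card ?B) * t = (\<Sum>q\<in>?B. t)" by simp
  also have "\<dots> \<le> (\<Sum>q\<in>?B. ?X q)" by (intro sum_mono) auto
  also have "\<dots> \<le> (\<Sum>q\<in>Q. ?X q)" using Q X0 by (intro sum_mono2) auto
  also have "\<dots> \<le> real (card Q) * (4 * (real J * b)\<^sup>2 * (4 * L / P0 + \<eta> * (\<Sum>p\<in>PH. 1 / real p)))"
    by (rule sum_overlaps_le) (use assms in auto)
  also have "\<dots> \<le> real (card Q) * ((1 - \<phi>) * t)" using small by (intro mult_left_mono) auto
  finally have "real (card ?B) * t \<le> (real (card Q) * (1 - \<phi>)) * t" by (simp add: mult_ac)
  then have "real (card ?B) \<le> real (card Q) * (1 - \<phi>)" using t by (rule mult_right_le_imp_le)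
  moreover have "card Q = card ?G + card ?B"
    using Q by (subst card_Un_disjoint[symmetric]) (auto intro!: arg_cong[where f=card])
  ultimately show ?thesis by (simp add: algebra_simps)
qed

section \<open>The scales\<close>

lemma ln_le_sum_recip_from:
  assumes "a \<ge> 1"
  shows "ln (real (a + n) / real a) \<le> (\<Sum>k=a..<a + n. 1 / real k)"
proof (induction n)
  case 0
  show ?case using assms by simp
next
  case (Suc n)
  have pos: "real a > 0" "real (a + n) > 0" using assms by auto
  have "ln (real (a + Suc n) / real a) = ln (real (a + n) / real a) + ln (real (a + Suc n) / real (a + n))"
    using pos by (simp add: ln_div)
  also have "ln (real (a + Suc n) / real (a + n)) \<le> real (a + Suc n) / real (a + n) - 1"
    using pos by (intro ln_le_minus_one) auto
  also have "\<dots> = 1 / real (a + n)" using pos by (simp add: field_simps)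
  finally show ?case using Suc.IH by simp
qed

text \<open>For H = \<xi>^k the summand is 1 / (k ln \<xi>), so the sum is harmonic over k between
  the logarithms of the end points to base \<xi>. The 1 in the denominator of the bound on
  \<open>A\<close> pays for rounding the lower end up.\<close>

lemma geometric_scales:
  fixes \<xi> lo hi A :: real
  assumes \<xi>: "\<xi> > 1" and lo: "lo > 1" and hi: "hi > 0" and A: "A > 1" "A \<le> (ln hi / ln \<xi>) / (ln lo / ln \<xi> + 1)"
  defines "S \<equiv> {H. (\<exists>k::nat. H = \<xi> ^ k) \<and> lo \<le> H \<and> H \<le> hi}"
  shows "finite S" "ln A / ln \<xi> \<le> (\<Sum>H\<in>S. 1 / ln H)" "real (card S) \<le> ln hi / ln \<xi> + 1"
proof -
  have lx: "ln \<xi> > 0" using \<xi> by simp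
  define u v where "u = ln lo / ln \<xi>" and "v = ln hi / ln \<xi>"
  have u0: "u > 0" unfolding u_def using lo lx by simp
  have uv: "A * (u + 1) \<le> v" using A(2) u0 unfolding u_def[symmetric] v_def[symmetric] by (simp add: pos_le_divide_eq)
  have v0: "v \<ge> u + 1" 
  proof -
    have "u + 1 = 1 * (u + 1)" by simp
    also have "\<dots> \<le> A * (u + 1)" using A(1) u0 by (intro mult_right_mono) auto
    also note uv
    finally show ?thesis .
  qed
  define a d where "a = nat \<lceil>u\<rceil>" and "d = nat \<lfloor>v\<rfloor>"
  have a: "u \<le> real a" "real a \<le> u + 1" "a \<ge> 1" unfolding a_def using u0 by linarith+
  have d: "real d \<le> v" "v \<le> real d + 1" unfolding d_def using v0 u0 by linarith+
  have iff: "lo \<le> \<xi> ^ k \<and> \<xi> ^ k \<le> hi \<longleftrightarrow> k \<in> {a..d}" for k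
  proof -
    have lk: "ln (\<xi> ^ k) = real k * ln \<xi>" using \<xi> by (simp add: ln_realpow)
    have pk: "\<xi> ^ k > 0" using \<xi> by simp
    have "lo \<le> \<xi> ^ k \<longleftrightarrow> ln lo \<le> real k * ln \<xi>" unfolding lk[symmetric] using pk lo by (subst ln_le_cancel_iff) auto
    also have "\<dots> \<longleftrightarrow> u \<le> real k" unfolding u_def using lx by (simp add: pos_divide_le_eq)
    also have "\<dots> \<longleftrightarrow> a \<le> k" unfolding a_def by (simp add: nat_le_iff ceiling_le_iff)
    finally have 1: "lo \<le> \<xi> ^ k \<longleftrightarrow> a \<le> k" .
    have "\<xi> ^ k \<le> hi \<longleftrightarrow> real k * ln \<xi> \<le> ln hi" unfolding lk[symmetric] using pk hi by (subst ln_le_cancel_iff) auto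
    also have "\<dots> \<longleftrightarrow> real k \<le> v" unfolding v_def using lx by (simp add: pos_le_divide_eq)
    also have "\<dots> \<longleftrightarrow> k \<le> d"
    proof
      assume "real k \<le> v"
      then show "k \<le> d" unfolding d_def by (rule le_nat_floor)
    next
      assume "k \<le> d"
      then have "real k \<le> real d" by simp
      then show "real k \<le> v" using d(1) by linarith
    qed
    finally show ?thesis using 1 by auto
  qed
  have S: "S = (\<lambda>k. \<xi> ^ k) ` {a..d}"
  proof (intro equalityI subsetI)
    fix H assume "H \<in> S"
    then obtain k where k: "H = \<xi> ^ k" "lo \<le> H" "H \<le> hi" unfolding S_def by blast
    then have "k \<in> {a..d}" using iff[of k] by simp
    then show "H \<in> (\<lambda>k. \<xi> ^ k) ` {a..d}" using k(1) by blast
  next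
    fix H assume "H \<in> (\<lambda>k. \<xi> ^ k) ` {a..d}"
    then obtain k where k: "H = \<xi> ^ k" "k \<in> {a..d}" by blast
    then have "lo \<le> \<xi> ^ k" "\<xi> ^ k \<le> hi" using iff[of k] by blast+
    then show "H \<in> S" unfolding S_def k(1) by blast
  qed
  have inj: "inj_on (\<lambda>k. \<xi> ^ k) {a..d}" 
  proof (rule inj_onI)
    fix k k' assume "\<xi> ^ k = \<xi> ^ k'"
    then show "k = k'" using power_inject_exp[OF \<xi>] by blast
  qed
  show "finite S" unfolding S by simp
  have ad: "a \<le> d + 1" using a d v0 by linarith
  have "(\<Sum>H\<in>S. 1 / ln H) = (\<Sum>k\<in>{a..d}. 1 / ln (\<xi> ^ k))" unfolding S by (subst sum.reindex[OF inj]) simp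
  also have "\<dots> = (\<Sum>k\<in>{a..d}. (1 / ln \<xi>) * (1 / real k))" using \<xi> by (intro sum.cong refl) (simp add: ln_realpow)
  also have "\<dots> = (1 / ln \<xi>) * (\<Sum>k\<in>{a..d}. 1 / real k)" by (rule sum_distrib_left[symmetric])
  \<comment> \<open>The inequality a \<le> d + 1 prevents the natural subtraction from
    truncating.\<close>
  also have "{a..d} = {a..<a + (d + 1 - a)}" using ad by auto
  also have "(1 / ln \<xi>) * (\<Sum>k\<in>{a..<a + (d + 1 - a)}. 1 / real k) \<ge> (1 / ln \<xi>) * ln A"
  proof (rule mult_left_mono)
    have "A \<le> v / (u + 1)" using uv u0 by (simp add: pos_le_divide_eq)
    also have "\<dots> \<le> (real d + 1) / real a" using a d u0 by (intro frac_le) auto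
    also have "\<dots> = real (a + (d + 1 - a)) / real a" using ad by simp
    finally have "A \<le> real (a + (d + 1 - a)) / real a" .
    then have "ln A \<le> ln (real (a + (d + 1 - a)) / real a)" using A(1) by (subst ln_le_cancel_iff) auto
    also have "\<dots> \<le> (\<Sum>k\<in>{a..<a + (d + 1 - a)}. 1 / real k)" by (rule ln_le_sum_recip_from[OF a(3)])
    finally show "ln A \<le> (\<Sum>k\<in>{a..<a + (d + 1 - a)}. 1 / real k)" .
  qed (use lx in simp)
  finally show "ln A / ln \<xi> \<le> (\<Sum>H\<in>S. 1 / ln H)" by simp
  have "card S = card {a..d}" unfolding S by (rule card_image[OF inj])
  also have "\<dots> \<le> d + 1" using a by simp
  finally have "real (card S) \<le> real (d + 1)" by (rule of_nat_mono)
  then show "real (card S) \<le> ln hi / ln \<xi> + 1" using d v_def by simp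
qed

lemma asymp_equiv_bounds:
  fixes f g :: "real \<Rightarrow> real"
  assumes "f \<sim>[at_top] g" "\<phi> < 1" "0 < \<phi>" "\<And>x. x > 1 \<Longrightarrow> g x > 0"
  shows "\<forall>\<^sub>F x in at_top. \<phi> * g x \<le> f x \<and> f x \<le> g x / \<phi>"
proof -
  \<comment> \<open>The relation assigns the ratio 1 to 0/0; positivity of \<open>g\<close> rules
    this case out below.\<close>
  have lim: "((\<lambda>x. if f x = 0 \<and> g x = 0 then 1 else f x / g x) \<longlongrightarrow> 1) at_top" by (rule asymp_equivD[OF assms(1)])
  have "1 / \<phi> > 1" using assms by simp
  then have "\<forall>\<^sub>F x in at_top. (if f x = 0 \<and> g x = 0 then 1 else f x / g x) < 1 / \<phi>" using order_tendstoD(2)[OF lim] by blast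
  moreover have "\<forall>\<^sub>F x in at_top. \<phi> < (if f x = 0 \<and> g x = 0 then 1 else f x / g x)" using order_tendstoD(1)[OF lim assms(2)] .
  moreover have "\<forall>\<^sub>F x::real in at_top. x > 1" by (rule eventually_gt_at_top)
  ultimately show ?thesis
  proof eventually_elim
    case (elim x)
    then have g: "g x > 0" using assms(4) by blast
    then have "\<phi> < f x / g x" "f x / g x < 1 / \<phi>" using elim by auto
    then show ?case using g assms(3) by (simp add: field_simps)
  qed
qed

context random_sieve
begin

lemma scale_indices:
  assumes "H \<ge> 0"
  shows "{h::nat. 1 \<le> h \<and> real h \<le> real K * H} = {1..J H}"
proof -
  have "real h \<le> real K * H \<longleftrightarrow> h \<le> J H" for h :: nat
  proof
    assume "real h \<le> real K * H"
    then show "h \<le> J H" unfolding J_def by (rule le_nat_floor)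
  next
    assume "h \<le> J H"
    then have "real h \<le> real (J H)" by simp
    also have "\<dots> \<le> real K * H" unfolding J_def using assms by (intro of_nat_floor) simp
    finally show "real h \<le> real K * H" .
  qed
  then have "{h::nat. 1 \<le> h \<and> real h \<le> real K * H} = {h. 1 \<le> h \<and> h \<le> J H}" by presburger
  then show ?thesis by (simp only: atLeastAtMost_def atLeast_def atMost_def Collect_conj_eq)
qed

lemma sum_scale_indices:
  assumes "H \<ge> 0"
  shows "(\<Sum>h | 1 \<le> h \<and> real h \<le> real K * H. f (int h)) = (\<Sum>h\<in>{1..int (J H)}. f h)"
proof -
  have "{1..int (J H)} = int ` {1..J H}" using image_int_atLeastAtMost[of 1 "J H"] by simp
  then show ?thesis unfolding scale_indices[OF assms] by (simp add: sum.reindex)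
qed

text \<open>The Chinese remainder theorem turns the family of residues into one shift. The shift is
  called \<open>a\<close> here, the name \<open>b\<close> being taken by the bound on the removed
  classes.\<close>

lemma realize:
  assumes \<beta>: "\<beta> \<in> full"
  obtains a :: int where "shift a (sifted I z) = S \<beta>"
    "\<And>H q n. H \<in> Hs \<Longrightarrow> sieve_weight I M K z a H q n = W H \<beta> q n"
proof -
  have "\<exists>x. \<forall>p\<in>Pz. [x = nat (\<beta> p)] (mod p)"
  proof (rule chinese_remainder_nat)
    show "\<forall>i\<in>Pz. \<forall>j\<in>Pz. i \<noteq> j \<longrightarrow> coprime i j" using primes_coprime unfolding Pz_def by blast
  qed (rule fin_Pz)
  then obtain x where x: "\<And>p. p \<in> Pz \<Longrightarrow> [x = nat (\<beta> p)] (mod p)" by blast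
  define a where "a = int x"
  have cg: "(n - a) mod int p = (n - \<beta> p) mod int p" if p: "p \<in> Pz" for n p
  proof -
    have "\<beta> p \<in> {0..<int p}" using \<beta> p unfolding full_def by (auto simp: PiE_def Pi_def)
    then have "int (nat (\<beta> p)) = \<beta> p" by simp
    moreover have "[int x = int (nat (\<beta> p))] (mod int p)" using x[OF p] by (simp only: cong_int_iff)
    ultimately have "[a = \<beta> p] (mod int p)" unfolding a_def by simp
    then have "[n - a = n - \<beta> p] (mod int p)" by (intro cong_diff cong_refl)
    then show ?thesis by (simp only: unique_euclidean_semiring_class.cong_def)
  qed
  have shift_iff: "n \<in> shift a A \<longleftrightarrow> n - a \<in> A" for n A
  proof
    assume "n \<in> shift a A"
    then show "n - a \<in> A" unfolding shift_def by auto
  next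
    assume "n - a \<in> A"
    then have "(n - a) + a \<in> shift a A" unfolding shift_def by (rule imageI)
    then show "n \<in> shift a A" by simp
  qed
  have S: "shift a (sifted I z) = S \<beta>"
  proof (rule set_eqI)
    fix n
    have "n \<in> shift a (sifted I z) \<longleftrightarrow> (\<forall>p\<in>Pz. (n - a) mod int p \<notin> I p)"
      unfolding shift_iff sifted_def Pz_def by blast
    also have "\<dots> \<longleftrightarrow> n \<in> S \<beta>" unfolding S_def using cg by auto
    finally show "n \<in> shift a (sifted I z) \<longleftrightarrow> n \<in> S \<beta>" .
  qed
  have V: "shift a (sifted I (H powr M)) = V H \<beta>" if H: "H \<in> Hs" for H
  proof (rule set_eqI)
    fix n
    have sub: "p \<in> Pz" if "p \<in> Ps H" for p using that Pz_split(1)[OF H] by blast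
    have "n \<in> shift a (sifted I (H powr M)) \<longleftrightarrow> (\<forall>p\<in>Ps H. (n - a) mod int p \<notin> I p)"
      unfolding shift_iff sifted_def Ps_def by blast
    also have "\<dots> \<longleftrightarrow> n \<in> V H \<beta>" unfolding V_def using cg[OF sub] by auto
    finally show "n \<in> shift a (sifted I (H powr M)) \<longleftrightarrow> n \<in> V H \<beta>" .
  qed
  have V2: "n \<in> shift a (sifted_between I (H powr M) z) \<longleftrightarrow> (\<forall>p\<in>PH H. (n - \<beta> p) mod int p \<notin> I p)" if H: "H \<in> Hs" for H n
  proof -
    have sub: "p \<in> Pz" if "p \<in> PH H" for p using that Pz_split(1)[OF H] by blast
    have "n \<in> shift a (sifted_between I (H powr M) z) \<longleftrightarrow> (\<forall>p\<in>PH H. (n - a) mod int p \<notin> I p)"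
      unfolding shift_iff sifted_between_def PH_def by blast
    also have "\<dots> \<longleftrightarrow> (\<forall>p\<in>PH H. (n - \<beta> p) mod int p \<notin> I p)" using cg[OF sub] by auto
    finally show ?thesis .
  qed
  have "sieve_weight I M K z a H q n = W H \<beta> q n" if H: "H \<in> Hs" for H q n
  proof -
    have H0: "H \<ge> 0" using Hs(2)[OF H] by simp
    have im: "{n + int q * int h | h::nat. 1 \<le> h \<and> real h \<le> real K * H} = (\<lambda>h. n + int q * h) ` {1..int (J H)}"
    proof -
      have "{n + int q * int h | h::nat. 1 \<le> h \<and> real h \<le> real K * H} = (\<lambda>h. n + int q * int h) ` {h::nat. 1 \<le> h \<and> real h \<le> real K * H}" by blast
      also have "\<dots> = (\<lambda>h. n + int q * h) ` (int ` {1..J H})" unfolding scale_indices[OF H0] image_image ..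
      also have "int ` {1..J H} = {1..int (J H)}" using image_int_atLeastAtMost[of 1 "J H"] by simp
      finally show ?thesis .
    qed
    have ap: "AP_set I M a H (real K * H) q n = ap H \<beta> q n"
      unfolding AP_set_def ap_def im V[OF H] ..
    have den: "sieve_density_between I (H powr M) z = \<sigma>2 H"
    proof -
      have "PH H = {p. prime p \<and> H powr M < real p \<and> real p \<le> z}" unfolding PH_def ..
      then show ?thesis unfolding sieve_density_between_def \<sigma>2_def by simp
    qed
    have sub: "ap H \<beta> q n \<subseteq> shift a (sifted_between I (H powr M) z) \<longleftrightarrow> (\<forall>p\<in>PH H. \<forall>n\<in>ap H \<beta> q n. (n - \<beta> p) mod int p \<notin> I p)"
      using V2[OF H] by blast
    have pw: "\<sigma>2 H powi (- int k) = (1 / \<sigma>2 H) ^ k" for k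
      by (simp add: power_int_minus power_inverse inverse_eq_divide power_one_over)
    show ?thesis unfolding sieve_weight_def Let_def ap sub den pw W_def local_weight_def \<sigma>2_def[symmetric] by simp
  qed
  then show thesis using that S by blast
qed

lemma sieve_density_eq: "sieve_density I z = \<sigma>" unfolding sieve_density_def \<sigma>_def Pz_def ..

end

lemma sieve_density_split:
  assumes "w \<le> z"
  shows "sieve_density I z = sieve_density I w * (\<Prod>p | prime p \<and> w < real p \<and> real p \<le> z. 1 - real (card (I p)) / real p)"
proof -
  have eq: "{p. prime p \<and> real p \<le> z} = {p. prime p \<and> real p \<le> w} \<union> {p. prime p \<and> w < real p \<and> real p \<le> z}" using assms by auto
  have "finite {p. prime p \<and> w < real p \<and> real p \<le> z}" by (rule finite_subset[OF _ finite_primes_le[of z]]) auto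
  then show ?thesis unfolding sieve_density_def eq by (intro prod.union_disjoint) auto
qed

text \<open>With x = exp l every magnitude is expressed through l; the quotient y / z, on which the
  largest scale depends, is exact.\<close>

lemma y_z_bounds:
  fixes l \<delta> :: real
  assumes \<delta>: "\<delta> > 0" and l: "l \<ge> 100" and n: "1 \<le> exp l * l powr \<delta>" "2 * l powr \<delta> \<le> exp l" "ln l \<le> sqrt l" "exp (l / 2) * sqrt l \<le> exp l"
    and \<phi>: "\<phi> * l \<le> l - ln l"
  defines "y \<equiv> real_of_int (y_of \<delta> (exp l))" and "z \<equiv> z_of \<delta> (exp l)"
  shows "exp l * l powr \<delta> \<le> y" "y \<le> 2 * (exp l * l powr \<delta>)" "exp l \<le> y" "ln l \<ge> 1"
    "exp (l / 2) \<le> z" "\<phi> * l \<le> ln z" "ln z \<le> 2 * l" "l / 2 \<le> ln z" "y / z = sqrt l / ln l" "z > 0"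
proof -
  have y_def': "y = of_int \<lceil>exp l * l powr \<delta>\<rceil>" unfolding y_def y_of_def by simp
  show y1: "exp l * l powr \<delta> \<le> y" unfolding y_def' by linarith
  show y2: "y \<le> 2 * (exp l * l powr \<delta>)" unfolding y_def' using n(1) by linarith
  have lp: "l powr \<delta> \<ge> 1" using l \<delta> by (simp add: ge_one_powr_ge_zero)
  have "exp l * 1 \<le> exp l * l powr \<delta>" using lp by (intro mult_left_mono) auto
  then show y3: "exp l \<le> y" using y1 by linarith
  show lnl: "ln l \<ge> 1"
  proof -
    have "exp (1::real) \<le> 3" by (rule exp_le)
    then have "exp 1 \<le> l" using l by linarith
    then have "ln (exp 1) \<le> ln l" using l by (subst ln_le_cancel_iff) auto
    then show ?thesis by simp
  qed
  have zy: "z = y * ln l / sqrt l" unfolding z_def z_of_def y_def by simp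
  have sl: "sqrt l > 0" using l by simp
  have y0: "y > 0" using y3 exp_gt_zero[of l] by linarith
  show z0: "z > 0" unfolding zy using y0 lnl sl by (intro divide_pos_pos mult_pos_pos) linarith+
  show "y / z = sqrt l / ln l" unfolding zy using y0 by simp
  have zx: "exp l / sqrt l \<le> z"
  proof -
    have "exp l * 1 \<le> y * ln l" using y3 lnl y0 by (intro mult_mono) auto
    then show ?thesis unfolding zy using sl by (simp add: divide_right_mono)
  qed
  show z1: "exp (l / 2) \<le> z"
  proof -
    have "exp (l / 2) \<le> exp l / sqrt l" using n(4) sl by (simp add: pos_le_divide_eq)
    then show ?thesis using zx by linarith
  qed
  have "ln (exp (l / 2)) \<le> ln z" using z1 z0 by (subst ln_le_cancel_iff) auto
  then show "l / 2 \<le> ln z" by simp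
  have "sqrt l \<le> l" using l real_sqrt_le_iff[of l "l\<^sup>2"] by (simp add: power2_eq_square)
  then have "exp l / l \<le> exp l / sqrt l" using sl l by (intro divide_left_mono) auto
  then have "exp l / l \<le> z" using zx by linarith
  then have "ln (exp l / l) \<le> ln z" using z0 l by (subst ln_le_cancel_iff) auto
  then show "\<phi> * l \<le> ln z" using \<phi> l by (simp add: ln_div)
  have "z \<le> y"
  proof -
    have "y * ln l \<le> y * sqrt l" using n(3) y0 by (intro mult_left_mono) auto
    then show ?thesis unfolding zy using sl by (simp add: pos_divide_le_eq)
  qed
  also have "y \<le> exp l * (2 * l powr \<delta>)" using y2 by simp
  also have "\<dots> \<le> exp l * exp l" using n(2) by (intro mult_left_mono) auto
  also have "\<dots> = exp (2 * l)" by (simp flip: exp_add)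
  finally have "ln z \<le> ln (exp (2 * l))" using z0 by (subst ln_le_cancel_iff) auto
  then show "ln z \<le> 2 * l" by simp
qed

section \<open>The construction for a fixed large \<open>x\<close>\<close>

text \<open>Here \<open>l = ln x\<close>, and \<open>\<phi>\<close>, slightly below \<open>1\<close>, measures the loss in every asymptotic relation.
  The assumptions \<open>n1\<close> to \<open>n14\<close> hold for all large \<open>l\<close>.\<close>

locale large_x =
  fixes I :: "nat \<Rightarrow> int set" and Q :: "real \<Rightarrow> real \<Rightarrow> nat set" and K :: nat
    and \<rho> \<delta> \<xi> M \<epsilon> \<phi> C1 W b l :: real
  assumes sys: "sieving_system I" and nondeg: "non_degenerate I" and bdd: "bounded_by b I" and b: "b \<ge> 1"
    and \<rho>: "\<rho> > 0" and \<delta>: "0 < \<delta>" "\<delta> < 1/2" and \<xi>: "\<xi> > 1" and K: "K \<ge> 2" and M: "4 < M" "M \<le> 5" and \<epsilon>: "\<epsilon> > 0"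
    and \<phi>: "1/2 \<le> \<phi>" "\<phi> < 1" and C1: "C1 > 0"
    and target: "10 powr (2 * \<delta>) \<le> \<phi> ^ 7 * (\<rho> * (1 - 1 / \<xi>) / ln \<xi> * (real K / (real K + 1)) / M * ln (1 / (2 * \<delta>)))"
    and density: "\<And>w. w \<ge> W \<Longrightarrow> \<phi> * (C1 / ln w) \<le> sieve_density I w \<and> sieve_density I w \<le> C1 / ln w / \<phi>"
    and family: "\<And>H. H \<in> scales \<delta> \<xi> (exp l) \<Longrightarrow> Q (exp l) H \<subseteq> {q. prime q \<and> card (I q) \<ge> 1 \<and>
                    real_of_int (y_of \<delta> (exp l)) / (\<xi> * H) < real q \<and> real q \<le> real_of_int (y_of \<delta> (exp l)) / H}"
      "\<And>H. H \<in> scales \<delta> \<xi> (exp l) \<Longrightarrow> 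
        \<bar>real (card (Q (exp l) H)) - \<rho> * (1 - 1 / \<xi>) * (real_of_int (y_of \<delta> (exp l)) / (H * l))\<bar>
          \<le> (1 - \<phi>) * (\<rho> * (1 - 1 / \<xi>) * (real_of_int (y_of \<delta> (exp l)) / (H * l)))"
    and brun: "(\<Prod>p\<in>brun_primes l. 1 - 1 / real p) 
       + exp (2 * (\<Sum>p\<in>brun_primes l. 1 / real p)) / 2 ^ (2 * brun_level l) \<le> (\<rho> * (1 - 1 / \<xi>) / 4) * (ln l) ^ 6 / l"
     "real (brun_size (brun_primes l) (brun_level l)) \<le> exp (l / 2)" "brun_limit l \<le> exp (l / 2)"
    and l: "l \<ge> 100"
    and n1: "exp (l/2) * l ^ 14 \<le> (\<rho> * (1 - 1 / \<xi>) / 4) * exp l" 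
    and n2: "exp (l/2) * l ^ 2 \<le> (\<rho> * (1 - 1 / \<xi>) / 4) * (exp l * exp (- l / 4))"
    and n3: "l ^ 12 \<le> exp l" and n4: "exp (l/2) * sqrt l \<le> exp l"
    and n5: "64 * (real K * b)\<^sup>2 \<le> l powr (2 * \<delta>)"
    and n6: "100000 * (real K * b) ^ 4 * (ln l)^6 * l powr (- (\<delta> * M)) \<le> 1/3 * ((ln l)^7 * l powr (- (\<delta> * M)))"
      "1088 * (real K * b) ^ 3 * l * exp (- l / 4) \<le> 1/3 * ((ln l)^7 * l powr (- (\<delta> * M)))"
      "8 * exp (- l / 4) * exp (32 * (real K * b)\<^sup>2 * (l / (ln l)^2) * (7 + 2 * ln l)) \<le> 1/3 * ((ln l)^7 * l powr (- (\<delta> * M)))"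
    and n7: "16 * (real K * b)\<^sup>2 * (ln l)^6 * l powr (- (\<delta> * (M / 2 - 2))) + 4 * (real K * b)\<^sup>2 * l * exp (- l / 4) * (7 + 2 * ln l) * l powr (\<delta> * M / 2) \<le> 1 - \<phi>"
    and n8: "6 \<le> l powr (\<delta> * M / 2)"
    and n9: "64 * \<rho> * real K * (ln l)^11 * l powr (- (\<delta> * M - 3 * (\<delta> * (1 + \<epsilon>)) - \<delta>)) \<le> \<rho> / 16"
      "64 * C1 * (ln l)^11 * l powr (- (\<delta> * M - 2 * (\<delta> * (1 + \<epsilon>)) - \<delta>)) \<le> \<rho> / 16"
    and n10: "ln l / ln \<xi> + 1 \<le> (ln l)^2"
    and n11: "exp (\<phi> * ln (1 / (2 * \<delta>))) \<le> (ln (sqrt l / (\<xi> * ln l)) / ln \<xi>) / (ln (4 * l powr \<delta>) / ln \<xi> + 1)"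
    and n12: "\<phi> * l \<le> l - ln l" and n13: "1 \<le> exp l * l powr \<delta>" "2 * l powr \<delta> \<le> exp l" "ln l \<le> sqrt l"
    and n14: "W \<le> l powr \<delta>" "exp (4 * \<rho>) \<le> l powr \<delta>" "1 / (1 - \<phi>) \<le> l powr \<delta>"
begin

abbreviation "x \<equiv> exp l"
abbreviation "y \<equiv> y_of \<delta> (exp l)"
abbreviation "yr \<equiv> real_of_int (y_of \<delta> (exp l))"
abbreviation "z \<equiv> z_of \<delta> (exp l)"
abbreviation "SC \<equiv> scales \<delta> \<xi> (exp l)"
abbreviation "\<kappa> \<equiv> real K * b"

definition J :: "real \<Rightarrow> nat" where "J = (\<lambda>H. nat \<lfloor>real K * H\<rfloor>)"
definition PH :: "real \<Rightarrow> nat set" where "PH = (\<lambda>H. {p. prime p \<and> H powr M < real p \<and> real p \<le> z})"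
text \<open>A compromise: t^2 is the size wanted for the variance, yet t exceeds the mean overlap,
  of order H^(2-M), by a power l^(\<delta>(M/2-2)) up to logarithms. Both are possible because M >
  4.\<close>

definition t :: real where "t = l powr (- (\<delta> * M / 2))"
definition Qg :: "real \<Rightarrow> nat set" where
  "Qg H = {q\<in>Q (exp l) H. (\<Sum>p\<in>PH H. real (J H + 1) * real (card (overlaps I (int (J H)) p (int q))) / real p) \<le> t}"
text \<open>Six logarithms come from the loss \<open>L\<close>; the seventh absorbs the
  constants.\<close>

definition v :: real where "v = (ln l)^7 * l powr (- (\<delta> * M))"

lemmas yz = y_z_bounds[OF \<delta>(1) l n13 n4 n12]

lemma lpos: "l > 0" "l \<ge> 1" using l by linarith+

lemma lnl: "ln l \<ge> 1" by (rule yz(4))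

lemma yr_pos: "yr > 0" using yz(3) exp_gt_zero[of l] by linarith

lemma ld1: "l powr \<delta> \<ge> 1" using l \<delta> by (simp add: ge_one_powr_ge_zero)

lemma t_sq: "t\<^sup>2 = l powr (- (\<delta> * M))"
  unfolding t_def power2_eq_square by (simp add: mult.commute flip: powr_add)

lemma t_bounds: "t > 0" "t \<le> 1/6" "t * l powr (\<delta> * M / 2) = 1"
proof -
  show "t > 0" unfolding t_def using lpos by simp
  show 1: "t * l powr (\<delta> * M / 2) = 1" unfolding t_def using lpos by (simp flip: powr_add)
  have "t * 6 \<le> t * l powr (\<delta> * M / 2)" using n8 \<open>t > 0\<close> by (intro mult_left_mono) auto
  then show "t \<le> 1/6" using 1 by linarith
qed

lemma v_pos: "v > 0"
proof -
  have "ln l > 0" using lnl by linarith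
  moreover have "l powr (- (\<delta> * M)) > 0" using lpos by simp
  ultimately show ?thesis unfolding v_def by (intro mult_pos_pos zero_less_power)
qed

lemma PH_prime: "p \<in> PH H \<Longrightarrow> prime p" unfolding PH_def by simp
lemma PH_lower: "p \<in> PH H \<Longrightarrow> H powr M \<le> real p" unfolding PH_def by simp
lemma fin_PH: "finite (PH H)" unfolding PH_def by (rule finite_subset[OF _ finite_primes_le[of z]]) auto

lemma scale_facts:
  assumes H: "H \<in> SC"
  shows "2 * l powr \<delta> \<le> H" "H \<le> sqrt l / (\<xi> * ln l)" "l powr \<delta> \<le> H" "H \<ge> 2" "H\<^sup>2 \<le> l / (ln l)\<^sup>2" "H\<^sup>2 \<le> l" "H \<le> l"
    "\<xi> * H * z \<le> yr"
proof -
  have sc: "2 * yr / x \<le> H" "H \<le> yr / (\<xi> * z)" using H unfolding scales_def by auto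
  have "l powr \<delta> \<le> yr / x" using yz(1) by (simp add: pos_le_divide_eq mult.commute)
  then show 1: "2 * l powr \<delta> \<le> H" using sc(1) by simp
  then show "l powr \<delta> \<le> H" "H \<ge> 2" using ld1 by linarith+
  show "\<xi> * H * z \<le> yr" using sc(2) \<xi> yz(10) by (simp add: pos_le_divide_eq mult_ac)
  have "yr / (\<xi> * z) = (yr / z) / \<xi>" by simp
  also have "\<dots> = sqrt l / (\<xi> * ln l)" unfolding yz(9) by simp
  finally show 2: "H \<le> sqrt l / (\<xi> * ln l)" using sc(2) by simp
  also have "\<dots> \<le> sqrt l / (1 * ln l)"
  proof (intro divide_left_mono mult_right_mono mult_pos_pos)
    show "0 < ln l" "0 < ln l" "0 \<le> ln l" using lnl by linarith+
  qed (use \<xi> lpos in auto)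
  finally have 3: "H \<le> sqrt l / ln l" by simp
  have "H\<^sup>2 \<le> (sqrt l / ln l)\<^sup>2" using 3 \<open>H \<ge> 2\<close> by (intro power_mono) auto
  also have "\<dots> = l / (ln l)\<^sup>2" using lpos by (simp add: power_divide)
  finally show 4: "H\<^sup>2 \<le> l / (ln l)\<^sup>2" .
  also have "\<dots> \<le> l / 1" using lnl lpos by (intro divide_left_mono) (auto simp: one_le_power)
  finally show "H\<^sup>2 \<le> l" by simp
  then show "H \<le> l" using \<open>H \<ge> 2\<close> self_le_power[of H 2] by linarith
qed

text \<open>Lower bounds for powers of H come from H \<ge> l^\<delta>, upper bounds from H^2 \<le>
  l. The estimate of H^2 / H^M keeps the extra power of l by which the mean overlap falls short of
  t.\<close>

lemma scale_powers:
  assumes H: "H \<in> SC"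
  defines "R \<equiv> H powr (M / 2)"
  shows "R\<^sup>2 = H powr M" "H\<^sup>2 \<le> R" "1 / R \<le> t" "1 / H ^ 6 \<le> t\<^sup>2" "H\<^sup>2 / H powr M \<le> t * l powr (- (\<delta> * (M / 2 - 2)))"
    "H powr M \<le> z" "H powr M \<ge> 2" "(H ^ 8) ^ 3 \<le> yr" "R > 0"
proof -
  note sf = scale_facts[OF H]
  have H0: "H > 0" "H \<ge> 1" using sf(4) by linarith+
  show R2: "R\<^sup>2 = H powr M" unfolding R_def power2_eq_square by (simp flip: powr_add)
  show R0: "R > 0" unfolding R_def using H0 by simp
  have "H powr 2 \<le> H powr (M / 2)" using H0 M by (intro powr_mono) auto
  then show HR: "H\<^sup>2 \<le> R" unfolding R_def using H0 by simp
  have pw: "l powr (\<delta> * e) \<le> H powr e" if "e \<ge> 0" for e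
  proof -
    have "l powr (\<delta> * e) = (l powr \<delta>) powr e" by (simp add: powr_powr)
    also have "\<dots> \<le> H powr e" using sf(3) that ld1 by (intro powr_mono2) auto
    finally show ?thesis .
  qed
  have Rt: "l powr (\<delta> * M / 2) \<le> R" using pw[of "M / 2"] M unfolding R_def by simp
  show Rt': "1 / R \<le> t"
  proof -
    have "1 / R \<le> 1 / l powr (\<delta> * M / 2)" using Rt lpos R0 by (intro divide_left_mono) auto
    also have "\<dots> = t" unfolding t_def by (simp add: powr_minus_divide)
    finally show ?thesis .
  qed
  show "1 / H ^ 6 \<le> t\<^sup>2"
  proof -
    have "l powr (\<delta> * M) \<le> l powr (\<delta> * 6)" using lpos M \<delta> by (intro powr_mono mult_left_mono) auto
    also have "\<dots> \<le> H powr 6" by (rule pw) simp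
    also have "\<dots> = H ^ 6" using H0 by simp
    finally have "1 / H ^ 6 \<le> 1 / l powr (\<delta> * M)" using lpos H0 by (intro divide_left_mono) auto
    then show ?thesis unfolding t_sq by (simp add: powr_minus_divide)
  qed
  show "H\<^sup>2 / H powr M \<le> t * l powr (- (\<delta> * (M / 2 - 2)))"
  proof -
    have "H powr M = R * (H powr (M / 2 - 2) * H\<^sup>2)"
    proof -
      have "R * (H powr (M / 2 - 2) * H\<^sup>2) = H powr (M / 2) * (H powr (M / 2 - 2) * H powr 2)" unfolding R_def using H0 by simp
      also have "\<dots> = H powr (M / 2 + (M / 2 - 2 + 2))" by (simp only: powr_add)
      finally show ?thesis by simp
    qed
    then have "H\<^sup>2 / H powr M = (1 / R) * (1 / H powr (M / 2 - 2))" using H0 by simp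
    also have "\<dots> \<le> t * (1 / l powr (\<delta> * (M / 2 - 2)))"
      using Rt' pw[of "M / 2 - 2"] M lpos H0 t_bounds R0 by (intro mult_mono divide_left_mono) auto
    finally show ?thesis by (simp add: powr_minus_divide)
  qed
  have l6: "l ^ 6 \<le> exp (l / 2)"
  proof (rule power2_le_imp_le)
    show "(l ^ 6)\<^sup>2 \<le> (exp (l / 2))\<^sup>2" using n3 by (simp flip: power_mult exp_double)
  qed simp
  show "H powr M \<le> z"
  proof -
    have "H powr M \<le> H powr 6" using H0 M by (intro powr_mono) auto
    also have "\<dots> = (H\<^sup>2) ^ 3" using H0 by (simp flip: power_mult)
    also have "\<dots> \<le> l ^ 3" using sf(6) by (intro power_mono) auto
    also have "\<dots> \<le> l ^ 6" using lpos by (intro power_increasing) auto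
    finally show ?thesis using l6 yz(5) by linarith
  qed
  have "2 \<le> H powr 1" using sf(4) by simp
  also have "\<dots> \<le> H powr M" using H0 M by (intro powr_mono) auto
  finally show "H powr M \<ge> 2" .
  have "(H ^ 8) ^ 3 = (H\<^sup>2) ^ 12" by (simp flip: power_mult)
  also have "\<dots> \<le> l ^ 12" using sf(6) by (intro power_mono) auto
  finally show "(H ^ 8) ^ 3 \<le> yr" using n3 yz(3) by linarith
qed

lemma J_bounds:
  assumes H: "H \<in> SC"
  shows "real (J H) \<le> real K * H" "\<phi> * (real K * H) \<le> real (J H)" "J H \<ge> 1" "real (J H) * b \<le> \<kappa> * H" "64 * (real (J H) * b)\<^sup>2 \<le> H powr M"
proof -
  note sf = scale_facts[OF H] and sp = scale_powers[OF H]
  have KH: "real K * H \<ge> 2 * 2" using K sf(4) by (intro mult_mono) auto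
  show 1: "real (J H) \<le> real K * H" unfolding J_def using KH by (intro of_nat_floor) auto
  have "real (J H) \<ge> real K * H - 1" unfolding J_def using KH by linarith
  \<comment> \<open>The proportion 1 - \<phi> of K H pays for rounding down to an integer.\<close>
  moreover have "1 \<le> (1 - \<phi>) * (real K * H)"
  proof -
    have "1 / (1 - \<phi>) \<le> H" using n14(3) sf(3) by linarith
    also have "\<dots> \<le> real K * H" using K sf(4) mult_right_mono[of 1 "real K" H] by simp
    finally show ?thesis using \<phi> by (simp add: pos_divide_le_eq mult.commute)
  qed
  ultimately show "\<phi> * (real K * H) \<le> real (J H)" by (simp add: left_diff_distrib)
  show "J H \<ge> 1" using \<open>real (J H) \<ge> real K * H - 1\<close> KH by linarith
  show 2: "real (J H) * b \<le> \<kappa> * H" using mult_right_mono[OF 1, of b] b by (simp add: mult_ac)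
  have "64 * (real (J H) * b)\<^sup>2 \<le> 64 * (\<kappa> * H)\<^sup>2" using 2 b by (intro mult_left_mono power_mono) auto
  also have "\<dots> = (64 * \<kappa>\<^sup>2) * H\<^sup>2" by (simp add: power_mult_distrib)
  also have "\<dots> \<le> H\<^sup>2 * H\<^sup>2"
  proof (rule mult_right_mono)
    have "l powr (2 * \<delta>) = l powr \<delta> * l powr \<delta>" by (simp flip: powr_add)
    also have "\<dots> \<le> H * H" using sf(3,4) ld1 by (intro mult_mono) auto
    finally show "64 * \<kappa>\<^sup>2 \<le> H\<^sup>2" using n5 by (simp add: power2_eq_square)
  qed simp
  also have "\<dots> \<le> H powr (M / 2) * H powr (M / 2)" using sp(2) by (intro mult_mono) auto
  also have "\<dots> = H powr M" using sp(1) by (simp add: power2_eq_square)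
  finally show "64 * (real (J H) * b)\<^sup>2 \<le> H powr M" .
qed

lemma sum_PH: 
  shows "(\<Sum>p\<in>PH H. 1 / real p) \<le> 7 + 2 * ln l"
proof -
  have z2: "z \<ge> 2"
  proof -
    have "(2::real) \<le> exp 1" using exp_ge_add_one_self[of 1] by simp
    also have "\<dots> \<le> exp (l / 2)" using l by simp
    finally show ?thesis using yz(5) by linarith
  qed
  have "(\<Sum>p\<in>PH H. 1 / real p) \<le> (\<Sum>p | prime p \<and> real p \<le> z. 1 / real p)"
    unfolding PH_def by (intro sum_mono2) auto
  also have "\<dots> \<le> 5 + 2 * ln (ln z)" by (rule sum_recip_primes_le[OF z2])
  also have "ln (ln z) \<le> ln (2 * l)" using yz(7,8) lpos by (subst ln_le_cancel_iff) auto
  also have "\<dots> = ln 2 + ln l" using lpos by (simp add: ln_mult)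
  also have "ln 2 \<le> (1::real)" using ln_2_less_1 by simp
  finally show ?thesis by simp
qed

lemma variance_at_scale:
  assumes H: "H \<in> SC"
  shows "2 * variance_bound (PH H) (real (J H) * b) (H powr M) (H ^ 8) ((ln l)^6) (exp (- l / 4)) (4 * ((ln l)^6 + 1)) t 
         + 2 * (6 * t + 10 * (real (J H) * b)\<^sup>2 / H powr M)\<^sup>2 \<le> v"
proof -
  note sf = scale_facts[OF H] and sp = scale_powers[OF H] and jb = J_bounds[OF H]
  have k1: "\<kappa> \<ge> 1" using K b mult_mono[of 1 "real K" 1 b] by auto
  have "2 * variance_bound (PH H) (real (J H) * b) ((H powr (M / 2))\<^sup>2) (H ^ 8) ((ln l)^6) (exp (- l / 4)) (4 * ((ln l)^6 + 1)) t 
         + 2 * (6 * t + 10 * (real (J H) * b)\<^sup>2 / (H powr (M / 2))\<^sup>2)\<^sup>2 \<le> 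
      100000 * \<kappa> ^ 4 * (ln l)^6 * t\<^sup>2 + 1088 * \<kappa> ^ 3 * H * exp (- l / 4) + 8 * exp (- l / 4) * exp (32 * (\<kappa> * H)\<^sup>2 * (\<Sum>p\<in>PH H. 1 / real p))"
    by (rule variance_numerics) (use sf sp jb k1 t_bounds lnl b in \<open>auto simp: one_le_power\<close>)
  also have "1088 * \<kappa> ^ 3 * H * exp (- l / 4) \<le> 1088 * \<kappa> ^ 3 * l * exp (- l / 4)"
    using sf(7) k1 by (intro mult_right_mono mult_left_mono) auto
  \<comment> \<open>Since H^2 \<le> l / (ln l)^2, the exponent is O(l / ln l), so exp(-l/4) still
    wins.\<close>
  also have "exp (32 * (\<kappa> * H)\<^sup>2 * (\<Sum>p\<in>PH H. 1 / real p)) \<le> exp (32 * \<kappa>\<^sup>2 * (l / (ln l)\<^sup>2) * (7 + 2 * ln l))"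
  proof -
    have "32 * (\<kappa> * H)\<^sup>2 = 32 * \<kappa>\<^sup>2 * H\<^sup>2" by (simp add: power_mult_distrib)
    also have "\<dots> \<le> 32 * \<kappa>\<^sup>2 * (l / (ln l)\<^sup>2)" using sf(5) by (intro mult_left_mono) auto
    finally have "32 * (\<kappa> * H)\<^sup>2 * (\<Sum>p\<in>PH H. 1 / real p) \<le> 32 * \<kappa>\<^sup>2 * (l / (ln l)\<^sup>2) * (7 + 2 * ln l)"
      using sum_PH[of H] lpos by (intro mult_mono[of "32 * (\<kappa> * H)\<^sup>2"]) (auto intro: sum_nonneg)
    then show ?thesis by simp
  qed
  finally have "2 * variance_bound (PH H) (real (J H) * b) ((H powr (M / 2))\<^sup>2) (H ^ 8) ((ln l)^6) (exp (- l / 4)) (4 * ((ln l)^6 + 1)) t 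
         + 2 * (6 * t + 10 * (real (J H) * b)\<^sup>2 / (H powr (M / 2))\<^sup>2)\<^sup>2 \<le> 
      100000 * \<kappa> ^ 4 * (ln l)^6 * t\<^sup>2 + 1088 * \<kappa> ^ 3 * l * exp (- l / 4) + 8 * exp (- l / 4) * exp (32 * \<kappa>\<^sup>2 * (l / (ln l)\<^sup>2) * (7 + 2 * ln l))" 
    by simp
  also have "\<dots> \<le> v" unfolding v_def t_sq using n6 by linarith
  finally show ?thesis unfolding sp(1) .
qed


text \<open>The quarter allows for \<phi>^2 \<ge> 1/4, so the same constant fits the full family and
  the family of good primes.\<close>

abbreviation "c \<equiv> \<rho> * (1 - 1 / \<xi>) / 4"
definition X :: "real \<Rightarrow> real" where "X H = \<rho> * (1 - 1 / \<xi>) * (yr / (H * l))"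

lemma c_pos: "c > 0" "1 - 1 / \<xi> > 0" "1 - 1 / \<xi> < 1"
  using \<rho> \<xi> by auto

lemma X_pos: "H \<in> SC \<Longrightarrow> X H > 0"
  unfolding X_def using scale_facts(4)[of H] c_pos \<rho> yr_pos lpos by (intro mult_pos_pos divide_pos_pos) auto

lemma Q_facts:
  assumes H: "H \<in> SC"
  shows "finite (Q x H)" "\<And>q. q \<in> Q x H \<Longrightarrow> prime q" "\<And>q. q \<in> Q x H \<Longrightarrow> z < real q" "\<And>q. q \<in> Q x H \<Longrightarrow> real q * H \<le> yr"
    "\<phi> * X H \<le> real (card (Q x H))" "real (card (Q x H)) \<le> 2 * X H"
proof -
  note sf = scale_facts[OF H] and fam = family(1)[OF H]
  have H0: "H > 0" using sf(4) by linarith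
  show "finite (Q x H)" by (rule finite_subset[OF _ finite_primes_le[of "yr / H"]]) (use fam in auto)
  show "prime q" if "q \<in> Q x H" for q using fam that by auto
  show "z < real q" if "q \<in> Q x H" for q
  proof -
    have "z \<le> yr / (\<xi> * H)" using sf(8) \<xi> H0 by (simp add: pos_le_divide_eq mult_ac)
    moreover have "yr / (\<xi> * H) < real q" using fam that by auto
    ultimately show ?thesis by linarith
  qed
  show "real q * H \<le> yr" if "q \<in> Q x H" for q
  proof -
    have "real q \<le> yr / H" using fam that by auto
    then show ?thesis using H0 by (simp add: pos_le_divide_eq)
  qed
  have dev: "\<bar>real (card (Q x H)) - X H\<bar> \<le> (1 - \<phi>) * X H" unfolding X_def by (rule family(2)[OF H])
  have "(1 - \<phi>) * X H \<le> 1 * X H" using X_pos[OF H] \<phi> by (intro mult_right_mono) auto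
  then show "real (card (Q x H)) \<le> 2 * X H" using dev by linarith
  have "(1 - \<phi>) * X H = X H - \<phi> * X H" by (simp add: algebra_simps)
  then show "\<phi> * X H \<le> real (card (Q x H))" using dev by linarith
qed

lemma I_facts: "prime p \<Longrightarrow> finite (I p)" "prime p \<Longrightarrow> real (card (I p)) \<le> b" "prime p \<Longrightarrow> card (I p) < p"
proof -
  assume p: "prime p"
  show "finite (I p)" using sys p finite_subset unfolding sieving_system_def by blast
  show "real (card (I p)) \<le> b" using bdd p unfolding bounded_by_def by blast
  have "card (I p) \<le> p - 1" using nondeg p unfolding non_degenerate_def by blast
  then show "card (I p) < p" using prime_gt_0_nat[OF p] by linarith
qed

lemmas at_scale = prime_family_at_scale[OF brun lpos(2) c_pos(1) yz(5) yz(3), OF _ _ n1 n2]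

lemma c_X: "H \<in> SC \<Longrightarrow> c * (yr / (H * l)) \<le> \<phi> * (\<phi> * X H)"
proof -
  assume H: "H \<in> SC"
  have "1/4 * X H \<le> \<phi> * \<phi> * X H"
    using \<phi> X_pos[OF H] mult_mono[of "1/2" \<phi> "1/2" \<phi>] by (intro mult_right_mono) auto
  then show ?thesis unfolding X_def by (simp add: mult.assoc)
qed

text \<open>Class counts for the full family bound its mean overlap, whence a proportion \<phi> is
  good; the other factor \<phi> is the accuracy of the assumed size of \<Q>_H.\<close>

lemma Qg_card:
  assumes H: "H \<in> SC"
  shows "\<phi> * (\<phi> * X H) \<le> real (card (Qg H))" "real (card (Qg H)) \<le> 2 * X H"
proof -
  note sf = scale_facts[OF H] and sp = scale_powers[OF H] and jb = J_bounds[OF H] and Q = Q_facts[OF H]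
  let ?\<eta> = "exp (- l / 4)" let ?L = "(ln l) ^ 6"
  have H1: "H \<ge> 1" using sf(4) by linarith
  have X0: "X H \<ge> 0" using X_pos[OF H] by simp
  have "\<phi> * (\<phi> * X H) \<le> 1 * (\<phi> * X H)" using \<phi> X0 by (intro mult_right_mono) auto
  then have cQ: "c * (yr / (H * l)) \<le> real (card (Q x H))" using c_X[OF H] Q(5) by linarith
  have JP: "J H < p" if p: "p \<in> PH H" for p
  proof -
    have "1 \<le> real (J H) * b" using jb(3) b mult_mono[of 1 "real (J H)" 1 b] by simp
    have "real (J H) \<le> real (J H) * b" using b mult_left_mono[of 1 b "real (J H)"] by simp
    also have "\<dots> \<le> (real (J H) * b)\<^sup>2" using \<open>1 \<le> real (J H) * b\<close> self_le_power[of "real (J H) * b" 2] by simp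
    also have "\<dots> < 64 * (real (J H) * b)\<^sup>2" using b jb(3) by simp
    also have "\<dots> \<le> real p" using jb(5) PH_lower[OF p] by linarith
    finally show ?thesis by simp
  qed
  have small: "4 * (real (J H) * b)\<^sup>2 * (4 * ?L / H powr M + ?\<eta> * (\<Sum>p\<in>PH H. 1 / real p)) \<le> (1 - \<phi>) * t"
  proof -
    let ?D = "l powr (- (\<delta> * (M / 2 - 2)))"
    have j2: "(real (J H) * b)\<^sup>2 \<le> \<kappa>\<^sup>2 * H\<^sup>2"
      using power_mono[OF jb(4), of 2] b by (simp add: power_mult_distrib)
    have s0: "(\<Sum>p\<in>PH H. 1 / real p) \<ge> 0" by (intro sum_nonneg) auto
    have "4 * (real (J H) * b)\<^sup>2 * (4 * ?L / H powr M + ?\<eta> * (\<Sum>p\<in>PH H. 1 / real p)) 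
       \<le> 4 * (\<kappa>\<^sup>2 * H\<^sup>2) * (4 * ?L / H powr M + ?\<eta> * (7 + 2 * ln l))"
    proof (intro mult_mono mult_left_mono add_mono j2 sum_PH order_refl)
      show "0 \<le> 4 * ?L / H powr M + ?\<eta> * (\<Sum>p\<in>PH H. 1 / real p)" using s0 by (intro add_nonneg_nonneg divide_nonneg_nonneg mult_nonneg_nonneg) auto
    qed (use s0 in auto)
    also have "\<dots> = 16 * \<kappa>\<^sup>2 * ?L * (H\<^sup>2 / H powr M) + (4 * \<kappa>\<^sup>2 * (?\<eta> * (7 + 2 * ln l))) * H\<^sup>2" by (simp add: algebra_simps)
    also have "\<dots> \<le> 16 * \<kappa>\<^sup>2 * ?L * (t * ?D) + (4 * \<kappa>\<^sup>2 * (?\<eta> * (7 + 2 * ln l))) * l"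
      using sp(5) sf(6) lnl by (intro add_mono mult_left_mono mult_nonneg_nonneg) auto
    also have "\<dots> = 16 * \<kappa>\<^sup>2 * ?L * (t * ?D) + (4 * \<kappa>\<^sup>2 * (?\<eta> * (7 + 2 * ln l))) * l * (t * l powr (\<delta> * M / 2))"
      unfolding t_bounds(3) by simp
    also have "\<dots> = (16 * \<kappa>\<^sup>2 * ?L * ?D + 4 * \<kappa>\<^sup>2 * l * ?\<eta> * (7 + 2 * ln l) * l powr (\<delta> * M / 2)) * t" by (simp only: algebra_simps)
    also have "\<dots> \<le> (1 - \<phi>) * t" using n7 t_bounds(1) by (intro mult_right_mono) auto
    finally show ?thesis .
  qed
  have "\<phi> * real (card (Q x H)) \<le> real (card (Qg H))" unfolding Qg_def
  proof (rule most_primes_good[OF fin_PH PH_prime PH_lower sp(7) JP I_facts(1)[OF PH_prime] I_facts(2)[OF PH_prime]])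
    show "real (card {\<omega> \<in> int ` Q x H. in_class D r \<omega>}) \<le> real (card (Q x H)) * (?L * (\<Prod>p\<in>D. 2 / real p) + ?\<eta>)" if D: "D \<subseteq> PH H" for D r
      using at_scale(1)[OF H1 sf(6) Q(1-4) cQ, of D r] D finite_subset[OF D fin_PH] PH_prime by blast
  qed (use b jb Q(1) t_bounds lnl small in auto)
  moreover have "\<phi> * (\<phi> * X H) \<le> \<phi> * real (card (Q x H))" using Q(5) \<phi> by (intro mult_left_mono) auto
  ultimately show "\<phi> * (\<phi> * X H) \<le> real (card (Qg H))" by linarith
  have "card (Qg H) \<le> card (Q x H)" unfolding Qg_def using Q(1) by (intro card_mono) auto
  then show "real (card (Qg H)) \<le> 2 * X H" using Q(6) by linarith
qed

text \<open>The upper bound sieve knows nothing of which primes were kept. The estimates therefore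
  hold relative to the smaller family as soon as its size has the right order.\<close>

lemma Qg_facts:
  assumes H: "H \<in> SC"
  shows "finite (Qg H)" "\<And>q. q \<in> Qg H \<Longrightarrow> prime q" "\<And>q. q \<in> Qg H \<Longrightarrow> z < real q" "\<And>q. q \<in> Qg H \<Longrightarrow> real q * H \<le> yr"
    and "\<And>D r. D \<subseteq> PH H \<Longrightarrow> real (card {\<omega>\<in>int ` Qg H. in_class D r \<omega>}) 
          \<le> real (card (Qg H)) * ((ln l) ^ 6 * (\<Prod>p\<in>D. 2 / real p) + exp (- l / 4))"
    and "\<And>\<alpha>. (\<And>\<omega>. \<omega> \<in> int ` Qg H \<Longrightarrow> \<bar>\<alpha> \<omega>\<bar> \<le> 2) \<Longrightarrow>
       (\<Sum>p | p \<in> PH H \<and> real p \<le> H ^ 8. real p * (\<Sum>r\<in>{0..<int p}. (class_dev (int ` Qg H) \<alpha> p r)\<^sup>2)) 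
        \<le> 4 * ((ln l) ^ 6 + 1) * (real (card (Qg H)))\<^sup>2"
proof -
  note sf = scale_facts[OF H] and Q = Q_facts[OF H]
  have sub: "Qg H \<subseteq> Q x H" unfolding Qg_def by blast
  show 1: "finite (Qg H)" using sub Q(1) finite_subset by blast
  show 2: "\<And>q. q \<in> Qg H \<Longrightarrow> prime q" and 3: "\<And>q. q \<in> Qg H \<Longrightarrow> z < real q" and 4: "\<And>q. q \<in> Qg H \<Longrightarrow> real q * H \<le> yr"
    using sub Q by auto
  have H1: "H \<ge> 1" using sf(4) by linarith
  have cQ: "c * (yr / (H * l)) \<le> real (card (Qg H))" using c_X[OF H] Qg_card[OF H] by linarith
  show "real (card {\<omega>\<in>int ` Qg H. in_class D r \<omega>}) \<le> real (card (Qg H)) * ((ln l) ^ 6 * (\<Prod>p\<in>D. 2 / real p) + exp (- l / 4))"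
    if D: "D \<subseteq> PH H" for D r
    using at_scale(1)[OF H1 sf(6) 1 2 3 4 cQ, of D r] D finite_subset[OF D fin_PH] PH_prime by blast
  show "(\<Sum>p | p \<in> PH H \<and> real p \<le> H ^ 8. real p * (\<Sum>r\<in>{0..<int p}. (class_dev (int ` Qg H) \<alpha> p r)\<^sup>2)) 
        \<le> 4 * ((ln l) ^ 6 + 1) * (real (card (Qg H)))\<^sup>2" if "\<And>\<omega>. \<omega> \<in> int ` Qg H \<Longrightarrow> \<bar>\<alpha> \<omega>\<bar> \<le> 2" for \<alpha>
    by (rule at_scale(2)[OF H1 sf(6) 1 2 3 4 cQ]) (use that fin_PH PH_prime in auto)
qed

text \<open>Stated for any set of scales, so that \<open>C_2\<close> can be trimmed before the
  residues are drawn.\<close>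

lemma random_sieve:
  assumes "finite Hs" "Hs \<subseteq> SC"
  shows "random_sieve I b M z K y Hs Qg ((ln l) ^ 6) (exp (- l / 4)) (4 * ((ln l) ^ 6 + 1)) t v J PH"
proof -
  have L1: "(ln l) ^ 6 \<ge> 1" using lnl by (rule one_le_power)
  have y1: "y \<ge> 1" using yr_pos by simp
  have ey: "1 / yr \<le> exp (- l / 4)"
  proof -
    have "1 / yr \<le> 1 / exp l" using yz(3) by (intro divide_left_mono mult_pos_pos yr_pos) auto
    also have "\<dots> = exp (- l)" by (simp add: exp_minus inverse_eq_divide)
    also have "\<dots> \<le> exp (- l / 4)" using lpos by simp
    finally show ?thesis .
  qed
  have sc: "\<And>H. H \<in> Hs \<Longrightarrow> H \<in> SC" using assms(2) by blast
  show ?thesis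
  proof
    show "J = (\<lambda>H. nat \<lfloor>real K * H\<rfloor>)" by (rule J_def)
    show "PH = (\<lambda>H. {p. prime p \<and> H powr M < real p \<and> real p \<le> z})" by (rule PH_def)
    show "(\<Sum>p\<in>PH H. real (J H + 1) * real (card (overlaps I (int (J H)) p (int q))) / real p) \<le> t" if "q \<in> Qg H" for H q
      using that unfolding Qg_def by simp
    show "2 * variance_bound (PH H) (real (J H) * b) (H powr M) (H ^ 8) ((ln l) ^ 6) (exp (- l / 4)) (4 * ((ln l) ^ 6 + 1)) t
         + 2 * (6 * t + 10 * (real (J H) * b)\<^sup>2 / H powr M)\<^sup>2 \<le> v" if "H \<in> Hs" for H by (rule variance_at_scale[OF sc[OF that]])
    show "t \<ge> 0" "t \<le> 1/6" "exp (- l / 4) \<ge> 0" using t_bounds by auto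
    show "4 * ((ln l) ^ 6 + 1) \<ge> 8" using L1 by simp
    show "K \<ge> 1" using K by simp
  qed (fact sys nondeg bdd b assms(1) L1 y1 ey scale_facts(4)[OF sc] J_bounds(5)[OF sc] scale_powers(6,7,8)[OF sc] Qg_facts[OF sc])+
qed


text \<open>With \<open>m\<close>, this repeats notions of \<open>random_sieve\<close> that are
  needed earlier: the set of scales on which that locale is interpreted is selected by their
  values.\<close>

definition s2 :: "real \<Rightarrow> real" where "s2 H = (\<Prod>p\<in>PH H. 1 - real (card (I p)) / real p)"
definition m :: "real \<Rightarrow> real" where "m H = real (card (Qg H)) * real (J H) / s2 H"

lemma ln_scale: "H \<in> SC \<Longrightarrow> ln H > 0" "H \<in> SC \<Longrightarrow> ln H \<ge> 4 * \<rho>"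
proof -
  assume H: "H \<in> SC"
  note sf = scale_facts[OF H]
  show "ln H > 0" using sf(4) by (intro ln_gt_zero) linarith
  have "ln (exp (4 * \<rho>)) \<le> ln H" using sf(3,4) n14(2) by (subst ln_le_cancel_iff) auto
  then show "ln H \<ge> 4 * \<rho>" by simp
qed

text \<open>A quotient of two densities, each known up to a factor \<phi> from one-dimensionality,
  in which C1 cancels.\<close>

lemma s2_bounds:
  assumes H: "H \<in> SC"
  shows "s2 H > 0" "\<phi>\<^sup>2 * (M * ln H / ln z) \<le> s2 H" "\<phi>\<^sup>2 * s2 H \<le> M * ln H / ln z"
proof -
  note sf = scale_facts[OF H] and sp = scale_powers[OF H] 
  show s0: "s2 H > 0" unfolding s2_def
    using I_facts(3)[OF PH_prime] by (intro prod_pos) (auto simp: divide_less_eq_1)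
  have split: "sieve_density I z = sieve_density I (H powr M) * s2 H"
    unfolding s2_def PH_def by (rule sieve_density_split[OF sp(6)])
  have H1: "H \<ge> 1" using sf(4) by linarith
  have "H powr 1 \<le> H powr M" using H1 M by (intro powr_mono) auto
  then have "W \<le> H powr M" using n14(1) sf(3) H1 by simp
  then have dw: "\<phi> * (C1 / (M * ln H)) \<le> sieve_density I (H powr M)" "sieve_density I (H powr M) \<le> C1 / (M * ln H) / \<phi>"
    and dz: "\<phi> * (C1 / ln z) \<le> sieve_density I z" "sieve_density I z \<le> C1 / ln z / \<phi>"
    using density[of "H powr M"] density[of z] sp(6) H1 by (auto simp: ln_powr)
  define u w where "u = M * ln H" and "w = ln z"
  have uw: "u > 0" "w > 0" unfolding u_def w_def using ln_scale(1)[OF H] M yz(8) lpos by auto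
  note du = dw[folded u_def] dz[folded w_def]
  have \<phi>0: "\<phi> > 0" using \<phi> by linarith
  have "\<phi> * (C1 / w) \<le> C1 / u / \<phi> * s2 H" using du(3) mult_right_mono[OF du(2), of "s2 H"] s0 unfolding split by linarith
  then have "(u / C1 * \<phi>) * (\<phi> * (C1 / w)) \<le> (u / C1 * \<phi>) * (C1 / u / \<phi> * s2 H)" using uw \<phi>0 C1 by (intro mult_left_mono) auto
  then show "\<phi>\<^sup>2 * (M * ln H / ln z) \<le> s2 H" unfolding u_def[symmetric] w_def[symmetric] using uw \<phi>0 C1 by (simp add: power2_eq_square mult_ac)
  have "\<phi> * (C1 / u) * s2 H \<le> C1 / w / \<phi>" using du(4) mult_right_mono[OF du(1), of "s2 H"] s0 unfolding split by linarith
  then have "(u / C1 * \<phi>) * (\<phi> * (C1 / u) * s2 H) \<le> (u / C1 * \<phi>) * (C1 / w / \<phi>)" using uw \<phi>0 C1 by (intro mult_left_mono) auto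
  then show "\<phi>\<^sup>2 * s2 H \<le> M * ln H / ln z" unfolding u_def[symmetric] w_def[symmetric] using uw \<phi>0 C1 by (simp add: power2_eq_square mult_ac)
qed

lemma card_J_le:
  assumes H: "H \<in> SC"
  shows "real (card (Qg H)) * real (J H) \<le> 2 * \<rho> * real K * yr / l"
proof -
  have H0: "H > 0" using scale_facts(4)[OF H] by linarith
  have "X H \<le> \<rho> * (yr / (H * l))" unfolding X_def using c_pos \<rho> yr_pos H0 lpos by (intro mult_right_mono) auto
  then have "real (card (Qg H)) * real (J H) \<le> (2 * (\<rho> * (yr / (H * l)))) * (real K * H)"
    using Qg_card(2)[OF H] J_bounds(1)[OF H] \<rho> yr_pos H0 lpos by (intro mult_mono) auto
  also have "\<dots> = 2 * \<rho> * real K * yr / l" using H0 by simp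
  finally show ?thesis .
qed

text \<open>Each scale contributes at most 1 to \<open>C_2\<close>, because ln H \<ge> 4 \<rho> for
  large x; this limits the overshoot when scales are discarded.\<close>

lemma m_le:
  assumes H: "H \<in> SC"
  shows "m H \<ge> 0" "m H \<le> (real K + 1) * yr"
proof -
  show "m H \<ge> 0" unfolding m_def using s2_bounds(1)[OF H] by simp
  have lz: "ln z > 0" "ln z \<le> 2 * l" using yz(7,8) lpos by linarith+
  have "ln H / (2 * l) = 1/4 * (4 * ln H / (2 * l))" by simp
  also have "\<dots> \<le> \<phi>\<^sup>2 * (M * ln H / ln z)"
    using power_mono[OF \<phi>(1), of 2] M ln_scale(1)[OF H] lz lpos by (intro mult_mono frac_le) (auto simp: power2_eq_square)
  also have "\<dots> \<le> s2 H" by (rule s2_bounds(2)[OF H])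
  finally have s: "ln H / (2 * l) \<le> s2 H" .
  have "m H \<le> (2 * \<rho> * real K * yr / l) / (ln H / (2 * l))" unfolding m_def
    using card_J_le[OF H] s ln_scale(1)[OF H] lpos \<rho> yr_pos by (intro frac_le) auto
  also have "\<dots> = real K * yr * (4 * \<rho>) / ln H" using lpos by simp
  also have "\<dots> \<le> real K * yr" using ln_scale[OF H] yr_pos by (simp add: pos_divide_le_eq mult_left_mono)
  also have "\<dots> \<le> (real K + 1) * yr" using yr_pos by simp
  finally show "m H \<le> (real K + 1) * yr" .
qed

text \<open>The six factors \<phi>: two for the number of good primes, one for rounding K H, two for
  the density quotient, one for replacing ln z by l.\<close>

lemma m_ge:
  assumes H: "H \<in> SC"
  shows "\<phi> ^ 6 * (\<rho> * (1 - 1 / \<xi>) * (real K / (real K + 1)) / M) * (1 / ln H) \<le> m H / ((real K + 1) * yr)"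
proof -
  have H0: "H > 0" using scale_facts(4)[OF H] by linarith
  note ls = ln_scale(1)[OF H] and sb = s2_bounds[OF H]
  have \<phi>0: "\<phi> > 0" using \<phi> by linarith
  have lz: "ln z > 0" using yz(8) lpos by linarith
  have "\<phi> ^ 3 * (l / (M * ln H)) = \<phi>\<^sup>2 * ((\<phi> * l) / (M * ln H))" by (simp add: power2_eq_square power3_eq_cube)
  also have "\<dots> \<le> \<phi>\<^sup>2 * (ln z / (M * ln H))" using yz(6) ls M by (intro mult_left_mono divide_right_mono) auto
  also have "\<dots> \<le> 1 / s2 H"
  proof -
    have "\<phi>\<^sup>2 * s2 H * (ln z / (M * ln H)) \<le> (M * ln H / ln z) * (ln z / (M * ln H))" using sb(3) lz ls M by (intro mult_right_mono) auto
    also have "\<dots> = 1" using lz ls M by simp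
    finally have "\<phi>\<^sup>2 * (ln z / (M * ln H)) * s2 H \<le> 1" by (simp only: mult_ac)
    then show ?thesis using sb(1) by (simp add: pos_le_divide_eq)
  qed
  finally have s: "\<phi> ^ 3 * (l / (M * ln H)) \<le> 1 / s2 H" .
  have "(\<phi> * (\<phi> * X H)) * (\<phi> * (real K * H)) * (\<phi> ^ 3 * (l / (M * ln H))) \<le> real (card (Qg H)) * real (J H) * (1 / s2 H)"
    using Qg_card(1)[OF H] J_bounds(2)[OF H] s \<phi>0 X_pos[OF H] H0 ls M lpos by (intro mult_mono) auto
  also have "\<dots> = m H" unfolding m_def by simp
  finally have "(\<phi> * (\<phi> * X H)) * (\<phi> * (real K * H)) * (\<phi> ^ 3 * (l / (M * ln H))) / ((real K + 1) * yr) \<le> m H / ((real K + 1) * yr)"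
    using yr_pos by (intro divide_right_mono) auto
  moreover have "(\<phi> * (\<phi> * X H)) * (\<phi> * (real K * H)) * (\<phi> ^ 3 * (l / (M * ln H))) / ((real K + 1) * yr) 
     = \<phi> ^ 6 * (\<rho> * (1 - 1 / \<xi>) * (real K / (real K + 1)) / M) * (1 / ln H)"
  proof -
    have "\<phi> ^ 6 = \<phi> * \<phi> * \<phi> * \<phi> ^ 3" by (simp add: eval_nat_numeral)
    then show ?thesis unfolding X_def using yr_pos H0 lpos by (simp add: mult_ac)
  qed
  ultimately show ?thesis by simp
qed

text \<open>The seventh factor \<phi> in \<open>target\<close> is spent on the harmonic sum, which
  is bounded below by \<phi> ln(1/(2\<delta>)) / ln \<xi> through ln A.\<close>

lemma scales_sum:
  shows "finite SC" "real (card SC) \<le> (ln l)\<^sup>2" "10 powr (2 * \<delta>) \<le> (\<Sum>H\<in>SC. m H / ((real K + 1) * yr))"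
proof -
  define lo hi A where "lo = 2 * yr / x" and "hi = sqrt l / (\<xi> * ln l)" and "A = exp (\<phi> * ln (1 / (2 * \<delta>)))"
  have lx: "ln \<xi> > 0" using \<xi> by simp
  have lnl0: "ln l > 0" using lnl by linarith
  have hi0: "hi > 0" unfolding hi_def using \<xi> lnl0 lpos by simp
  have "1 \<le> yr / x" using yz(3) by simp
  then have lo1: "lo > 1" unfolding lo_def times_divide_eq_right[symmetric] by linarith
  have "yr / x \<le> 2 * l powr \<delta>" using yz(2) by (simp add: pos_divide_le_eq mult_ac)
  then have lo2: "lo \<le> 4 * l powr \<delta>" unfolding lo_def by simp
  have ld: "ln (1 / (2 * \<delta>)) > 0" using \<delta> by (intro ln_gt_zero) (auto simp: less_divide_eq)
  have A1: "A > 1" unfolding A_def using ld \<phi> by simp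
  have lnlo: "0 < ln lo" "ln lo \<le> ln (4 * l powr \<delta>)"
  proof -
    show "0 < ln lo" using lo1 by simp
    show "ln lo \<le> ln (4 * l powr \<delta>)" using lo1 lo2 by (intro ln_mono) linarith+
  qed
  have AA: "A \<le> (ln hi / ln \<xi>) / (ln (4 * l powr \<delta>) / ln \<xi> + 1)" unfolding A_def hi_def by (rule n11)
  have den: "ln (4 * l powr \<delta>) / ln \<xi> + 1 > 0" using lnlo lx by (intro add_nonneg_pos) auto
  have nhi: "ln hi / ln \<xi> \<ge> 0"
  proof (rule ccontr)
    assume "\<not> ln hi / ln \<xi> \<ge> 0"
    then have "(ln hi / ln \<xi>) / (ln (4 * l powr \<delta>) / ln \<xi> + 1) < 0" using den by (intro divide_neg_pos[of "ln hi / ln \<xi>"]) linarith+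
    then show False using AA A1 by linarith
  qed
  have "(ln hi / ln \<xi>) / (ln (4 * l powr \<delta>) / ln \<xi> + 1) \<le> (ln hi / ln \<xi>) / (ln lo / ln \<xi> + 1)"
    using lnlo lx nhi by (intro divide_left_mono mult_pos_pos add_mono divide_right_mono add_nonneg_pos) auto
  then have A2: "A \<le> (ln hi / ln \<xi>) / (ln lo / ln \<xi> + 1)" using AA by linarith
  have "yr / (\<xi> * z) = (yr / z) / \<xi>" by simp
  also have "\<dots> = hi" unfolding yz(9) hi_def by simp
  finally have SC_eq: "SC = {H. (\<exists>k::nat. H = \<xi> ^ k) \<and> lo \<le> H \<and> H \<le> hi}" unfolding scales_def lo_def by simp
  note gs = geometric_scales[OF \<xi> lo1 hi0 A1 A2, folded SC_eq]
  show "finite SC" by (rule gs(1))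
  have "hi \<le> l"
  proof -
    have "1 * 1 \<le> \<xi> * ln l" using \<xi> lnl by (intro mult_mono) auto
    then have "hi \<le> sqrt l / 1" unfolding hi_def using lpos by (intro divide_left_mono) auto
    also have "\<dots> \<le> l" using lpos real_sqrt_le_iff[of l "l\<^sup>2"] by (simp add: power2_eq_square)
    finally show ?thesis .
  qed
  then have "ln hi \<le> ln l" using hi0 by simp
  then have "ln hi / ln \<xi> + 1 \<le> ln l / ln \<xi> + 1" using lx by (simp add: divide_right_mono)
  then show "real (card SC) \<le> (ln l)\<^sup>2" using gs(3) n10 by linarith
  let ?c = "\<phi> ^ 6 * (\<rho> * (1 - 1 / \<xi>) * (real K / (real K + 1)) / M)"
  have "10 powr (2 * \<delta>) \<le> ?c * (ln A / ln \<xi>)"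
  proof -
    have "\<phi> ^ 7 = \<phi> ^ 6 * \<phi>" by (simp add: eval_nat_numeral)
    then have "\<phi> ^ 7 * (\<rho> * (1 - 1 / \<xi>) / ln \<xi> * (real K / (real K + 1)) / M * ln (1 / (2 * \<delta>))) = ?c * (ln A / ln \<xi>)"
      unfolding A_def by (simp add: mult_ac)
    then show ?thesis using target by simp
  qed
  also have "\<dots> \<le> ?c * (\<Sum>H\<in>SC. 1 / ln H)" using gs(2) \<phi> \<rho> c_pos M by (intro mult_left_mono) auto
  also have "\<dots> = (\<Sum>H\<in>SC. ?c * (1 / ln H))" by (rule sum_distrib_left)
  also have "\<dots> \<le> (\<Sum>H\<in>SC. m H / ((real K + 1) * yr))" by (intro sum_mono m_ge)
  finally show "10 powr (2 * \<delta>) \<le> (\<Sum>H\<in>SC. m H / ((real K + 1) * yr))" .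
qed

text \<open>For powers of \<xi> the intervals (y / (\<xi> H), y / H] are pairwise disjoint, so the
  prime determines its scale.\<close>

lemma scale_of_eq:
  assumes H: "H \<in> SC" and q: "q \<in> Q x H"
  shows "scale_of \<delta> \<xi> x q = H"
proof -
  have q': "yr / (\<xi> * H) < real q" "real q \<le> yr / H" using family(1)[OF H] q by auto
  have le: "k1 \<le> k2" if "yr / (\<xi> * \<xi> ^ k2) < real q" "real q \<le> yr / \<xi> ^ k1" for k1 k2
  proof (rule ccontr)
    assume "\<not> k1 \<le> k2"
    then have "\<xi> ^ Suc k2 \<le> \<xi> ^ k1" using \<xi> by (intro power_increasing) auto
    then have "yr / \<xi> ^ k1 \<le> yr / (\<xi> * \<xi> ^ k2)" using yr_pos \<xi> by (intro divide_left_mono) auto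
    then show False using that by linarith
  qed
  show ?thesis unfolding scale_of_def
  proof (rule the_equality)
    show "H \<in> SC \<and> yr / (\<xi> * H) < real q \<and> real q \<le> yr / H" using H q' by blast
  next
    fix H' assume H': "H' \<in> SC \<and> yr / (\<xi> * H') < real q \<and> real q \<le> yr / H'"
    obtain k where k: "H = \<xi> ^ k" using H unfolding scales_def by blast
    obtain k' where k': "H' = \<xi> ^ k'" using H' unfolding scales_def by blast
    have "k \<le> k'" "k' \<le> k" using le H' q' unfolding k k' by blast+
    then show "H' = H" unfolding k k' by simp
  qed
qed


text \<open>Relative to x / l, the bad primes leave the exponent -\<delta>M +
  3\<delta>(1+\<epsilon>) + \<delta> of l and the deviations -\<delta>M + 2\<delta>(1+\<epsilon>) +
  \<delta>. Each part gets half of the allowance \<rho> / 8.\<close>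

lemma exceptions_bound:
  assumes Hs: "finite Hs" "Hs \<subseteq> SC"
  defines "\<tau> \<equiv> l powr (- \<delta> * (1 + \<epsilon>))"
  shows "16 * v / \<tau> ^ 3 * (\<Sum>H\<in>Hs. real (card (Qg H)) * real (J H)) + 8 * (real (card Hs))\<^sup>2 * sieve_density I z * yr * v / \<tau>\<^sup>2
     \<le> \<rho> * x / (8 * l)"
proof -
  have \<tau>0: "\<tau> > 0" unfolding \<tau>_def using lpos by simp
  have \<tau>n: "1 / \<tau> ^ n = l powr (real n * (\<delta> * (1 + \<epsilon>)))" for n
  proof -
    have "\<tau> ^ n = l powr (real n * (- \<delta> * (1 + \<epsilon>)))" unfolding \<tau>_def using lpos by (simp add: powr_power)
    also have "\<dots> = l powr (- (real n * (\<delta> * (1 + \<epsilon>))))" by (simp add: mult_ac)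
    finally show ?thesis by (simp add: powr_minus_divide)
  qed
  have "card Hs \<le> card SC" by (intro card_mono scales_sum(1) Hs(2))
  then have cH: "real (card Hs) \<le> (ln l)\<^sup>2" using scales_sum(2) by linarith
  have lnl0: "ln l \<ge> 0" using lnl by linarith
  have yr2: "yr \<le> 2 * (x * l powr \<delta>)" by (rule yz(2))
  have pw: "(ln l) ^ 9 \<le> (ln l) ^ 11" using lnl by (intro power_increasing) auto
  let ?e = "\<delta> * (1 + \<epsilon>)"
  have A: "16 * v / \<tau> ^ 3 * (\<Sum>H\<in>Hs. real (card (Qg H)) * real (J H)) \<le> \<rho> / 16 * (x / l)"
  proof -
    have "(\<Sum>H\<in>Hs. real (card (Qg H)) * real (J H)) \<le> (\<Sum>H\<in>Hs. 2 * \<rho> * real K * yr / l)"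
      using Hs by (intro sum_mono card_J_le) auto
    also have "\<dots> = real (card Hs) * (2 * \<rho> * real K * yr / l)" by simp
    also have "\<dots> \<le> (ln l)\<^sup>2 * (2 * \<rho> * real K * (2 * (x * l powr \<delta>)) / l)"
      using cH yr2 \<rho> lpos yr_pos by (intro mult_mono divide_right_mono mult_left_mono) auto
    finally have s: "(\<Sum>H\<in>Hs. real (card (Qg H)) * real (J H)) \<le> (ln l)\<^sup>2 * (2 * \<rho> * real K * (2 * (x * l powr \<delta>)) / l)" .
    have "16 * v / \<tau> ^ 3 * (\<Sum>H\<in>Hs. real (card (Qg H)) * real (J H))
       \<le> 16 * v / \<tau> ^ 3 * ((ln l)\<^sup>2 * (2 * \<rho> * real K * (2 * (x * l powr \<delta>)) / l))"
      using s v_pos \<tau>0 by (intro mult_left_mono) auto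
    also have "\<dots> = 64 * \<rho> * real K * ((ln l)\<^sup>2 * (ln l) ^ 7) * (l powr (- (\<delta> * M)) * (1 / \<tau> ^ 3) * l powr \<delta>) * (x / l)"
      unfolding v_def by simp
    also have "(ln l)\<^sup>2 * (ln l) ^ 7 = (ln l) ^ 9" by (simp flip: power_add)
    also have "l powr (- (\<delta> * M)) * (1 / \<tau> ^ 3) * l powr \<delta> = l powr (- (\<delta> * M - 3 * ?e - \<delta>))"
      unfolding \<tau>n by (simp add: algebra_simps flip: powr_add)
    also have "64 * \<rho> * real K * (ln l) ^ 9 * l powr (- (\<delta> * M - 3 * ?e - \<delta>)) * (x / l)
       \<le> 64 * \<rho> * real K * (ln l) ^ 11 * l powr (- (\<delta> * M - 3 * ?e - \<delta>)) * (x / l)"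
      using pw \<rho> lpos by (intro mult_right_mono mult_left_mono) auto
    also have "\<dots> \<le> \<rho> / 16 * (x / l)" using n9(1) lpos by (intro mult_right_mono) auto
    finally show ?thesis .
  qed
  have B: "8 * (real (card Hs))\<^sup>2 * sieve_density I z * yr * v / \<tau>\<^sup>2 \<le> \<rho> / 16 * (x / l)"
  proof -
    have s0: "sieve_density I z \<ge> 0" unfolding sieve_density_def
    proof (intro prod_nonneg)
      fix p assume "p \<in> {p. prime p \<and> real p \<le> z}"
      then have "real (card (I p)) < real p" using I_facts(3) by simp
      then show "0 \<le> 1 - real (card (I p)) / real p" by (simp add: divide_le_eq_1)
    qed
    have "W \<le> 1 * exp (l / 2)"
    proof -
      have "l powr \<delta> \<le> l powr 1" using lpos \<delta> by (intro powr_mono) auto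
      also have "\<dots> = 2 * (l / 2)" using lpos by simp
      also have "\<dots> \<le> (l / 2)\<^sup>2 / 2" using l mult_mono[of 8 "l/2" 1 "l/2"] mult_right_mono[of 4 "l/2" "l/2"] by (simp add: power2_eq_square)
      also have "\<dots> \<le> exp (l / 2)" using exp_lower_Taylor_quadratic[of "l/2"] lpos by linarith
      finally show ?thesis using n14(1) by simp
    qed
    then have "W \<le> z" using yz(5) by linarith
    then have "sieve_density I z \<le> C1 / ln z / \<phi>" using density by blast
    also have "\<dots> \<le> C1 / (l / 2) / (1 / 2)" using yz(8) \<phi> C1 lpos by (intro frac_le divide_nonneg_nonneg) auto
    finally have s: "sieve_density I z \<le> 4 * C1 / l" by simp
    have c4: "(real (card Hs))\<^sup>2 \<le> (ln l) ^ 4" using power_mono[OF cH, of 2] by (simp flip: power_mult)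
    have "(real (card Hs))\<^sup>2 * sieve_density I z * yr \<le> (ln l) ^ 4 * (4 * C1 / l) * (2 * (x * l powr \<delta>))"
      using c4 s s0 yr2 lpos C1 yr_pos by (intro mult_mono) auto
    then have "8 * v / \<tau>\<^sup>2 * ((real (card Hs))\<^sup>2 * sieve_density I z * yr) \<le> 8 * v / \<tau>\<^sup>2 * ((ln l) ^ 4 * (4 * C1 / l) * (2 * (x * l powr \<delta>)))"
      using v_pos \<tau>0 by (intro mult_left_mono) auto
    also have "\<dots> = 64 * C1 * ((ln l) ^ 4 * (ln l) ^ 7) * (l powr (- (\<delta> * M)) * (1 / \<tau>\<^sup>2) * l powr \<delta>) * (x / l)"
      unfolding v_def by simp
    also have "(ln l) ^ 4 * (ln l) ^ 7 = (ln l) ^ 11" by (simp flip: power_add)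
    also have "l powr (- (\<delta> * M)) * (1 / \<tau>\<^sup>2) * l powr \<delta> = l powr (- (\<delta> * M - 2 * ?e - \<delta>))"
      unfolding \<tau>n by (simp add: algebra_simps flip: powr_add)
    also have "64 * C1 * (ln l) ^ 11 * l powr (- (\<delta> * M - 2 * ?e - \<delta>)) * (x / l) \<le> \<rho> / 16 * (x / l)" using n9(2) lpos by (intro mult_right_mono) auto
    finally show ?thesis by (simp add: mult_ac)
  qed
  have "\<rho> / 16 * (x / l) + \<rho> / 16 * (x / l) = \<rho> * x / (8 * l)" using lpos by (simp add: field_simps)
  then show ?thesis using A B by linarith
qed

theorem conclusion:
  defines "Err \<equiv> 2 * l powr (- \<delta> * (1 + \<epsilon>))"
  shows "\<exists>(a::int) (Q'::nat set) (C2::real).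
                Q' \<subseteq> all_large_primes Q \<delta> \<xi> x \<and>
                10 powr (2 * \<delta>) \<le> C2 \<and> C2 \<le> 100 \<and>
                real (card (shift a (sifted I z) \<inter> {1..y})) \<le> 2 * sieve_density I z * yr \<and>
                (\<forall>q\<in>Q'.
                  \<bar>(\<Sum>n\<in>{- int K * y <.. y}. sieve_weight I M K z a (scale_of \<delta> \<xi> x q) q n)
                     - (real K + 1) * yr\<bar>
                  \<le> Err * ((real K + 1) * yr)) \<and>
                real (card {n \<in> shift a (sifted I z) \<inter> {1..y}.
                  \<not> \<bar>(\<Sum>q\<in>Q'. \<Sum>h | 1 \<le> h \<and> real h \<le> real K * scale_of \<delta> \<xi> x q.
                          sieve_weight I M K z a (scale_of \<delta> \<xi> x q) q (n - int q * int h))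
                        - C2 * ((real K + 1) * yr)\<bar>
                      \<le> Err * ((real K + 1) * yr)})
                \<le> \<rho> * x / (8 * l)"
proof -
  define \<tau> where "\<tau> = l powr (- \<delta> * (1 + \<epsilon>))"
  have \<tau>: "0 < \<tau>" "\<tau> \<le> 1"
  proof -
    show "0 < \<tau>" unfolding \<tau>_def using lpos by simp
    have "l powr (- \<delta> * (1 + \<epsilon>)) \<le> l powr 0" using lpos \<delta> \<epsilon> by (intro powr_mono mult_nonpos_nonneg) auto
    then show "\<tau> \<le> 1" unfolding \<tau>_def using lpos by simp
  qed
  let ?N = "(real K + 1) * yr"
  have N0: "?N > 0" using yr_pos by simp
  have T0: "(10::real) powr (2 * \<delta>) > 0" by simp
  \<comment> \<open>Trimming leaves \<open>C_2\<close> at most 10^(2\<delta>) + 1 \<le> 11, well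
    within the required bound.\<close>
  obtain Hs where Hs: "Hs \<subseteq> SC" "10 powr (2 * \<delta>) \<le> (\<Sum>H\<in>Hs. m H / ?N)" "(\<Sum>H\<in>Hs. m H / ?N) \<le> 10 powr (2 * \<delta>) + 1"
    using subset_sum_between[of SC "\<lambda>H. m H / ?N" "10 powr (2 * \<delta>)"] scales_sum m_le N0 T0 by auto
  have fHs: "finite Hs" using Hs(1) scales_sum(1) finite_subset by blast
  interpret R: random_sieve I b M z K y Hs Qg "(ln l) ^ 6" "exp (- l / 4)" "4 * ((ln l) ^ 6 + 1)" t v J PH
    by (rule random_sieve[OF fHs Hs(1)])
  have R\<mu>: "R.\<mu> H = m H" for H unfolding R.\<mu>_def m_def R.\<sigma>2_def s2_def ..
  have RN: "R.NN = ?N" unfolding R.NN_def ..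
  define C2 where "C2 = (\<Sum>H\<in>Hs. m H / ?N)"
  have C2: "10 powr (2 * \<delta>) \<le> C2" "C2 \<le> 100" "(\<Sum>H\<in>Hs. R.\<mu> H) = C2 * ?N"
  proof -
    show "10 powr (2 * \<delta>) \<le> C2" unfolding C2_def by (rule Hs(2))
    have "(10::real) powr (2 * \<delta>) \<le> 10 powr 1" using \<delta> by (intro powr_mono) auto
    then show "C2 \<le> 100" unfolding C2_def using Hs(3) by simp
    show "(\<Sum>H\<in>Hs. R.\<mu> H) = C2 * ?N" unfolding C2_def R\<mu> sum_divide_distrib[symmetric] using yr_pos by simp
  qed
  have s0: "(\<Sum>H\<in>Hs. real (card (Qg H)) * real (J H)) > 0"
  proof (rule sum_pos)
    show "Hs \<noteq> {}" using Hs(2) T0 by auto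
    fix H assume "H \<in> Hs"
    then have H: "H \<in> SC" using Hs(1) by blast
    have "0 < \<phi> * (\<phi> * X H)" using X_pos[OF H] \<phi> by simp
    then have "real (card (Qg H)) > 0" using Qg_card(1)[OF H] by linarith
    then show "real (card (Qg H)) * real (J H) > 0" using J_bounds(3)[OF H] by simp
  qed (rule fHs)
  have \<mu>N: "R.\<mu> H \<le> R.NN" if "H \<in> Hs" for H unfolding R\<mu> RN using m_le(2) Hs(1) that by blast
  obtain \<beta> where \<beta>: "\<beta> \<in> R.full" "real (card (R.S \<beta> \<inter> {1..y})) \<le> 2 * R.\<sigma> * yr"
    "real (card {n\<in>R.S \<beta> \<inter> {1..y}. \<not> \<bar>(\<Sum>H\<in>Hs. \<Sum>q\<in>R.Qp \<tau> \<beta> H. \<Sum>h\<in>{1..int (J H)}. R.W H \<beta> q (n - int q * h)) - (\<Sum>H\<in>Hs. R.\<mu> H)\<bar> \<le> 2 * \<tau> * R.NN})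
      \<le> 16 * v / \<tau> ^ 3 * (\<Sum>H\<in>Hs. real (card (Qg H)) * real (J H)) + 8 * (real (card Hs))\<^sup>2 * R.\<sigma> * yr * v / \<tau>\<^sup>2"
    using R.selection[OF \<tau> v_pos \<mu>N s0] by blast
  obtain a where a: "shift a (sifted I z) = R.S \<beta>" "\<And>H q n. H \<in> Hs \<Longrightarrow> sieve_weight I M K z a H q n = R.W H \<beta> q n"
    using R.realize[OF \<beta>(1)] by blast
  define Q' where "Q' = (\<Union>H\<in>Hs. R.Qp \<tau> \<beta> H)"
  have QpQ: "q \<in> Q x H" if "q \<in> R.Qp \<tau> \<beta> H" for q H using that unfolding R.Qp_def Qg_def by simp
  have sc: "scale_of \<delta> \<xi> x q = H" if "H \<in> Hs" "q \<in> R.Qp \<tau> \<beta> H" for q H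
    using scale_of_eq[of H q] QpQ[OF that(2)] that(1) Hs(1) by blast
  have c1: "Q' \<subseteq> all_large_primes Q \<delta> \<xi> x"
    unfolding Q'_def all_large_primes_def using QpQ Hs(1) by blast
  have c2: "\<bar>(\<Sum>n\<in>{- int K * y <.. y}. sieve_weight I M K z a (scale_of \<delta> \<xi> x q) q n) - ?N\<bar> \<le> Err * ?N" if qQ: "q \<in> Q'" for q
  proof -
    obtain H where H: "H \<in> Hs" "q \<in> R.Qp \<tau> \<beta> H" using qQ unfolding Q'_def by blast
    have "\<bar>R.F H \<beta> q - ?N\<bar> \<le> \<tau> * ?N" using H(2) unfolding R.Qp_def RN by simp
    also have "\<dots> \<le> Err * ?N" unfolding Err_def \<tau>_def[symmetric] using \<tau> N0 by (intro mult_right_mono) auto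
    finally show ?thesis unfolding sc[OF H] R.F_def a(2)[OF H(1)] .
  qed
  have c3: "(\<Sum>q\<in>Q'. \<Sum>h | 1 \<le> h \<and> real h \<le> real K * scale_of \<delta> \<xi> x q. sieve_weight I M K z a (scale_of \<delta> \<xi> x q) q (n - int q * int h))
     = (\<Sum>H\<in>Hs. \<Sum>q\<in>R.Qp \<tau> \<beta> H. \<Sum>h\<in>{1..int (J H)}. R.W H \<beta> q (n - int q * h))" for n
  proof -
    let ?f = "\<lambda>q. \<Sum>h | 1 \<le> h \<and> real h \<le> real K * scale_of \<delta> \<xi> x q. sieve_weight I M K z a (scale_of \<delta> \<xi> x q) q (n - int q * int h)"
    have "(\<Sum>q\<in>Q'. ?f q) = (\<Sum>H\<in>Hs. \<Sum>q\<in>R.Qp \<tau> \<beta> H. ?f q)" unfolding Q'_def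
    proof (rule sum.UNION_disjoint)
      show "\<forall>H\<in>Hs. finite (R.Qp \<tau> \<beta> H)" unfolding R.Qp_def using R.Qg(1) by simp
      show "\<forall>H\<in>Hs. \<forall>H'\<in>Hs. H \<noteq> H' \<longrightarrow> R.Qp \<tau> \<beta> H \<inter> R.Qp \<tau> \<beta> H' = {}"
      proof (intro ballI impI equals0I)
        fix H H' q assume "H \<in> Hs" "H' \<in> Hs" "H \<noteq> H'" "q \<in> R.Qp \<tau> \<beta> H \<inter> R.Qp \<tau> \<beta> H'"
        then show False using sc[of H q] sc[of H' q] by simp
      qed
    qed (rule fHs)
    also have "\<dots> = (\<Sum>H\<in>Hs. \<Sum>q\<in>R.Qp \<tau> \<beta> H. \<Sum>h\<in>{1..int (J H)}. R.W H \<beta> q (n - int q * h))"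
    proof (intro sum.cong refl)
      fix H q assume H: "H \<in> Hs" "q \<in> R.Qp \<tau> \<beta> H"
      have "H \<ge> 0" using R.Hs(2)[OF H(1)] by simp
      then show "?f q = (\<Sum>h\<in>{1..int (J H)}. R.W H \<beta> q (n - int q * h))"
        unfolding sc[OF H] a(2)[OF H(1)] by (rule R.sum_scale_indices)
    qed
    finally show ?thesis .
  qed
  have c4: "real (card {n \<in> shift a (sifted I z) \<inter> {1..y}.
                  \<not> \<bar>(\<Sum>q\<in>Q'. \<Sum>h | 1 \<le> h \<and> real h \<le> real K * scale_of \<delta> \<xi> x q.
                          sieve_weight I M K z a (scale_of \<delta> \<xi> x q) q (n - int q * int h)) - C2 * ?N\<bar> \<le> Err * ?N}) \<le> \<rho> * x / (8 * l)"
    unfolding c3 a(1) Err_def using order_trans[OF \<beta>(3)[unfolded C2(3) RN R.sieve_density_eq[symmetric] \<tau>_def] exceptions_bound[OF fHs Hs(1)]]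
    by (simp only: \<tau>_def)
  have c5: "real (card (shift a (sifted I z) \<inter> {1..y})) \<le> 2 * sieve_density I z * yr"
    unfolding a(1) R.sieve_density_eq by (rule \<beta>(2))
  show ?thesis using c1 C2(1,2) c5 c2 c4 by blast
qed

end

section \<open>Choice of the parameters\<close>

text \<open>The strict inequality leaves a slack factor, written as r^4. One factor r is allotted to
  each of \<phi>^7, (1 - 1/\<xi>) / ln \<xi>, K / (K+1), and the excess of M over 4 +
  \<delta>.\<close>

lemma parameters:
  fixes \<rho> \<delta> :: real
  assumes "0 < \<rho>" "0 < \<delta>" "\<delta> < 1/2" "(4 + \<delta>) * 10 powr (2 * \<delta>) / ln (1 / (2 * \<delta>)) < \<rho>"
  obtains r \<phi> where "r > 1" "1/2 \<le> \<phi>" "\<phi> < 1"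
    "\<And>K \<xi> M. 1 / (r - 1) \<le> real K \<Longrightarrow> 1 < \<xi> \<Longrightarrow> \<xi> \<le> r \<Longrightarrow> 0 < M \<Longrightarrow> M \<le> (4 + \<delta>) * r \<Longrightarrow>
      10 powr (2 * \<delta>) \<le> \<phi> ^ 7 * (\<rho> * (1 - 1 / \<xi>) / ln \<xi> * (real K / (real K + 1)) / M * ln (1 / (2 * \<delta>)))"
proof -
  define T where "T = (10::real) powr (2 * \<delta>)"
  define g where "g = ln (1 / (2 * \<delta>))"
  have T: "T > 0" unfolding T_def by simp
  have g: "g > 0" unfolding g_def using assms by (intro ln_gt_zero) (auto simp: less_divide_eq)
  define c where "c = \<rho> * g / (4 + \<delta>)"
  have "(4 + \<delta>) * T < \<rho> * g" using assms(4) g unfolding T_def[symmetric] g_def[symmetric] by (simp add: pos_divide_less_eq)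
  then have cT: "T < c" unfolding c_def using assms by (simp add: pos_less_divide_eq mult.commute)
  define r where "r = (c / T) powr (1/4)"
  have r1: "r > 1" unfolding r_def using cT T by (intro gr_one_powr) auto
  have r4: "r ^ 4 = c / T" unfolding r_def using cT T by (simp add: powr_power)
  define \<phi> where "\<phi> = max (1/2) ((1 / r) powr (1/7))"
  have \<phi>: "1/2 \<le> \<phi>" "\<phi> < 1"
  proof -
    show "1/2 \<le> \<phi>" unfolding \<phi>_def by simp
    have "(1 / r) powr (1/7) < 1 powr (1/7)" using r1 by (intro powr_less_mono2) auto
    then show "\<phi> < 1" unfolding \<phi>_def by simp
  qed
  have \<phi>7: "1 / r \<le> \<phi> ^ 7"
  proof -
    have "((1 / r) powr (1/7)) ^ 7 = 1 / r" using r1 by (simp add: powr_power)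
    moreover have "((1 / r) powr (1/7)) ^ 7 \<le> \<phi> ^ 7" unfolding \<phi>_def by (intro power_mono) auto
    ultimately show ?thesis by simp
  qed
  have "T \<le> \<phi> ^ 7 * (\<rho> * (1 - 1 / \<xi>) / ln \<xi> * (real K / (real K + 1)) / M * g)"
    if h: "1 / (r - 1) \<le> real K" "1 < \<xi>" "\<xi> \<le> r" "0 < M" "M \<le> (4 + \<delta>) * r" for K \<xi> M
  proof -
    have f1: "1 / r \<le> (1 - 1 / \<xi>) / ln \<xi>"
    proof -
      have "1 / r \<le> 1 / \<xi>" using h by (intro divide_left_mono) auto
      also have "\<dots> = (\<xi> - 1) / \<xi> / (\<xi> - 1)" using h by simp
      also have "\<dots> \<le> (\<xi> - 1) / \<xi> / ln \<xi>" using h ln_le_minus_one[of \<xi>] by (intro divide_left_mono) auto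
      also have "(\<xi> - 1) / \<xi> = 1 - 1 / \<xi>" using h by (simp add: diff_divide_distrib)
      finally show ?thesis .
    qed
    have f2: "1 / r \<le> real K / (real K + 1)"
    proof -
      have "1 \<le> real K * (r - 1)" using h(1) r1 by (simp add: pos_divide_le_eq)
      then show ?thesis using r1 by (simp add: field_simps)
    qed
    have f3: "1 / ((4 + \<delta>) * r) \<le> 1 / M" using h by (intro divide_left_mono) (auto intro: mult_pos_pos)
    have "T = 1 / r * (c / r ^ 3)"
    proof -
      have "1 / r * (c / r ^ 3) = c / r ^ 4" by (simp add: eval_nat_numeral)
      also have "\<dots> = T" unfolding r4 using cT T by simp
      finally show ?thesis ..
    qed
    also have "c / r ^ 3 = \<rho> * (1 / r) * (1 / r) * (1 / ((4 + \<delta>) * r)) * g" unfolding c_def by (simp add: power3_eq_cube)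
    also have "1 / r * \<dots> \<le> \<phi> ^ 7 * (\<rho> * ((1 - 1 / \<xi>) / ln \<xi>) * (real K / (real K + 1)) * (1 / M) * g)"
      using f1 f2 f3 \<phi>7 \<phi>(1) r1 assms g h by (intro mult_mono mult_nonneg_nonneg order_refl) auto
    finally show ?thesis by (simp add: mult_ac)
  qed
  then show thesis using that[OF r1 \<phi>] unfolding T_def g_def by blast
qed

lemma eventually_scale_ratio:
  fixes \<delta> \<xi> \<phi> :: real
  assumes "\<delta> > 0" "\<delta> < 1/2" "\<xi> > 1" "\<phi> < 1" 
  shows "\<forall>\<^sub>F l::real in at_top. exp (\<phi> * ln (1 / (2 * \<delta>))) \<le> (ln (sqrt l / (\<xi> * ln l)) / ln \<xi>) / (ln (4 * l powr \<delta>) / ln \<xi> + 1)"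
proof -
  have lx: "ln \<xi> > 0" using assms by simp
  \<comment> \<open>The limit is 1/(2\<delta>), written in the shape produced by the asymptotic
    expansion; since \<phi> < 1 it exceeds the left side strictly.\<close>
  have "((\<lambda>l::real. (ln (sqrt l / (\<xi> * ln l)) / ln \<xi>) / (ln (4 * l powr \<delta>) / ln \<xi> + 1)) \<longlongrightarrow> inverse (ln \<xi>) * (inverse \<delta> * ln \<xi>) / 2) at_top" 
    using assms lx by real_asymp
  moreover have "exp (\<phi> * ln (1 / (2 * \<delta>))) < inverse (ln \<xi>) * (inverse \<delta> * ln \<xi>) / 2"
  proof -
    have "ln (1 / (2 * \<delta>)) > 0" using assms by (intro ln_gt_zero) (auto simp: less_divide_eq)
    then have "exp (\<phi> * ln (1 / (2 * \<delta>))) < exp (ln (1 / (2 * \<delta>)))" using assms(4) by simp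
    also have "\<dots> = inverse (ln \<xi>) * (inverse \<delta> * ln \<xi>) / 2" using assms lx by (simp add: field_simps)
    finally show ?thesis .
  qed
  ultimately have "\<forall>\<^sub>F l in at_top. exp (\<phi> * ln (1 / (2 * \<delta>))) < (ln (sqrt l / (\<xi> * ln l)) / ln \<xi>) / (ln (4 * l powr \<delta>) / ln \<xi> + 1)"
    by (rule order_tendstoD(1))
  then show ?thesis by (rule eventually_mono) simp
qed

text \<open>The only threshold for \<epsilon> is (M - 4) / 8: it keeps 3 \<epsilon> below M - 4, so
  that the bound for the exceptions decays.\<close>

lemma eventually_large_x:
  fixes \<rho> \<delta> \<xi> M \<epsilon> \<phi> C1 B :: real
  assumes p: "\<rho> > 0" "0 < \<delta>" "\<delta> < 1/2" "\<xi> > 1" "K \<ge> 2" "4 < M" "M \<le> 5" "0 < \<epsilon>" "\<epsilon> \<le> (M - 4) / 8" "1/2 \<le> \<phi>" "\<phi> < 1" "C1 > 0"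
    and target: "10 powr (2 * \<delta>) \<le> \<phi> ^ 7 * (\<rho> * (1 - 1 / \<xi>) / ln \<xi> * (real K / (real K + 1)) / M * ln (1 / (2 * \<delta>)))"
    and I: "sieving_system I" "non_degenerate I" "bounded_by B I" "one_dimensional C1 I" and Q: "large_prime_family I \<rho> \<delta> \<xi> Q"
  shows "\<forall>\<^sub>F x in at_top. \<exists>W b. large_x I Q K \<rho> \<delta> \<xi> M \<epsilon> \<phi> C1 W b (ln x)"
proof -
  define b where "b = max 1 B"
  define c where "c = \<rho> * (1 - 1 / \<xi>) / 4"
  define k where "k = real K * b"
  have b: "b \<ge> 1" "bounded_by b I" unfolding b_def using I(3) unfolding bounded_by_def by (auto simp: le_max_iff_disj)
  have c: "c > 0" unfolding c_def using p by simp
  have k: "k > 0" unfolding k_def using p b by simp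
  have k2: "16 * k\<^sup>2 > 0" "4 * k\<^sup>2 > 0" "32 * k\<^sup>2 > 0" "64 * k\<^sup>2 > 0" "100000 * k ^ 4 > 0" "1088 * k ^ 3 > 0" "64 * \<rho> * real K > 0" "64 * C1 > 0"
    using k p by simp_all
  obtain W where W: "\<And>w. w \<ge> W \<Longrightarrow> \<phi> * (C1 / ln w) \<le> sieve_density I w \<and> sieve_density I w \<le> C1 / ln w / \<phi>"
  proof -
    have "\<forall>\<^sub>F w in at_top. \<phi> * (C1 / ln w) \<le> sieve_density I w \<and> sieve_density I w \<le> C1 / ln w / \<phi>"
      using I(4) p unfolding one_dimensional_def by (intro asymp_equiv_bounds) auto
    then show ?thesis using that unfolding eventually_at_top_linorder by blast
  qed
  have fam1: "Q x H \<subseteq> {q. prime q \<and> card (I q) \<ge> 1 \<and>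
                    real_of_int (y_of \<delta> x) / (\<xi> * H) < real q \<and> real q \<le> real_of_int (y_of \<delta> x) / H}" if "H \<in> scales \<delta> \<xi> x" for x H
    using Q that unfolding large_prime_family_def by blast
  have fam2: "\<forall>\<^sub>F x in at_top. \<forall>H \<in> scales \<delta> \<xi> x.
        \<bar>real (card (Q x H)) - \<rho> * (1 - 1 / \<xi>) * (real_of_int (y_of \<delta> x) / (H * ln x))\<bar>
          \<le> (1 - \<phi>) * (\<rho> * (1 - 1 / \<xi>) * (real_of_int (y_of \<delta> x) / (H * ln x)))"
    using Q p unfolding large_prime_family_def by simp
  note ev = eventually_compose_filterlim[OF _ ln_at_top]
  \<comment> \<open>Each exponent becomes a single positive parameter, the form in which the
    comparisons of growth are decided.\<close>
  define D where "D = \<delta> * M"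
  define D1 where "D1 = \<delta> * (M / 2 - 2)"
  define D2 where "D2 = \<delta> * M - 3 * (\<delta> * (1 + \<epsilon>)) - \<delta>"
  define D3 where "D3 = \<delta> * M - 2 * (\<delta> * (1 + \<epsilon>)) - \<delta>"
  define E where "E = \<delta> * M / 2"
  have D: "D > 0" "D1 > 0" "D2 > 0" "D3 > 0" "E > 0"
  proof -
    show "D > 0" "D1 > 0" "E > 0" unfolding D_def D1_def E_def using p by auto
    \<comment> \<open>These are minus the exponents of l left by bad primes and by deviations in the
      count of exceptions.\<close>
    have "D2 = \<delta> * (M - 4 - 3 * \<epsilon>)" "D3 = \<delta> * (M - 3 - 2 * \<epsilon>)" unfolding D2_def D3_def by (auto simp: algebra_simps)
    then show "D2 > 0" "D3 > 0" using p by auto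
  qed
  have br: "\<forall>\<^sub>F l in at_top. (\<Prod>p\<in>brun_primes l. 1 - 1 / real p) 
       + exp (2 * (\<Sum>p\<in>brun_primes l. 1 / real p)) / 2 ^ (2 * brun_level l) \<le> c * (ln l) ^ 6 / l
     \<and> real (brun_size (brun_primes l) (brun_level l)) \<le> exp (l / 2) \<and> brun_limit l \<le> exp (l / 2)" by (rule brun_numerics[OF c])
  have l: "\<forall>\<^sub>F l::real in at_top. l \<ge> 100" by (rule eventually_ge_at_top)
  have n1: "\<forall>\<^sub>F l::real in at_top. exp (l/2) * l ^ 14 \<le> c * exp l" using c by real_asymp
  have n2: "\<forall>\<^sub>F l::real in at_top. exp (l/2) * l ^ 2 \<le> c * (exp l * exp (- l / 4))" using c by real_asymp
  have n3: "\<forall>\<^sub>F l::real in at_top. l ^ 12 \<le> exp l" by real_asymp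
  have n4: "\<forall>\<^sub>F l::real in at_top. exp (l/2) * sqrt l \<le> exp l" by real_asymp
  have pw: "\<forall>\<^sub>F l::real in at_top. a \<le> l powr e" if "e > 0" for a e :: real
  proof -
    have "filterlim (\<lambda>l::real. l powr e) at_top at_top" using that by real_asymp
    then show ?thesis unfolding filterlim_at_top by blast
  qed
  have n6: "\<forall>\<^sub>F l::real in at_top. a * (ln l)^6 * l powr (- D) \<le> 1/3 * ((ln l)^7 * l powr (- D))" if "a > 0" for a using D that by real_asymp
  have n6': "\<forall>\<^sub>F l::real in at_top. a * l * exp (- l / 4) \<le> 1/3 * ((ln l)^7 * l powr (- D))" if "a > 0" for a using D that by real_asymp
  have n6'': "\<forall>\<^sub>F l::real in at_top. 8 * exp (- l / 4) * exp (a * (l / (ln l)^2) * (7 + 2 * ln l)) \<le> 1/3 * ((ln l)^7 * l powr (- D))" if "a > 0" for a 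
    using D that by real_asymp
  have n7: "\<forall>\<^sub>F l::real in at_top. a * (ln l)^6 * l powr (- D1) + a' * l * exp (- l / 4) * (7 + 2 * ln l) * l powr E \<le> \<theta>" 
    if "a > 0" "a' > 0" "\<theta> > 0" for a a' \<theta> using D that by real_asymp
  have n9: "\<forall>\<^sub>F l::real in at_top. a * (ln l)^11 * l powr (- e) \<le> \<theta>" if "a > 0" "\<theta> > 0" "e > 0" for a \<theta> e using that by real_asymp
  have lx: "ln \<xi> > 0" using p by simp
  have n10: "\<forall>\<^sub>F l::real in at_top. ln l / ln \<xi> + 1 \<le> (ln l)^2" using lx by real_asymp
  have n11: "\<forall>\<^sub>F l::real in at_top. exp (\<phi> * ln (1 / (2 * \<delta>))) \<le> (ln (sqrt l / (\<xi> * ln l)) / ln \<xi>) / (ln (4 * l powr \<delta>) / ln \<xi> + 1)"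
    using p by (intro eventually_scale_ratio) auto
  have n12: "\<forall>\<^sub>F l::real in at_top. \<phi> * l \<le> l - ln l" using p by real_asymp
  have n13: "\<forall>\<^sub>F l::real in at_top. 1 \<le> exp l * l powr \<delta>" "\<forall>\<^sub>F l::real in at_top. 2 * l powr \<delta> \<le> exp l"
    using p by real_asymp+
  have n13': "\<forall>\<^sub>F l::real in at_top. ln l \<le> sqrt l" by real_asymp
  have "\<delta> * 2 > 0" "2 * \<delta> > 0" "\<rho> / 16 > 0" "1 - \<phi> > 0" using p by auto
  note pos = this
  show ?thesis
    using fam2 eventually_gt_at_top[of 0] ev[OF br] ev[OF l] ev[OF n1] ev[OF n2] ev[OF n3] ev[OF n4] ev[OF pw[OF pos(2), of "64 * k\<^sup>2"]]
      ev[OF n6[OF k2(5)]] ev[OF n6'[OF k2(6)]] ev[OF n6''[OF k2(3)]] ev[OF n7[OF k2(1,2) pos(4)]] ev[OF pw[OF D(5), of 6]]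
      ev[OF n9[OF k2(7) pos(3) D(3)]] ev[OF n9[OF k2(8) pos(3) D(4)]] ev[OF n10] ev[OF n11] ev[OF n12] ev[OF n13(1)] ev[OF n13(2)] ev[OF n13']
      ev[OF pw[OF p(2), of W]] ev[OF pw[OF p(2), of "exp (4 * \<rho>)"]] ev[OF pw[OF p(2), of "1 / (1 - \<phi>)"]]
  proof eventually_elim
    case (elim x)
    note elim = elim[unfolded c_def k_def D_def D1_def D2_def D3_def E_def]
    have ex: "exp (ln x) = x" using elim(2) by simp
    have f1: "\<And>H. H \<in> scales \<delta> \<xi> (exp (ln x)) \<Longrightarrow> Q (exp (ln x)) H \<subseteq> {q. prime q \<and> card (I q) \<ge> 1 \<and>
                    real_of_int (y_of \<delta> (exp (ln x))) / (\<xi> * H) < real q \<and> real q \<le> real_of_int (y_of \<delta> (exp (ln x))) / H}"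
      unfolding ex by (rule fam1)
    have f2: "\<And>H. H \<in> scales \<delta> \<xi> (exp (ln x)) \<Longrightarrow> 
        \<bar>real (card (Q (exp (ln x)) H)) - \<rho> * (1 - 1 / \<xi>) * (real_of_int (y_of \<delta> (exp (ln x))) / (H * ln x))\<bar>
          \<le> (1 - \<phi>) * (\<rho> * (1 - 1 / \<xi>) * (real_of_int (y_of \<delta> (exp (ln x))) / (H * ln x)))"
      unfolding ex using elim(1) by blast
    note br = elim(3)[THEN conjunct1] elim(3)[THEN conjunct2, THEN conjunct1] elim(3)[THEN conjunct2, THEN conjunct2]
    have "large_x I Q K \<rho> \<delta> \<xi> M \<epsilon> \<phi> C1 W b (ln x)"
      by (rule large_x.intro) (fact I b p target W f1 f2 br elim)+
    then show ?case by blast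
  qed
qed

text \<open>The order of quantifiers encodes "sufficiently large, close, small": the constant
  \<open>A\<close> precedes the system and the prime families, while the threshold for x may depend
  on them.\<close>

theorem theorem3p1:
  fixes \<rho> \<delta> :: real
  assumes "0 < \<rho>" and "0 < \<delta>" and "\<delta> < 1/2"
    and "(4 + \<delta>) * 10 powr (2 * \<delta>) / ln (1 / (2 * \<delta>)) < \<rho>"
  shows
    "\<exists>(K\<^sub>0::nat) (\<xi>\<^sub>0::real) (M\<^sub>0::real). \<xi>\<^sub>0 > 1 \<and> M\<^sub>0 > 4 + \<delta> \<and>
      (\<forall>(K::nat) (\<xi>::real) (M::real) (B::real) (C\<^sub>1::real).
        2 \<le> K \<and> K\<^sub>0 \<le> K \<and> 1 < \<xi> \<and> \<xi> \<le> \<xi>\<^sub>0 \<and> 4 + \<delta> < M \<and> M \<le> 5 \<and> M \<le> M\<^sub>0 \<and> 0 < C\<^sub>1 \<longrightarrow>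
        (\<exists>\<epsilon>\<^sub>0>0. \<forall>\<epsilon>::real. 0 < \<epsilon> \<and> \<epsilon> \<le> \<epsilon>\<^sub>0 \<longrightarrow>
          (\<exists>A::real. \<forall>(I :: nat \<Rightarrow> int set) (Q :: real \<Rightarrow> real \<Rightarrow> nat set).
            sieving_system I \<and> non_degenerate I \<and> bounded_by B I \<and>
            one_dimensional C\<^sub>1 I \<and> supported \<rho> I \<and> large_prime_family I \<rho> \<delta> \<xi> Q \<longrightarrow>
            (\<forall>\<^sub>F x in at_top.
              let y = y_of \<delta> x; z = z_of \<delta> x; H = scale_of \<delta> \<xi> x;
                  Err = A * ln x powr (- \<delta> * (1 + \<epsilon>))
              in \<exists>(b::int) (Q'::nat set) (C\<^sub>2::real).
                Q' \<subseteq> all_large_primes Q \<delta> \<xi> x \<and>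
                10 powr (2 * \<delta>) \<le> C\<^sub>2 \<and> C\<^sub>2 \<le> 100 \<and>
                real (card (shift b (sifted I z) \<inter> {1..y})) \<le> 2 * sieve_density I z * real_of_int y \<and>
                (\<forall>q\<in>Q'.
                  \<bar>(\<Sum>n\<in>{- int K * y <.. y}. sieve_weight I M K z b (H q) q n)
                     - (real K + 1) * real_of_int y\<bar>
                  \<le> Err * ((real K + 1) * real_of_int y)) \<and>
                real (card {n \<in> shift b (sifted I z) \<inter> {1..y}.
                  \<not> \<bar>(\<Sum>q\<in>Q'. \<Sum>h | 1 \<le> h \<and> real h \<le> real K * H q.
                          sieve_weight I M K z b (H q) q (n - int q * int h))
                        - C\<^sub>2 * ((real K + 1) * real_of_int y)\<bar>
                      \<le> Err * ((real K + 1) * real_of_int y)})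
                \<le> \<rho> * x / (8 * ln x)))))"
proof -
  obtain r \<phi> where r: "r > 1" and \<phi>: "1/2 \<le> \<phi>" "\<phi> < 1" and target: 
    "\<And>K \<xi> M. 1 / (r - 1) \<le> real K \<Longrightarrow> 1 < \<xi> \<Longrightarrow> \<xi> \<le> r \<Longrightarrow> 0 < M \<Longrightarrow> M \<le> (4 + \<delta>) * r \<Longrightarrow>
      10 powr (2 * \<delta>) \<le> \<phi> ^ 7 * (\<rho> * (1 - 1 / \<xi>) / ln \<xi> * (real K / (real K + 1)) / M * ln (1 / (2 * \<delta>)))"
    using parameters[OF assms] by blast
  show ?thesis
  proof (intro exI conjI allI impI)
    \<comment> \<open>The witnesses are \<open>nat \<lceil>1 / (r - 1)\<rceil>\<close> for K, r for
      \<xi>, \<open>(4 + \<delta>) * r\<close> for M, (M - 4) / 8 for \<epsilon>, and 2 for the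
      implied constant, the tolerance 2 \<tau> of \<open>selection\<close>.\<close>
    show "r > 1" by (rule r)
    have "(4 + \<delta>) * 1 < (4 + \<delta>) * r" using assms r by (intro mult_strict_left_mono) auto
    then show "(4 + \<delta>) * r > 4 + \<delta>" by simp
    fix K :: nat and \<xi> M B C1 :: real
    assume h: "2 \<le> K \<and> nat \<lceil>1 / (r - 1)\<rceil> \<le> K \<and> 1 < \<xi> \<and> \<xi> \<le> r \<and> 4 + \<delta> < M \<and> M \<le> 5 \<and> M \<le> (4 + \<delta>) * r \<and> 0 < C1"
    then have M: "M > 4" using assms by linarith
    show "(M - 4) / 8 > 0" using M by simp
    fix \<epsilon> :: real and I :: "nat \<Rightarrow> int set" and Q :: "real \<Rightarrow> real \<Rightarrow> nat set"
    assume \<epsilon>: "0 < \<epsilon> \<and> \<epsilon> \<le> (M - 4) / 8"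
    assume I: "sieving_system I \<and> non_degenerate I \<and> bounded_by B I \<and>
            one_dimensional C1 I \<and> supported \<rho> I \<and> large_prime_family I \<rho> \<delta> \<xi> Q"
    have K: "1 / (r - 1) \<le> real K" using h by (simp add: nat_le_iff ceiling_le_iff)
    have "10 powr (2 * \<delta>) \<le> \<phi> ^ 7 * (\<rho> * (1 - 1 / \<xi>) / ln \<xi> * (real K / (real K + 1)) / M * ln (1 / (2 * \<delta>)))"
      using target[OF K] h M by simp
    then have "\<forall>\<^sub>F x in at_top. \<exists>W b. large_x I Q K \<rho> \<delta> \<xi> M \<epsilon> \<phi> C1 W b (ln x)"
      by (intro eventually_large_x[where B=B]) (use assms h M \<epsilon> I \<phi> in auto)
    then show "\<forall>\<^sub>F x in at_top.
              let y = y_of \<delta> x; z = z_of \<delta> x; H = scale_of \<delta> \<xi> x;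
                  Err = 2 * ln x powr (- \<delta> * (1 + \<epsilon>))
              in \<exists>(b::int) (Q'::nat set) (C\<^sub>2::real).
                Q' \<subseteq> all_large_primes Q \<delta> \<xi> x \<and>
                10 powr (2 * \<delta>) \<le> C\<^sub>2 \<and> C\<^sub>2 \<le> 100 \<and>
                real (card (shift b (sifted I z) \<inter> {1..y})) \<le> 2 * sieve_density I z * real_of_int y \<and>
                (\<forall>q\<in>Q'.
                  \<bar>(\<Sum>n\<in>{- int K * y <.. y}. sieve_weight I M K z b (H q) q n)
                     - (real K + 1) * real_of_int y\<bar>
                  \<le> Err * ((real K + 1) * real_of_int y)) \<and>
                real (card {n \<in> shift b (sifted I z) \<inter> {1..y}.
                  \<not> \<bar>(\<Sum>q\<in>Q'. \<Sum>h | 1 \<le> h \<and> real h \<le> real K * H q.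
                          sieve_weight I M K z b (H q) q (n - int q * int h))
                        - C\<^sub>2 * ((real K + 1) * real_of_int y)\<bar>
                      \<le> Err * ((real K + 1) * real_of_int y)})
                \<le> \<rho> * x / (8 * ln x)" using eventually_gt_at_top[of 0]
    proof eventually_elim
      case (elim x)
      then obtain W b where "large_x I Q K \<rho> \<delta> \<xi> M \<epsilon> \<phi> C1 W b (ln x)" by blast
      moreover have "exp (ln x) = x" using elim by simp
      ultimately show ?case unfolding Let_def using large_x.conclusion[of I Q K \<rho> \<delta> \<xi> M \<epsilon> \<phi> C1 W b "ln x"] by (simp only:)
    qed
  qed
qed

end
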